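(* The category $\mathit{Gpd}_A$ of localic étale groupoids and algebraic morphisms is equivalent to the category $\mathit{InvQuF}$ of inverse quantal frames and homomorphisms of unital involutive quantales.
   Context: Locales. $\mathit{Loc}=\mathit{Frm}^{\mathrm{op}}$; a map of locales $f:X\to Y$ is a frame homomorphism $f^*:Y\to X$. $f$ is open if $f^*$ has a left adjoint $f_!$ satisfying $f_!(f^*(y)\wedge x)=y\wedge f_!(x)$; it is a local homeomorphism if it is open and there is $\Gamma\subset X$ with $\bigvee\Gamma=1$ such that for each $s\in\Gamma$, $f_!$ restricts to an isomorphism ${\downarrow}(s)\cong{\downarrow}(f_!(s))$. Pullbacks in $\mathit{Loc}$ over $B$ are written $X\otimes_BY$. Groupoids. A localic groupoid $G$ is an internal groupoid in $\mathit{Loc}$ with objects $G_0$, arrows $G_1$, domain and range $d,r:G_1\to G_0$, units $u$ (also written $u_G$), inversion $i$, multiplication $m:G_2\to G_1$, where $G_2=G_1\otimes_{G_0}G_1$ is the pullback with $r\circ\pi_1=d\circ\pi_2$ (so $xy$ is defined when $r(x)=d(y)$). $G$ is étale if $d$ is a local homeomorphism. A left $G$-locale $(X,p,\mathfrak a)$ consists of maps of locales $p:X\to G_0$ and $\mathfrak a:G_1\otimes_{G_0}X\to X$ (pullback of $r$ and $p$) satisfying the usual axioms of an internal category action (in point notation $p(gx)=d(g)$, unitality, associativity). Algebraic morphisms. An algebraic morphism $(p,\mathfrak a):G\to H$ consists of maps $p:H_1\to G_0$ and $\mathfrak a:G_1\otimes_{G_0}H_1\to H_1$ making $(H_1,p,\mathfrak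 a)$ a left $G$-locale and such that: $r\circ\mathfrak a=r\circ\pi_2$ as maps $G_1\otimes_{G_0}H_1\to H_0$; $p\circ m=p\circ\pi_1$ as maps $H_1\otimes_{H_0}H_1=H_2\to G_0$; and $m\circ(\mathfrak a\otimes 1)=\mathfrak a\circ(1\otimes m)$ as maps $G_1\otimes_{G_0}H_1\otimes_{H_0}H_1\to H_1$. The composite of $(p,\mathfrak a):G\to H$ and $(q,\mathfrak b):H\to K$ is $(p\circ u_H\circ q,\mathfrak c)$, where in point-set notation $\mathfrak c:G_1\otimes_{G_0}K_1\to K_1$ is $g\cdot_{\mathfrak c}k=(g\cdot_{\mathfrak a}u_H(q(k)))\cdot_{\mathfrak b}k$. This composition is strictly associative, and $\mathit{Gpd}_A$ is the resulting category, with localic étale groupoids as objects. Quantales. A unital involutive quantale is a unital involutive semigroup in the category of sup-lattices (complete lattices and join-preserving maps), with product $ab$, involution $a^*$, unit $e$. An inverse quantal frame is a unital involutive quantale $Q$ that is also a frame and satisfies: (1) $a1\wedge e=aa^*\wedge e$ for all $a\in Q$; (2) $(a1\wedge e)a=a$ for all $a\in Q$; (3) $\bigvee Q_{\mathcal I}=1$, where $Q_{\mathcal I}=\{s\in Q: ss^*\vee s^*s\le e\}$. The morphisms of $\mathit{InvQuF}$ are the join-preserving maps $h:Q\to R$ that preserve multiplication, involution and unit. *)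

theory Defs
  imports "HOL-Algebra.Complete_Lattice"
begin

section \<open>Frames and locales\<close>

definition sup_preserving :: "('a, 'c) gorder_scheme \<Rightarrow> ('b, 'd) gorder_scheme \<Rightarrow> ('a \<Rightarrow> 'b) \<Rightarrow> bool"
  where "sup_preserving L M h \<longleftrightarrow> h \<in> carrier L \<rightarrow> carrier M \<and>
    (\<forall>A. A \<subseteq> carrier L \<longrightarrow> h (\<Squnion>\<^bsub>L\<^esub>A) = \<Squnion>\<^bsub>M\<^esub>(h ` A))"

locale frame = complete_lattice L for L (structure) +
  assumes meet_sup_distrib:
    "\<lbrakk>a \<in> carrier L; A \<subseteq> carrier L\<rbrakk> \<Longrightarrow> a \<sqinter> \<Squnion>A = \<Squnion>((\<lambda>b. a \<sqinter> b) ` A)"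

definition frame_hom :: "('a, 'c) gorder_scheme \<Rightarrow> ('b, 'd) gorder_scheme \<Rightarrow> ('a \<Rightarrow> 'b) \<Rightarrow> bool"
  where "frame_hom L M h \<longleftrightarrow> sup_preserving L M h \<and> h \<top>\<^bsub>L\<^esub> = \<top>\<^bsub>M\<^esub> \<and>
    (\<forall>a\<in>carrier L. \<forall>b\<in>carrier L. h (a \<sqinter>\<^bsub>L\<^esub> b) = h a \<sqinter>\<^bsub>M\<^esub> h b)"

text \<open>
  A locale is a frame. A map of locales \<open>f : X \<rightarrow> Y\<close> is recorded together with its domain \<open>X\<close> and
  codomain \<open>Y\<close>; the field \<open>invim f\<close> is the frame homomorphism \<open>f\<^sup>* : Y \<rightarrow> X\<close>. Being extensional, it
  is determined by its values on the carrier of \<open>Y\<close>, so equality of records is equality of maps.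
\<close>

record ('x, 'y) lmap =
  lsrc :: "'x gorder"
  ltgt :: "'y gorder"
  invim :: "'y \<Rightarrow> 'x"

definition locale_map :: "'x gorder \<Rightarrow> 'y gorder \<Rightarrow> ('x, 'y) lmap \<Rightarrow> bool"
  where "locale_map X Y f \<longleftrightarrow> lsrc f = X \<and> ltgt f = Y \<and> frame X \<and> frame Y \<and>
    frame_hom Y X (invim f) \<and> invim f \<in> extensional (carrier Y)"

definition lid :: "'x gorder \<Rightarrow> ('x, 'x) lmap"
  where "lid X = \<lparr>lsrc = X, ltgt = X, invim = (\<lambda>x\<in>carrier X. x)\<rparr>"

definition lcomp :: "('y, 'z) lmap \<Rightarrow> ('x, 'y) lmap \<Rightarrow> ('x, 'z) lmap" (infixl \<open>\<circ>\<^sub>L\<close> 55)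
  where "g \<circ>\<^sub>L f = \<lparr>lsrc = lsrc f, ltgt = ltgt g, invim = compose (carrier (ltgt g)) (invim f) (invim g)\<rparr>"

text \<open>
  \<open>direct_image f h\<close>: \<open>f\<close> is open, with \<open>h = f\<^sub>!\<close> left adjoint to \<open>f\<^sup>*\<close>. The map \<open>h\<close> is unique on
  the carrier.
\<close>

definition direct_image :: "('x, 'y) lmap \<Rightarrow> ('x \<Rightarrow> 'y) \<Rightarrow> bool"
  where "direct_image f h \<longleftrightarrow> h \<in> carrier (lsrc f) \<rightarrow> carrier (ltgt f) \<and>
    (\<forall>x\<in>carrier (lsrc f). \<forall>y\<in>carrier (ltgt f).
      h x \<sqsubseteq>\<^bsub>ltgt f\<^esub> y \<longleftrightarrow> x \<sqsubseteq>\<^bsub>lsrc f\<^esub> invim f y) \<and>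
    (\<forall>x\<in>carrier (lsrc f). \<forall>y\<in>carrier (ltgt f).
      h (invim f y \<sqinter>\<^bsub>lsrc f\<^esub> x) = y \<sqinter>\<^bsub>ltgt f\<^esub> h x)"

definition down_set :: "('a, 'c) gorder_scheme \<Rightarrow> 'a \<Rightarrow> 'a set"
  where "down_set L s = {a \<in> carrier L. a \<sqsubseteq>\<^bsub>L\<^esub> s}"

definition local_homeomorphism :: "('x, 'y) lmap \<Rightarrow> bool"
  where "local_homeomorphism f \<longleftrightarrow> (\<exists>h. direct_image f h \<and>
    (\<exists>\<Gamma>. \<Gamma> \<subseteq> carrier (lsrc f) \<and> \<Squnion>\<^bsub>lsrc f\<^esub>\<Gamma> = \<top>\<^bsub>lsrc f\<^esub> \<and>
      (\<forall>s\<in>\<Gamma>. bij_betw h (down_set (lsrc f) s) (down_set (ltgt f) (h s)) \<and>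
        (\<forall>x\<in>down_set (lsrc f) s. \<forall>x'\<in>down_set (lsrc f) s.
          x \<sqsubseteq>\<^bsub>lsrc f\<^esub> x' \<longleftrightarrow> h x \<sqsubseteq>\<^bsub>ltgt f\<^esub> h x'))))"


section \<open>Pullbacks of locales\<close>

text \<open>
  The pullback of \<open>f : X \<rightarrow> B\<close> and \<open>g : Y \<rightarrow> B\<close> is the tensor product of frames over \<open>B\<close>, presented as
  the frame of those downsets of \<open>X \<times> Y\<close> that are closed under joins (including the empty one) in
  each variable and under the relation \<open>(x \<and> f\<^sup>*(b)) \<otimes> y = x \<otimes> (g\<^sup>*(b) \<and> y)\<close>. Its universal property
  is \<open>lpullback_universal\<close> below.
\<close>

definition balanced_ideal :: "('x, 'b) lmap \<Rightarrow> ('y, 'b) lmap \<Rightarrow> ('x \<times> 'y) set \<Rightarrow> bool"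
  where "balanced_ideal f g U \<longleftrightarrow>
    (let X = lsrc f; Y = lsrc g; B = ltgt f in
      U \<subseteq> carrier X \<times> carrier Y \<and>
      (\<forall>x\<in>carrier X. \<forall>x'\<in>carrier X. \<forall>y\<in>carrier Y. \<forall>y'\<in>carrier Y.
        (x, y) \<in> U \<and> x' \<sqsubseteq>\<^bsub>X\<^esub> x \<and> y' \<sqsubseteq>\<^bsub>Y\<^esub> y \<longrightarrow> (x', y') \<in> U) \<and>
      (\<forall>S y. S \<subseteq> carrier X \<and> y \<in> carrier Y \<and> (\<forall>x\<in>S. (x, y) \<in> U) \<longrightarrow> (\<Squnion>\<^bsub>X\<^esub>S, y) \<in> U) \<and>
      (\<forall>x T. x \<in> carrier X \<and> T \<subseteq> carrier Y \<and> (\<forall>y\<in>T. (x, y) \<in> U) \<longrightarrow> (x, \<Squnion>\<^bsub>Y\<^esub>T) \<in> U) \<and>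
      (\<forall>x\<in>carrier X. \<forall>y\<in>carrier Y. \<forall>b\<in>carrier B.
        (x \<sqinter>\<^bsub>X\<^esub> invim f b, y) \<in> U \<longleftrightarrow> (x, invim g b \<sqinter>\<^bsub>Y\<^esub> y) \<in> U))"

definition lpullback :: "('x, 'b) lmap \<Rightarrow> ('y, 'b) lmap \<Rightarrow> ('x \<times> 'y) set gorder"
  where "lpullback f g = \<lparr>carrier = {U. balanced_ideal f g U}, eq = (=), le = (\<subseteq>)\<rparr>"

definition tensor :: "('x, 'b) lmap \<Rightarrow> ('y, 'b) lmap \<Rightarrow> 'x \<Rightarrow> 'y \<Rightarrow> ('x \<times> 'y) set"
  where "tensor f g x y = \<Inter>{U. balanced_ideal f g U \<and> (x, y) \<in> U}"

definition lfst :: "('x, 'b) lmap \<Rightarrow> ('y, 'b) lmap \<Rightarrow> (('x \<times> 'y) set, 'x) lmap"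
  where "lfst f g = \<lparr>lsrc = lpullback f g, ltgt = lsrc f,
    invim = (\<lambda>x\<in>carrier (lsrc f). tensor f g x \<top>\<^bsub>lsrc g\<^esub>)\<rparr>"

definition lsnd :: "('x, 'b) lmap \<Rightarrow> ('y, 'b) lmap \<Rightarrow> (('x \<times> 'y) set, 'y) lmap"
  where "lsnd f g = \<lparr>lsrc = lpullback f g, ltgt = lsrc g,
    invim = (\<lambda>y\<in>carrier (lsrc g). tensor f g \<top>\<^bsub>lsrc f\<^esub> y)\<rparr>"

text \<open>
  \<open>lpair f g h k\<close> is the map \<open>\<langle>h, k\<rangle>\<close> into the pullback of \<open>f\<close> and \<open>g\<close> induced by \<open>h : Z \<rightarrow> X\<close> and
  \<open>k : Z \<rightarrow> Y\<close> with \<open>f \<circ> h = g \<circ> k\<close>.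
\<close>

definition lpair :: "('x, 'b) lmap \<Rightarrow> ('y, 'b) lmap \<Rightarrow> ('z, 'x) lmap \<Rightarrow> ('z, 'y) lmap \<Rightarrow> ('z, ('x \<times> 'y) set) lmap"
  where "lpair f g h k = \<lparr>lsrc = lsrc h, ltgt = lpullback f g,
    invim = (\<lambda>U\<in>carrier (lpullback f g).
      \<Squnion>\<^bsub>lsrc h\<^esub>((\<lambda>(x, y). invim h x \<sqinter>\<^bsub>lsrc h\<^esub> invim k y) ` U))\<rparr>"

lemma sup_preserving_closed: "sup_preserving L M h \<Longrightarrow> x \<in> carrier L \<Longrightarrow> h x \<in> carrier M"
  and sup_preserving_sup: "sup_preserving L M h \<Longrightarrow> A \<subseteq> carrier L \<Longrightarrow> h (\<Squnion>\<^bsub>L\<^esub>A) = \<Squnion>\<^bsub>M\<^esub>(h ` A)"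
  by (auto simp: sup_preserving_def)

lemma frame_homD:
  assumes "frame_hom L M h"
  shows "sup_preserving L M h" "x \<in> carrier L \<Longrightarrow> h x \<in> carrier M"
    "A \<subseteq> carrier L \<Longrightarrow> h (\<Squnion>\<^bsub>L\<^esub>A) = \<Squnion>\<^bsub>M\<^esub>(h ` A)" "h \<top>\<^bsub>L\<^esub> = \<top>\<^bsub>M\<^esub>"
    "\<lbrakk>a \<in> carrier L; b \<in> carrier L\<rbrakk> \<Longrightarrow> h (a \<sqinter>\<^bsub>L\<^esub> b) = h a \<sqinter>\<^bsub>M\<^esub> h b"
  using assms by (auto simp: frame_hom_def sup_preserving_def)

lemma locale_mapD:
  assumes "locale_map X Y f"
  shows "lsrc f = X" "ltgt f = Y" "frame X" "frame Y" "frame_hom Y X (invim f)"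
    "invim f \<in> extensional (carrier Y)"
  using assms by (auto simp: locale_map_def)

lemma locale_map_restrictI:
  assumes X: "frame X" and Y: "frame Y"
    and cl: "\<And>y. y \<in> carrier Y \<Longrightarrow> h y \<in> carrier X"
    and sup: "\<And>A. A \<subseteq> carrier Y \<Longrightarrow> h (\<Squnion>\<^bsub>Y\<^esub>A) = \<Squnion>\<^bsub>X\<^esub>(h ` A)"
    and top: "h \<top>\<^bsub>Y\<^esub> = \<top>\<^bsub>X\<^esub>"
    and meet: "\<And>a b. \<lbrakk>a \<in> carrier Y; b \<in> carrier Y\<rbrakk> \<Longrightarrow> h (a \<sqinter>\<^bsub>Y\<^esub> b) = h a \<sqinter>\<^bsub>X\<^esub> h b"
  shows "locale_map X Y \<lparr>lsrc = X, ltgt = Y, invim = restrict h (carrier Y)\<rparr>"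
proof -
  interpret Y: frame Y by fact
  have "restrict h (carrier Y) (\<Squnion>\<^bsub>Y\<^esub>A) = \<Squnion>\<^bsub>X\<^esub>(restrict h (carrier Y) ` A)" if A: "A \<subseteq> carrier Y" for A
  proof -
    have "restrict h (carrier Y) ` A = h ` A"
      by (rule image_cong) (use A in \<open>auto simp: subset_iff\<close>)
    then show ?thesis using Y.sup_closed[OF A] sup[OF A] by simp
  qed
  then show ?thesis
    using X Y cl top meet by (simp add: locale_map_def frame_hom_def sup_preserving_def)
qed

lemma balanced_ideal_iff:
  assumes "lsrc f = X" "lsrc g = Y" "ltgt f = B"
  shows "balanced_ideal f g U \<longleftrightarrow>
      U \<subseteq> carrier X \<times> carrier Y \<and>
      (\<forall>x x' y y'. (x, y) \<in> U \<longrightarrow> x' \<in> carrier X \<longrightarrow> y' \<in> carrier Y \<longrightarrow> x' \<sqsubseteq>\<^bsub>X\<^esub> x \<longrightarrow> y' \<sqsubseteq>\<^bsub>Y\<^esub> y \<longrightarrow> (x', y') \<in> U) \<and>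
      (\<forall>S y. S \<subseteq> carrier X \<longrightarrow> y \<in> carrier Y \<longrightarrow> (\<forall>x. x \<in> S \<longrightarrow> (x, y) \<in> U) \<longrightarrow> (\<Squnion>\<^bsub>X\<^esub>S, y) \<in> U) \<and>
      (\<forall>T x. T \<subseteq> carrier Y \<longrightarrow> x \<in> carrier X \<longrightarrow> (\<forall>y. y \<in> T \<longrightarrow> (x, y) \<in> U) \<longrightarrow> (x, \<Squnion>\<^bsub>Y\<^esub>T) \<in> U) \<and>
      (\<forall>x y b. x \<in> carrier X \<longrightarrow> y \<in> carrier Y \<longrightarrow> b \<in> carrier B \<longrightarrow>
        ((x \<sqinter>\<^bsub>X\<^esub> invim f b, y) \<in> U \<longleftrightarrow> (x, invim g b \<sqinter>\<^bsub>Y\<^esub> y) \<in> U))"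
  unfolding balanced_ideal_def Let_def assms
  apply (intro conj_cong refl)
  subgoal by blast
  subgoal by meson
  subgoal by meson
  subgoal by meson
  done

lemma (in frame) sup_insert_le:
  assumes "x \<in> carrier L" "y \<in> carrier L" "x \<sqsubseteq> y"
  shows "\<Squnion>{x, y} = y"
  using le_iff_meet[OF assms(1,2)] assms(3) by (simp add: join_def)

lemma sup_preserving_mono:
  assumes "frame L" "frame M" and h: "sup_preserving L M h"
    and x: "x \<in> carrier L" and y: "y \<in> carrier L" and xy: "x \<sqsubseteq>\<^bsub>L\<^esub> y"
  shows "h x \<sqsubseteq>\<^bsub>M\<^esub> h y"
proof -
  have "h (\<Squnion>\<^bsub>L\<^esub>{x, y}) = \<Squnion>\<^bsub>M\<^esub>(h ` {x, y})"
    using x y by (intro sup_preserving_sup[OF h]) simp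
  then have e: "h y = \<Squnion>\<^bsub>M\<^esub>{h x, h y}"
    using frame.sup_insert_le[OF assms(1) x y xy] by simp
  interpret M: frame M by fact
  show ?thesis
    by (subst e) (rule M.sup_upper; simp add: sup_preserving_closed[OF h] x y)
qed

lemma (in frame) meet_sup_le:
  assumes "a \<in> carrier L" "A \<subseteq> carrier L" "c \<in> carrier L" "\<And>b. b \<in> A \<Longrightarrow> b \<sqinter> a \<sqsubseteq> c"
  shows "\<Squnion>A \<sqinter> a \<sqsubseteq> c"
proof -
  have "\<Squnion>A \<sqinter> a = \<Squnion>((\<lambda>b. a \<sqinter> b) ` A)"
    using meet_sup_distrib[OF assms(1,2)] by (simp add: meet_comm)
  also have "\<dots> \<sqsubseteq> c"
    using assms by (intro sup_least) (auto simp: meet_comm)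
  finally show ?thesis .
qed

text \<open>The next two locales only serve to prove the universal property of \<open>lpullback\<close>.\<close>

locale cospan =
  fixes X :: "'x gorder" and Y :: "'y gorder" and B :: "'b gorder"
    and f :: "('x, 'b) lmap" and g :: "('y, 'b) lmap"
  assumes f: "locale_map X B f" and g: "locale_map Y B g"
begin

sublocale X: frame X using f unfolding locale_map_def by blast
sublocale Y: frame Y using g unfolding locale_map_def by blast
sublocale B: frame B using f unfolding locale_map_def by blast

lemma src [simp]: "lsrc f = X" "lsrc g = Y" "ltgt f = B" "ltgt g = B"
  by (fact locale_mapD[OF f] locale_mapD[OF g])+

lemma cl [simp]: "b \<in> carrier B \<Longrightarrow> invim f b \<in> carrier X" "b \<in> carrier B \<Longrightarrow> invim g b \<in> carrier Y"
  by (fact frame_homD(2)[OF locale_mapD(5)[OF f]] frame_homD(2)[OF locale_mapD(5)[OF g]])+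

abbreviation "I \<equiv> balanced_ideal f g"
abbreviation "P \<equiv> lpullback f g"

lemmas I_iff = balanced_ideal_iff[OF src(1,2,3)]

lemma I_subset: "I U \<Longrightarrow> U \<subseteq> carrier X \<times> carrier Y"
  by (simp only: I_iff)

lemma I_sub: "I U \<Longrightarrow> (x, y) \<in> U \<Longrightarrow> x \<in> carrier X \<and> y \<in> carrier Y"
  using I_subset[of U] by (simp add: subset_iff)

lemma I_down: "\<lbrakk>I U; (x, y) \<in> U; x' \<in> carrier X; y' \<in> carrier Y; x' \<sqsubseteq>\<^bsub>X\<^esub> x; y' \<sqsubseteq>\<^bsub>Y\<^esub> y\<rbrakk> \<Longrightarrow> (x', y') \<in> U"
  unfolding I_iff by metis

lemma I_sup1: "\<lbrakk>I U; S \<subseteq> carrier X; y \<in> carrier Y; \<And>x. x \<in> S \<Longrightarrow> (x, y) \<in> U\<rbrakk> \<Longrightarrow> (\<Squnion>\<^bsub>X\<^esub>S, y) \<in> U"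
  unfolding I_iff by metis

lemma I_sup2: "\<lbrakk>I U; T \<subseteq> carrier Y; x \<in> carrier X; \<And>y. y \<in> T \<Longrightarrow> (x, y) \<in> U\<rbrakk> \<Longrightarrow> (x, \<Squnion>\<^bsub>Y\<^esub>T) \<in> U"
  unfolding I_iff by metis

lemma I_bal: "\<lbrakk>I U; x \<in> carrier X; y \<in> carrier Y; b \<in> carrier B\<rbrakk>
   \<Longrightarrow> (x \<sqinter>\<^bsub>X\<^esub> invim f b, y) \<in> U \<longleftrightarrow> (x, invim g b \<sqinter>\<^bsub>Y\<^esub> y) \<in> U"
  unfolding I_iff by metis

lemma II:
  assumes "U \<subseteq> carrier X \<times> carrier Y"
    "\<And>x x' y y'. \<lbrakk>(x, y) \<in> U; x' \<in> carrier X; y' \<in> carrier Y; x' \<sqsubseteq>\<^bsub>X\<^esub> x; y' \<sqsubseteq>\<^bsub>Y\<^esub> y\<rbrakk> \<Longrightarrow> (x', y') \<in> U"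
    "\<And>S y. \<lbrakk>S \<subseteq> carrier X; y \<in> carrier Y; \<And>x. x \<in> S \<Longrightarrow> (x, y) \<in> U\<rbrakk> \<Longrightarrow> (\<Squnion>\<^bsub>X\<^esub>S, y) \<in> U"
    "\<And>T x. \<lbrakk>T \<subseteq> carrier Y; x \<in> carrier X; \<And>y. y \<in> T \<Longrightarrow> (x, y) \<in> U\<rbrakk> \<Longrightarrow> (x, \<Squnion>\<^bsub>Y\<^esub>T) \<in> U"
    "\<And>x y b. \<lbrakk>x \<in> carrier X; y \<in> carrier Y; b \<in> carrier B\<rbrakk>
       \<Longrightarrow> (x \<sqinter>\<^bsub>X\<^esub> invim f b, y) \<in> U \<longleftrightarrow> (x, invim g b \<sqinter>\<^bsub>Y\<^esub> y) \<in> U"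
  shows "I U"
  unfolding I_iff
  by (intro conjI allI impI; (rule assms; simp)?)

lemma I_top: "I (carrier X \<times> carrier Y)"
  by (rule II) auto

lemma I_Inter:
  assumes "\<U> \<noteq> {}" "\<And>U. U \<in> \<U> \<Longrightarrow> I U"
  shows "I (\<Inter>\<U>)"
proof (rule II)
  show "\<Inter>\<U> \<subseteq> carrier X \<times> carrier Y" using assms I_sub by fast
next
  fix x x' y y' assume "(x, y) \<in> \<Inter>\<U>" "x' \<in> carrier X" "y' \<in> carrier Y" "x' \<sqsubseteq>\<^bsub>X\<^esub> x" "y' \<sqsubseteq>\<^bsub>Y\<^esub> y"
  then show "(x', y') \<in> \<Inter>\<U>" using assms(2) I_down by blast
next
  fix S y assume "S \<subseteq> carrier X" "y \<in> carrier Y" "\<And>x. x \<in> S \<Longrightarrow> (x, y) \<in> \<Inter>\<U>"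
  then show "(\<Squnion>\<^bsub>X\<^esub>S, y) \<in> \<Inter>\<U>" using assms(2) I_sup1 by blast
next
  fix T x assume "T \<subseteq> carrier Y" "x \<in> carrier X" "\<And>y. y \<in> T \<Longrightarrow> (x, y) \<in> \<Inter>\<U>"
  then show "(x, \<Squnion>\<^bsub>Y\<^esub>T) \<in> \<Inter>\<U>" using assms(2) I_sup2 by blast
next
  fix x y b assume "x \<in> carrier X" "y \<in> carrier Y" "b \<in> carrier B"
  then show "(x \<sqinter>\<^bsub>X\<^esub> invim f b, y) \<in> \<Inter>\<U> \<longleftrightarrow> (x, invim g b \<sqinter>\<^bsub>Y\<^esub> y) \<in> \<Inter>\<U>"
    using assms(2) I_bal by blast
qed

lemma I_Int: "I U \<Longrightarrow> I V \<Longrightarrow> I (U \<inter> V)"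
  using I_Inter[of "{U, V}"] by auto

text \<open>\<open>residual a c W\<close> is the Heyting implication from \<open>a \<otimes> c\<close> to \<open>W\<close>.\<close>

definition residual :: "'x \<Rightarrow> 'y \<Rightarrow> ('x \<times> 'y) set \<Rightarrow> ('x \<times> 'y) set"
  where "residual a c W =
    {(x, y). x \<in> carrier X \<and> y \<in> carrier Y \<and> (x \<sqinter>\<^bsub>X\<^esub> a, y \<sqinter>\<^bsub>Y\<^esub> c) \<in> W}"

lemma I_residual:
  assumes W: "I W" and a: "a \<in> carrier X" and c: "c \<in> carrier Y"
  shows "I (residual a c W)"
proof (rule II)
  show "residual a c W \<subseteq> carrier X \<times> carrier Y" by (auto simp: residual_def)
next
  fix x x' y y'
  assume xy: "(x, y) \<in> residual a c W" "x' \<in> carrier X" "y' \<in> carrier Y" "x' \<sqsubseteq>\<^bsub>X\<^esub> x" "y' \<sqsubseteq>\<^bsub>Y\<^esub> y"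
  then have x: "x \<in> carrier X" "y \<in> carrier Y" "(x \<sqinter>\<^bsub>X\<^esub> a, y \<sqinter>\<^bsub>Y\<^esub> c) \<in> W"
    by (auto simp: residual_def)
  have "x' \<sqinter>\<^bsub>X\<^esub> a \<sqsubseteq>\<^bsub>X\<^esub> x \<sqinter>\<^bsub>X\<^esub> a"
    using xy x a X.le_trans[OF X.meet_left] by (intro X.meet_le X.meet_right) auto
  moreover have "y' \<sqinter>\<^bsub>Y\<^esub> c \<sqsubseteq>\<^bsub>Y\<^esub> y \<sqinter>\<^bsub>Y\<^esub> c"
    using xy x c Y.le_trans[OF Y.meet_left] by (intro Y.meet_le Y.meet_right) auto
  ultimately have "(x' \<sqinter>\<^bsub>X\<^esub> a, y' \<sqinter>\<^bsub>Y\<^esub> c) \<in> W"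
    using I_down[OF W x(3)] xy a c by auto
  then show "(x', y') \<in> residual a c W" using xy by (simp add: residual_def)
next
  fix S y assume S: "S \<subseteq> carrier X" "y \<in> carrier Y" "\<And>x. x \<in> S \<Longrightarrow> (x, y) \<in> residual a c W"
  have "(\<Squnion>\<^bsub>X\<^esub>((\<lambda>x. a \<sqinter>\<^bsub>X\<^esub> x) ` S), y \<sqinter>\<^bsub>Y\<^esub> c) \<in> W"
    using S a c by (intro I_sup1[OF W]) (auto simp: residual_def meet_comm)
  then show "(\<Squnion>\<^bsub>X\<^esub>S, y) \<in> residual a c W"
    using X.meet_sup_distrib[OF a S(1)] S by (simp add: residual_def meet_comm)
next
  fix T x assume T: "T \<subseteq> carrier Y" "x \<in> carrier X" "\<And>y. y \<in> T \<Longrightarrow> (x, y) \<in> residual a c W"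
  have "(x \<sqinter>\<^bsub>X\<^esub> a, \<Squnion>\<^bsub>Y\<^esub>((\<lambda>y. c \<sqinter>\<^bsub>Y\<^esub> y) ` T)) \<in> W"
    using T a c by (intro I_sup2[OF W]) (auto simp: residual_def meet_comm)
  then show "(x, \<Squnion>\<^bsub>Y\<^esub>T) \<in> residual a c W"
    using Y.meet_sup_distrib[OF c T(1)] T by (simp add: residual_def meet_comm)
next
  fix x y b assume h: "x \<in> carrier X" "y \<in> carrier Y" "b \<in> carrier B"
  have 1: "(x \<sqinter>\<^bsub>X\<^esub> invim f b) \<sqinter>\<^bsub>X\<^esub> a = (x \<sqinter>\<^bsub>X\<^esub> a) \<sqinter>\<^bsub>X\<^esub> invim f b"
    using h a by (simp add: X.meet_assoc meet_comm[of X a])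
  have 2: "(invim g b \<sqinter>\<^bsub>Y\<^esub> y) \<sqinter>\<^bsub>Y\<^esub> c = invim g b \<sqinter>\<^bsub>Y\<^esub> (y \<sqinter>\<^bsub>Y\<^esub> c)"
    using h c by (simp add: Y.meet_assoc)
  show "(x \<sqinter>\<^bsub>X\<^esub> invim f b, y) \<in> residual a c W \<longleftrightarrow> (x, invim g b \<sqinter>\<^bsub>Y\<^esub> y) \<in> residual a c W"
    using h a c I_bal[OF W, of "x \<sqinter>\<^bsub>X\<^esub> a" "y \<sqinter>\<^bsub>Y\<^esub> c" b] by (simp add: residual_def 1 2)
qed

lemma P_simps [simp]: "carrier P = {U. I U}" "(U \<sqsubseteq>\<^bsub>P\<^esub> V) = (U \<subseteq> V)" "eq P = (=)"
  by (auto simp: lpullback_def)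

lemma P_complete: "complete_lattice P"
proof -
  interpret partial_order P by standard auto
  show ?thesis
  proof (rule complete_lattice_criterion1)
    show "\<exists>t. greatest P t (carrier P)"
      using I_top I_subset by (intro exI[of _ "carrier X \<times> carrier Y"]) (simp add: greatest_def Ball_def)
    fix A assume A: "A \<subseteq> carrier P" "A \<noteq> {}"
    then have "I (\<Inter>A)" by (intro I_Inter) auto
    then show "\<exists>i. greatest P i (Lower P A)"
      using A by (intro exI[of _ "\<Inter>A"]) (auto simp: greatest_def Lower_def)
  qed
qed

interpretation P: complete_lattice P by (rule P_complete)

lemma P_meet: assumes "I U" "I V" shows "U \<sqinter>\<^bsub>P\<^esub> V = U \<inter> V"
proof -
  have "I (U \<sqinter>\<^bsub>P\<^esub> V)" using P.meet_closed assms by simp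
  moreover have "U \<sqinter>\<^bsub>P\<^esub> V \<subseteq> U" "U \<sqinter>\<^bsub>P\<^esub> V \<subseteq> V"
    using P.meet_left[of U V] P.meet_right[of U V] assms by auto
  moreover have "U \<inter> V \<subseteq> U \<sqinter>\<^bsub>P\<^esub> V"
    using P.meet_le[of "U \<inter> V" U V] assms I_Int by auto
  ultimately show ?thesis by blast
qed

lemma P_top: "\<top>\<^bsub>P\<^esub> = carrier X \<times> carrier Y"
  using P.weak.top_weak_eq[of "carrier X \<times> carrier Y"] I_top I_subset by simp

lemma P_sup_closed: "(\<And>U. U \<in> A \<Longrightarrow> I U) \<Longrightarrow> I (\<Squnion>\<^bsub>P\<^esub>A)"
  using P.sup_closed[of A] by auto

lemma P_sup_upper: "(\<And>U. U \<in> A \<Longrightarrow> I U) \<Longrightarrow> U \<in> A \<Longrightarrow> U \<subseteq> \<Squnion>\<^bsub>P\<^esub>A"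
  using P.sup_upper[of A U] by auto

lemma P_sup_least: "(\<And>U. U \<in> A \<Longrightarrow> I U) \<Longrightarrow> I W \<Longrightarrow> (\<And>U. U \<in> A \<Longrightarrow> U \<subseteq> W) \<Longrightarrow> \<Squnion>\<^bsub>P\<^esub>A \<subseteq> W"
  using P.sup_least[of A W] by auto

lemma P_frame: "frame P"
proof -
  have "U \<sqinter>\<^bsub>P\<^esub> \<Squnion>\<^bsub>P\<^esub>A = \<Squnion>\<^bsub>P\<^esub>((\<lambda>V. U \<sqinter>\<^bsub>P\<^esub> V) ` A)"
    if U: "U \<in> carrier P" and A: "A \<subseteq> carrier P" for U A
  proof -
    have IU: "I U" and IA: "\<And>V. V \<in> A \<Longrightarrow> I V" using U A by auto
    let ?W = "\<Squnion>\<^bsub>P\<^esub>((\<lambda>V. U \<sqinter>\<^bsub>P\<^esub> V) ` A)"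
    have IJ: "\<And>V. V \<in> (\<lambda>V. U \<sqinter>\<^bsub>P\<^esub> V) ` A \<Longrightarrow> I V" using IU IA by (auto simp: P_meet I_Int)
    have W: "I ?W" by (rule P_sup_closed[OF IJ])
    have up: "U \<inter> V \<subseteq> ?W" if "V \<in> A" for V
      using P_sup_upper[OF IJ, where U = "U \<sqinter>\<^bsub>P\<^esub> V"] that IU IA by (auto simp: P_meet)
    have S: "I (\<Squnion>\<^bsub>P\<^esub>A)" by (rule P_sup_closed[OF IA])
    have "U \<inter> \<Squnion>\<^bsub>P\<^esub>A \<subseteq> ?W"
    proof
      fix z assume z: "z \<in> U \<inter> \<Squnion>\<^bsub>P\<^esub>A"
      obtain a c where zz: "z = (a, c)" by (cases z)
      have ac: "a \<in> carrier X" "c \<in> carrier Y" using z zz IU I_sub by auto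
      have "\<Squnion>\<^bsub>P\<^esub>A \<subseteq> residual a c ?W"
      proof (rule P_sup_least[OF IA I_residual[OF W ac]])
        fix V assume V: "V \<in> A"
        show "V \<subseteq> residual a c ?W"
        proof
          fix v assume "v \<in> V"
          then obtain x y where v: "v = (x, y)" "(x, y) \<in> V" by (cases v) auto
          have xy: "x \<in> carrier X" "y \<in> carrier Y" using I_sub[OF IA[OF V] v(2)] by auto
          have "(x \<sqinter>\<^bsub>X\<^esub> a, y \<sqinter>\<^bsub>Y\<^esub> c) \<in> V"
            using I_down[OF IA[OF V] v(2)] xy ac X.meet_left Y.meet_left by auto
          moreover have "(x \<sqinter>\<^bsub>X\<^esub> a, y \<sqinter>\<^bsub>Y\<^esub> c) \<in> U"
            using z zz I_down[OF IU, of a c] xy ac X.meet_right Y.meet_right by auto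
          ultimately show "v \<in> residual a c ?W" using up[OF V] xy v by (auto simp: residual_def)
        qed
      qed auto
      then have "(a \<sqinter>\<^bsub>X\<^esub> a, c \<sqinter>\<^bsub>Y\<^esub> c) \<in> ?W" using z zz by (auto simp: residual_def)
      then show "z \<in> ?W" using ac zz by (simp add: meet_def)
    qed
    moreover have "?W \<subseteq> U \<inter> \<Squnion>\<^bsub>P\<^esub>A"
    proof (rule P_sup_least[OF IJ I_Int[OF IU S]])
      fix V assume "V \<in> (\<lambda>V. U \<sqinter>\<^bsub>P\<^esub> V) ` A"
      then obtain V' where "V' \<in> A" "V = U \<inter> V'" using IU IA P_meet by auto
      then show "V \<subseteq> U \<inter> \<Squnion>\<^bsub>P\<^esub>A" using P_sup_upper[OF IA, where U = V'] by blast
    qed auto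
    ultimately show ?thesis unfolding P_meet[OF IU S] by (rule subset_antisym)
  qed
  then show ?thesis by unfold_locales
qed

abbreviation "T \<equiv> tensor f g"

lemma T_I: assumes "x \<in> carrier X" "y \<in> carrier Y" shows "I (T x y)"
  unfolding tensor_def using assms I_top by (intro I_Inter) auto

lemma T_mem: "(x, y) \<in> T x y" by (auto simp: tensor_def)

lemma T_le: "I U \<Longrightarrow> (x, y) \<in> U \<Longrightarrow> T x y \<subseteq> U" by (auto simp: tensor_def)

lemma T_meet:
  assumes "x \<in> carrier X" "y \<in> carrier Y" "x' \<in> carrier X" "y' \<in> carrier Y"
  shows "T x y \<inter> T x' y' = T (x \<sqinter>\<^bsub>X\<^esub> x') (y \<sqinter>\<^bsub>Y\<^esub> y')"
proof
  let ?W = "T (x \<sqinter>\<^bsub>X\<^esub> x') (y \<sqinter>\<^bsub>Y\<^esub> y')"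
  have W: "I ?W" using assms by (intro T_I) auto
  have 1: "T x y \<subseteq> residual x' y' ?W"
    using assms T_mem by (intro T_le I_residual W) (auto simp: residual_def)
  show "T x y \<inter> T x' y' \<subseteq> ?W"
  proof
    fix z assume z: "z \<in> T x y \<inter> T x' y'"
    obtain a c where zz: "z = (a, c)" by (cases z)
    have ac: "a \<in> carrier X" "c \<in> carrier Y" using z zz I_sub[OF T_I[OF assms(1,2)], of a c] by simp_all
    have "(a, c) \<in> residual x' y' ?W" using 1 z zz by (simp add: subset_iff)
    then have "(a \<sqinter>\<^bsub>X\<^esub> x', c \<sqinter>\<^bsub>Y\<^esub> y') \<in> ?W" by (simp add: residual_def)
    then have "T x' y' \<subseteq> residual a c ?W"
      using assms ac by (intro T_le I_residual W) (auto simp: residual_def meet_comm)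
    then have "(a \<sqinter>\<^bsub>X\<^esub> a, c \<sqinter>\<^bsub>Y\<^esub> c) \<in> ?W" using z zz by (auto simp: residual_def)
    then show "z \<in> ?W" using ac zz by (simp add: meet_def)
  qed
  have "(x \<sqinter>\<^bsub>X\<^esub> x', y \<sqinter>\<^bsub>Y\<^esub> y') \<in> T x y"
    using assms by (intro I_down[OF T_I T_mem] X.meet_left Y.meet_left) auto
  moreover have "(x \<sqinter>\<^bsub>X\<^esub> x', y \<sqinter>\<^bsub>Y\<^esub> y') \<in> T x' y'"
    using assms by (intro I_down[OF T_I T_mem] X.meet_right Y.meet_right) auto
  ultimately show "?W \<subseteq> T x y \<inter> T x' y'"
    using assms by (intro T_le I_Int T_I) auto
qed

lemma X_meet_top: "x \<in> carrier X \<Longrightarrow> x \<sqinter>\<^bsub>X\<^esub> \<top>\<^bsub>X\<^esub> = x" "x \<in> carrier X \<Longrightarrow> \<top>\<^bsub>X\<^esub> \<sqinter>\<^bsub>X\<^esub> x = x"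
  using X.top_meet X.eq_is_equal by (auto simp: meet_comm[of X x])

lemma Y_meet_top: "x \<in> carrier Y \<Longrightarrow> x \<sqinter>\<^bsub>Y\<^esub> \<top>\<^bsub>Y\<^esub> = x" "x \<in> carrier Y \<Longrightarrow> \<top>\<^bsub>Y\<^esub> \<sqinter>\<^bsub>Y\<^esub> x = x"
  using Y.top_meet Y.eq_is_equal by (auto simp: meet_comm[of Y x])

lemma T_top: "T \<top>\<^bsub>X\<^esub> \<top>\<^bsub>Y\<^esub> = \<top>\<^bsub>P\<^esub>"
proof -
  have "carrier X \<times> carrier Y \<subseteq> T \<top>\<^bsub>X\<^esub> \<top>\<^bsub>Y\<^esub>"
    using I_down[OF T_I T_mem, of "\<top>\<^bsub>X\<^esub>" "\<top>\<^bsub>Y\<^esub>"] X.top_higher Y.top_higher by auto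
  then show ?thesis using P_top T_I[of "\<top>\<^bsub>X\<^esub>" "\<top>\<^bsub>Y\<^esub>"] I_sub by fastforce
qed

lemma T_sup1:
  assumes A: "A \<subseteq> carrier X" and y: "y \<in> carrier Y"
  shows "T (\<Squnion>\<^bsub>X\<^esub>A) y = \<Squnion>\<^bsub>P\<^esub>((\<lambda>x. T x y) ` A)"
proof
  let ?J = "(\<lambda>x. T x y) ` A"
  have J: "\<And>U. U \<in> ?J \<Longrightarrow> I U" using A y T_I by auto
  show "T (\<Squnion>\<^bsub>X\<^esub>A) y \<subseteq> \<Squnion>\<^bsub>P\<^esub>?J"
    using P_sup_upper[OF J] T_mem A y
    by (intro T_le P_sup_closed[OF J] I_sup1[OF P_sup_closed[OF J]]) blast+
  show "\<Squnion>\<^bsub>P\<^esub>?J \<subseteq> T (\<Squnion>\<^bsub>X\<^esub>A) y"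
  proof (rule P_sup_least[OF J])
    show "I (T (\<Squnion>\<^bsub>X\<^esub>A) y)" using A y by (intro T_I) auto
    fix U assume "U \<in> ?J"
    then obtain x where x: "x \<in> A" "U = T x y" by auto
    show "U \<subseteq> T (\<Squnion>\<^bsub>X\<^esub>A) y"
      unfolding x(2) using A y x X.sup_upper[OF A x(1)]
      by (intro T_le T_I I_down[OF T_I T_mem]) auto
  qed auto
qed

lemma T_sup2:
  assumes A: "A \<subseteq> carrier Y" and x: "x \<in> carrier X"
  shows "T x (\<Squnion>\<^bsub>Y\<^esub>A) = \<Squnion>\<^bsub>P\<^esub>((\<lambda>y. T x y) ` A)"
proof
  let ?J = "(\<lambda>y. T x y) ` A"
  have J: "\<And>U. U \<in> ?J \<Longrightarrow> I U" using A x T_I by auto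
  show "T x (\<Squnion>\<^bsub>Y\<^esub>A) \<subseteq> \<Squnion>\<^bsub>P\<^esub>?J"
    using P_sup_upper[OF J] T_mem A x
    by (intro T_le P_sup_closed[OF J] I_sup2[OF P_sup_closed[OF J]]) blast+
  show "\<Squnion>\<^bsub>P\<^esub>?J \<subseteq> T x (\<Squnion>\<^bsub>Y\<^esub>A)"
  proof (rule P_sup_least[OF J])
    show "I (T x (\<Squnion>\<^bsub>Y\<^esub>A))" using A x by (intro T_I) auto
    fix U assume "U \<in> ?J"
    then obtain y where y: "y \<in> A" "U = T x y" by auto
    show "U \<subseteq> T x (\<Squnion>\<^bsub>Y\<^esub>A)"
      unfolding y(2) using A x y Y.sup_upper[OF A y(1)]
      by (intro T_le T_I I_down[OF T_I T_mem]) auto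
  qed auto
qed

lemma lfst_map: "locale_map P X (lfst f g)"
  unfolding lfst_def src
  by (rule locale_map_restrictI)
     (simp_all add: P_frame X.frame_axioms T_I T_top T_sup1 P_meet T_meet Y_meet_top)

lemma lsnd_map: "locale_map P Y (lsnd f g)"
  unfolding lsnd_def src
  by (rule locale_map_restrictI)
     (simp_all add: P_frame Y.frame_axioms T_I T_top T_sup2 P_meet T_meet X_meet_top)

lemma square: "f \<circ>\<^sub>L lfst f g = g \<circ>\<^sub>L lsnd f g"
proof -
  have "T (invim f b) \<top>\<^bsub>Y\<^esub> = T \<top>\<^bsub>X\<^esub> (invim g b)" if b: "b \<in> carrier B" for b
  proof
    show "T (invim f b) \<top>\<^bsub>Y\<^esub> \<subseteq> T \<top>\<^bsub>X\<^esub> (invim g b)"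
      using b I_bal[OF T_I, of "\<top>\<^bsub>X\<^esub>" "invim g b" "\<top>\<^bsub>X\<^esub>" "\<top>\<^bsub>Y\<^esub>" b] T_mem
      by (intro T_le T_I) (auto simp: X_meet_top Y_meet_top)
    show "T \<top>\<^bsub>X\<^esub> (invim g b) \<subseteq> T (invim f b) \<top>\<^bsub>Y\<^esub>"
      using b I_bal[OF T_I, of "invim f b" "\<top>\<^bsub>Y\<^esub>" "\<top>\<^bsub>X\<^esub>" "\<top>\<^bsub>Y\<^esub>" b] T_mem
      by (intro T_le T_I) (auto simp: X_meet_top Y_meet_top)
  qed
  then show ?thesis
    by (auto simp: lcomp_def lfst_def lsnd_def compose_def fun_eq_iff)
qed

end

locale cone = cospan X Y B f g
  for X :: "'x gorder" and Y :: "'y gorder" and B :: "'b gorder"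
    and f :: "('x, 'b) lmap" and g :: "('y, 'b) lmap" +
  fixes Z :: "'z gorder" and h :: "('z, 'x) lmap" and k :: "('z, 'y) lmap"
  assumes h: "locale_map Z X h" and k: "locale_map Z Y k" and comm: "f \<circ>\<^sub>L h = g \<circ>\<^sub>L k"
begin

sublocale Z: frame Z using h unfolding locale_map_def by blast

interpretation P: frame P by (rule P_frame)

lemma src' [simp]: "lsrc h = Z" "lsrc k = Z" "ltgt h = X" "ltgt k = Y"
  using h k unfolding locale_map_def by auto

lemma h_hom: "frame_hom X Z (invim h)" and k_hom: "frame_hom Y Z (invim k)"
  using h k unfolding locale_map_def by auto

lemma h_sp: "sup_preserving X Z (invim h)" and k_sp: "sup_preserving Y Z (invim k)"
  using h_hom k_hom unfolding frame_hom_def by auto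

lemma hk_cl [simp]: "x \<in> carrier X \<Longrightarrow> invim h x \<in> carrier Z" "y \<in> carrier Y \<Longrightarrow> invim k y \<in> carrier Z"
  using h_sp k_sp unfolding sup_preserving_def by auto

lemma hk_meet:
  "\<lbrakk>x \<in> carrier X; x' \<in> carrier X\<rbrakk> \<Longrightarrow> invim h (x \<sqinter>\<^bsub>X\<^esub> x') = invim h x \<sqinter>\<^bsub>Z\<^esub> invim h x'"
  "\<lbrakk>y \<in> carrier Y; y' \<in> carrier Y\<rbrakk> \<Longrightarrow> invim k (y \<sqinter>\<^bsub>Y\<^esub> y') = invim k y \<sqinter>\<^bsub>Z\<^esub> invim k y'"
  using h_hom k_hom unfolding frame_hom_def by auto

lemma hk_top: "invim h \<top>\<^bsub>X\<^esub> = \<top>\<^bsub>Z\<^esub>" "invim k \<top>\<^bsub>Y\<^esub> = \<top>\<^bsub>Z\<^esub>"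
  using h_hom k_hom unfolding frame_hom_def by auto

lemma Z_meet_top: "z \<in> carrier Z \<Longrightarrow> z \<sqinter>\<^bsub>Z\<^esub> \<top>\<^bsub>Z\<^esub> = z" "z \<in> carrier Z \<Longrightarrow> \<top>\<^bsub>Z\<^esub> \<sqinter>\<^bsub>Z\<^esub> z = z"
  using Z.top_meet Z.eq_is_equal by (auto simp: meet_comm[of Z z])

lemma comm': assumes "b \<in> carrier B" shows "invim h (invim f b) = invim k (invim g b)"
proof -
  have "compose (carrier B) (invim h) (invim f) = compose (carrier B) (invim k) (invim g)"
    using comm by (simp add: lcomp_def)
  then show ?thesis using assms by (metis compose_eq)
qed

definition m :: "'x \<Rightarrow> 'y \<Rightarrow> 'z" where "m x y = invim h x \<sqinter>\<^bsub>Z\<^esub> invim k y"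

lemma m_cl [simp]: "\<lbrakk>x \<in> carrier X; y \<in> carrier Y\<rbrakk> \<Longrightarrow> m x y \<in> carrier Z"
  by (simp add: m_def)

lemma m_meet:
  assumes "x \<in> carrier X" "y \<in> carrier Y" "x' \<in> carrier X" "y' \<in> carrier Y"
  shows "m x y \<sqinter>\<^bsub>Z\<^esub> m x' y' = m (x \<sqinter>\<^bsub>X\<^esub> x') (y \<sqinter>\<^bsub>Y\<^esub> y')"
proof -
  have "invim h x \<sqinter>\<^bsub>Z\<^esub> invim k y \<sqinter>\<^bsub>Z\<^esub> (invim h x' \<sqinter>\<^bsub>Z\<^esub> invim k y')
    = invim h x \<sqinter>\<^bsub>Z\<^esub> (invim k y \<sqinter>\<^bsub>Z\<^esub> invim h x') \<sqinter>\<^bsub>Z\<^esub> invim k y'"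
    using assms by (simp add: Z.meet_assoc)
  also have "\<dots> = invim h x \<sqinter>\<^bsub>Z\<^esub> (invim h x' \<sqinter>\<^bsub>Z\<^esub> invim k y) \<sqinter>\<^bsub>Z\<^esub> invim k y'"
    by (simp add: meet_comm)
  also have "\<dots> = invim h x \<sqinter>\<^bsub>Z\<^esub> invim h x' \<sqinter>\<^bsub>Z\<^esub> (invim k y \<sqinter>\<^bsub>Z\<^esub> invim k y')"
    using assms by (simp add: Z.meet_assoc)
  finally show ?thesis using assms by (simp add: m_def hk_meet)
qed

lemma m_mono:
  assumes "x \<in> carrier X" "y \<in> carrier Y" "x' \<in> carrier X" "y' \<in> carrier Y" "x' \<sqsubseteq>\<^bsub>X\<^esub> x" "y' \<sqsubseteq>\<^bsub>Y\<^esub> y"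
  shows "m x' y' \<sqsubseteq>\<^bsub>Z\<^esub> m x y"
proof -
  have "invim h x' \<sqsubseteq>\<^bsub>Z\<^esub> invim h x"
    by (rule sup_preserving_mono[OF X.frame_axioms 
          Z.frame_axioms h_sp]) (use assms in auto)
  moreover have "invim k y' \<sqsubseteq>\<^bsub>Z\<^esub> invim k y"
    by (rule sup_preserving_mono[OF Y.frame_axioms 
          Z.frame_axioms k_sp]) (use assms in auto)
  ultimately show ?thesis
    unfolding m_def using assms Z.le_trans[OF Z.meet_left] Z.le_trans[OF Z.meet_right]
    by (intro Z.meet_le) auto
qed

lemma I_below:
  assumes c: "c \<in> carrier Z"
  shows "I {(x, y). x \<in> carrier X \<and> y \<in> carrier Y \<and> m x y \<sqsubseteq>\<^bsub>Z\<^esub> c}" (is "I ?U")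
proof (rule II)
  show "?U \<subseteq> carrier X \<times> carrier Y" by auto
next
  fix x x' y y' assume "(x, y) \<in> ?U" "x' \<in> carrier X" "y' \<in> carrier Y" "x' \<sqsubseteq>\<^bsub>X\<^esub> x" "y' \<sqsubseteq>\<^bsub>Y\<^esub> y"
  then show "(x', y') \<in> ?U" using Z.le_trans[OF m_mono] c by auto
next
  fix S y assume S: "S \<subseteq> carrier X" "y \<in> carrier Y" "\<And>x. x \<in> S \<Longrightarrow> (x, y) \<in> ?U"
  have "invim h (\<Squnion>\<^bsub>X\<^esub>S) = \<Squnion>\<^bsub>Z\<^esub>(invim h ` S)" using h_sp S unfolding sup_preserving_def by blast
  moreover have "\<Squnion>\<^bsub>Z\<^esub>(invim h ` S) \<sqinter>\<^bsub>Z\<^esub> invim k y \<sqsubseteq>\<^bsub>Z\<^esub> c"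
    using S c by (intro Z.meet_sup_le) (auto simp: m_def)
  ultimately show "(\<Squnion>\<^bsub>X\<^esub>S, y) \<in> ?U" using S by (simp add: m_def)
next
  fix S x assume S: "S \<subseteq> carrier Y" "x \<in> carrier X" "\<And>y. y \<in> S \<Longrightarrow> (x, y) \<in> ?U"
  have "invim k (\<Squnion>\<^bsub>Y\<^esub>S) = \<Squnion>\<^bsub>Z\<^esub>(invim k ` S)" using k_sp S unfolding sup_preserving_def by blast
  moreover have "\<Squnion>\<^bsub>Z\<^esub>(invim k ` S) \<sqinter>\<^bsub>Z\<^esub> invim h x \<sqsubseteq>\<^bsub>Z\<^esub> c"
    using S c by (intro Z.meet_sup_le) (auto simp: m_def meet_comm[of Z _ "invim h x"])
  ultimately show "(x, \<Squnion>\<^bsub>Y\<^esub>S) \<in> ?U" using S by (simp add: m_def meet_comm[of Z _ "invim h x"])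
next
  fix x y b assume a: "x \<in> carrier X" "y \<in> carrier Y" "b \<in> carrier B"
  then have "m (x \<sqinter>\<^bsub>X\<^esub> invim f b) y = m x (invim g b \<sqinter>\<^bsub>Y\<^esub> y)"
    by (simp add: m_def hk_meet comm' Z.meet_assoc)
  then show "(x \<sqinter>\<^bsub>X\<^esub> invim f b, y) \<in> ?U \<longleftrightarrow> (x, invim g b \<sqinter>\<^bsub>Y\<^esub> y) \<in> ?U"
    using a by simp
qed

definition p :: "('x \<times> 'y) set \<Rightarrow> 'z" where "p U = \<Squnion>\<^bsub>Z\<^esub>((\<lambda>(x, y). m x y) ` U)"

lemma m_image: "I U \<Longrightarrow> (\<lambda>(x, y). m x y) ` U \<subseteq> carrier Z"
  using I_sub by fastforce

lemma p_cl [simp]: "I U \<Longrightarrow> p U \<in> carrier Z"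
  unfolding p_def using m_image by (rule Z.sup_closed)

lemma p_le:
  assumes U: "I U" and c: "c \<in> carrier Z"
  shows "p U \<sqsubseteq>\<^bsub>Z\<^esub> c \<longleftrightarrow> U \<subseteq> {(x, y). x \<in> carrier X \<and> y \<in> carrier Y \<and> m x y \<sqsubseteq>\<^bsub>Z\<^esub> c}" (is "_ \<longleftrightarrow> U \<subseteq> ?U")
proof
  assume l: "p U \<sqsubseteq>\<^bsub>Z\<^esub> c"
  show "U \<subseteq> ?U"
  proof clarify
    fix x y assume xy: "(x, y) \<in> U"
    have "m x y \<sqsubseteq>\<^bsub>Z\<^esub> p U" unfolding p_def by (rule Z.sup_upper[OF m_image[OF U]]) (use xy in force)
    then show "x \<in> carrier X \<and> y \<in> carrier Y \<and> m x y \<sqsubseteq>\<^bsub>Z\<^esub> c"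
      using I_sub[OF U xy] l c U Z.le_trans[of "m x y" "p U" c] by auto
  qed
next
  assume "U \<subseteq> ?U"
  then show "p U \<sqsubseteq>\<^bsub>Z\<^esub> c" unfolding p_def by (intro Z.sup_least[OF m_image[OF U] c]) auto
qed

lemma m_le_p: "I U \<Longrightarrow> (x, y) \<in> U \<Longrightarrow> m x y \<sqsubseteq>\<^bsub>Z\<^esub> p U"
  using p_le[of U "p U"] by auto

lemma p_T: assumes "x \<in> carrier X" "y \<in> carrier Y" shows "p (T x y) = m x y"
proof (rule Z.le_antisym)
  show "p (T x y) \<sqsubseteq>\<^bsub>Z\<^esub> m x y"
    unfolding p_le[OF T_I[OF assms] m_cl[OF assms]]
    using assms by (intro T_le I_below) auto
  show "m x y \<sqsubseteq>\<^bsub>Z\<^esub> p (T x y)" using assms by (intro m_le_p T_I T_mem)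
qed (use assms T_I in auto)

lemma p_mono: "I U \<Longrightarrow> I V \<Longrightarrow> U \<subseteq> V \<Longrightarrow> p U \<sqsubseteq>\<^bsub>Z\<^esub> p V"
  using p_le[of U "p V"] p_le[of V "p V"] by auto

lemma p_sup: assumes A: "\<And>U. U \<in> A \<Longrightarrow> I U" shows "p (\<Squnion>\<^bsub>P\<^esub>A) = \<Squnion>\<^bsub>Z\<^esub>(p ` A)"
proof (rule Z.le_antisym)
  have c: "p ` A \<subseteq> carrier Z" using A by auto
  have S: "I (\<Squnion>\<^bsub>P\<^esub>A)" by (rule P_sup_closed[OF A])
  show cl: "p (\<Squnion>\<^bsub>P\<^esub>A) \<in> carrier Z" "\<Squnion>\<^bsub>Z\<^esub>(p ` A) \<in> carrier Z" using S c by auto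
  show "\<Squnion>\<^bsub>Z\<^esub>(p ` A) \<sqsubseteq>\<^bsub>Z\<^esub> p (\<Squnion>\<^bsub>P\<^esub>A)"
    using A S P_sup_upper[OF A] p_mono by (intro Z.sup_least[OF c]) auto
  show "p (\<Squnion>\<^bsub>P\<^esub>A) \<sqsubseteq>\<^bsub>Z\<^esub> \<Squnion>\<^bsub>Z\<^esub>(p ` A)"
    unfolding p_le[OF S cl(2)]
  proof (rule P_sup_least[OF A I_below[OF cl(2)]])
    fix U assume U: "U \<in> A"
    then show "U \<subseteq> {(x, y). x \<in> carrier X \<and> y \<in> carrier Y \<and> m x y \<sqsubseteq>\<^bsub>Z\<^esub> \<Squnion>\<^bsub>Z\<^esub>(p ` A)}"
      using p_le[OF A[OF U] cl(2)] Z.sup_upper[OF c] by blast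
  qed auto
qed

lemma p_meet: assumes U: "I U" and V: "I V" shows "p (U \<inter> V) = p U \<sqinter>\<^bsub>Z\<^esub> p V"
proof (rule Z.le_antisym)
  have UV: "I (U \<inter> V)" using U V by (rule I_Int)
  show "p (U \<inter> V) \<in> carrier Z" "p U \<sqinter>\<^bsub>Z\<^esub> p V \<in> carrier Z" using U V UV by auto
  show "p (U \<inter> V) \<sqsubseteq>\<^bsub>Z\<^esub> p U \<sqinter>\<^bsub>Z\<^esub> p V" using U V UV by (intro Z.meet_le p_mono) auto
  have *: "m x y \<sqinter>\<^bsub>Z\<^esub> m x' y' \<sqsubseteq>\<^bsub>Z\<^esub> p (U \<inter> V)" if "(x, y) \<in> U" "(x', y') \<in> V" for x y x' y'
  proof -
    have c: "x \<in> carrier X" "y \<in> carrier Y" "x' \<in> carrier X" "y' \<in> carrier Y"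
      using that I_sub U V by auto
    have "(x \<sqinter>\<^bsub>X\<^esub> x', y \<sqinter>\<^bsub>Y\<^esub> y') \<in> U"
      using I_down[OF U that(1)] c X.meet_left Y.meet_left by auto
    moreover have "(x \<sqinter>\<^bsub>X\<^esub> x', y \<sqinter>\<^bsub>Y\<^esub> y') \<in> V"
      using I_down[OF V that(2)] c X.meet_right Y.meet_right by auto
    ultimately show ?thesis using m_le_p[OF UV] c by (simp add: m_meet)
  qed
  have "p V \<sqinter>\<^bsub>Z\<^esub> m x y \<sqsubseteq>\<^bsub>Z\<^esub> p (U \<inter> V)" if "(x, y) \<in> U" for x y
    unfolding p_def[of V] using I_sub[OF U that] UV * that
    by (intro Z.meet_sup_le m_image V) (auto simp: meet_comm[of Z _ "m x y"])
  then have "\<Squnion>\<^bsub>Z\<^esub>((\<lambda>(x, y). m x y) ` U) \<sqinter>\<^bsub>Z\<^esub> p V \<sqsubseteq>\<^bsub>Z\<^esub> p (U \<inter> V)"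
    using UV V by (intro Z.meet_sup_le m_image U) (auto simp: meet_comm[of Z "p V"])
  then show "p U \<sqinter>\<^bsub>Z\<^esub> p V \<sqsubseteq>\<^bsub>Z\<^esub> p (U \<inter> V)" by (simp add: p_def)
qed

lemma lpair_p: "lpair f g h k = \<lparr>lsrc = Z, ltgt = P, invim = restrict p (carrier P)\<rparr>"
  by (simp add: lpair_def p_def m_def cong: restrict_cong)

lemma lpair_map: "locale_map Z P (lpair f g h k)"
proof -
  have "p \<top>\<^bsub>P\<^esub> = \<top>\<^bsub>Z\<^esub>"
    using p_T[of "\<top>\<^bsub>X\<^esub>" "\<top>\<^bsub>Y\<^esub>"] by (simp add: T_top m_def hk_top Z_meet_top)
  then show ?thesis
    unfolding lpair_p
    by (intro locale_map_restrictI) (simp_all add: P_frame Z.frame_axioms p_sup p_meet P_meet subset_iff)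
qed

lemma lmap_eqI:
  assumes "locale_map Z W s" "locale_map Z W t" "\<And>w. w \<in> carrier W \<Longrightarrow> invim s w = invim t w"
  shows "s = t"
  using assms extensionalityI[of "invim s" "carrier W" "invim t"]
  unfolding locale_map_def by (cases s; cases t) auto

lemma lfst_lpair: "lfst f g \<circ>\<^sub>L lpair f g h k = h"
proof -
  have "invim h \<in> extensional (carrier X)" using h unfolding locale_map_def by auto
  then have "compose (carrier X) (restrict p (carrier P)) (\<lambda>x\<in>carrier X. T x \<top>\<^bsub>Y\<^esub>) = invim h"
    by (intro extensionalityI[of _ "carrier X"])
       (auto simp: compose_def T_I p_T m_def hk_top Z_meet_top)
  then show ?thesis unfolding lcomp_def lpair_p lfst_def by (cases h) (use src' in auto)
qed

lemma lsnd_lpair: "lsnd f g \<circ>\<^sub>L lpair f g h k = k"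
proof -
  have "invim k \<in> extensional (carrier Y)" using k unfolding locale_map_def by auto
  then have "compose (carrier Y) (restrict p (carrier P)) (\<lambda>y\<in>carrier Y. T \<top>\<^bsub>X\<^esub> y) = invim k"
    by (intro extensionalityI[of _ "carrier Y"])
       (auto simp: compose_def T_I p_T m_def hk_top Z_meet_top)
  then show ?thesis unfolding lcomp_def lpair_p lsnd_def by (cases k) (use src' in auto)
qed

lemma lpair_unique:
  assumes t: "locale_map Z P t" and th: "lfst f g \<circ>\<^sub>L t = h" and tk: "lsnd f g \<circ>\<^sub>L t = k"
  shows "t = lpair f g h k"
proof (rule lmap_eqI[OF t lpair_map])
  have tt: "lsrc t = Z" "ltgt t = P" "frame_hom P Z (invim t)" using t unfolding locale_map_def by auto
  have fh: "invim h x = invim t (T x \<top>\<^bsub>Y\<^esub>)" if "x \<in> carrier X" for x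
    using th that by (auto simp: lcomp_def lfst_def compose_def)
  have fk: "invim k y = invim t (T \<top>\<^bsub>X\<^esub> y)" if "y \<in> carrier Y" for y
    using tk that by (auto simp: lcomp_def lsnd_def compose_def)
  have tm: "invim t (T x y) = m x y" if xy: "x \<in> carrier X" "y \<in> carrier Y" for x y
  proof -
    have "T x y = T x \<top>\<^bsub>Y\<^esub> \<sqinter>\<^bsub>P\<^esub> T \<top>\<^bsub>X\<^esub> y"
      using xy by (simp add: P_meet T_I T_meet X_meet_top Y_meet_top)
    then have "invim t (T x y) = invim t (T x \<top>\<^bsub>Y\<^esub>) \<sqinter>\<^bsub>Z\<^esub> invim t (T \<top>\<^bsub>X\<^esub> y)"
      using tt(3) xy T_I unfolding frame_hom_def by simp
    then show ?thesis using xy by (simp add: m_def fh fk)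
  qed
  fix U assume "U \<in> carrier P"
  then have U: "I U" by simp
  let ?J = "(\<lambda>(x, y). T x y) ` U"
  have J: "\<And>V. V \<in> ?J \<Longrightarrow> I V" using I_sub[OF U] T_I by auto
  have "\<Squnion>\<^bsub>P\<^esub>?J = U"
  proof
    show "\<Squnion>\<^bsub>P\<^esub>?J \<subseteq> U" using U T_le[OF U] by (intro P_sup_least[OF J]) auto
    show "U \<subseteq> \<Squnion>\<^bsub>P\<^esub>?J" using P_sup_upper[OF J] T_mem by fast
  qed
  then have "invim t U = \<Squnion>\<^bsub>Z\<^esub>(invim t ` ?J)"
    using tt(3) J unfolding frame_hom_def sup_preserving_def P_simps
    by (metis mem_Collect_eq subsetI)
  also have "invim t ` ?J = (\<lambda>(x, y). m x y) ` U"
    unfolding image_image using I_sub[OF U] tm by (intro image_cong) auto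
  finally show "invim t U = invim (lpair f g h k) U" using U by (simp add: lpair_p p_def)
qed

end

theorem lpullback_universal:
  fixes f :: "('x, 'b) lmap" and g :: "('y, 'b) lmap"
  assumes f: "locale_map X B f" and g: "locale_map Y B g"
  shows "locale_map (lpullback f g) X (lfst f g)"
    and "locale_map (lpullback f g) Y (lsnd f g)"
    and "f \<circ>\<^sub>L lfst f g = g \<circ>\<^sub>L lsnd f g"
    and "\<And>Z (h :: ('z, 'x) lmap) k t.
      \<lbrakk>locale_map Z X h; locale_map Z Y k; f \<circ>\<^sub>L h = g \<circ>\<^sub>L k\<rbrakk> \<Longrightarrow>
        (locale_map Z (lpullback f g) t \<and> lfst f g \<circ>\<^sub>L t = h \<and> lsnd f g \<circ>\<^sub>L t = k)
          \<longleftrightarrow> t = lpair f g h k"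
proof -
  interpret cospan X Y B f g using f g by unfold_locales
  show "locale_map (lpullback f g) X (lfst f g)" by (rule lfst_map)
  show "locale_map (lpullback f g) Y (lsnd f g)" by (rule lsnd_map)
  show "f \<circ>\<^sub>L lfst f g = g \<circ>\<^sub>L lsnd f g" by (rule square)
  fix Z and h :: "('z, 'x) lmap" and k t
  assume "locale_map Z X h" "locale_map Z Y k" "f \<circ>\<^sub>L h = g \<circ>\<^sub>L k"
  then interpret cone X Y B f g Z h k by unfold_locales
  show "(locale_map Z (lpullback f g) t \<and> lfst f g \<circ>\<^sub>L t = h \<and> lsnd f g \<circ>\<^sub>L t = k)
          \<longleftrightarrow> t = lpair f g h k"
    using lpair_map lfst_lpair lsnd_lpair lpair_unique by blast
qed

section \<open>Localic groupoids\<close>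

record 'a groupoid =
  objs :: "'a gorder"
  arrs :: "'a gorder"
  gdom :: "('a, 'a) lmap"
  grng :: "('a, 'a) lmap"
  gunit :: "('a, 'a) lmap"
  ginv :: "('a, 'a) lmap"
  gmult :: "(('a \<times> 'a) set, 'a) lmap"

text \<open>
  Identities between maps out of (iterated) pullbacks are written with generalized elements: a
  composable triple \<open>(x, y, z)\<close> is the triple of projections from \<open>(G\<^sub>1 \<otimes> G\<^sub>1) \<otimes> G\<^sub>1\<close>. The product
  \<open>xy\<close> is defined when \<open>r(x) = d(y)\<close>.
\<close>

locale localic_groupoid =
  fixes G :: "'a groupoid"
  assumes dom_map: "locale_map (arrs G) (objs G) (gdom G)"
    and rng_map: "locale_map (arrs G) (objs G) (grng G)"
    and unit_map: "locale_map (objs G) (arrs G) (gunit G)"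
    and inv_map: "locale_map (arrs G) (arrs G) (ginv G)"
    and mult_map: "locale_map (lpullback (grng G) (gdom G)) (arrs G) (gmult G)"
    and dom_unit: "gdom G \<circ>\<^sub>L gunit G = lid (objs G)"
    and rng_unit: "grng G \<circ>\<^sub>L gunit G = lid (objs G)"
    and dom_mult: "gdom G \<circ>\<^sub>L gmult G = gdom G \<circ>\<^sub>L lfst (grng G) (gdom G)"
    and rng_mult: "grng G \<circ>\<^sub>L gmult G = grng G \<circ>\<^sub>L lsnd (grng G) (gdom G)"
    and unit_left:
      "gmult G \<circ>\<^sub>L lpair (grng G) (gdom G) (gunit G \<circ>\<^sub>L gdom G) (lid (arrs G)) = lid (arrs G)"
    and unit_right:
      "gmult G \<circ>\<^sub>L lpair (grng G) (gdom G) (lid (arrs G)) (gunit G \<circ>\<^sub>L grng G) = lid (arrs G)"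
    and assoc:
      "let s = grng G \<circ>\<^sub>L lsnd (grng G) (gdom G);
           x = lfst (grng G) (gdom G) \<circ>\<^sub>L lfst s (gdom G);
           y = lsnd (grng G) (gdom G) \<circ>\<^sub>L lfst s (gdom G);
           z = lsnd s (gdom G)
       in gmult G \<circ>\<^sub>L lpair (grng G) (gdom G) (gmult G \<circ>\<^sub>L lpair (grng G) (gdom G) x y) z
          = gmult G \<circ>\<^sub>L lpair (grng G) (gdom G) x (gmult G \<circ>\<^sub>L lpair (grng G) (gdom G) y z)"
    and dom_inv: "gdom G \<circ>\<^sub>L ginv G = grng G"
    and rng_inv: "grng G \<circ>\<^sub>L ginv G = gdom G"
    and inv_right:
      "gmult G \<circ>\<^sub>L lpair (grng G) (gdom G) (lid (arrs G)) (ginv G) = gunit G \<circ>\<^sub>L gdom G"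
    and inv_left:
      "gmult G \<circ>\<^sub>L lpair (grng G) (gdom G) (ginv G) (lid (arrs G)) = gunit G \<circ>\<^sub>L grng G"

locale localic_etale_groupoid = localic_groupoid +
  assumes etale: "local_homeomorphism (gdom G)"

definition left_G_locale ::
  "'a groupoid \<Rightarrow> 'x gorder \<Rightarrow> ('x, 'a) lmap \<Rightarrow> (('a \<times> 'x) set, 'x) lmap \<Rightarrow> bool"
  where "left_G_locale G X p \<aa> \<longleftrightarrow>
    locale_map X (objs G) p \<and>
    locale_map (lpullback (grng G) p) X \<aa> \<and>
    p \<circ>\<^sub>L \<aa> = gdom G \<circ>\<^sub>L lfst (grng G) p \<and>
    \<aa> \<circ>\<^sub>L lpair (grng G) p (gunit G \<circ>\<^sub>L p) (lid X) = lid X \<and>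
    (let s = grng G \<circ>\<^sub>L lsnd (grng G) (gdom G);
         g = lfst (grng G) (gdom G) \<circ>\<^sub>L lfst s p;
         h = lsnd (grng G) (gdom G) \<circ>\<^sub>L lfst s p;
         x = lsnd s p
     in \<aa> \<circ>\<^sub>L lpair (grng G) p (gmult G \<circ>\<^sub>L lpair (grng G) (gdom G) g h) x
        = \<aa> \<circ>\<^sub>L lpair (grng G) p g (\<aa> \<circ>\<^sub>L lpair (grng G) p h x))"

type_synonym 'a algmor = "('a, 'a) lmap \<times> (('a \<times> 'a) set, 'a) lmap"

definition algebraic_morphism :: "'a groupoid \<Rightarrow> 'a groupoid \<Rightarrow> 'a algmor \<Rightarrow> bool"
  where "algebraic_morphism G H = (\<lambda>(p, \<aa>).
    left_G_locale G (arrs H) p \<aa> \<and>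
    grng H \<circ>\<^sub>L \<aa> = grng H \<circ>\<^sub>L lsnd (grng G) p \<and>
    p \<circ>\<^sub>L gmult H = p \<circ>\<^sub>L lfst (grng H) (gdom H) \<and>
    (let s = grng H \<circ>\<^sub>L lsnd (grng G) p;
         g = lfst (grng G) p \<circ>\<^sub>L lfst s (gdom H);
         h = lsnd (grng G) p \<circ>\<^sub>L lfst s (gdom H);
         k = lsnd s (gdom H)
     in gmult H \<circ>\<^sub>L lpair (grng H) (gdom H) (\<aa> \<circ>\<^sub>L lpair (grng G) p g h) k
        = \<aa> \<circ>\<^sub>L lpair (grng G) p g (gmult H \<circ>\<^sub>L lpair (grng H) (gdom H) h k)))"

text \<open>The composite of \<open>(p, \<aa>) : G \<rightarrow> H\<close> followed by \<open>(q, \<bb>) : H \<rightarrow> K\<close>.\<close>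

definition algmor_comp ::
  "'a groupoid \<Rightarrow> 'a groupoid \<Rightarrow> 'a groupoid \<Rightarrow> 'a algmor \<Rightarrow> 'a algmor \<Rightarrow> 'a algmor"
  where "algmor_comp G H K = (\<lambda>(q, \<bb>) (p, \<aa>).
    let t = p \<circ>\<^sub>L gunit H \<circ>\<^sub>L q;
        g = lfst (grng G) t;
        k = lsnd (grng G) t
    in (t, \<bb> \<circ>\<^sub>L lpair (grng H) q (\<aa> \<circ>\<^sub>L lpair (grng G) p g (gunit H \<circ>\<^sub>L q \<circ>\<^sub>L k)) k))"

text \<open>The identity on \<open>G\<close> is the action of \<open>G\<close> on itself by left multiplication.\<close>

definition algmor_id :: "'a groupoid \<Rightarrow> 'a algmor"
  where "algmor_id G = (gdom G, gmult G)"


section \<open>Inverse quantal frames\<close>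

record 'a quantale = "'a gorder" +
  qmult :: "'a \<Rightarrow> 'a \<Rightarrow> 'a" (infixl \<open>\<cdot>\<index>\<close> 75)
  qstar :: "'a \<Rightarrow> 'a" (\<open>(_\<^sup>\<star>\<index>)\<close> [1000] 999)
  qunit :: "'a" (\<open>\<ee>\<index>\<close>)

locale unital_involutive_quantale = complete_lattice Q for Q :: "'a quantale" (structure) +
  assumes mult_closed: "\<lbrakk>a \<in> carrier Q; b \<in> carrier Q\<rbrakk> \<Longrightarrow> a \<cdot> b \<in> carrier Q"
    and star_closed: "a \<in> carrier Q \<Longrightarrow> a\<^sup>\<star> \<in> carrier Q"
    and unit_closed: "\<ee> \<in> carrier Q"
    and mult_assoc: "\<lbrakk>a \<in> carrier Q; b \<in> carrier Q; c \<in> carrier Q\<rbrakk> \<Longrightarrow> (a \<cdot> b) \<cdot> c = a \<cdot> (b \<cdot> c)"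
    and unit_mult: "a \<in> carrier Q \<Longrightarrow> \<ee> \<cdot> a = a"
    and mult_unit: "a \<in> carrier Q \<Longrightarrow> a \<cdot> \<ee> = a"
    and star_star: "a \<in> carrier Q \<Longrightarrow> (a\<^sup>\<star>)\<^sup>\<star> = a"
    and star_mult: "\<lbrakk>a \<in> carrier Q; b \<in> carrier Q\<rbrakk> \<Longrightarrow> (a \<cdot> b)\<^sup>\<star> = b\<^sup>\<star> \<cdot> a\<^sup>\<star>"
    and mult_sup_left: "a \<in> carrier Q \<Longrightarrow> sup_preserving Q Q (\<lambda>b. a \<cdot> b)"
    and mult_sup_right: "b \<in> carrier Q \<Longrightarrow> sup_preserving Q Q (\<lambda>a. a \<cdot> b)"
    and star_sup: "sup_preserving Q Q (\<lambda>a. a\<^sup>\<star>)"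

locale inverse_quantal_frame = unital_involutive_quantale Q + frame Q for Q (structure) +
  assumes support: "a \<in> carrier Q \<Longrightarrow> a \<cdot> \<top> \<sqinter> \<ee> = a \<cdot> a\<^sup>\<star> \<sqinter> \<ee>"
    and support_mult: "a \<in> carrier Q \<Longrightarrow> (a \<cdot> \<top> \<sqinter> \<ee>) \<cdot> a = a"
    and cover: "\<Squnion>{s \<in> carrier Q. s \<cdot> s\<^sup>\<star> \<squnion> s\<^sup>\<star> \<cdot> s \<sqsubseteq> \<ee>} = \<top>"

text \<open>Extensionality makes equality of homomorphisms depend only on their values on the carrier.\<close>

definition quantale_hom :: "'a quantale \<Rightarrow> 'a quantale \<Rightarrow> ('a \<Rightarrow> 'a) \<Rightarrow> bool"
  where "quantale_hom Q R h \<longleftrightarrow>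
    h \<in> extensional (carrier Q) \<and> sup_preserving Q R h \<and>
    (\<forall>a\<in>carrier Q. \<forall>b\<in>carrier Q. h (a \<cdot>\<^bsub>Q\<^esub> b) = h a \<cdot>\<^bsub>R\<^esub> h b) \<and>
    (\<forall>a\<in>carrier Q. h (a\<^sup>\<star>\<^bsub>Q\<^esub>) = (h a)\<^sup>\<star>\<^bsub>R\<^esub>) \<and>
    h \<ee>\<^bsub>Q\<^esub> = \<ee>\<^bsub>R\<^esub>"


section \<open>Categories\<close>

text \<open>\<open>Comp C X Y Z g f\<close> is the composite of \<open>f : X \<rightarrow> Y\<close> followed by \<open>g : Y \<rightarrow> Z\<close>.\<close>

record ('o, 'm) cat =
  Ob :: "'o set"
  Hom :: "'o \<Rightarrow> 'o \<Rightarrow> 'm set"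
  Id :: "'o \<Rightarrow> 'm"
  Comp :: "'o \<Rightarrow> 'o \<Rightarrow> 'o \<Rightarrow> 'm \<Rightarrow> 'm \<Rightarrow> 'm"

locale category =
  fixes C :: "('o, 'm) cat"
  assumes Id_in_Hom: "X \<in> Ob C \<Longrightarrow> Id C X \<in> Hom C X X"
    and Comp_in_Hom:
      "\<lbrakk>X \<in> Ob C; Y \<in> Ob C; Z \<in> Ob C; f \<in> Hom C X Y; g \<in> Hom C Y Z\<rbrakk> \<Longrightarrow> Comp C X Y Z g f \<in> Hom C X Z"
    and Comp_Id: "\<lbrakk>X \<in> Ob C; Y \<in> Ob C; f \<in> Hom C X Y\<rbrakk> \<Longrightarrow> Comp C X X Y f (Id C X) = f"
    and Id_Comp: "\<lbrakk>X \<in> Ob C; Y \<in> Ob C; f \<in> Hom C X Y\<rbrakk> \<Longrightarrow> Comp C X Y Y (Id C Y) f = f"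
    and Comp_assoc:
      "\<lbrakk>W \<in> Ob C; X \<in> Ob C; Y \<in> Ob C; Z \<in> Ob C; f \<in> Hom C W X; g \<in> Hom C X Y; h \<in> Hom C Y Z\<rbrakk>
        \<Longrightarrow> Comp C W X Z (Comp C X Y Z h g) f = Comp C W Y Z h (Comp C W X Y g f)"

record ('o, 'm, 'p, 'n) fctr =
  onObj :: "'o \<Rightarrow> 'p"
  onMor :: "'o \<Rightarrow> 'o \<Rightarrow> 'm \<Rightarrow> 'n"

definition is_functor :: "('o, 'm) cat \<Rightarrow> ('p, 'n) cat \<Rightarrow> ('o, 'm, 'p, 'n) fctr \<Rightarrow> bool"
  where "is_functor C D F \<longleftrightarrow>
    (\<forall>X\<in>Ob C. onObj F X \<in> Ob D) \<and>
    (\<forall>X\<in>Ob C. \<forall>Y\<in>Ob C. \<forall>f\<in>Hom C X Y. onMor F X Y f \<in> Hom D (onObj F X) (onObj F Y)) \<and>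
    (\<forall>X\<in>Ob C. onMor F X X (Id C X) = Id D (onObj F X)) \<and>
    (\<forall>X\<in>Ob C. \<forall>Y\<in>Ob C. \<forall>Z\<in>Ob C. \<forall>f\<in>Hom C X Y. \<forall>g\<in>Hom C Y Z.
      onMor F X Z (Comp C X Y Z g f)
        = Comp D (onObj F X) (onObj F Y) (onObj F Z) (onMor F Y Z g) (onMor F X Y f))"

definition id_functor :: "('o, 'm, 'o, 'm) fctr"
  where "id_functor = \<lparr>onObj = (\<lambda>X. X), onMor = (\<lambda>X Y f. f)\<rparr>"

definition comp_functor ::
  "('p, 'n, 'q, 'l) fctr \<Rightarrow> ('o, 'm, 'p, 'n) fctr \<Rightarrow> ('o, 'm, 'q, 'l) fctr"
  where "comp_functor F' F = \<lparr>onObj = (\<lambda>X. onObj F' (onObj F X)),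
    onMor = (\<lambda>X Y f. onMor F' (onObj F X) (onObj F Y) (onMor F X Y f))\<rparr>"

definition is_iso :: "('o, 'm) cat \<Rightarrow> 'o \<Rightarrow> 'o \<Rightarrow> 'm \<Rightarrow> bool"
  where "is_iso C X Y f \<longleftrightarrow> f \<in> Hom C X Y \<and>
    (\<exists>g\<in>Hom C Y X. Comp C X Y X g f = Id C X \<and> Comp C Y X Y f g = Id C Y)"

definition naturally_isomorphic ::
  "('o, 'm) cat \<Rightarrow> ('p, 'n) cat \<Rightarrow> ('o, 'm, 'p, 'n) fctr \<Rightarrow> ('o, 'm, 'p, 'n) fctr \<Rightarrow> bool"
  where "naturally_isomorphic C D F F' \<longleftrightarrow> (\<exists>\<eta>.
    (\<forall>X\<in>Ob C. is_iso D (onObj F X) (onObj F' X) (\<eta> X)) \<and>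
    (\<forall>X\<in>Ob C. \<forall>Y\<in>Ob C. \<forall>f\<in>Hom C X Y.
      Comp D (onObj F X) (onObj F Y) (onObj F' Y) (\<eta> Y) (onMor F X Y f)
        = Comp D (onObj F X) (onObj F' X) (onObj F' Y) (onMor F' X Y f) (\<eta> X)))"

definition equivalent_categories :: "('o, 'm) cat \<Rightarrow> ('p, 'n) cat \<Rightarrow> bool"
  where "equivalent_categories C D \<longleftrightarrow> category C \<and> category D \<and>
    (\<exists>F F'. is_functor C D F \<and> is_functor D C F' \<and>
      naturally_isomorphic C C id_functor (comp_functor F' F) \<and>
      naturally_isomorphic D D (comp_functor F F') id_functor)"

text \<open>
  The type \<open>'u\<close> plays the role of the universe: the objects are the groupoids, respectively quantales,
  whose underlying sets are subsets of \<open>'u\<close>.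
\<close>

definition Gpd_A :: "('u groupoid, 'u algmor) cat"
  where "Gpd_A = \<lparr>Ob = {G. localic_etale_groupoid G},
    Hom = (\<lambda>G H. {m. algebraic_morphism G H m}),
    Id = algmor_id,
    Comp = algmor_comp\<rparr>"

definition InvQuF :: "('u quantale, 'u \<Rightarrow> 'u) cat"
  where "InvQuF = \<lparr>Ob = {Q. inverse_quantal_frame Q},
    Hom = (\<lambda>Q R. {h. quantale_hom Q R h}),
    Id = (\<lambda>Q. \<lambda>a\<in>carrier Q. a),
    Comp = (\<lambda>Q R S k h. compose (carrier Q) k h)\<rparr>"

end

theory Submission
  imports Defs
begin

text \<open>
  Write \<open>x y = m\<^sub>!(x \<otimes> y)\<close>. For an etale groupoid \<open>G\<close> this product makes the frame of \<open>G\<^sub>1\<close> an inverse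
  quantal frame \<open>Q\<close>, with \<open>i\<^sup>*\<close> as involution and the open set of units as unit \<open>e\<close>. Conversely \<open>G\<close> is
  recovered from \<open>Q\<close>: \<open>G\<^sub>0\<close> is the frame of subunits \<open>b \<le> e\<close>, and \<open>d\<^sup>*(b) = b1\<close>, \<open>r\<^sup>*(b) = 1b\<close>,
  \<open>u\<^sup>*(a) = a \<and> e\<close>, \<open>m\<^sup>*(a) = \<Squnion>{x \<otimes> y. x y \<le> a}\<close>. For an inverse quantal frame \<open>Q\<close> these formulas
  define an etale groupoid, because \<open>Q\<close> is covered by partial units.

  The action of an algebraic morphism \<open>(p, a)\<close> is open, and \<open>h(g) = a\<^sub>!(g \<otimes> e)\<close> is a homomorphism with
  \<open>a\<^sub>!(g \<otimes> x) = h(g) x\<close> and \<open>p\<^sup>*(b) = h(b) 1\<close>. It preserves the involution since \<open>h(s)\<close> and \<open>h(s\<^sup>*)\<close>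
  are inverse to each other for every partial unit \<open>s\<close>. Conversely every homomorphism \<open>h\<close> defines an
  algebraic morphism by these formulas. The bijection respects identities and composition, so the
  category laws of \<open>Gpd_A\<close> follow from those of \<open>InvQuF\<close>.
\<close>

text \<open>Locales have no points, and inverse images along maps out of a pullback are balanced
  ideals. Equations are translated in two ways. A map with a left adjoint is replaced by the
  bilinear operation which that adjoint defines, so that all associativity laws become associativity
  of products. Before the adjoint is available, as in the proof that actions are open, points are
  replaced by maps from an arbitrary locale.

  For a general quantale the slices \<open>h(g) x \<le> y\<close> need not preserve joins in
  \<open>y\<close>. For a partial unit \<open>s\<close> an inequality
  \<open>h(s) x \<le> \<Squnion>y\<close> moves to
  \<open>h(s\<^sup>\<star> s) x \<le> \<Squnion>h(s\<^sup>\<star>) y\<close>, and frame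
  distributivity splits it there.

  The axioms of an algebraic morphism do not mention inversion, so \<open>h(s)\<close> is not known
  to be a partial unit when its involution is sought; uniqueness of inverses is proved in a form
  that covers this. The quantale of a groupoid is only chosen, so essential surjectivity rests on
  its uniqueness up to isomorphism.\<close>

context frame begin

lemma le_meet_iff:
  "\<lbrakk>x \<in> carrier L; y \<in> carrier L; z \<in> carrier L\<rbrakk> \<Longrightarrow> z \<sqsubseteq> x \<sqinter> y \<longleftrightarrow> z \<sqsubseteq> x \<and> z \<sqsubseteq> y"
  by (meson le_trans meet_closed meet_le meet_left meet_right)

lemma sup_le_iff:
  "\<lbrakk>A \<subseteq> carrier L; z \<in> carrier L\<rbrakk> \<Longrightarrow> \<Squnion>A \<sqsubseteq> z \<longleftrightarrow> (\<forall>x\<in>A. x \<sqsubseteq> z)"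
  by (meson le_trans subsetD sup_closed sup_least sup_upper)

text \<open>The order form of the Yoneda lemma. Left adjoints are known only through the
  inequalities they satisfy, so equations between them are proved this way.\<close>

lemma eq_by_upper:
  assumes "x \<in> carrier L" "y \<in> carrier L" "\<And>z. z \<in> carrier L \<Longrightarrow> x \<sqsubseteq> z \<longleftrightarrow> y \<sqsubseteq> z"
  shows "x = y"
  using assms by (intro le_antisym) auto

lemma meet_top [simp]: "x \<in> carrier L \<Longrightarrow> x \<sqinter> \<top> = x" "x \<in> carrier L \<Longrightarrow> \<top> \<sqinter> x = x"
  using top_meet eq_is_equal by (auto simp: meet_comm[of L x])

lemma meet_idem [simp]: "x \<in> carrier L \<Longrightarrow> x \<sqinter> x = x"
  by (simp add: meet_def)

lemma meet_mono:
  assumes "x \<sqsubseteq> x'" "y \<sqsubseteq> y'" "x \<in> carrier L" "y \<in> carrier L" "x' \<in> carrier L" "y' \<in> carrier L"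
  shows "x \<sqinter> y \<sqsubseteq> x' \<sqinter> y'"
  using assms le_trans[of "x \<sqinter> y" x x'] le_trans[of "x \<sqinter> y" y y']
  by (simp add: le_meet_iff meet_left meet_right)

lemma meet_absorb: "\<lbrakk>x \<sqsubseteq> y; x \<in> carrier L; y \<in> carrier L\<rbrakk> \<Longrightarrow> x \<sqinter> y = x"
  "\<lbrakk>x \<sqsubseteq> y; x \<in> carrier L; y \<in> carrier L\<rbrakk> \<Longrightarrow> y \<sqinter> x = x"
  using le_iff_join[of x y] by (auto simp: meet_comm)

lemma meet_left_commute:
  "\<lbrakk>x \<in> carrier L; y \<in> carrier L; z \<in> carrier L\<rbrakk> \<Longrightarrow> x \<sqinter> (y \<sqinter> z) = y \<sqinter> (x \<sqinter> z)"
  by (metis meet_assoc meet_comm)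

lemma top_le: "\<lbrakk>\<top> \<sqsubseteq> x; x \<in> carrier L\<rbrakk> \<Longrightarrow> x = \<top>"
  by (meson le_antisym top_closed top_higher)

lemma top_greatest [simp]: "x \<in> carrier L \<Longrightarrow> x \<sqsubseteq> \<top>"
  by (rule top_higher)

lemma sup_mono:
  assumes "B \<subseteq> carrier L" "A \<subseteq> carrier L" "\<And>a. a \<in> A \<Longrightarrow> \<exists>b\<in>B. a \<sqsubseteq> b"
  shows "\<Squnion>A \<sqsubseteq> \<Squnion>B"
  using assms by (intro sup_least) (auto, meson le_trans subsetD sup_closed sup_upper)

text \<open>Cuts \<open>x\<close> into pieces along a cover, so that an inequality for
  \<open>x\<close> can be checked on the pieces.\<close>

lemma le_sup_meet:
  assumes "x \<in> carrier L" "A \<subseteq> carrier L" "\<Squnion>A = \<top>"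
  shows "\<Squnion>((\<lambda>b. x \<sqinter> b) ` A) = x"
  using meet_sup_distrib[OF assms(1,2)] assms by simp

end

text \<open>The operations are computed from the carrier and the order alone. This lets them pass
  between a quantale, the frame it is built from and \<open>locale_of\<close>, which are records of
  different types.\<close>

lemma lattice_ops_cong:
  assumes "carrier L = carrier M" "le L = le M"
  shows "Lattice.sup L = Lattice.sup M" "Lattice.inf L = Lattice.inf M" "meet L = meet M" "join L = join M"
    "top L = top M" "bottom L = bottom M"
  unfolding Lattice.sup_def Lattice.inf_def meet_def join_def top_def bottom_def least_def greatest_def Upper_def Lower_def
  by (simp_all add: assms)

lemma frame_cong:
  assumes "frame L" "carrier L = carrier M" "le L = le M" "eq L = eq M"
  shows "frame M"
proof -
  interpret frame L by fact
  note [simp] = assms(2-4)[symmetric] lattice_ops_cong[OF assms(2,3), symmetric]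
  show ?thesis
  proof
    show "\<And>x y. x \<in> carrier M \<Longrightarrow> y \<in> carrier M \<Longrightarrow> x .=\<^bsub>M\<^esub> y \<Longrightarrow> y .=\<^bsub>M\<^esub> x" by (simp add: eq_is_equal)
    show "\<And>A. A \<subseteq> carrier M \<Longrightarrow> \<exists>s. is_lub M s A"
      using sup_exists by (simp add: least_def Upper_def)
    show "\<And>A. A \<subseteq> carrier M \<Longrightarrow> \<exists>s. is_glb M s A"
      using inf_exists by (simp add: greatest_def Lower_def)
    show "(.=\<^bsub>M\<^esub>) = (=)" using eq_is_equal by simp
    show "\<And>a A. a \<in> carrier M \<Longrightarrow> A \<subseteq> carrier M \<Longrightarrow>
        a \<sqinter>\<^bsub>M\<^esub> \<Squnion>\<^bsub>M\<^esub>A = \<Squnion>\<^bsub>M\<^esub>((\<sqinter>\<^bsub>M\<^esub>) a ` A)"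
      using meet_sup_distrib by simp
  qed (auto intro: le_trans simp: eq_is_equal)
qed

section \<open>Maps of locales\<close>

lemma locale_map_eqI:
  assumes "locale_map X Y f" "locale_map X Y g" "\<And>y. y \<in> carrier Y \<Longrightarrow> invim f y = invim g y"
  shows "f = g"
proof -
  have "invim f = invim g"
    using assms unfolding locale_map_def by (intro extensionalityI[of _ "carrier Y"]) auto
  then show ?thesis using assms(1,2) unfolding locale_map_def by (cases f, cases g) simp
qed

lemma invim_closed: "locale_map X Y f \<Longrightarrow> y \<in> carrier Y \<Longrightarrow> invim f y \<in> carrier X"
  unfolding locale_map_def frame_hom_def sup_preserving_def by auto

lemma invim_top: "locale_map X Y f \<Longrightarrow> invim f \<top>\<^bsub>Y\<^esub> = \<top>\<^bsub>X\<^esub>"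
  unfolding locale_map_def frame_hom_def by auto

lemma invim_meet: "\<lbrakk>locale_map X Y f; a \<in> carrier Y; b \<in> carrier Y\<rbrakk>
    \<Longrightarrow> invim f (a \<sqinter>\<^bsub>Y\<^esub> b) = invim f a \<sqinter>\<^bsub>X\<^esub> invim f b"
  unfolding locale_map_def frame_hom_def by auto

lemma invim_sup: "\<lbrakk>locale_map X Y f; A \<subseteq> carrier Y\<rbrakk>
    \<Longrightarrow> invim f (\<Squnion>\<^bsub>Y\<^esub>A) = \<Squnion>\<^bsub>X\<^esub>(invim f ` A)"
  unfolding locale_map_def frame_hom_def sup_preserving_def by auto

lemma invim_mono: "\<lbrakk>locale_map X Y f; a \<in> carrier Y; b \<in> carrier Y; a \<sqsubseteq>\<^bsub>Y\<^esub> b\<rbrakk>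
    \<Longrightarrow> invim f a \<sqsubseteq>\<^bsub>X\<^esub> invim f b"
  unfolding locale_map_def frame_hom_def by (auto intro: sup_preserving_mono)

lemma lcomp_simps [simp]: "lsrc (g \<circ>\<^sub>L f) = lsrc f" "ltgt (g \<circ>\<^sub>L f) = ltgt g"
  by (simp_all add: lcomp_def)

lemma invim_lcomp: "z \<in> carrier (ltgt g) \<Longrightarrow> invim (g \<circ>\<^sub>L f) z = invim f (invim g z)"
  by (simp add: lcomp_def compose_eq)

lemma invim_lcomp': "locale_map Y Z g \<Longrightarrow> z \<in> carrier Z \<Longrightarrow> invim (g \<circ>\<^sub>L f) z = invim f (invim g z)"
  by (simp add: lcomp_def compose_eq locale_mapD)

lemma lcomp_map [intro]:
  assumes f: "locale_map X Y f" and g: "locale_map Y Z g"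
  shows "locale_map X Z (g \<circ>\<^sub>L f)"
proof -
  have e: "g \<circ>\<^sub>L f = \<lparr>lsrc = X, ltgt = Z, invim = restrict (\<lambda>z. invim f (invim g z)) (carrier Z)\<rparr>"
    using f g by (simp add: lcomp_def locale_map_def compose_def)
  show ?thesis unfolding e
  proof (rule locale_map_restrictI)
    fix A assume "A \<subseteq> carrier Z"
    then show "invim f (invim g (\<Squnion>\<^bsub>Z\<^esub>A)) = \<Squnion>\<^bsub>X\<^esub>((\<lambda>z. invim f (invim g z)) ` A)"
      using f g invim_closed[OF g] by (subst invim_sup[OF g], simp, subst invim_sup[OF f]) (auto simp: image_image)
  qed (use f g in \<open>auto simp: locale_mapD invim_closed invim_top invim_meet\<close>)
qed

lemma lcomp_assoc:
  assumes "locale_map Y Z h" "ltgt g = Y"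
  shows "h \<circ>\<^sub>L g \<circ>\<^sub>L f = h \<circ>\<^sub>L (g \<circ>\<^sub>L f)"
  using assms invim_closed[OF assms(1)]
  by (auto simp: lcomp_def compose_def fun_eq_iff locale_mapD)

lemma lid_map [intro]: "frame X \<Longrightarrow> locale_map X X (lid X)"
  unfolding lid_def
  by (rule locale_map_restrictI) auto

lemma invim_lid [simp]: "x \<in> carrier X \<Longrightarrow> invim (lid X) x = x"
  by (simp add: lid_def)

lemma lid_simps [simp]: "lsrc (lid X) = X" "ltgt (lid X) = X"
  by (simp_all add: lid_def)

lemma lcomp_lid: "locale_map X Y f \<Longrightarrow> f \<circ>\<^sub>L lid X = f"
  by (rule locale_map_eqI[of X Y]) (auto simp: invim_lcomp' invim_closed dest: locale_mapD)

lemma lid_lcomp: "locale_map X Y f \<Longrightarrow> lid Y \<circ>\<^sub>L f = f"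
  by (rule locale_map_eqI[of X Y]) (auto simp: invim_lcomp locale_mapD dest: locale_mapD)

lemma comp_eq_iff:
  assumes "locale_map X Y f" "locale_map Y Z g" "locale_map X Y' f'" "locale_map Y' Z g'"
  shows "g \<circ>\<^sub>L f = g' \<circ>\<^sub>L f' \<longleftrightarrow> (\<forall>z\<in>carrier Z. invim f (invim g z) = invim f' (invim g' z))"
proof
  assume "g \<circ>\<^sub>L f = g' \<circ>\<^sub>L f'"
  then show "\<forall>z\<in>carrier Z. invim f (invim g z) = invim f' (invim g' z)"
    using assms by (metis invim_lcomp')
next
  assume "\<forall>z\<in>carrier Z. invim f (invim g z) = invim f' (invim g' z)"
  then show "g \<circ>\<^sub>L f = g' \<circ>\<^sub>L f'"
    using assms by (intro locale_map_eqI[of X Z]) (auto simp: invim_lcomp')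
qed

section \<open>Pullbacks\<close>

context cospan begin

lemma pr_maps [intro, simp]: "locale_map P X (lfst f g)" "locale_map P Y (lsnd f g)"
  using lfst_map lsnd_map .

lemma T_le_iff: "\<lbrakk>I U\<rbrakk> \<Longrightarrow> T x y \<subseteq> U \<longleftrightarrow> (x, y) \<in> U"
  using T_le T_mem by blast

lemma invim_lfst: "x \<in> carrier X \<Longrightarrow> invim (lfst f g) x = T x \<top>\<^bsub>Y\<^esub>"
  by (simp add: lfst_def)

lemma invim_lsnd: "y \<in> carrier Y \<Longrightarrow> invim (lsnd f g) y = T \<top>\<^bsub>X\<^esub> y"
  by (simp add: lsnd_def)

lemma lpr_simps [simp]: "lsrc (lfst f g) = P" "lsrc (lsnd f g) = P" "ltgt (lfst f g) = X" "ltgt (lsnd f g) = Y"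
  by (auto simp: lfst_def lsnd_def)

lemma I_invim: "locale_map P Z t \<Longrightarrow> z \<in> carrier Z \<Longrightarrow> I (invim t z)"
  using invim_closed[of P Z t z] by simp

text \<open>A generator of the pullback is the intersection of two cylinders; pairs of projections
  are evaluated in this form.\<close>

lemma T_meet_tops:
  assumes "x \<in> carrier X" "y \<in> carrier Y"
  shows "T x \<top>\<^bsub>Y\<^esub> \<sqinter>\<^bsub>P\<^esub> T \<top>\<^bsub>X\<^esub> y = T x y"
  using assms by (simp add: P_meet T_I T_meet X_meet_top Y_meet_top)

end

context cone begin

lemma invim_lpair: "I U \<Longrightarrow> invim (lpair f g h k) U = p U"
  by (simp add: lpair_p)

lemma invim_lpair_le:
  assumes "I U" "c \<in> carrier Z"
  shows "invim (lpair f g h k) U \<sqsubseteq>\<^bsub>Z\<^esub> c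
    \<longleftrightarrow> (\<forall>x y. (x, y) \<in> U \<longrightarrow> invim h x \<sqinter>\<^bsub>Z\<^esub> invim k y \<sqsubseteq>\<^bsub>Z\<^esub> c)"
  using p_le[OF assms] I_sub[OF assms(1)] unfolding invim_lpair[OF assms(1)] m_def by blast

lemma le_invim_lpair:
  assumes "I U" "(x, y) \<in> U"
  shows "invim h x \<sqinter>\<^bsub>Z\<^esub> invim k y \<sqsubseteq>\<^bsub>Z\<^esub> invim (lpair f g h k) U"
  using m_le_p[OF assms] unfolding invim_lpair[OF assms(1)] m_def .

end

lemma coneI:
  assumes "locale_map X B f" "locale_map Y B g" "locale_map Z X h" "locale_map Z Y k" "f \<circ>\<^sub>L h = g \<circ>\<^sub>L k"
  shows "cone X Y B f g Z h k"
  using assms by unfold_locales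

text \<open>Both sides have the same projections, so the uniqueness half of the universal property
  identifies them.\<close>

lemma lpair_lcomp:
  assumes c: "cone X Y B f g Z h k" and t: "locale_map W Z t"
  shows "lpair f g h k \<circ>\<^sub>L t = lpair f g (h \<circ>\<^sub>L t) (k \<circ>\<^sub>L t)"
proof -
  interpret cone X Y B f g Z h k by fact
  have 1: "locale_map W P (lpair f g h k \<circ>\<^sub>L t)" using lpair_map t by blast
  have ht: "locale_map W X (h \<circ>\<^sub>L t)" and kt: "locale_map W Y (k \<circ>\<^sub>L t)" using h k t by blast+
  have sq: "f \<circ>\<^sub>L (h \<circ>\<^sub>L t) = g \<circ>\<^sub>L (k \<circ>\<^sub>L t)"
    using comm by (simp add: lcomp_assoc[symmetric, OF f] lcomp_assoc[symmetric, OF g] src')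
  show ?thesis
    using lpullback_universal(4)[OF f g ht kt sq, of "lpair f g h k \<circ>\<^sub>L t"] 1 locale_mapD(2)[OF lpair_map]
    by (simp add: lcomp_assoc[OF lfst_map, symmetric] lcomp_assoc[OF lsnd_map, symmetric]
        lfst_lpair lsnd_lpair)
qed

lemma lpair_lfst_lsnd:
  assumes f: "locale_map X B f" and g: "locale_map Y B g" and t: "locale_map Z (lpullback f g) t"
  shows "lpair f g (lfst f g \<circ>\<^sub>L t) (lsnd f g \<circ>\<^sub>L t) = t"
proof -
  interpret cospan X Y B f g using f g by unfold_locales
  have "f \<circ>\<^sub>L (lfst f g \<circ>\<^sub>L t) = g \<circ>\<^sub>L (lsnd f g \<circ>\<^sub>L t)"
    using square t by (simp add: lcomp_assoc[symmetric, OF f] lcomp_assoc[symmetric, OF g] lpr_simps)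
  then show ?thesis
    using lpullback_universal(4)[OF f g lcomp_map[OF t lfst_map] lcomp_map[OF t lsnd_map], of t] t by auto
qed

text \<open>A map \<open>t\<close> out of a pullback whose inverse image has a left adjoint \<open>t\<^sub>!\<close>, with
  \<open>\<mu> x y = t\<^sub>!(x \<otimes> y)\<close>. This turns equations between locale maps into equations between
  bilinear operations.\<close>

locale repr_map = cospan X Y B f g
  for X :: "'x gorder" and Y :: "'y gorder" and B :: "'b gorder"
    and f :: "('x, 'b) lmap" and g :: "('y, 'b) lmap" +
  fixes Z :: "'z gorder" and t :: "(('x \<times> 'y) set, 'z) lmap" and \<mu> :: "'x \<Rightarrow> 'y \<Rightarrow> 'z"
  assumes t: "locale_map P Z t"
    and \<mu>_cl [simp]: "\<lbrakk>x \<in> carrier X; y \<in> carrier Y\<rbrakk> \<Longrightarrow> \<mu> x y \<in> carrier Z"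
    and rep: "\<lbrakk>x \<in> carrier X; y \<in> carrier Y; z \<in> carrier Z\<rbrakk> \<Longrightarrow> (x, y) \<in> invim t z \<longleftrightarrow> \<mu> x y \<sqsubseteq>\<^bsub>Z\<^esub> z"
begin

sublocale Z: frame Z using t unfolding locale_map_def by blast

lemma t_I: "z \<in> carrier Z \<Longrightarrow> I (invim t z)" by (rule I_invim[OF t])

text \<open>Everything about \<open>\<mu>\<close> is read off from \<open>rep\<close>: its slices
  \<open>\<mu> x y \<le> z\<close> are the balanced ideals \<open>invim t z\<close>, and the closure
  conditions of such ideals become monotonicity, preservation of joins in each variable and the
  balance law \<open>\<mu>_bal\<close>.\<close>

lemma \<mu>_mono: "\<lbrakk>x \<sqsubseteq>\<^bsub>X\<^esub> x'; y \<sqsubseteq>\<^bsub>Y\<^esub> y'; x \<in> carrier X; y \<in> carrier Y; x' \<in> carrier X; y' \<in> carrier Y\<rbrakk>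
    \<Longrightarrow> \<mu> x y \<sqsubseteq>\<^bsub>Z\<^esub> \<mu> x' y'"
  using I_down[OF t_I, of "\<mu> x' y'" x' y' x y] by (simp add: rep)

lemma I_slice: "z \<in> carrier Z \<Longrightarrow> I {(x, y). x \<in> carrier X \<and> y \<in> carrier Y \<and> \<mu> x y \<sqsubseteq>\<^bsub>Z\<^esub> z}"
proof -
  assume z: "z \<in> carrier Z"
  then have "{(x, y). x \<in> carrier X \<and> y \<in> carrier Y \<and> \<mu> x y \<sqsubseteq>\<^bsub>Z\<^esub> z} = invim t z"
    using I_subset[OF t_I[OF z]] by (auto simp: rep[OF _ _ z])
  then show ?thesis using t_I z by simp
qed

lemma \<mu>_sup1_le:
  assumes "S \<subseteq> carrier X" "y \<in> carrier Y" "z \<in> carrier Z"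
  shows "\<mu> (\<Squnion>\<^bsub>X\<^esub>S) y \<sqsubseteq>\<^bsub>Z\<^esub> z \<longleftrightarrow> (\<forall>x\<in>S. \<mu> x y \<sqsubseteq>\<^bsub>Z\<^esub> z)"
proof
  assume "\<mu> (\<Squnion>\<^bsub>X\<^esub>S) y \<sqsubseteq>\<^bsub>Z\<^esub> z"
  moreover have "\<mu> x y \<sqsubseteq>\<^bsub>Z\<^esub> \<mu> (\<Squnion>\<^bsub>X\<^esub>S) y" if "x \<in> S" for x
    using assms that by (intro \<mu>_mono) (auto intro: X.sup_upper)
  ultimately show "\<forall>x\<in>S. \<mu> x y \<sqsubseteq>\<^bsub>Z\<^esub> z"
    using assms subsetD[OF assms(1)] by (auto intro: Z.le_trans[of _ "\<mu> (\<Squnion>\<^bsub>X\<^esub>S) y"])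
next
  assume "\<forall>x\<in>S. \<mu> x y \<sqsubseteq>\<^bsub>Z\<^esub> z"
  then show "\<mu> (\<Squnion>\<^bsub>X\<^esub>S) y \<sqsubseteq>\<^bsub>Z\<^esub> z"
    using I_sup1[OF I_slice[OF assms(3)] assms(1,2)] assms subsetD[OF assms(1)] by simp
qed

lemma \<mu>_sup2_le:
  assumes "S \<subseteq> carrier Y" "x \<in> carrier X" "z \<in> carrier Z"
  shows "\<mu> x (\<Squnion>\<^bsub>Y\<^esub>S) \<sqsubseteq>\<^bsub>Z\<^esub> z \<longleftrightarrow> (\<forall>y\<in>S. \<mu> x y \<sqsubseteq>\<^bsub>Z\<^esub> z)"
proof
  assume "\<mu> x (\<Squnion>\<^bsub>Y\<^esub>S) \<sqsubseteq>\<^bsub>Z\<^esub> z"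
  moreover have "\<mu> x y \<sqsubseteq>\<^bsub>Z\<^esub> \<mu> x (\<Squnion>\<^bsub>Y\<^esub>S)" if "y \<in> S" for y
    using assms that by (intro \<mu>_mono) (auto intro: Y.sup_upper)
  ultimately show "\<forall>y\<in>S. \<mu> x y \<sqsubseteq>\<^bsub>Z\<^esub> z"
    using assms subsetD[OF assms(1)] by (auto intro: Z.le_trans[of _ "\<mu> x (\<Squnion>\<^bsub>Y\<^esub>S)"])
next
  assume "\<forall>y\<in>S. \<mu> x y \<sqsubseteq>\<^bsub>Z\<^esub> z"
  then show "\<mu> x (\<Squnion>\<^bsub>Y\<^esub>S) \<sqsubseteq>\<^bsub>Z\<^esub> z"
    using I_sup2[OF I_slice[OF assms(3)] assms(1,2)] assms subsetD[OF assms(1)] by simp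
qed

lemma \<mu>_sup1:
  assumes "S \<subseteq> carrier X" "y \<in> carrier Y"
  shows "\<mu> (\<Squnion>\<^bsub>X\<^esub>S) y = \<Squnion>\<^bsub>Z\<^esub>((\<lambda>x. \<mu> x y) ` S)"
  using assms subsetD[OF assms(1)]
  by (intro Z.eq_by_upper) (simp_all add: \<mu>_sup1_le Z.sup_le_iff image_subset_iff)

lemma \<mu>_sup2:
  assumes "S \<subseteq> carrier Y" "x \<in> carrier X"
  shows "\<mu> x (\<Squnion>\<^bsub>Y\<^esub>S) = \<Squnion>\<^bsub>Z\<^esub>((\<lambda>y. \<mu> x y) ` S)"
  using assms subsetD[OF assms(1)]
  by (intro Z.eq_by_upper) (simp_all add: \<mu>_sup2_le Z.sup_le_iff image_subset_iff)

lemma \<mu>_bal: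
  assumes "x \<in> carrier X" "y \<in> carrier Y" "b \<in> carrier B"
  shows "\<mu> (x \<sqinter>\<^bsub>X\<^esub> invim f b) y = \<mu> x (invim g b \<sqinter>\<^bsub>Y\<^esub> y)"
  using assms I_bal[OF t_I] by (intro Z.eq_by_upper) (auto simp: rep[symmetric])

lemma invim_rep: "z \<in> carrier Z \<Longrightarrow> invim t z = {(x, y). x \<in> carrier X \<and> y \<in> carrier Y \<and> \<mu> x y \<sqsubseteq>\<^bsub>Z\<^esub> z}"
  using I_subset[OF t_I, of z] by (auto simp: rep[of _ _ z])

end

text \<open>\<open>E1 v\<close> and \<open>E2 v\<close> below are the inverse images of \<open>v\<close> along the two composites. The Frobenius
  conditions \<open>F\<alpha>\<close> and \<open>F\<beta>\<close> make them balanced ideals. All the associativity laws of groupoids,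
  actions and algebraic morphisms are instances of \<open>triple_eq_iff'\<close>.\<close>

locale triple =
  fixes X :: "'x gorder" and Y :: "'y gorder" and Z :: "'z gorder"
    and A :: "'a gorder" and B :: "'b gorder"
    and f :: "('x, 'a) lmap" and g :: "('y, 'a) lmap"
    and f' :: "('y, 'b) lmap" and g' :: "('z, 'b) lmap"
    and X' :: "'p gorder" and f'' :: "('p, 'b) lmap" and \<alpha> :: "(('x \<times> 'y) set, 'p) lmap" and \<mu>
    and Y' :: "'q gorder" and g'' :: "('q, 'a) lmap" and \<beta> :: "(('y \<times> 'z) set, 'q) lmap" and \<nu>
    and V :: "'v gorder" and \<gamma> :: "(('p \<times> 'z) set, 'v) lmap" and \<sigma>
    and \<delta> :: "(('x \<times> 'q) set, 'v) lmap" and \<tau>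
  assumes \<alpha>: "repr_map X Y A f g X' \<alpha> \<mu>" and \<beta>: "repr_map Y Z B f' g' Y' \<beta> \<nu>"
    and \<gamma>: "repr_map X' Z B f'' g' V \<gamma> \<sigma>" and \<delta>: "repr_map X Y' A f g'' V \<delta> \<tau>"
    and c\<alpha>: "f'' \<circ>\<^sub>L \<alpha> = f' \<circ>\<^sub>L lsnd f g" and c\<beta>: "g'' \<circ>\<^sub>L \<beta> = g \<circ>\<^sub>L lfst f' g'"
    and F\<alpha>: "\<lbrakk>x \<in> carrier X; y \<in> carrier Y; b \<in> carrier B\<rbrakk>
      \<Longrightarrow> \<mu> x (invim f' b \<sqinter>\<^bsub>Y\<^esub> y) = \<mu> x y \<sqinter>\<^bsub>X'\<^esub> invim f'' b"
    and F\<beta>: "\<lbrakk>y \<in> carrier Y; z \<in> carrier Z; a \<in> carrier A\<rbrakk>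
      \<Longrightarrow> \<nu> (invim g a \<sqinter>\<^bsub>Y\<^esub> y) z = invim g'' a \<sqinter>\<^bsub>Y'\<^esub> \<nu> y z"
begin

sublocale A: repr_map X Y A f g X' \<alpha> \<mu> by (fact \<alpha>)
sublocale B: repr_map Y Z B f' g' Y' \<beta> \<nu> by (fact \<beta>)
sublocale C: repr_map X' Z B f'' g' V \<gamma> \<sigma> by (fact \<gamma>)
sublocale D: repr_map X Y' A f g'' V \<delta> \<tau> by (fact \<delta>)

text \<open>The map along which \<open>Z\<close> is attached, so that the pullback of
  \<open>s\<close> and \<open>g'\<close> is the locale of composable triples.\<close>

definition s where "s = f' \<circ>\<^sub>L lsnd f g"

lemma s_map: "locale_map A.P B s" unfolding s_def using B.f A.pr_maps(2) by blast

sublocale W: cospan A.P Z B s g' using s_map B.g by unfold_locales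

lemma s_invim: "b \<in> carrier B \<Longrightarrow> invim s b = A.T \<top>\<^bsub>X\<^esub> (invim f' b)"
  by (simp add: s_def invim_lcomp A.invim_lsnd)

abbreviation "px \<equiv> lfst f g \<circ>\<^sub>L lfst s g'"
abbreviation "py \<equiv> lsnd f g \<circ>\<^sub>L lfst s g'"
abbreviation "pz \<equiv> lsnd s g'"
abbreviation "h1 \<equiv> \<gamma> \<circ>\<^sub>L lpair f'' g' (\<alpha> \<circ>\<^sub>L lfst s g') pz"
abbreviation "h2 \<equiv> \<delta> \<circ>\<^sub>L lpair f g'' px (\<beta> \<circ>\<^sub>L lpair f' g' py pz)"

sublocale c1: cone X' Z B f'' g' W.P "\<alpha> \<circ>\<^sub>L lfst s g'" pz
proof (rule coneI)
  show "f'' \<circ>\<^sub>L (\<alpha> \<circ>\<^sub>L lfst s g') = g' \<circ>\<^sub>L pz"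
    using c\<alpha> W.square by (simp add: lcomp_assoc[symmetric, OF C.f] locale_mapD[OF A.t] s_def)
qed (use C.f C.g A.t W.pr_maps in blast)+

sublocale c2: cone Y Z B f' g' W.P py pz
proof (rule coneI)
  show "f' \<circ>\<^sub>L py = g' \<circ>\<^sub>L pz"
    using W.square by (simp add: lcomp_assoc[symmetric, OF B.f] s_def)
qed (use B.f B.g A.pr_maps W.pr_maps in blast)+

sublocale c3: cone X Y' A f g'' W.P px "\<beta> \<circ>\<^sub>L lpair f' g' py pz"
proof (rule coneI)
  have "g'' \<circ>\<^sub>L (\<beta> \<circ>\<^sub>L lpair f' g' py pz) = g \<circ>\<^sub>L lfst f' g' \<circ>\<^sub>L lpair f' g' py pz"
    using c\<beta> by (simp add: lcomp_assoc[symmetric, OF D.g] locale_mapD[OF B.t])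
  also have "\<dots> = g \<circ>\<^sub>L py"
    by (simp add: lcomp_assoc[OF A.g] c2.lfst_lpair)
  also have "\<dots> = f \<circ>\<^sub>L px"
    using A.square by (simp add: lcomp_assoc[symmetric, OF A.g] lcomp_assoc[symmetric, OF A.f])
  finally show "f \<circ>\<^sub>L px = g'' \<circ>\<^sub>L (\<beta> \<circ>\<^sub>L lpair f' g' py pz)" by simp
qed (use D.f D.g A.pr_maps W.pr_maps B.t c2.lpair_map in blast)+

lemma h1_map: "locale_map W.P V h1" and h2_map: "locale_map W.P V h2"
  using C.t D.t c1.lpair_map c3.lpair_map by blast+

definition E1 where "E1 v = {(U, z). A.I U \<and> z \<in> carrier Z \<and> (\<forall>(x, y)\<in>U. \<sigma> (\<mu> x y) z \<sqsubseteq>\<^bsub>V\<^esub> v)}"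
definition E2 where "E2 v = {(U, z). A.I U \<and> z \<in> carrier Z \<and> (\<forall>(x, y)\<in>U. \<tau> x (\<nu> y z) \<sqsubseteq>\<^bsub>V\<^esub> v)}"

text \<open>A pair \<open>(U, z)\<close> belongs to the set when the ideal \<open>U\<close> lies in
  the slice of \<open>\<kappa>\<close> at \<open>z\<close>. Closure in \<open>U\<close> therefore
  comes from the slices being ideals, and closure in \<open>z\<close> from the behaviour of
  \<open>\<kappa>\<close> in its last argument. Only the balance condition involves both.\<close>

lemma I_E:
  fixes \<kappa> :: "'x \<Rightarrow> 'y \<Rightarrow> 'z \<Rightarrow> 'v"
  assumes v: "v \<in> carrier V"
    and cl: "\<And>x y z. \<lbrakk>x \<in> carrier X; y \<in> carrier Y; z \<in> carrier Z\<rbrakk> \<Longrightarrow> \<kappa> x y z \<in> carrier V"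
    and slice: "\<And>z. z \<in> carrier Z \<Longrightarrow> A.I {(x, y). x \<in> carrier X \<and> y \<in> carrier Y \<and> \<kappa> x y z \<sqsubseteq>\<^bsub>V\<^esub> v}"
    and down: "\<And>x y z z'. \<lbrakk>x \<in> carrier X; y \<in> carrier Y; z \<in> carrier Z; z' \<in> carrier Z; z' \<sqsubseteq>\<^bsub>Z\<^esub> z\<rbrakk>
      \<Longrightarrow> \<kappa> x y z' \<sqsubseteq>\<^bsub>V\<^esub> \<kappa> x y z"
    and sup: "\<And>x y T. \<lbrakk>x \<in> carrier X; y \<in> carrier Y; T \<subseteq> carrier Z; \<forall>z\<in>T. \<kappa> x y z \<sqsubseteq>\<^bsub>V\<^esub> v\<rbrakk>
      \<Longrightarrow> \<kappa> x y (\<Squnion>\<^bsub>Z\<^esub>T) \<sqsubseteq>\<^bsub>V\<^esub> v"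
    and bal: "\<And>x y z b. \<lbrakk>x \<in> carrier X; y \<in> carrier Y; z \<in> carrier Z; b \<in> carrier B\<rbrakk>
      \<Longrightarrow> \<kappa> x (invim f' b \<sqinter>\<^bsub>Y\<^esub> y) z = \<kappa> x y (invim g' b \<sqinter>\<^bsub>Z\<^esub> z)"
  shows "W.I {(U, z). A.I U \<and> z \<in> carrier Z \<and> (\<forall>(x, y)\<in>U. \<kappa> x y z \<sqsubseteq>\<^bsub>V\<^esub> v)}"
proof -
  let ?S = "\<lambda>z. {(x, y). x \<in> carrier X \<and> y \<in> carrier Y \<and> \<kappa> x y z \<sqsubseteq>\<^bsub>V\<^esub> v}"
  have eq: "{(U, z). A.I U \<and> z \<in> carrier Z \<and> (\<forall>(x, y)\<in>U. \<kappa> x y z \<sqsubseteq>\<^bsub>V\<^esub> v)}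
    = {(U, z). A.I U \<and> z \<in> carrier Z \<and> U \<subseteq> ?S z}"
    using A.I_sub by fast
  show ?thesis unfolding eq
  proof (rule W.II, goal_cases)
    case 1 show ?case by auto
  next
    case (2 U U' z z')
    then have z: "z \<in> carrier Z" "z' \<in> carrier Z" "z' \<sqsubseteq>\<^bsub>Z\<^esub> z" by auto
    have "?S z \<subseteq> ?S z'"
    proof clarify
      fix x y assume "x \<in> carrier X" "y \<in> carrier Y" "\<kappa> x y z \<sqsubseteq>\<^bsub>V\<^esub> v"
      then show "\<kappa> x y z' \<sqsubseteq>\<^bsub>V\<^esub> v"
        using down[of x y z z'] cl C.Z.le_trans[of "\<kappa> x y z'" "\<kappa> x y z" v] z v by simp
    qed
    with 2 show ?case by (simp, blast)
  next
    case (3 S y)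
    then show ?case using A.P_sup_closed A.P_sup_least slice by auto
  next
    case (4 S U)
    then have "A.I U" by auto
    moreover have "U \<subseteq> ?S (\<Squnion>\<^bsub>Z\<^esub>S)"
    proof clarify
      fix a b assume ab: "(a, b) \<in> U"
      then have c: "a \<in> carrier X" "b \<in> carrier Y" using A.I_sub[OF \<open>A.I U\<close>] by auto
      moreover have "\<forall>z\<in>S. \<kappa> a b z \<sqsubseteq>\<^bsub>V\<^esub> v" using 4 ab by (simp, blast)
      ultimately show "a \<in> carrier X \<and> b \<in> carrier Y \<and> \<kappa> a b (\<Squnion>\<^bsub>Z\<^esub>S) \<sqsubseteq>\<^bsub>V\<^esub> v"
        using sup 4 by auto
    qed
    ultimately show ?case using 4 by auto
  next
    case (5 U z b)
    then have U: "A.I U" and z: "z \<in> carrier Z" and b: "b \<in> carrier B" by auto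
    have fb: "invim f' b \<in> carrier Y" using b by simp
    let ?R = "A.residual \<top>\<^bsub>X\<^esub> (invim f' b) (?S z)"
    have IT: "A.I (A.T \<top>\<^bsub>X\<^esub> (invim f' b))" using b by (intro A.T_I) auto
    have "U \<inter> A.T \<top>\<^bsub>X\<^esub> (invim f' b) \<subseteq> ?S z \<longleftrightarrow> U \<subseteq> ?S (invim g' b \<sqinter>\<^bsub>Z\<^esub> z)" (is "?l \<longleftrightarrow> ?r")
    proof
      assume l: ?l
      show ?r
      proof clarify
        fix x y assume xy: "(x, y) \<in> U"
        then have c: "x \<in> carrier X" "y \<in> carrier Y" using A.I_sub[OF U] by auto
        have "(x, invim f' b \<sqinter>\<^bsub>Y\<^esub> y) \<in> U"
          using A.I_down[OF U xy] c fb by (simp add: A.Y.meet_right)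
        moreover have "(x, invim f' b \<sqinter>\<^bsub>Y\<^esub> y) \<in> A.T \<top>\<^bsub>X\<^esub> (invim f' b)"
          using A.I_down[OF A.T_I A.T_mem] c fb by (simp add: A.Y.meet_left)
        ultimately show "x \<in> carrier X \<and> y \<in> carrier Y \<and> \<kappa> x y (invim g' b \<sqinter>\<^bsub>Z\<^esub> z) \<sqsubseteq>\<^bsub>V\<^esub> v"
          using l c bal[OF c z b] by auto
      qed
    next
      assume r: ?r
      have "U \<subseteq> ?R"
      proof clarify
        fix x y assume xy: "(x, y) \<in> U"
        then have c: "x \<in> carrier X" "y \<in> carrier Y" using A.I_sub[OF U] by auto
        then show "(x, y) \<in> ?R"
          using r xy bal[OF c z b] fb by (auto simp: A.residual_def meet_comm[of Y])
      qed
      \<comment> \<open>For \<open>(a, c)\<close> in the intersection this yields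
        \<open>(a \<sqinter> a, c \<sqinter> c)\<close> in the slice: the generator of the cylinder
        lies in the Heyting implication from \<open>(a, c)\<close>, hence so does the whole
        cylinder.\<close>
      moreover have "A.T \<top>\<^bsub>X\<^esub> (invim f' b) \<subseteq> A.residual a c (?S z)"
        if "(a, c) \<in> U" for a c
        using that A.I_sub[OF U that] \<open>U \<subseteq> ?R\<close> b
        by (intro A.T_le A.I_residual slice z) (auto simp: A.residual_def meet_comm[of Y])
      ultimately show ?l
        using A.I_sub[OF U] by (fastforce simp: A.residual_def)
    qed
    then show ?case
      using 5 b IT by (simp add: s_invim A.P_meet A.I_Int)
  qed
qed

lemma I_E1: assumes v: "v \<in> carrier V" shows "W.I (E1 v)"
  unfolding E1_def
proof (rule I_E[OF v])
  fix z assume z: "z \<in> carrier Z"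
  \<comment> \<open>Since \<open>\<sigma>\<close> preserves joins in its first argument, there is a
    largest \<open>w\<close> with \<open>\<sigma> w z \<le> v\<close>. The slice is its inverse
    image along \<open>\<alpha>\<close>, hence an ideal.\<close>
  let ?w = "\<Squnion>\<^bsub>X'\<^esub>{w \<in> carrier X'. \<sigma> w z \<sqsubseteq>\<^bsub>V\<^esub> v}"
  have w: "?w \<in> carrier X'" by (intro A.Z.sup_closed) auto
  have wz: "\<sigma> ?w z \<sqsubseteq>\<^bsub>V\<^esub> v" using v z by (subst C.\<mu>_sup1_le) auto
  have "u \<sqsubseteq>\<^bsub>X'\<^esub> ?w \<longleftrightarrow> \<sigma> u z \<sqsubseteq>\<^bsub>V\<^esub> v" if u: "u \<in> carrier X'" for u
  proof
    assume "u \<sqsubseteq>\<^bsub>X'\<^esub> ?w"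
    then have "\<sigma> u z \<sqsubseteq>\<^bsub>V\<^esub> \<sigma> ?w z" using u w z by (intro C.\<mu>_mono) auto
    then show "\<sigma> u z \<sqsubseteq>\<^bsub>V\<^esub> v" by (rule C.Z.le_trans[OF _ wz]) (use u w z v in simp_all)
  qed (use u in \<open>auto intro!: A.Z.sup_upper\<close>)
  then have "{(x, y). x \<in> carrier X \<and> y \<in> carrier Y \<and> \<sigma> (\<mu> x y) z \<sqsubseteq>\<^bsub>V\<^esub> v} = invim \<alpha> ?w"
    unfolding A.invim_rep[OF w] by (intro Collect_cong) (auto split: prod.splits)
  then show "A.I {(x, y). x \<in> carrier X \<and> y \<in> carrier Y \<and> \<sigma> (\<mu> x y) z \<sqsubseteq>\<^bsub>V\<^esub> v}"
    using A.t_I[OF w] by simp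
qed (use v in \<open>auto simp: C.\<mu>_sup2_le F\<alpha> C.\<mu>_bal C.\<mu>_mono\<close>)

text \<open>Here \<open>x\<close> and \<open>y\<close> enter different products, so the ideal
  conditions are checked one by one. Balance slides \<open>a\<close> from \<open>x\<close> onto
  \<open>\<nu> y z\<close> by the balance of \<open>\<tau>\<close>, and then inside
  \<open>\<nu>\<close> by \<open>F\<beta>\<close>.\<close>

lemma I_E2_slice:
  assumes v: "v \<in> carrier V" and z: "z \<in> carrier Z"
  shows "A.I {(x, y). x \<in> carrier X \<and> y \<in> carrier Y \<and> \<tau> x (\<nu> y z) \<sqsubseteq>\<^bsub>V\<^esub> v}"
proof (rule A.II, goal_cases)
  case 1 show ?case by auto
next
  case (2 x x' y y')
  then have "\<tau> x' (\<nu> y' z) \<sqsubseteq>\<^bsub>V\<^esub> \<tau> x (\<nu> y z)" using z by (intro D.\<mu>_mono B.\<mu>_mono) auto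
  then show ?case using 2 z v C.Z.le_trans[of "\<tau> x' (\<nu> y' z)" "\<tau> x (\<nu> y z)" v] by auto
next
  case (3 S y) then show ?case using v z by (auto simp: D.\<mu>_sup1_le)
next
  case (4 S x)
  then have "\<tau> x (\<nu> (\<Squnion>\<^bsub>Y\<^esub>S) z) \<sqsubseteq>\<^bsub>V\<^esub> v"
    using v z by (subst B.\<mu>_sup1) (auto simp: subset_iff, subst D.\<mu>_sup2_le, auto)
  then show ?case using 4 by auto
next
  case (5 x y b)
  then show ?case using v z F\<beta>[of y z b] D.\<mu>_bal[of x "\<nu> y z" b] by auto
qed

lemma I_E2: assumes v: "v \<in> carrier V" shows "W.I (E2 v)"
  unfolding E2_def
proof (rule I_E[OF v])
  fix x y T assume a: "x \<in> carrier X" "y \<in> carrier Y" "T \<subseteq> carrier Z" "\<forall>z\<in>T. \<tau> x (\<nu> y z) \<sqsubseteq>\<^bsub>V\<^esub> v"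
  then show "\<tau> x (\<nu> y (\<Squnion>\<^bsub>Z\<^esub>T)) \<sqsubseteq>\<^bsub>V\<^esub> v"
    using v by (subst B.\<mu>_sup2) (auto simp: subset_iff, subst D.\<mu>_sup2_le, auto)
next
  fix x y z b assume "x \<in> carrier X" "y \<in> carrier Y" "z \<in> carrier Z" "b \<in> carrier B"
  then show "\<tau> x (\<nu> (invim f' b \<sqinter>\<^bsub>Y\<^esub> y) z) = \<tau> x (\<nu> y (invim g' b \<sqinter>\<^bsub>Z\<^esub> z))"
    by (simp add: B.\<mu>_bal[symmetric] meet_comm[of Y])
qed (use v in \<open>auto simp: I_E2_slice D.\<mu>_mono B.\<mu>_mono\<close>)

lemma lfst_W: "A.I U \<Longrightarrow> invim (lfst s g') U = W.T U \<top>\<^bsub>Z\<^esub>"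
  by (simp add: W.invim_lfst)

lemma h1_invim: assumes v: "v \<in> carrier V" shows "invim h1 v = E1 v"
proof (rule subset_antisym)
  have I: "C.I (invim \<gamma> v)" using C.t_I v .
  have e: "invim h1 v = invim (lpair f'' g' (\<alpha> \<circ>\<^sub>L lfst s g') pz) (invim \<gamma> v)"
    using v by (simp add: invim_lcomp'[OF C.t])
  have m: "invim (\<alpha> \<circ>\<^sub>L lfst s g') w \<sqinter>\<^bsub>W.P\<^esub> invim pz c = W.T (invim \<alpha> w) c"
    if "w \<in> carrier X'" "c \<in> carrier Z" for w c
    using that A.t_I[OF that(1)]
    by (simp add: invim_lcomp'[OF A.t] lfst_W W.invim_lsnd W.T_meet_tops)
  have "invim (lpair f'' g' (\<alpha> \<circ>\<^sub>L lfst s g') pz) (invim \<gamma> v) \<sqsubseteq>\<^bsub>W.P\<^esub> E1 v"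
  proof (subst c1.invim_lpair_le[OF I], use I_E1[OF v] in simp, intro allI impI)
    fix w c assume wc: "(w, c) \<in> invim \<gamma> v"
    then have cl: "w \<in> carrier X'" "c \<in> carrier Z" using C.I_sub[OF I] by auto
    have le: "\<sigma> w c \<sqsubseteq>\<^bsub>V\<^esub> v" using wc C.rep cl v by simp
    have "(invim \<alpha> w, c) \<in> E1 v"
      unfolding E1_def
    proof (clarsimp, intro conjI A.t_I cl, clarify)
      fix x y assume "(x, y) \<in> invim \<alpha> w"
      then have "\<mu> x y \<sqsubseteq>\<^bsub>X'\<^esub> w" "x \<in> carrier X" "y \<in> carrier Y" using A.invim_rep cl by auto
      moreover from this have "\<sigma> (\<mu> x y) c \<sqsubseteq>\<^bsub>V\<^esub> \<sigma> w c" using cl by (intro C.\<mu>_mono) auto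
      ultimately show "\<sigma> (\<mu> x y) c \<sqsubseteq>\<^bsub>V\<^esub> v"
        using C.Z.le_trans[OF _ le, of "\<sigma> (\<mu> x y) c"] cl v by simp
    qed
    then show "invim (\<alpha> \<circ>\<^sub>L lfst s g') w \<sqinter>\<^bsub>W.P\<^esub> invim pz c \<sqsubseteq>\<^bsub>W.P\<^esub> E1 v"
      unfolding m[OF cl] using I_E1[OF v] by (simp add: W.T_le)
  qed
  then show "invim h1 v \<subseteq> E1 v" unfolding e by simp
  show "E1 v \<subseteq> invim h1 v"
  proof clarify
    fix U c assume "(U, c) \<in> E1 v"
    then have U: "A.I U" and c: "c \<in> carrier Z" and le: "\<forall>(x, y)\<in>U. \<sigma> (\<mu> x y) c \<sqsubseteq>\<^bsub>V\<^esub> v"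
      unfolding E1_def by auto
    \<comment> \<open>The join of the products over \<open>U\<close> is the smallest
      \<open>w\<close> with \<open>U \<subseteq> invim \<alpha> w\<close>, and
      \<open>\<sigma> w c \<le> v\<close> holds because \<open>\<sigma>\<close> preserves joins in
      its first argument.\<close>
    let ?S = "(\<lambda>(x, y). \<mu> x y) ` U"
    have S: "?S \<subseteq> carrier X'" using A.I_sub[OF U] by auto
    let ?w = "\<Squnion>\<^bsub>X'\<^esub>?S"
    have w: "?w \<in> carrier X'" using S by simp
    have "\<sigma> ?w c \<sqsubseteq>\<^bsub>V\<^esub> v" using le by (subst C.\<mu>_sup1_le[OF S c v]) auto
    then have "(?w, c) \<in> invim \<gamma> v" using C.rep w c v by simp
    then have "W.T (invim \<alpha> ?w) c \<subseteq> invim h1 v"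
      using c1.le_invim_lpair[OF I] unfolding e m[OF w c, symmetric] by simp
    moreover have "U \<subseteq> invim \<alpha> ?w"
    proof clarify
      fix x y assume xy: "(x, y) \<in> U"
      then have "\<mu> x y \<sqsubseteq>\<^bsub>X'\<^esub> ?w" using S by (intro A.Z.sup_upper) force+
      then show "(x, y) \<in> invim \<alpha> ?w" using A.rep w A.I_sub[OF U xy] by simp
    qed
    then have "(U, c) \<in> W.T (invim \<alpha> ?w) c"
      using W.I_down[OF W.T_I W.T_mem] U c A.t_I[OF w] by simp
    ultimately show "(U, c) \<in> invim h1 v" by blast
  qed
qed

lemma h2_invim: assumes v: "v \<in> carrier V" shows "invim h2 v = E2 v"
proof (rule subset_antisym)
  have I: "D.I (invim \<delta> v)" using D.t_I v .
  have e: "invim h2 v = invim (lpair f g'' px (\<beta> \<circ>\<^sub>L lpair f' g' py pz)) (invim \<delta> v)"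
    using v by (simp add: invim_lcomp'[OF D.t])
  have mx: "invim px a = W.T (A.T a \<top>\<^bsub>Y\<^esub>) \<top>\<^bsub>Z\<^esub>" if "a \<in> carrier X" for a
    using that by (simp add: invim_lcomp'[OF A.pr_maps(1)] A.invim_lfst W.invim_lfst A.T_I)
  have myz: "invim py b \<sqinter>\<^bsub>W.P\<^esub> invim pz c = W.T (A.T \<top>\<^bsub>X\<^esub> b) c" if "b \<in> carrier Y" "c \<in> carrier Z" for b c
    using that by (simp add: invim_lcomp'[OF A.pr_maps(2)] A.invim_lsnd W.invim_lfst W.invim_lsnd A.T_I W.T_meet_tops)
  have mxyz: "W.T (A.T a \<top>\<^bsub>Y\<^esub>) \<top>\<^bsub>Z\<^esub> \<inter> W.T (A.T \<top>\<^bsub>X\<^esub> b) c = W.T (A.T a b) c"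
    if "a \<in> carrier X" "b \<in> carrier Y" "c \<in> carrier Z" for a b c
    using that by (simp add: W.T_meet A.T_I A.P_meet A.T_meet A.X_meet_top A.Y_meet_top W.Y_meet_top)
  have yz: "invim (\<beta> \<circ>\<^sub>L lpair f' g' py pz) w = invim (lpair f' g' py pz) (invim \<beta> w)"
    if "w \<in> carrier Y'" for w
    using that by (simp add: invim_lcomp'[OF B.t])
  have "invim (lpair f g'' px (\<beta> \<circ>\<^sub>L lpair f' g' py pz)) (invim \<delta> v) \<sqsubseteq>\<^bsub>W.P\<^esub> E2 v"
  proof (subst c3.invim_lpair_le[OF I], use I_E2[OF v] in simp, intro allI impI)
    fix a w assume aw: "(a, w) \<in> invim \<delta> v"
    then have cl: "a \<in> carrier X" "w \<in> carrier Y'" using D.I_sub[OF I] by auto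
    have le: "\<tau> a w \<sqsubseteq>\<^bsub>V\<^esub> v" using aw D.rep cl v by simp
    have Ib: "B.I (invim \<beta> w)" using B.t_I cl by simp
    let ?S = "(\<lambda>(b, c). c2.m b c) ` invim \<beta> w"
    have S: "?S \<subseteq> carrier W.P" using c2.m_image[OF Ib] .
    have yw: "invim (lpair f' g' py pz) (invim \<beta> w) = \<Squnion>\<^bsub>W.P\<^esub>?S"
      by (simp add: c2.invim_lpair[OF Ib] c2.p_def)
    have "\<Squnion>\<^bsub>W.P\<^esub>?S \<sqinter>\<^bsub>W.P\<^esub> invim px a \<sqsubseteq>\<^bsub>W.P\<^esub> E2 v"
    proof (rule c1.Z.meet_sup_le[OF _ S])
      show "invim px a \<in> carrier W.P" using mx cl by (simp add: W.T_I A.T_I)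
      show "E2 v \<in> carrier W.P" using I_E2[OF v] by simp
      fix U assume "U \<in> ?S"
      then obtain b c where bc: "(b, c) \<in> invim \<beta> w" "U = c2.m b c" by auto
      have bcl: "b \<in> carrier Y" "c \<in> carrier Z" using B.I_sub[OF Ib bc(1)] by auto
      have "\<nu> b c \<sqsubseteq>\<^bsub>Y'\<^esub> w" using B.rep bcl cl bc by simp
      then have "\<tau> a (\<nu> b c) \<sqsubseteq>\<^bsub>V\<^esub> \<tau> a w" using cl bcl by (intro D.\<mu>_mono) auto
      then have l: "\<tau> a (\<nu> b c) \<sqsubseteq>\<^bsub>V\<^esub> v" by (rule C.Z.le_trans[OF _ le]) (use cl bcl v in simp_all)
      have "A.T a b \<subseteq> {(x, y). x \<in> carrier X \<and> y \<in> carrier Y \<and> \<tau> x (\<nu> y c) \<sqsubseteq>\<^bsub>V\<^esub> v}"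
        using I_E2_slice[OF v bcl(2)] l cl bcl by (intro A.T_le) auto
      then have "(A.T a b, c) \<in> E2 v" using cl bcl by (auto simp: E2_def A.T_I)
      then have "W.T (A.T a b) c \<subseteq> E2 v" using I_E2[OF v] by (rule W.T_le[rotated])
      moreover have "W.I (W.T (A.T a \<top>\<^bsub>Y\<^esub>) \<top>\<^bsub>Z\<^esub>)" "W.I (W.T (A.T \<top>\<^bsub>X\<^esub> b) c)"
        using cl bcl by (auto intro!: W.T_I simp: A.T_I)
      ultimately show "U \<sqinter>\<^bsub>W.P\<^esub> invim px a \<sqsubseteq>\<^bsub>W.P\<^esub> E2 v"
        unfolding bc(2) c2.m_def myz[OF bcl] mx[OF cl(1)]
        using mxyz[OF cl(1) bcl] by (simp add: W.P_meet Int_commute)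
    qed
    then show "invim px a \<sqinter>\<^bsub>W.P\<^esub> invim (\<beta> \<circ>\<^sub>L lpair f' g' py pz) w \<sqsubseteq>\<^bsub>W.P\<^esub> E2 v"
      unfolding yz[OF cl(2)] yw by (simp add: meet_comm)
  qed
  then show "invim h2 v \<subseteq> E2 v" unfolding e by simp
  have IW: "W.I (invim h2 v)" using W.I_invim[OF h2_map v] .
  show "E2 v \<subseteq> invim h2 v"
  proof clarify
    fix U c assume "(U, c) \<in> E2 v"
    then have U: "A.I U" and c: "c \<in> carrier Z" and le: "\<forall>(x, y)\<in>U. \<tau> x (\<nu> y c) \<sqsubseteq>\<^bsub>V\<^esub> v"
      unfolding E2_def by auto
    \<comment> \<open>It suffices to reach generators, since \<open>U\<close> is the join of its
      elements \<open>a \<otimes> b\<close> and ideals are closed under joins in the first argument.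
      The witness is \<open>\<nu> b c\<close>, the least element of \<open>Y'\<close> whose inverse
      image along \<open>\<beta>\<close> contains \<open>(b, c)\<close>.\<close>
    have gen: "(A.T a b, c) \<in> invim h2 v" if ab: "(a, b) \<in> U" for a b
    proof -
      have cl: "a \<in> carrier X" "b \<in> carrier Y" using A.I_sub[OF U ab] by auto
      let ?w = "\<nu> b c"
      have w: "?w \<in> carrier Y'" using cl c by simp
      have d: "(a, ?w) \<in> invim \<delta> v" using le ab D.rep cl w v by auto
      have bc: "(b, c) \<in> invim \<beta> ?w" using B.rep cl c w by auto
      have "W.T (A.T \<top>\<^bsub>X\<^esub> b) c \<subseteq> invim (lpair f' g' py pz) (invim \<beta> ?w)"
        using c2.le_invim_lpair[OF B.t_I[OF w] bc] unfolding myz[OF cl(2) c] by simp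
      moreover have "W.I (invim (lpair f' g' py pz) (invim \<beta> ?w))"
        using W.I_invim[OF c2.lpair_map] B.t_I[OF w] by simp
      moreover have "W.I (W.T (A.T a \<top>\<^bsub>Y\<^esub>) \<top>\<^bsub>Z\<^esub>)" using cl by (auto intro!: W.T_I simp: A.T_I)
      ultimately have "W.T (A.T a \<top>\<^bsub>Y\<^esub>) \<top>\<^bsub>Z\<^esub> \<inter> W.T (A.T \<top>\<^bsub>X\<^esub> b) c \<subseteq> invim h2 v"
        using c3.le_invim_lpair[OF I d] unfolding e mx[OF cl(1)] yz[OF w]
        by (auto simp: W.P_meet)
      then have "W.T (A.T a b) c \<subseteq> invim h2 v" unfolding mxyz[OF cl c] .
      then show ?thesis using W.T_mem by blast
    qed
    let ?S = "(\<lambda>(a, b). A.T a b) ` U"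
    have S: "?S \<subseteq> carrier A.P" using A.I_sub[OF U] A.T_I by auto
    have "(\<Squnion>\<^bsub>A.P\<^esub>?S, c) \<in> invim h2 v"
      using gen by (intro W.I_sup1[OF IW S c]) auto
    moreover have "U \<subseteq> \<Squnion>\<^bsub>A.P\<^esub>?S"
      using A.P_sup_upper[of ?S] S A.T_mem by fastforce
    ultimately show "(U, c) \<in> invim h2 v"
      using W.I_down[OF IW] U c S A.P_sup_closed[of ?S] by auto
  qed
qed

text \<open>Testing the ideals \<open>E1 v\<close> and \<open>E2 v\<close> on the generator
  \<open>(x \<otimes> y, z)\<close> recovers the inequalities
  \<open>\<sigma> (\<mu> x y) z \<le> v\<close> and \<open>\<tau> x (\<nu> y z) \<le> v\<close>, so
  equal ideals for all \<open>v\<close> mean equal products.\<close>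

theorem triple_eq_iff:
  "h1 = h2 \<longleftrightarrow> (\<forall>x\<in>carrier X. \<forall>y\<in>carrier Y. \<forall>z\<in>carrier Z. \<sigma> (\<mu> x y) z = \<tau> x (\<nu> y z))"
proof
  assume eq: "h1 = h2"
  have key: "(A.T x y, z) \<in> E1 v \<longleftrightarrow> \<sigma> (\<mu> x y) z \<sqsubseteq>\<^bsub>V\<^esub> v" "(A.T x y, z) \<in> E2 v \<longleftrightarrow> \<tau> x (\<nu> y z) \<sqsubseteq>\<^bsub>V\<^esub> v"
    if "x \<in> carrier X" "y \<in> carrier Y" "z \<in> carrier Z" "v \<in> carrier V" for x y z v
  proof -
    let ?S1 = "{(x, y). x \<in> carrier X \<and> y \<in> carrier Y \<and> \<sigma> (\<mu> x y) z \<sqsubseteq>\<^bsub>V\<^esub> v}"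
    have 1: "A.I ?S1"
    proof (rule A.II, goal_cases)
      case (2 x x' y y')
      then have "\<sigma> (\<mu> x' y') z \<sqsubseteq>\<^bsub>V\<^esub> \<sigma> (\<mu> x y) z" using that by (intro C.\<mu>_mono A.\<mu>_mono) auto
      then show ?case using 2 that C.Z.le_trans[of "\<sigma> (\<mu> x' y') z" "\<sigma> (\<mu> x y) z" v] by auto
    next
      case (3 S y)
      then have "\<sigma> (\<mu> (\<Squnion>\<^bsub>X\<^esub>S) y) z \<sqsubseteq>\<^bsub>V\<^esub> v"
        using that by (subst A.\<mu>_sup1) (auto simp: subset_iff, subst C.\<mu>_sup1_le, auto)
      then show ?case using 3 by auto
    next
      case (4 S x)
      then have "\<sigma> (\<mu> x (\<Squnion>\<^bsub>Y\<^esub>S)) z \<sqsubseteq>\<^bsub>V\<^esub> v"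
        using that by (subst A.\<mu>_sup2) (auto simp: subset_iff, subst C.\<mu>_sup1_le, auto)
      then show ?case using 4 by auto
    next
      case (5 x y b) then show ?case using A.\<mu>_bal[of x y b] by auto
    qed auto
    then have "A.T x y \<subseteq> ?S1 \<longleftrightarrow> (x, y) \<in> ?S1" by (rule A.T_le_iff)
    then show "(A.T x y, z) \<in> E1 v \<longleftrightarrow> \<sigma> (\<mu> x y) z \<sqsubseteq>\<^bsub>V\<^esub> v"
      using that A.T_I[of x y] A.I_sub[OF A.T_I[of x y]] by (fastforce simp: E1_def)
    let ?S2 = "{(x, y). x \<in> carrier X \<and> y \<in> carrier Y \<and> \<tau> x (\<nu> y z) \<sqsubseteq>\<^bsub>V\<^esub> v}"
    have "A.T x y \<subseteq> ?S2 \<longleftrightarrow> (x, y) \<in> ?S2" using I_E2_slice that by (intro A.T_le_iff) auto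
    then show "(A.T x y, z) \<in> E2 v \<longleftrightarrow> \<tau> x (\<nu> y z) \<sqsubseteq>\<^bsub>V\<^esub> v"
      using that A.T_I[of x y] A.I_sub[OF A.T_I[of x y]] by (fastforce simp: E2_def)
  qed
  show "\<forall>x\<in>carrier X. \<forall>y\<in>carrier Y. \<forall>z\<in>carrier Z. \<sigma> (\<mu> x y) z = \<tau> x (\<nu> y z)"
  proof (intro ballI C.Z.eq_by_upper)
    fix x y z v assume "x \<in> carrier X" "y \<in> carrier Y" "z \<in> carrier Z" "v \<in> carrier V"
    then show "\<sigma> (\<mu> x y) z \<sqsubseteq>\<^bsub>V\<^esub> v \<longleftrightarrow> \<tau> x (\<nu> y z) \<sqsubseteq>\<^bsub>V\<^esub> v"
      using key eq h1_invim h2_invim by metis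
  qed auto
next
  assume eq: "\<forall>x\<in>carrier X. \<forall>y\<in>carrier Y. \<forall>z\<in>carrier Z. \<sigma> (\<mu> x y) z = \<tau> x (\<nu> y z)"
  show "h1 = h2"
  proof (rule locale_map_eqI[OF h1_map h2_map])
    fix v assume v: "v \<in> carrier V"
    have "E1 v = E2 v" using eq A.I_sub unfolding E1_def E2_def by fastforce
    then show "invim h1 v = invim h2 v" using h1_invim h2_invim v by simp
  qed
qed

text \<open>The shape in which associativity is stated in the definitions, where the first two
  projections are paired again. That pairing is just the projection onto the pullback of
  \<open>f\<close> and \<open>g\<close>.\<close>

theorem triple_eq_iff':
  "\<gamma> \<circ>\<^sub>L lpair f'' g' (\<alpha> \<circ>\<^sub>L lpair f g (lfst f g \<circ>\<^sub>L lfst (f' \<circ>\<^sub>L lsnd f g) g') (lsnd f g \<circ>\<^sub>L lfst (f' \<circ>\<^sub>L lsnd f g) g'))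
      (lsnd (f' \<circ>\<^sub>L lsnd f g) g')
    = \<delta> \<circ>\<^sub>L lpair f g'' (lfst f g \<circ>\<^sub>L lfst (f' \<circ>\<^sub>L lsnd f g) g')
      (\<beta> \<circ>\<^sub>L lpair f' g' (lsnd f g \<circ>\<^sub>L lfst (f' \<circ>\<^sub>L lsnd f g) g') (lsnd (f' \<circ>\<^sub>L lsnd f g) g'))
    \<longleftrightarrow> (\<forall>x\<in>carrier X. \<forall>y\<in>carrier Y. \<forall>z\<in>carrier Z. \<sigma> (\<mu> x y) z = \<tau> x (\<nu> y z))"
  unfolding s_def[symmetric] lpair_lfst_lsnd[OF A.f A.g W.pr_maps(1)] by (rule triple_eq_iff)

end

section \<open>Inverse quantal frames\<close>

context unital_involutive_quantale begin

lemmas closed [simp] = mult_closed star_closed unit_closed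

lemma mult_sup_distrib:
  "\<lbrakk>a \<in> carrier Q; A \<subseteq> carrier Q\<rbrakk> \<Longrightarrow> a \<cdot> \<Squnion>A = \<Squnion>((\<lambda>b. a \<cdot> b) ` A)"
  "\<lbrakk>a \<in> carrier Q; A \<subseteq> carrier Q\<rbrakk> \<Longrightarrow> \<Squnion>A \<cdot> a = \<Squnion>((\<lambda>b. b \<cdot> a) ` A)"
  using sup_preserving_sup[OF mult_sup_left] sup_preserving_sup[OF mult_sup_right] by auto

end

context inverse_quantal_frame begin

lemma mult_mono:
  assumes "a \<sqsubseteq> a'" "b \<sqsubseteq> b'" "a \<in> carrier Q" "a' \<in> carrier Q" "b \<in> carrier Q" "b' \<in> carrier Q"
  shows "a \<cdot> b \<sqsubseteq> a' \<cdot> b'"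
proof -
  have "a \<cdot> b \<sqsubseteq> a' \<cdot> b"
    using sup_preserving_mono[OF frame_axioms frame_axioms mult_sup_right[of b]] assms by blast
  moreover have "a' \<cdot> b \<sqsubseteq> a' \<cdot> b'"
    using sup_preserving_mono[OF frame_axioms frame_axioms mult_sup_left[of a']] assms by blast
  ultimately show ?thesis using assms by (auto intro: le_trans[of _ "a' \<cdot> b"])
qed

lemma mult_le_left: "\<lbrakk>a \<sqsubseteq> \<ee>; a \<in> carrier Q; b \<in> carrier Q\<rbrakk> \<Longrightarrow> a \<cdot> b \<sqsubseteq> b"
  using mult_mono[of a \<ee> b b] by (simp add: unit_mult)

lemma mult_le_right: "\<lbrakk>a \<sqsubseteq> \<ee>; a \<in> carrier Q; b \<in> carrier Q\<rbrakk> \<Longrightarrow> b \<cdot> a \<sqsubseteq> b"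
  using mult_mono[of b b a \<ee>] by (simp add: mult_unit)

lemma star_mono: "\<lbrakk>a \<sqsubseteq> b; a \<in> carrier Q; b \<in> carrier Q\<rbrakk> \<Longrightarrow> a\<^sup>\<star> \<sqsubseteq> b\<^sup>\<star>"
  using sup_preserving_mono[OF frame_axioms frame_axioms star_sup] by blast

lemma star_le_iff: "\<lbrakk>a \<in> carrier Q; b \<in> carrier Q\<rbrakk> \<Longrightarrow> a\<^sup>\<star> \<sqsubseteq> b \<longleftrightarrow> a \<sqsubseteq> b\<^sup>\<star>"
  using star_mono[of a "b\<^sup>\<star>"] star_mono[of "a\<^sup>\<star>" b] by (auto simp: star_star)

lemma star_unit [simp]: "\<ee>\<^sup>\<star> = \<ee>"
  by (metis mult_unit star_closed star_mult star_star unit_closed unit_mult)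

lemma star_top [simp]: "\<top>\<^sup>\<star> = \<top>"
  using star_le_iff[of \<top> "\<top>\<^sup>\<star>"] top_le[of "\<top>\<^sup>\<star>"] star_le_iff[of \<top> \<top>] by (simp add: star_star)

lemma star_meet: 
  assumes "a \<in> carrier Q" "b \<in> carrier Q"
  shows "(a \<sqinter> b)\<^sup>\<star> = a\<^sup>\<star> \<sqinter> b\<^sup>\<star>"
proof (rule le_antisym)
  show "(a \<sqinter> b)\<^sup>\<star> \<sqsubseteq> a\<^sup>\<star> \<sqinter> b\<^sup>\<star>"
    using assms by (intro meet_le star_mono meet_left meet_right) auto
  have "a\<^sup>\<star> \<sqinter> b\<^sup>\<star> \<sqsubseteq> a\<^sup>\<star>" "a\<^sup>\<star> \<sqinter> b\<^sup>\<star> \<sqsubseteq> b\<^sup>\<star>" using assms by (auto intro: meet_left meet_right)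
  then have "(a\<^sup>\<star> \<sqinter> b\<^sup>\<star>)\<^sup>\<star> \<sqsubseteq> a" "(a\<^sup>\<star> \<sqinter> b\<^sup>\<star>)\<^sup>\<star> \<sqsubseteq> b" using assms by (auto simp: star_le_iff)
  then show "a\<^sup>\<star> \<sqinter> b\<^sup>\<star> \<sqsubseteq> (a \<sqinter> b)\<^sup>\<star>"
    using assms by (subst star_le_iff[symmetric]) (auto intro: meet_le)
qed (use assms in auto)

text \<open>The two support axioms give \<open>a = (a a\<^sup>\<star> \<sqinter> \<ee>) a\<close>,
  and the first factor is below \<open>a a\<^sup>\<star>\<close>.\<close>

lemma le_mult_star: "a \<in> carrier Q \<Longrightarrow> a \<sqsubseteq> a \<cdot> (a\<^sup>\<star> \<cdot> a)"
proof -
  assume a: "a \<in> carrier Q"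
  have "(a \<cdot> a\<^sup>\<star> \<sqinter> \<ee>) \<cdot> a \<sqsubseteq> (a \<cdot> a\<^sup>\<star>) \<cdot> a"
    using a by (intro mult_mono meet_left) auto
  then show ?thesis using support[OF a] support_mult[OF a] a by (simp add: mult_assoc)
qed

text \<open>For \<open>c\<close> below the unit,
  \<open>c \<le> c c\<^sup>\<star> c \<le> c\<^sup>\<star>\<close>; this applies to \<open>b\<close>
  and to \<open>b\<^sup>\<star>\<close>.\<close>

lemma subunit_star:
  assumes b: "b \<in> carrier Q" "b \<sqsubseteq> \<ee>" shows "b\<^sup>\<star> = b"
proof -
  have *: "c \<sqsubseteq> c\<^sup>\<star>" if c: "c \<in> carrier Q" "c \<sqsubseteq> \<ee>" for c
  proof (rule le_trans[OF le_mult_star[OF c(1)]])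
    have "c \<cdot> (c\<^sup>\<star> \<cdot> c) \<sqsubseteq> \<ee> \<cdot> (c\<^sup>\<star> \<cdot> \<ee>)" using c by (intro mult_mono) auto
    then show "c \<cdot> (c\<^sup>\<star> \<cdot> c) \<sqsubseteq> c\<^sup>\<star>" using c by (simp add: unit_mult mult_unit)
  qed (use c in auto)
  have "b\<^sup>\<star> \<sqsubseteq> \<ee>" using star_mono[of b \<ee>] b by simp
  then show ?thesis using *[of b] *[of "b\<^sup>\<star>"] b by (intro le_antisym) (auto simp: star_star)
qed

lemma subunit_idem:
  assumes b: "b \<in> carrier Q" "b \<sqsubseteq> \<ee>" shows "b \<cdot> b = b"
proof (rule le_antisym)
  show "b \<cdot> b \<sqsubseteq> b" using b by (rule_tac mult_le_left) auto
  have "b \<cdot> (b \<cdot> b) \<sqsubseteq> b \<cdot> b" using b by (intro mult_mono mult_le_left) auto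
  then show "b \<sqsubseteq> b \<cdot> b" using le_mult_star[of b] b le_trans[of b "b \<cdot> (b \<cdot> b)" "b \<cdot> b"] by (simp add: subunit_star)
qed (use b in auto)

lemma subunit_support: 
  assumes b: "b \<in> carrier Q" "b \<sqsubseteq> \<ee>" shows "b \<cdot> \<top> \<sqinter> \<ee> = b"
  using support[of b] b by (simp add: subunit_star subunit_idem meet_absorb)

text \<open>The support of \<open>b \<top> \<sqinter> x\<close> is below \<open>b\<close>, and an
  element is its support times itself. This makes restriction to an inverse image along the domain a
  multiplication; its mirror image does the same for the range. Nearly every balance and Frobenius
  condition below reduces to associativity in this way.\<close>

lemma subunit_mult_left:
  assumes b: "b \<in> carrier Q" "b \<sqsubseteq> \<ee>" and x: "x \<in> carrier Q"
  shows "b \<cdot> \<top> \<sqinter> x = b \<cdot> x"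
proof (rule le_antisym)
  let ?y = "b \<cdot> \<top> \<sqinter> x"
  have y: "?y \<in> carrier Q" using b x by simp
  have "?y \<cdot> \<top> \<sqsubseteq> b \<cdot> \<top> \<cdot> \<top>" using b x by (intro mult_mono meet_left) auto
  also have "b \<cdot> \<top> \<cdot> \<top> \<sqsubseteq> b \<cdot> \<top>" using b by (simp add: mult_assoc mult_mono)
  finally have "?y \<cdot> \<top> \<sqsubseteq> b \<cdot> \<top>" using b x by simp
  then have "?y \<cdot> \<top> \<sqinter> \<ee> \<sqsubseteq> b" using subunit_support[OF b] b x by (metis meet_mono le_refl y mult_closed top_closed unit_closed)
  then have "(?y \<cdot> \<top> \<sqinter> \<ee>) \<cdot> ?y \<sqsubseteq> b \<cdot> x" using b x by (intro mult_mono meet_right) auto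
  then show "?y \<sqsubseteq> b \<cdot> x" unfolding support_mult[OF y] .
  show "b \<cdot> x \<sqsubseteq> ?y" using b x by (intro meet_le mult_mono mult_le_left) auto
qed (use b x in auto)

lemma subunit_mult_right:
  assumes b: "b \<in> carrier Q" "b \<sqsubseteq> \<ee>" and x: "x \<in> carrier Q"
  shows "\<top> \<cdot> b \<sqinter> x = x \<cdot> b"
proof -
  have "(\<top> \<cdot> b \<sqinter> x)\<^sup>\<star> = (x \<cdot> b)\<^sup>\<star>"
    using subunit_mult_left[OF b, of "x\<^sup>\<star>"] b x by (simp add: star_meet star_mult subunit_star)
  then show ?thesis using b x by (metis star_star mult_closed meet_closed top_closed)
qed

lemma subunit_mult_subunit:
  assumes "b \<in> carrier Q" "b \<sqsubseteq> \<ee>" "c \<in> carrier Q" "c \<sqsubseteq> \<ee>"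
  shows "b \<cdot> c = b \<sqinter> c"
  using subunit_mult_left[of b c] subunit_support[of b] assms
  by (metis meet_absorb(1,2) meet_assoc mult_closed top_closed unit_closed)

lemma mult_support: "a \<in> carrier Q \<Longrightarrow> a \<cdot> (a\<^sup>\<star> \<cdot> a \<sqinter> \<ee>) = a"
  using support_mult[of "a\<^sup>\<star>"] support[of "a\<^sup>\<star>"]
  by (metis meet_closed meet_right mult_closed star_closed star_mult star_star subunit_star unit_closed)

lemma support_mult': "a \<in> carrier Q \<Longrightarrow> (a \<cdot> a\<^sup>\<star> \<sqinter> \<ee>) \<cdot> a = a"
  using support_mult[of a] support[of a] by simp

text \<open>In the quantale of an etale groupoid these are the open local bisections. They are the
  elements of the cover axiom, with its join split into two inequalities.\<close>

definition partial_unit :: "'a \<Rightarrow> bool"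
  where "partial_unit s \<longleftrightarrow> s \<in> carrier Q \<and> s \<cdot> s\<^sup>\<star> \<sqsubseteq> \<ee> \<and> s\<^sup>\<star> \<cdot> s \<sqsubseteq> \<ee>"

lemma partial_unitD:
  assumes "partial_unit s"
  shows "s \<in> carrier Q" "s \<cdot> s\<^sup>\<star> \<sqsubseteq> \<ee>" "s\<^sup>\<star> \<cdot> s \<sqsubseteq> \<ee>"
  using assms by (auto simp: partial_unit_def)

lemma partial_unit_down:
  assumes "partial_unit s" "x \<sqsubseteq> s" "x \<in> carrier Q"
  shows "partial_unit x"
proof -
  note s = partial_unitD[OF assms(1)]
  have "x \<cdot> x\<^sup>\<star> \<sqsubseteq> s \<cdot> s\<^sup>\<star>" "x\<^sup>\<star> \<cdot> x \<sqsubseteq> s\<^sup>\<star> \<cdot> s" using assms s by (auto intro!: mult_mono star_mono)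
  then show ?thesis
    using assms s le_trans[of "x \<cdot> x\<^sup>\<star>" "s \<cdot> s\<^sup>\<star>" \<ee>] le_trans[of "x\<^sup>\<star> \<cdot> x" "s\<^sup>\<star> \<cdot> s" \<ee>] by (simp add: partial_unit_def)
qed

lemma partial_unit_star: "partial_unit s \<Longrightarrow> partial_unit (s\<^sup>\<star>)"
  by (auto simp: partial_unit_def star_star)

lemma sup_partial_units: "\<Squnion>{s. partial_unit s} = \<top>"
proof -
  have "{s. partial_unit s} = {s \<in> carrier Q. s \<cdot> s\<^sup>\<star> \<squnion> s\<^sup>\<star> \<cdot> s \<sqsubseteq> \<ee>}"
    by (auto simp: partial_unit_def join_le)
      (metis join_closed join_left join_right le_trans mult_closed star_closed unit_closed)+
  then show ?thesis using cover by simp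
qed

text \<open>Partial units are closed downwards, so meeting the cover with \<open>a\<close> stays
  among them.\<close>

lemma sup_partial_units_below:
  assumes a: "a \<in> carrier Q"
  shows "\<Squnion>{s. partial_unit s \<and> s \<sqsubseteq> a} = a"
proof -
  have P: "{s. partial_unit s} \<subseteq> carrier Q" by (auto simp: partial_unit_def)
  have "a = \<Squnion>((\<lambda>s. a \<sqinter> s) ` {s. partial_unit s})"
    using le_sup_meet[OF a P sup_partial_units] by simp
  also have "\<dots> \<sqsubseteq> \<Squnion>{s. partial_unit s \<and> s \<sqsubseteq> a}"
  proof (rule sup_mono)
    fix b assume "b \<in> (\<lambda>s. a \<sqinter> s) ` {s. partial_unit s}"
    then obtain s where s: "partial_unit s" "b = a \<sqinter> s" by auto
    then have "partial_unit b" "b \<sqsubseteq> a"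
      using a partial_unitD(1)[OF s(1)] partial_unit_down[OF s(1), of b] by (auto intro: meet_left meet_right)
    then show "\<exists>c\<in>{s. partial_unit s \<and> s \<sqsubseteq> a}. b \<sqsubseteq> c"
      using partial_unitD(1) by (intro bexI[of _ b]) auto
  qed (use a P in auto)
  finally have "a \<sqsubseteq> \<Squnion>{s. partial_unit s \<and> s \<sqsubseteq> a}" .
  moreover have "{s. partial_unit s \<and> s \<sqsubseteq> a} \<subseteq> carrier Q" using P by auto
  ultimately show ?thesis using a by (intro le_antisym sup_least) auto
qed

lemma mult_le_by_partial_units:
  assumes "a \<in> carrier Q" "b \<in> carrier Q" "c \<in> carrier Q"
    and "\<And>s. \<lbrakk>partial_unit s; s \<sqsubseteq> a\<rbrakk> \<Longrightarrow> s \<cdot> b \<sqsubseteq> c"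
  shows "a \<cdot> b \<sqsubseteq> c"
proof -
  let ?S = "{s. partial_unit s \<and> s \<sqsubseteq> a}"
  have S: "?S \<subseteq> carrier Q" by (auto simp: partial_unit_def)
  have "\<Squnion>?S \<cdot> b \<sqsubseteq> c"
    unfolding mult_sup_distrib(2)[OF assms(2) S] using assms S by (intro sup_least) auto
  then show ?thesis using sup_partial_units_below[OF assms(1)] by simp
qed

lemma mult_le_by_partial_units':
  assumes "a \<in> carrier Q" "b \<in> carrier Q" "c \<in> carrier Q"
    and "\<And>s. \<lbrakk>partial_unit s; s \<sqsubseteq> b\<rbrakk> \<Longrightarrow> a \<cdot> s \<sqsubseteq> c"
  shows "a \<cdot> b \<sqsubseteq> c"
proof -
  let ?S = "{s. partial_unit s \<and> s \<sqsubseteq> b}"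
  have S: "?S \<subseteq> carrier Q" by (auto simp: partial_unit_def)
  have "a \<cdot> \<Squnion>?S \<sqsubseteq> c"
    unfolding mult_sup_distrib(1)[OF assms(1) S] using assms S by (intro sup_least) auto
  then show ?thesis using sup_partial_units_below[OF assms(2)] by simp
qed

lemma partial_unit_cancel: "partial_unit s \<Longrightarrow> s \<cdot> (s\<^sup>\<star> \<cdot> s) = s"
proof (rule le_antisym)
  assume "partial_unit s"
  note s = partial_unitD[OF this]
  show "s \<cdot> (s\<^sup>\<star> \<cdot> s) \<sqsubseteq> s" using s by (intro mult_le_right) auto
  show "s \<sqsubseteq> s \<cdot> (s\<^sup>\<star> \<cdot> s)" using s le_mult_star by simp
qed (auto simp: partial_unit_def)

text \<open>Neither \<open>x\<close> nor \<open>y\<close> is assumed to be a partial unit. But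
  \<open>x = x y x\<close> is a join of products \<open>z = t w t'\<close> of partial units with
  \<open>t, t' \<le> x\<close> and \<open>w \<le> y\<close>. Such a \<open>z\<close> is below
  \<open>t\<close> and \<open>t'\<close>, hence itself a partial unit, and the computation gives
  \<open>z\<^sup>\<star> \<le> w\<close>.\<close>

lemma le_star_of_sections:
  assumes x: "x \<in> carrier Q" and y: "y \<in> carrier Q"
    and xy: "x \<cdot> y \<sqsubseteq> \<ee>" and yx: "y \<cdot> x \<sqsubseteq> \<ee>" and xyx: "x \<cdot> (y \<cdot> x) = x"
  shows "x \<sqsubseteq> y\<^sup>\<star>"
proof -
  have "t \<cdot> (w \<cdot> t') \<sqsubseteq> y\<^sup>\<star>"
    if t: "partial_unit t" "t \<sqsubseteq> x" and w: "partial_unit w" "w \<sqsubseteq> y" and t': "partial_unit t'" "t' \<sqsubseteq> x" for t w t'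
  proof -
    note c [simp] = partial_unitD(1)[OF t(1)] partial_unitD(1)[OF w(1)] partial_unitD(1)[OF t'(1)]
    let ?z = "t \<cdot> (w \<cdot> t')"
    have "w \<cdot> t' \<sqsubseteq> y \<cdot> x" "t \<cdot> w \<sqsubseteq> x \<cdot> y" using t w t' x y by (auto intro!: mult_mono)
    then have wt: "w \<cdot> t' \<sqsubseteq> \<ee>" and tw: "t \<cdot> w \<sqsubseteq> \<ee>"
      using xy yx x y le_trans[of "w \<cdot> t'" "y \<cdot> x" \<ee>] le_trans[of "t \<cdot> w" "x \<cdot> y" \<ee>] by auto
    have zt: "?z \<sqsubseteq> t" using wt by (simp add: mult_le_right)
    have zt': "?z \<sqsubseteq> t'" using mult_le_left[OF tw, of t'] by (simp add: mult_assoc)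
    have z: "partial_unit ?z" using partial_unit_down[OF t(1) zt] by simp
    note zc = partial_unitD[OF z]
    have zz: "?z\<^sup>\<star> \<cdot> (?z \<cdot> ?z\<^sup>\<star>) = ?z\<^sup>\<star>"
      using partial_unit_cancel[OF partial_unit_star[OF z]] zc(1) by (simp only: star_star)
    have "?z\<^sup>\<star> \<sqsubseteq> t'\<^sup>\<star>" using zt' zc by (intro star_mono) auto
    then have "t' \<cdot> ?z\<^sup>\<star> \<sqsubseteq> t' \<cdot> t'\<^sup>\<star>" using zc by (intro mult_mono) auto
    then have "t' \<cdot> ?z\<^sup>\<star> \<sqsubseteq> \<ee>" using partial_unitD[OF t'(1)] le_trans[of "t' \<cdot> ?z\<^sup>\<star>" "t' \<cdot> t'\<^sup>\<star>" \<ee>] zc by simp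
    \<comment> \<open>Because \<open>z\<^sup>\<star> z z\<^sup>\<star> = z\<^sup>\<star>\<close>,
      this reads \<open>t' z\<^sup>\<star> \<le> z z\<^sup>\<star>\<close>, which removes
      \<open>t'\<close> from the expansion of \<open>z z\<^sup>\<star>\<close>.\<close>
    then have "(t' \<cdot> ?z\<^sup>\<star>) \<cdot> (?z \<cdot> ?z\<^sup>\<star>) \<sqsubseteq> ?z \<cdot> ?z\<^sup>\<star>" using zc by (intro mult_le_left) auto
    then have a: "t' \<cdot> ?z\<^sup>\<star> \<sqsubseteq> ?z \<cdot> ?z\<^sup>\<star>" using zz zc by (subst (asm) mult_assoc) auto
    have "?z \<cdot> ?z\<^sup>\<star> = t \<cdot> (w \<cdot> (t' \<cdot> ?z\<^sup>\<star>))" using zc(1) by (simp add: mult_assoc)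
    also have "\<dots> \<sqsubseteq> t \<cdot> (w \<cdot> (?z \<cdot> ?z\<^sup>\<star>))" using zc(1)
      by (intro mult_mono[OF le_refl mult_mono[OF le_refl a]]) auto
    finally have b: "?z \<cdot> ?z\<^sup>\<star> \<sqsubseteq> t \<cdot> (w \<cdot> (?z \<cdot> ?z\<^sup>\<star>))" using zc by simp
    have "?z\<^sup>\<star> \<sqsubseteq> t\<^sup>\<star>" using zt zc by (intro star_mono) auto
    then have "?z\<^sup>\<star> \<cdot> t \<sqsubseteq> t\<^sup>\<star> \<cdot> t" using zc by (intro mult_mono) auto
    then have zte: "?z\<^sup>\<star> \<cdot> t \<sqsubseteq> \<ee>" using partial_unitD[OF t(1)] le_trans[of "?z\<^sup>\<star> \<cdot> t" "t\<^sup>\<star> \<cdot> t" \<ee>] zc by simp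
    have "?z\<^sup>\<star> \<cdot> (?z \<cdot> ?z\<^sup>\<star>) \<sqsubseteq> ?z\<^sup>\<star> \<cdot> (t \<cdot> (w \<cdot> (?z \<cdot> ?z\<^sup>\<star>)))"
      using zc(1) by (intro mult_mono[OF le_refl b]) auto
    then have "?z\<^sup>\<star> \<sqsubseteq> (?z\<^sup>\<star> \<cdot> t) \<cdot> (w \<cdot> (?z \<cdot> ?z\<^sup>\<star>))"
      unfolding zz using zc by (subst mult_assoc) auto
    also have "\<dots> \<sqsubseteq> w \<cdot> (?z \<cdot> ?z\<^sup>\<star>)" using zte zc by (intro mult_le_left) auto
    also have "\<dots> \<sqsubseteq> w" using zc by (intro mult_le_right) auto
    also have "\<dots> \<sqsubseteq> y" using w by simp
    finally show ?thesis using zc y by (simp add: star_le_iff)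
  qed
  \<comment> \<open>The partial units are now released one at a time by joins: \<open>t'\<close> to
    \<open>x\<close>, then \<open>w\<close> to \<open>y\<close>, and finally \<open>t\<close> to
    \<open>x\<close>.\<close>
  then have twx: "t \<cdot> (w \<cdot> x) \<sqsubseteq> y\<^sup>\<star>"
    if t: "partial_unit t" "t \<sqsubseteq> x" and w: "partial_unit w" "w \<sqsubseteq> y" for t w
    using that x y mult_le_by_partial_units'[of "t \<cdot> w" x "y\<^sup>\<star>"] by (simp add: mult_assoc partial_unitD(1))
  have "t \<cdot> (y \<cdot> x) \<sqsubseteq> y\<^sup>\<star>" if t: "partial_unit t" "t \<sqsubseteq> x" for t
  proof -
    have tc: "t \<in> carrier Q" using t partial_unitD by simp
    let ?S = "{s. partial_unit s \<and> s \<sqsubseteq> y}"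
    have S: "?S \<subseteq> carrier Q" by (auto simp: partial_unit_def)
    have "t \<cdot> (\<Squnion>?S \<cdot> x) \<sqsubseteq> y\<^sup>\<star>"
      using S x y tc t twx
      by (subst mult_sup_distrib(2)[OF x S], subst mult_sup_distrib(1)[OF tc]) (auto intro!: sup_least)
    then show ?thesis using sup_partial_units_below[OF y] by simp
  qed
  then have "x \<cdot> (y \<cdot> x) \<sqsubseteq> y\<^sup>\<star>"
    using x y by (rule_tac mult_le_by_partial_units) auto
  then show ?thesis using xyx by simp
qed

text \<open>Uniqueness of inverses from multiplicative data only. It will recognise the image of
  \<open>s\<^sup>\<star>\<close> under a map that is not yet known to preserve the
  involution.\<close>

lemma star_eq_of_sections:
  assumes "x \<in> carrier Q" "y \<in> carrier Q" "x \<cdot> y \<sqsubseteq> \<ee>" "y \<cdot> x \<sqsubseteq> \<ee>"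
    "x \<cdot> (y \<cdot> x) = x" "y \<cdot> (x \<cdot> y) = y"
  shows "y = x\<^sup>\<star>"
  using le_star_of_sections[of x y] le_star_of_sections[of y x] assms
  by (intro le_antisym) (auto simp: star_le_iff)

end

section \<open>Homomorphisms of inverse quantal frames\<close>

locale quantale_morphism = Q: inverse_quantal_frame Q + R: inverse_quantal_frame R
  for Q :: "'a quantale" (structure) and R :: "'a quantale" +
  fixes h :: "'a \<Rightarrow> 'a"
  assumes h: "quantale_hom Q R h"
begin

lemma h_cl [simp]: "a \<in> carrier Q \<Longrightarrow> h a \<in> carrier R"
  and h_sup: "A \<subseteq> carrier Q \<Longrightarrow> h (\<Squnion>A) = \<Squnion>\<^bsub>R\<^esub>(h ` A)"
  and h_mult: "\<lbrakk>a \<in> carrier Q; b \<in> carrier Q\<rbrakk> \<Longrightarrow> h (a \<cdot> b) = h a \<cdot>\<^bsub>R\<^esub> h b"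
  and h_star: "a \<in> carrier Q \<Longrightarrow> h (a\<^sup>\<star>) = (h a)\<^sup>\<star>\<^bsub>R\<^esub>"
  and h_unit [simp]: "h \<ee> = \<ee>\<^bsub>R\<^esub>"
  and h_ext: "h \<in> extensional (carrier Q)"
  using h by (auto simp: quantale_hom_def sup_preserving_def)

lemma h_mono: "\<lbrakk>a \<sqsubseteq> b; a \<in> carrier Q; b \<in> carrier Q\<rbrakk> \<Longrightarrow> h a \<sqsubseteq>\<^bsub>R\<^esub> h b"
  using h sup_preserving_mono[OF Q.frame_axioms R.frame_axioms] by (auto simp: quantale_hom_def)

lemma h_subunit: "\<lbrakk>a \<sqsubseteq> \<ee>; a \<in> carrier Q\<rbrakk> \<Longrightarrow> h a \<sqsubseteq>\<^bsub>R\<^esub> \<ee>\<^bsub>R\<^esub>"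
  using h_mono[of a "\<ee>"] by simp

end

lemma quantale_hom_id:
  assumes "inverse_quantal_frame Q"
  shows "quantale_hom Q Q (\<lambda>a\<in>carrier Q. a)"
proof -
  interpret inverse_quantal_frame Q by fact
  have "restrict (\<lambda>a. a) (carrier Q) ` A = A" if "A \<subseteq> carrier Q" for A
    using that by (auto simp: image_iff subset_iff)
  then show ?thesis by (auto simp: quantale_hom_def sup_preserving_def)
qed

lemma quantale_hom_comp:
  assumes "inverse_quantal_frame Q" "inverse_quantal_frame R" "inverse_quantal_frame S"
    and h: "quantale_hom Q R h" and k: "quantale_hom R S k"
  shows "quantale_hom Q S (compose (carrier Q) k h)"
proof -
  interpret h: quantale_morphism Q R h using assms by (simp add: quantale_morphism_def quantale_morphism_axioms_def)
  interpret k: quantale_morphism R S k using assms by (simp add: quantale_morphism_def quantale_morphism_axioms_def)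
  have "compose (carrier Q) k h (\<Squnion>\<^bsub>Q\<^esub>A) = \<Squnion>\<^bsub>S\<^esub>(compose (carrier Q) k h ` A)" if A: "A \<subseteq> carrier Q" for A
  proof -
    have "compose (carrier Q) k h ` A = k ` h ` A"
      using A by (auto simp: compose_def image_iff subset_iff)
    moreover have "h ` A \<subseteq> carrier R" using A by auto
    ultimately show ?thesis using A by (simp add: compose_eq h.h_sup k.h_sup)
  qed
  then show ?thesis
    by (auto simp: quantale_hom_def sup_preserving_def compose_eq h.h_mult k.h_mult h.h_star k.h_star)
qed

text \<open>\<open>e\<close> is the image \<open>u\<^sub>!(1)\<close> of the section \<open>u\<close>, and \<open>x \<mapsto> e \<otimes> x\<close> is left adjoint to the inverse
  image of \<open>\<langle>u \<circ> g, 1\<rangle>\<close>.\<close>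

locale unit_section = cospan X Y B f g
  for X :: "'x gorder" and Y :: "'y gorder" and B :: "'b gorder"
    and f :: "('x, 'b) lmap" and g :: "('y, 'b) lmap" +
  fixes u :: "('b, 'x) lmap" and e :: 'x
  assumes u: "locale_map B X u" and fu: "f \<circ>\<^sub>L u = lid B"
    and e [simp]: "e \<in> carrier X" and ue: "invim u e = \<top>\<^bsub>B\<^esub>"
    and e_meet: "x \<in> carrier X \<Longrightarrow> e \<sqinter>\<^bsub>X\<^esub> invim f (invim u x) = e \<sqinter>\<^bsub>X\<^esub> x"
begin

lemma unit_cone: "cone X Y B f g Y (u \<circ>\<^sub>L g) (lid Y)"
proof (rule coneI)
  show "f \<circ>\<^sub>L (u \<circ>\<^sub>L g) = g \<circ>\<^sub>L lid Y"
    using fu by (simp add: lcomp_assoc[symmetric, OF f] locale_mapD[OF u] lid_lcomp[OF g] lcomp_lid[OF g])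
qed (use f g u Y.frame_axioms in blast)+

lemma le_unit_pair_iff:
  assumes V: "I V" and y: "y \<in> carrier Y"
  shows "y \<sqsubseteq>\<^bsub>Y\<^esub> invim (lpair f g (u \<circ>\<^sub>L g) (lid Y)) V \<longleftrightarrow> (e, y) \<in> V"
proof
  interpret c: cone X Y B f g Y "u \<circ>\<^sub>L g" "lid Y" by (rule unit_cone)
  have ug: "invim (u \<circ>\<^sub>L g) x = invim g (invim u x)" if "x \<in> carrier X" for x
    using that by (simp add: invim_lcomp'[OF u])
  have ux: "x \<in> carrier X \<Longrightarrow> invim u x \<in> carrier B" for x using invim_closed[OF u] .
  {
    assume l: "y \<sqsubseteq>\<^bsub>Y\<^esub> invim (lpair f g (u \<circ>\<^sub>L g) (lid Y)) V"
    let ?S = "(\<lambda>(x, y). c.m x y) ` V"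
    have S: "?S \<subseteq> carrier Y" by (rule c.m_image[OF V])
    have "(e, \<Squnion>\<^bsub>Y\<^esub>?S) \<in> V"
    proof (rule I_sup2[OF V S e])
      fix z assume "z \<in> ?S"
      then obtain x w where xw: "(x, w) \<in> V" "z = c.m x w" by auto
      have c: "x \<in> carrier X" "w \<in> carrier Y" using I_sub[OF V xw(1)] by auto
      have "(x \<sqinter>\<^bsub>X\<^esub> e, w) \<in> V" using I_down[OF V xw(1)] c by (simp add: X.meet_left)
      \<comment> \<open>On the image of the section, \<open>x\<close> agrees with
        \<open>invim f (invim u x)\<close>; in this form the balance condition can carry it over to
        the second factor.\<close>
      then have "(e \<sqinter>\<^bsub>X\<^esub> invim f (invim u x), w) \<in> V" using e_meet c by (simp add: meet_comm[of X])
      then show "(e, z) \<in> V" using I_bal[OF V e c(2) ux[OF c(1)]] c by (simp add: xw c.m_def ug)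
    qed
    then show "(e, y) \<in> V"
      using I_down[OF V _ e y] l S by (simp add: c.invim_lpair[OF V] c.p_def)
  next
    assume "(e, y) \<in> V"
    from c.le_invim_lpair[OF V this] show "y \<sqsubseteq>\<^bsub>Y\<^esub> invim (lpair f g (u \<circ>\<^sub>L g) (lid Y)) V"
      using y by (simp add: ug ue invim_top[OF g])
  }
qed

text \<open>By \<open>le_unit_pair_iff\<close> the map \<open>\<mu> e\<close> is left adjoint to the
  inverse image of the composite, so one is the identity exactly when the other is.\<close>

lemma unit_law_iff:
  assumes "repr_map X Y B f g Y t \<mu>"
  shows "t \<circ>\<^sub>L lpair f g (u \<circ>\<^sub>L g) (lid Y) = lid Y \<longleftrightarrow> (\<forall>y\<in>carrier Y. \<mu> e y = y)"
proof -
  interpret repr_map X Y B f g Y t \<mu> by fact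
  interpret c: cone X Y B f g Y "u \<circ>\<^sub>L g" "lid Y" by (rule unit_cone)
  have map: "locale_map Y Y (t \<circ>\<^sub>L lpair f g (u \<circ>\<^sub>L g) (lid Y))" using t c.lpair_map by blast
  have k: "y \<sqsubseteq>\<^bsub>Y\<^esub> invim (t \<circ>\<^sub>L lpair f g (u \<circ>\<^sub>L g) (lid Y)) z \<longleftrightarrow> \<mu> e y \<sqsubseteq>\<^bsub>Y\<^esub> z"
    if "y \<in> carrier Y" "z \<in> carrier Y" for y z
    using that by (simp add: invim_lcomp'[OF t] le_unit_pair_iff[OF t_I] rep)
  show ?thesis
  proof
    assume "t \<circ>\<^sub>L lpair f g (u \<circ>\<^sub>L g) (lid Y) = lid Y"
    then show "\<forall>y\<in>carrier Y. \<mu> e y = y"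
      using k by (intro ballI Y.eq_by_upper) auto
  next
    assume m: "\<forall>y\<in>carrier Y. \<mu> e y = y"
    show "t \<circ>\<^sub>L lpair f g (u \<circ>\<^sub>L g) (lid Y) = lid Y"
    proof (rule locale_map_eqI[OF map lid_map[OF Y.frame_axioms]])
      fix z assume z: "z \<in> carrier Y"
      let ?w = "invim (t \<circ>\<^sub>L lpair f g (u \<circ>\<^sub>L g) (lid Y)) z"
      have w: "?w \<in> carrier Y" using invim_closed[OF map z] .
      show "?w = invim (lid Y) z"
        using k[OF w z] k[OF z z] m w z by (simp add: Y.le_antisym)
    qed
  qed
qed

end

section \<open>The groupoid of an inverse quantal frame\<close>

text \<open>The locales of a groupoid have the bare type \<open>gorder\<close>, while a quantale is
  an extended record; this strips the extension.\<close>

definition locale_of :: "'a quantale \<Rightarrow> 'a gorder"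
  where "locale_of Q = \<lparr>carrier = carrier Q, eq = eq Q, le = le Q\<rparr>"

lemma locale_of_simps [simp]:
  "carrier (locale_of Q) = carrier Q" "le (locale_of Q) = le Q" "eq (locale_of Q) = eq Q"
  by (simp_all add: locale_of_def)

lemma locale_of_ops [simp]:
  "Lattice.sup (locale_of Q) = Lattice.sup Q" "meet (locale_of Q) = meet Q" "top (locale_of Q) = top Q"
  by (rule lattice_ops_cong; simp)+

lemma frame_locale_of: "frame Q \<Longrightarrow> frame (locale_of Q)" for Q :: "'a quantale"
  by (rule frame_cong) simp_all

text \<open>The map \<open>\<epsilon>\<close> is arbitrary here, so that the same formula with
  \<open>h (\<epsilon> b)\<close> in place of \<open>\<epsilon> b\<close> gives the anchor
  \<open>p\<close> of the action defined by a homomorphism \<open>h\<close>.\<close>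

definition q_dom :: "'a gorder \<Rightarrow> ('a \<Rightarrow> 'a) \<Rightarrow> 'a quantale \<Rightarrow> ('a, 'a) lmap"
  where "q_dom B \<epsilon> Q = \<lparr>lsrc = locale_of Q, ltgt = B, invim = (\<lambda>b\<in>carrier B. \<epsilon> b \<cdot>\<^bsub>Q\<^esub> \<top>\<^bsub>Q\<^esub>)\<rparr>"

definition q_rng :: "'a gorder \<Rightarrow> ('a \<Rightarrow> 'a) \<Rightarrow> 'a quantale \<Rightarrow> ('a, 'a) lmap"
  where "q_rng B \<epsilon> Q = \<lparr>lsrc = locale_of Q, ltgt = B, invim = (\<lambda>b\<in>carrier B. \<top>\<^bsub>Q\<^esub> \<cdot>\<^bsub>Q\<^esub> \<epsilon> b)\<rparr>"

definition q_unit :: "'a gorder \<Rightarrow> ('a \<Rightarrow> 'a) \<Rightarrow> 'a quantale \<Rightarrow> ('a, 'a) lmap"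
  where "q_unit B \<epsilon> Q = \<lparr>lsrc = B, ltgt = locale_of Q,
    invim = (\<lambda>a\<in>carrier Q. inv_into (carrier B) \<epsilon> (a \<sqinter>\<^bsub>Q\<^esub> \<ee>\<^bsub>Q\<^esub>))\<rparr>"

definition q_inv :: "'a quantale \<Rightarrow> ('a, 'a) lmap"
  where "q_inv Q = \<lparr>lsrc = locale_of Q, ltgt = locale_of Q, invim = (\<lambda>a\<in>carrier Q. a\<^sup>\<star>\<^bsub>Q\<^esub>)\<rparr>"

text \<open>The inverse image is right adjoint to
  \<open>g \<otimes> x \<mapsto> h g \<cdot> x\<close>. Multiplication of the groupoid is the case
  where \<open>h\<close> is the identity, so its laws specialise those of actions.\<close>

definition q_act :: "'a gorder \<Rightarrow> ('a \<Rightarrow> 'a) \<Rightarrow> 'a quantale \<Rightarrow> 'a quantale \<Rightarrow> ('a \<Rightarrow> 'a) \<Rightarrow> (('a \<times> 'a) set, 'a) lmap"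
  where "q_act B \<epsilon> Q R h = \<lparr>lsrc = lpullback (q_rng B \<epsilon> Q) (q_dom B (\<lambda>b. h (\<epsilon> b)) R), ltgt = locale_of R,
    invim = (\<lambda>y\<in>carrier R. {(g, x). g \<in> carrier Q \<and> x \<in> carrier R \<and> h g \<cdot>\<^bsub>R\<^esub> x \<sqsubseteq>\<^bsub>R\<^esub> y})\<rparr>"

definition quantale_groupoid :: "'a gorder \<Rightarrow> ('a \<Rightarrow> 'a) \<Rightarrow> 'a quantale \<Rightarrow> 'a groupoid"
  where "quantale_groupoid B \<epsilon> Q = \<lparr>objs = B, arrs = locale_of Q, gdom = q_dom B \<epsilon> Q, grng = q_rng B \<epsilon> Q,
    gunit = q_unit B \<epsilon> Q, ginv = q_inv Q, gmult = q_act B \<epsilon> Q Q (\<lambda>a\<in>carrier Q. a)\<rparr>"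

text \<open>The locale of objects is any frame \<open>B\<close> isomorphic to the subunits of \<open>Q\<close>, not only the frame of
  subunits itself. In this form every etale groupoid is equal, not just isomorphic, to some
  \<open>quantale_groupoid\<close>.\<close>

locale base_iso = Q: inverse_quantal_frame Q + B: frame B
  for Q :: "'a quantale" (structure) and B :: "'a gorder" +
  fixes \<epsilon> :: "'a \<Rightarrow> 'a"
  assumes eps_cl [simp]: "b \<in> carrier B \<Longrightarrow> \<epsilon> b \<in> carrier Q"
    and eps_le [simp]: "b \<in> carrier B \<Longrightarrow> \<epsilon> b \<sqsubseteq> \<ee>"
    and eps_iff: "\<lbrakk>b \<in> carrier B; c \<in> carrier B\<rbrakk> \<Longrightarrow> \<epsilon> b \<sqsubseteq> \<epsilon> c \<longleftrightarrow> b \<sqsubseteq>\<^bsub>B\<^esub> c"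
    and eps_surj: "\<lbrakk>a \<in> carrier Q; a \<sqsubseteq> \<ee>\<rbrakk> \<Longrightarrow> \<exists>b\<in>carrier B. \<epsilon> b = a"
begin

lemma LQ: "frame (locale_of Q)" by (rule frame_locale_of[OF Q.frame_axioms])

abbreviation del :: "'a \<Rightarrow> 'a" where "del \<equiv> inv_into (carrier B) \<epsilon>"

lemma eps_inj: "inj_on \<epsilon> (carrier B)"
  by (rule inj_onI) (metis B.le_antisym Q.le_refl eps_cl eps_iff)

lemma eps_eqD: "\<lbrakk>\<epsilon> b = \<epsilon> c; b \<in> carrier B; c \<in> carrier B\<rbrakk> \<Longrightarrow> b = c"
  using eps_inj by (rule inj_onD)

lemma del_eps [simp]: "b \<in> carrier B \<Longrightarrow> del (\<epsilon> b) = b"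
  by (rule inv_into_f_f[OF eps_inj])

lemma del_cl [simp]: "\<lbrakk>a \<in> carrier Q; a \<sqsubseteq> \<ee>\<rbrakk> \<Longrightarrow> del a \<in> carrier B"
  by (metis eps_surj image_eqI inv_into_into)

lemma eps_del [simp]: "\<lbrakk>a \<in> carrier Q; a \<sqsubseteq> \<ee>\<rbrakk> \<Longrightarrow> \<epsilon> (del a) = a"
  by (metis del_eps eps_surj)

lemma eps_top [simp]: "\<epsilon> \<top>\<^bsub>B\<^esub> = \<ee>"
proof (rule Q.le_antisym)
  obtain b where b: "b \<in> carrier B" "\<epsilon> b = \<ee>" using eps_surj[of "\<ee>"] by auto
  then show "\<ee> \<sqsubseteq> \<epsilon> \<top>\<^bsub>B\<^esub>" using eps_iff[of b "\<top>\<^bsub>B\<^esub>"] by simp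
qed simp_all

lemma eps_sup:
  assumes S: "S \<subseteq> carrier B"
  shows "\<epsilon> (\<Squnion>\<^bsub>B\<^esub>S) = \<Squnion>(\<epsilon> ` S)"
proof (rule Q.le_antisym)
  have S': "\<epsilon> ` S \<subseteq> carrier Q" using S by auto
  have le: "\<Squnion>(\<epsilon> ` S) \<sqsubseteq> \<ee>" using S S' by (intro Q.sup_least) auto
  obtain b where b: "b \<in> carrier B" "\<epsilon> b = \<Squnion>(\<epsilon> ` S)" using eps_surj[OF _ le] S' by auto
  have "\<Squnion>\<^bsub>B\<^esub>S \<sqsubseteq>\<^bsub>B\<^esub> b"
  proof (rule B.sup_least[OF S b(1)])
    fix c assume c: "c \<in> S"
    then have "\<epsilon> c \<sqsubseteq> \<epsilon> b" unfolding b(2) using S' by (intro Q.sup_upper) auto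
    then show "c \<sqsubseteq>\<^bsub>B\<^esub> b" using eps_iff b(1) c S by auto
  qed
  then show "\<epsilon> (\<Squnion>\<^bsub>B\<^esub>S) \<sqsubseteq> \<Squnion>(\<epsilon> ` S)" using eps_iff[of "\<Squnion>\<^bsub>B\<^esub>S" b] b S by simp
  show "\<Squnion>(\<epsilon> ` S) \<sqsubseteq> \<epsilon> (\<Squnion>\<^bsub>B\<^esub>S)"
    using S S' B.sup_upper[OF S] by (intro Q.sup_least) (auto simp: eps_iff subset_iff)
qed (use S in \<open>auto intro!: Q.sup_closed\<close>)

lemma eps_meet:
  assumes b: "b \<in> carrier B" and c: "c \<in> carrier B"
  shows "\<epsilon> (b \<sqinter>\<^bsub>B\<^esub> c) = \<epsilon> b \<cdot> \<epsilon> c"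
proof -
  have m: "\<epsilon> b \<cdot> \<epsilon> c = \<epsilon> b \<sqinter> \<epsilon> c" using b c by (intro Q.subunit_mult_subunit) auto
  have le: "\<epsilon> b \<sqinter> \<epsilon> c \<sqsubseteq> \<ee>"
    using Q.le_trans[OF Q.meet_left[of "\<epsilon> b" "\<epsilon> c"] eps_le[OF b]] b c by simp
  obtain d where d: "d \<in> carrier B" "\<epsilon> d = \<epsilon> b \<sqinter> \<epsilon> c" using eps_surj[OF _ le] b c by auto
  have "d \<sqsubseteq>\<^bsub>B\<^esub> b" "d \<sqsubseteq>\<^bsub>B\<^esub> c" using b c d eps_iff[of d b] eps_iff[of d c] by (auto intro: Q.meet_left Q.meet_right)
  then have "\<epsilon> d \<sqsubseteq> \<epsilon> (b \<sqinter>\<^bsub>B\<^esub> c)" using b c d eps_iff[of d "b \<sqinter>\<^bsub>B\<^esub> c"] B.meet_le by simp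
  moreover have "\<epsilon> (b \<sqinter>\<^bsub>B\<^esub> c) \<sqsubseteq> \<epsilon> d" unfolding d(2)
    using b c eps_iff by (intro Q.meet_le) (auto intro: B.meet_left B.meet_right)
  ultimately show ?thesis using b c d m by (metis B.meet_closed Q.le_antisym eps_cl)
qed

lemma rng_map: "locale_map (locale_of Q) B (q_rng B \<epsilon> Q)"
  unfolding q_rng_def
proof (rule locale_map_restrictI[OF LQ B.frame_axioms], simp_all)
  fix A assume A: "A \<subseteq> carrier B"
  then have "\<epsilon> ` A \<subseteq> carrier Q" by auto
  then show "\<top> \<cdot> \<epsilon> (\<Squnion>\<^bsub>B\<^esub>A) = \<Squnion>((\<lambda>b. \<top> \<cdot> \<epsilon> b) ` A)"
    by (simp add: eps_sup[OF A] Q.mult_sup_distrib image_image)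
next
  fix a b assume "a \<in> carrier B" "b \<in> carrier B"
  then show "\<top> \<cdot> \<epsilon> (a \<sqinter>\<^bsub>B\<^esub> b) = \<top> \<cdot> \<epsilon> a \<sqinter> \<top> \<cdot> \<epsilon> b"
    using Q.subunit_mult_right[of "\<epsilon> b" "\<top> \<cdot> \<epsilon> a"]
    by (simp add: eps_meet Q.mult_assoc meet_comm[of Q])
qed (simp add: Q.mult_unit)

text \<open>Equations in \<open>B\<close> are checked after applying the injective
  \<open>\<epsilon>\<close>, which turns joins into joins of \<open>Q\<close> and meets into
  products of subunits.\<close>

lemma unit_map: "locale_map B (locale_of Q) (q_unit B \<epsilon> Q)"
proof -
  have le: "a \<in> carrier Q \<Longrightarrow> a \<sqinter> \<ee> \<sqsubseteq> \<ee>" for a by (simp add: Q.meet_right)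
  have "locale_map B (locale_of Q) \<lparr>lsrc = B, ltgt = locale_of Q,
    invim = restrict (\<lambda>a. del (a \<sqinter> \<ee>)) (carrier (locale_of Q))\<rparr>"
  proof (rule locale_map_restrictI[OF B.frame_axioms LQ]; simp)
    show "\<And>y. y \<in> carrier Q \<Longrightarrow> del (y \<sqinter> \<ee>) \<in> carrier B" by (simp add: le)
  next
    fix A assume A: "A \<subseteq> carrier Q"
    let ?S = "(\<lambda>a. del (a \<sqinter> \<ee>)) ` A"
    have S: "?S \<subseteq> carrier B" using A le by auto
    have "\<epsilon> ` ?S = (\<lambda>a. \<ee> \<sqinter> a) ` A"
      unfolding image_image using A le by (intro image_cong) (auto simp: meet_comm[of Q])
    then have "\<epsilon> (\<Squnion>\<^bsub>B\<^esub>?S) = \<Squnion>A \<sqinter> \<ee>"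
      using eps_sup[OF S] Q.meet_sup_distrib[of "\<ee>" A] A by (simp add: meet_comm[of Q])
    then show "del (\<Squnion>A \<sqinter> \<ee>) = \<Squnion>\<^bsub>B\<^esub>?S" using S by (metis B.sup_closed del_eps)
  next
    have "\<top> \<sqinter> \<ee> = \<epsilon> \<top>\<^bsub>B\<^esub>" by simp
    then show "del \<ee> = \<top>\<^bsub>B\<^esub>" by (metis B.top_closed del_eps eps_top)
  next
    fix a b assume ab: "a \<in> carrier Q" "b \<in> carrier Q"
    have "\<epsilon> (del (a \<sqinter> \<ee>) \<sqinter>\<^bsub>B\<^esub> del (b \<sqinter> \<ee>)) = (a \<sqinter> \<ee>) \<sqinter> (b \<sqinter> \<ee>)"
      using ab le by (simp add: eps_meet Q.subunit_mult_subunit)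
    also have "\<dots> = a \<sqinter> b \<sqinter> \<ee>"
      using ab by (simp add: Q.meet_assoc Q.meet_left_commute[of "\<ee>" b])
    finally show "del (a \<sqinter> b \<sqinter> \<ee>) = del (a \<sqinter> \<ee>) \<sqinter>\<^bsub>B\<^esub> del (b \<sqinter> \<ee>)"
      using ab le by (metis B.meet_closed Q.meet_closed Q.unit_closed del_cl del_eps)
  qed
  then show ?thesis by (simp add: q_unit_def)
qed

lemma inv_map: "locale_map (locale_of Q) (locale_of Q) (q_inv Q)"
proof -
  have "locale_map (locale_of Q) (locale_of Q) \<lparr>lsrc = locale_of Q, ltgt = locale_of Q,
    invim = restrict (\<lambda>a. a\<^sup>\<star>) (carrier (locale_of Q))\<rparr>"
    by (rule locale_map_restrictI[OF LQ LQ])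
      (simp_all add: Q.star_meet sup_preserving_sup[OF Q.star_sup])
  then show ?thesis by (simp add: q_inv_def)
qed

lemma invim_q [simp]:
  "b \<in> carrier B \<Longrightarrow> invim (q_dom B \<epsilon> Q) b = \<epsilon> b \<cdot> \<top>"
  "b \<in> carrier B \<Longrightarrow> invim (q_rng B \<epsilon> Q) b = \<top> \<cdot> \<epsilon> b"
  "a \<in> carrier Q \<Longrightarrow> invim (q_unit B \<epsilon> Q) a = del (a \<sqinter> \<ee>)"
  "a \<in> carrier Q \<Longrightarrow> invim (q_inv Q) a = a\<^sup>\<star>"
  by (simp_all add: q_dom_def q_rng_def q_unit_def q_inv_def)

lemma rng_unit: "q_rng B \<epsilon> Q \<circ>\<^sub>L q_unit B \<epsilon> Q = lid B"
proof (rule locale_map_eqI)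
  show "locale_map B B (q_rng B \<epsilon> Q \<circ>\<^sub>L q_unit B \<epsilon> Q)" using rng_map unit_map by blast
  show "locale_map B B (lid B)" using B.frame_axioms by blast
  fix b assume b: "b \<in> carrier B"
  then show "invim (q_rng B \<epsilon> Q \<circ>\<^sub>L q_unit B \<epsilon> Q) b = invim (lid B) b"
    using Q.subunit_mult_right[of "\<epsilon> b" "\<ee>"] by (simp add: invim_lcomp'[OF rng_map] Q.unit_mult)
qed

lemma unit_section_rng:
  assumes "locale_map Y B g"
  shows "unit_section (locale_of Q) Y B (q_rng B \<epsilon> Q) g (q_unit B \<epsilon> Q) \<ee>"
proof (unfold_locales; (fact rng_map unit_map rng_unit assms)?)
  show "invim (q_unit B \<epsilon> Q) \<ee> = \<top>\<^bsub>B\<^esub>" using del_eps[of "\<top>\<^bsub>B\<^esub>"] by simp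
  fix x assume "x \<in> carrier (locale_of Q)"
  then have x: "x \<in> carrier Q" "x \<sqinter> \<ee> \<sqsubseteq> \<ee>" by (auto simp: Q.meet_right)
  then show "\<ee> \<sqinter>\<^bsub>locale_of Q\<^esub> invim (q_rng B \<epsilon> Q) (invim (q_unit B \<epsilon> Q) x) = \<ee> \<sqinter>\<^bsub>locale_of Q\<^esub> x"
    using Q.subunit_mult_right[of "x \<sqinter> \<ee>" "\<ee>"] by (simp add: Q.unit_mult meet_comm[of Q])
qed simp

end

section \<open>The action defined by a homomorphism\<close>

locale hom_action = base_iso Q B \<epsilon> + quantale_morphism Q R h
  for Q :: "'a quantale" (structure) and B \<epsilon> and R :: "'a quantale" and h
begin

abbreviation "r \<equiv> q_rng B \<epsilon> Q"
abbreviation "p \<equiv> q_dom B (\<lambda>b. h (\<epsilon> b)) R"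
abbreviation "act \<equiv> q_act B \<epsilon> Q R h"

lemma LR: "frame (locale_of R)" by (rule frame_locale_of[OF R.frame_axioms])

lemma h_eps_le [simp]: "b \<in> carrier B \<Longrightarrow> h (\<epsilon> b) \<sqsubseteq>\<^bsub>R\<^esub> \<ee>\<^bsub>R\<^esub>" by (simp add: h_subunit)

lemma p_map: "locale_map (locale_of R) B p"
  unfolding q_dom_def
proof (rule locale_map_restrictI[OF LR B.frame_axioms], simp_all)
  fix A assume A: "A \<subseteq> carrier B"
  then have "\<epsilon> ` A \<subseteq> carrier Q" "h ` \<epsilon> ` A \<subseteq> carrier R" by auto
  then show "h (\<epsilon> (\<Squnion>\<^bsub>B\<^esub>A)) \<cdot>\<^bsub>R\<^esub> \<top>\<^bsub>R\<^esub> = \<Squnion>\<^bsub>R\<^esub>((\<lambda>b. h (\<epsilon> b) \<cdot>\<^bsub>R\<^esub> \<top>\<^bsub>R\<^esub>) ` A)"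
    by (simp add: eps_sup[OF A] h_sup R.mult_sup_distrib image_image)
next
  fix a b assume "a \<in> carrier B" "b \<in> carrier B"
  then show "h (\<epsilon> (a \<sqinter>\<^bsub>B\<^esub> b)) \<cdot>\<^bsub>R\<^esub> \<top>\<^bsub>R\<^esub> = h (\<epsilon> a) \<cdot>\<^bsub>R\<^esub> \<top>\<^bsub>R\<^esub> \<sqinter>\<^bsub>R\<^esub> h (\<epsilon> b) \<cdot>\<^bsub>R\<^esub> \<top>\<^bsub>R\<^esub>"
    using R.subunit_mult_left[of "h (\<epsilon> a)" "h (\<epsilon> b) \<cdot>\<^bsub>R\<^esub> \<top>\<^bsub>R\<^esub>"]
    by (simp add: eps_meet h_mult R.mult_assoc)
qed (simp add: R.unit_mult)

sublocale ap: cospan "locale_of Q" "locale_of R" B r p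
  using rng_map p_map by unfold_locales

lemma invim_p [simp]: "b \<in> carrier B \<Longrightarrow> invim p b = h (\<epsilon> b) \<cdot>\<^bsub>R\<^esub> \<top>\<^bsub>R\<^esub>"
  by (simp add: q_dom_def)

text \<open>The balance condition over a subunit, with restriction rewritten as multiplication on
  both sides.\<close>

lemma slide:
  assumes "ap.I W" "g \<in> carrier Q" "x \<in> carrier R" "c \<in> carrier Q" "c \<sqsubseteq> \<ee>"
  shows "(g \<cdot> c, x) \<in> W \<longleftrightarrow> (g, h c \<cdot>\<^bsub>R\<^esub> x) \<in> W"
  using ap.I_bal[OF assms(1), of g x "del c"] assms Q.subunit_mult_right[of c g] R.subunit_mult_left[of "h c" x]
  by (simp add: h_subunit meet_comm[of Q])

lemma slice: 
  assumes y: "y \<in> carrier R"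
  shows "ap.I {(g, x). g \<in> carrier Q \<and> x \<in> carrier R \<and> h g \<cdot>\<^bsub>R\<^esub> x \<sqsubseteq>\<^bsub>R\<^esub> y}" (is "ap.I ?U")
proof (rule ap.II, goal_cases)
  case 1 show ?case by auto
next
  case (2 g g' x x')
  then have c: "g \<in> carrier Q" "g' \<in> carrier Q" "x \<in> carrier R" "x' \<in> carrier R" by auto
  then have "h g' \<cdot>\<^bsub>R\<^esub> x' \<sqsubseteq>\<^bsub>R\<^esub> h g \<cdot>\<^bsub>R\<^esub> x" using 2 by (intro R.mult_mono h_mono) auto
  then show ?case using 2 c y R.le_trans[of "h g' \<cdot>\<^bsub>R\<^esub> x'" "h g \<cdot>\<^bsub>R\<^esub> x" y] by auto
next
  case (3 S x)
  then have S: "S \<subseteq> carrier Q" "x \<in> carrier R" by auto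
  then have "h ` S \<subseteq> carrier R" by auto
  then have "h (\<Squnion>S) \<cdot>\<^bsub>R\<^esub> x \<sqsubseteq>\<^bsub>R\<^esub> y"
    using S 3 y by (simp add: h_sup R.mult_sup_distrib(2)) (rule R.sup_least, auto)
  then show ?case using S by simp
next
  case (4 S g)
  then have S: "S \<subseteq> carrier R" "g \<in> carrier Q" by auto
  then have "h g \<cdot>\<^bsub>R\<^esub> \<Squnion>\<^bsub>R\<^esub>S \<sqsubseteq>\<^bsub>R\<^esub> y"
    using 4 y by (simp add: R.mult_sup_distrib(1)) (rule R.sup_least, auto)
  then show ?case using S by simp
next
  case (5 g x b)
  then have "h (g \<sqinter> \<top> \<cdot> \<epsilon> b) \<cdot>\<^bsub>R\<^esub> x = h g \<cdot>\<^bsub>R\<^esub> (h (\<epsilon> b) \<cdot>\<^bsub>R\<^esub> \<top>\<^bsub>R\<^esub> \<sqinter>\<^bsub>R\<^esub> x)"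
    using Q.subunit_mult_right[of "\<epsilon> b" g] R.subunit_mult_left[of "h (\<epsilon> b)" x]
    by (simp add: meet_comm[of Q] h_mult R.mult_assoc)
  then show ?case using 5 by simp
qed

lemma invim_act: "y \<in> carrier R \<Longrightarrow>
    invim act y = {(g, x). g \<in> carrier Q \<and> x \<in> carrier R \<and> h g \<cdot>\<^bsub>R\<^esub> x \<sqsubseteq>\<^bsub>R\<^esub> y}"
  by (simp add: q_act_def)

text \<open>Since \<open>s = s (s\<^sup>\<star> s)\<close>, sliding the subunit across lets
  \<open>x\<close> be replaced by \<open>h (s\<^sup>\<star> s) x\<close>, the part of
  \<open>x\<close> on which \<open>h s\<close> is invertible; the join over all
  \<open>s \<le> g\<close> then gives \<open>(g, x)\<close>.\<close>

lemma by_partial_units: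
  assumes W: "ap.I W" and g: "g \<in> carrier Q" and x: "x \<in> carrier R"
    and s: "\<And>s. \<lbrakk>Q.partial_unit s; s \<sqsubseteq> g\<rbrakk> \<Longrightarrow> (s, h (s\<^sup>\<star> \<cdot> s) \<cdot>\<^bsub>R\<^esub> x) \<in> W"
  shows "(g, x) \<in> W"
proof -
  let ?S = "{s. Q.partial_unit s \<and> s \<sqsubseteq> g}"
  have "(\<Squnion>\<^bsub>locale_of Q\<^esub>?S, x) \<in> W"
  proof (rule ap.I_sup1[OF W])
    fix s assume "s \<in> ?S"
    then have s': "Q.partial_unit s" "s \<sqsubseteq> g" by auto
    note c = Q.partial_unitD[OF s'(1)]
    show "(s, x) \<in> W"
      using s[OF s'] slide[OF W, of s x "s\<^sup>\<star> \<cdot> s"] c x Q.partial_unit_cancel[OF s'(1)] by simp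
  qed (use x in \<open>auto simp: Q.partial_unitD\<close>)
  then show ?thesis using Q.sup_partial_units_below[OF g] by simp
qed

text \<open>The difficulty is preservation of joins: \<open>h g x\<close> below a join of elements
  of \<open>A\<close> must put \<open>(g, x)\<close> into the ideal generated by the slices at those
  elements. By \<open>by_partial_units\<close> only a partial unit \<open>s\<close> and
  \<open>h (s\<^sup>\<star> s) x\<close> have to be treated, where applying
  \<open>h (s\<^sup>\<star>)\<close> makes the inequality one about \<open>x\<close>.\<close>

lemma act_map: "locale_map ap.P (locale_of R) act"
proof -
  let ?f = "\<lambda>y. {(g, x). g \<in> carrier Q \<and> x \<in> carrier R \<and> h g \<cdot>\<^bsub>R\<^esub> x \<sqsubseteq>\<^bsub>R\<^esub> y}"
  have "locale_map ap.P (locale_of R) \<lparr>lsrc = ap.P, ltgt = locale_of R, invim = restrict ?f (carrier (locale_of R))\<rparr>"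
  proof (rule locale_map_restrictI[OF ap.P_frame LR])
    show "\<And>y. y \<in> carrier (locale_of R) \<Longrightarrow> ?f y \<in> carrier ap.P" using slice by simp
  next
    fix A assume "A \<subseteq> carrier (locale_of R)"
    then have A: "A \<subseteq> carrier R" by simp
    have IA: "\<And>U. U \<in> ?f ` A \<Longrightarrow> ap.I U" using slice A by auto
    let ?W = "\<Squnion>\<^bsub>ap.P\<^esub>(?f ` A)"
    have W: "ap.I ?W" by (rule ap.P_sup_closed[OF IA])
    have supA: "\<Squnion>\<^bsub>R\<^esub>A \<in> carrier R" using A by simp
    have "?f (\<Squnion>\<^bsub>R\<^esub>A) = ?W"
    proof
      show "?W \<subseteq> ?f (\<Squnion>\<^bsub>R\<^esub>A)"
      proof (rule ap.P_sup_least[OF IA slice[OF supA]])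
        fix U assume "U \<in> ?f ` A"
        then obtain y where y: "y \<in> A" "U = ?f y" by auto
        then have "y \<sqsubseteq>\<^bsub>R\<^esub> \<Squnion>\<^bsub>R\<^esub>A" "y \<in> carrier R" using A R.sup_upper by auto
        then show "U \<subseteq> ?f (\<Squnion>\<^bsub>R\<^esub>A)"
          unfolding y(2) using supA by (auto intro: R.le_trans[of _ y])
      qed
      show "?f (\<Squnion>\<^bsub>R\<^esub>A) \<subseteq> ?W"
      proof clarify
        fix g x assume g: "g \<in> carrier Q" and x: "x \<in> carrier R" and le: "h g \<cdot>\<^bsub>R\<^esub> x \<sqsubseteq>\<^bsub>R\<^esub> \<Squnion>\<^bsub>R\<^esub>A"
        show "(g, x) \<in> ?W"
        proof (rule by_partial_units[OF W g x])
          fix s assume s: "Q.partial_unit s" "s \<sqsubseteq> g"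
          note c = Q.partial_unitD[OF s(1)]
          let ?c = "s\<^sup>\<star> \<cdot> s"
          \<comment> \<open>A piece of \<open>h ?c x\<close> which \<open>h s\<close> carries below
            \<open>y\<close>. By distributivity these pieces have join
            \<open>h ?c x\<close>.\<close>
          let ?z = "\<lambda>y. h ?c \<cdot>\<^bsub>R\<^esub> x \<sqinter>\<^bsub>R\<^esub> h (s\<^sup>\<star>) \<cdot>\<^bsub>R\<^esub> y"
          have z: "?z ` A \<subseteq> carrier R" using A c x by auto
          have "(s, \<Squnion>\<^bsub>locale_of R\<^esub>(?z ` A)) \<in> ?W"
          proof (rule ap.I_sup2[OF W])
            fix w assume "w \<in> ?z ` A"
            then obtain y where y: "y \<in> A" "w = ?z y" by auto
            have yc: "y \<in> carrier R" using y A by auto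
            have "h s \<cdot>\<^bsub>R\<^esub> w \<sqsubseteq>\<^bsub>R\<^esub> h s \<cdot>\<^bsub>R\<^esub> (h (s\<^sup>\<star>) \<cdot>\<^bsub>R\<^esub> y)"
              unfolding y(2) using c x yc by (intro R.mult_mono R.meet_right) auto
            also have "\<dots> = h (s \<cdot> s\<^sup>\<star>) \<cdot>\<^bsub>R\<^esub> y" using c yc by (simp add: h_mult R.mult_assoc)
            also have "\<dots> \<sqsubseteq>\<^bsub>R\<^esub> y" using c yc by (intro R.mult_le_left h_subunit) auto
            finally have "(s, w) \<in> ?f y" using c x yc y by auto
            then show "(s, w) \<in> ?W" using ap.P_sup_upper[OF IA] y by blast
          qed (use z c in auto)
          moreover have "h ?c \<cdot>\<^bsub>R\<^esub> x \<sqsubseteq>\<^bsub>R\<^esub> \<Squnion>\<^bsub>R\<^esub>(?z ` A)"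
          proof -
            have A': "(\<lambda>y. h (s\<^sup>\<star>) \<cdot>\<^bsub>R\<^esub> y) ` A \<subseteq> carrier R" using A c by auto
            have "h s \<cdot>\<^bsub>R\<^esub> x \<sqsubseteq>\<^bsub>R\<^esub> h g \<cdot>\<^bsub>R\<^esub> x" using s c g x by (intro R.mult_mono h_mono) auto
            then have "h s \<cdot>\<^bsub>R\<^esub> x \<sqsubseteq>\<^bsub>R\<^esub> \<Squnion>\<^bsub>R\<^esub>A" using le c g x supA R.le_trans[of "h s \<cdot>\<^bsub>R\<^esub> x" "h g \<cdot>\<^bsub>R\<^esub> x"] by simp
            then have "h (s\<^sup>\<star>) \<cdot>\<^bsub>R\<^esub> (h s \<cdot>\<^bsub>R\<^esub> x) \<sqsubseteq>\<^bsub>R\<^esub> h (s\<^sup>\<star>) \<cdot>\<^bsub>R\<^esub> \<Squnion>\<^bsub>R\<^esub>A"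
              using c x supA by (intro R.mult_mono) auto
            then have "h ?c \<cdot>\<^bsub>R\<^esub> x \<sqsubseteq>\<^bsub>R\<^esub> h (s\<^sup>\<star>) \<cdot>\<^bsub>R\<^esub> \<Squnion>\<^bsub>R\<^esub>A"
              using c x by (simp add: h_mult R.mult_assoc)
            then have "h ?c \<cdot>\<^bsub>R\<^esub> x = h ?c \<cdot>\<^bsub>R\<^esub> x \<sqinter>\<^bsub>R\<^esub> (h (s\<^sup>\<star>) \<cdot>\<^bsub>R\<^esub> \<Squnion>\<^bsub>R\<^esub>A)"
              using c x supA by (simp add: R.meet_absorb)
            also have "\<dots> = \<Squnion>\<^bsub>R\<^esub>(?z ` A)"
              using c x A A' by (simp add: R.mult_sup_distrib R.meet_sup_distrib image_image)
            finally have "h ?c \<cdot>\<^bsub>R\<^esub> x = \<Squnion>\<^bsub>R\<^esub>(?z ` A)" .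
            then show ?thesis using c x by (metis R.le_refl R.mult_closed Q.mult_closed Q.star_closed h_cl)
          qed
          ultimately show "(s, h ?c \<cdot>\<^bsub>R\<^esub> x) \<in> ?W"
            using ap.I_down[OF W] c x by fastforce
        qed
      qed
    qed
    then show "?f (\<Squnion>\<^bsub>locale_of R\<^esub>A) = ?W" by simp
  next
    show "?f \<top>\<^bsub>locale_of R\<^esub> = \<top>\<^bsub>ap.P\<^esub>" by (auto simp: ap.P_top)
  next
    fix a b assume "a \<in> carrier (locale_of R)" "b \<in> carrier (locale_of R)"
    then show "?f (a \<sqinter>\<^bsub>locale_of R\<^esub> b) = ?f a \<sqinter>\<^bsub>ap.P\<^esub> ?f b"
      using slice by (auto simp: ap.P_meet R.le_meet_iff)
  qed
  then show ?thesis by (simp add: q_act_def)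
qed

sublocale act: repr_map "locale_of Q" "locale_of R" B r p "locale_of R" act "\<lambda>g x. h g \<cdot>\<^bsub>R\<^esub> x"
  by unfold_locales (auto simp: act_map invim_act)

end

section \<open>Multiplication as the action of the identity\<close>

context base_iso begin

lemma hom_action_id: "hom_action Q B \<epsilon> Q (\<lambda>a\<in>carrier Q. a)"
  using base_iso_axioms quantale_hom_id[OF Q.inverse_quantal_frame_axioms] Q.inverse_quantal_frame_axioms
  by (simp add: hom_action_def quantale_morphism_def quantale_morphism_axioms_def)

lemma q_dom_id: "q_dom B (\<lambda>b. (\<lambda>a\<in>carrier Q. a) (\<epsilon> b)) Q = q_dom B \<epsilon> Q"
  by (simp add: q_dom_def cong: restrict_cong)

abbreviation "rn \<equiv> q_rng B \<epsilon> Q"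
abbreviation "dm \<equiv> q_dom B \<epsilon> Q"
abbreviation "un \<equiv> q_unit B \<epsilon> Q"
abbreviation "mul \<equiv> q_act B \<epsilon> Q Q (\<lambda>a\<in>carrier Q. a)"

lemma dom_map: "locale_map (locale_of Q) B dm"
  using hom_action.p_map[OF hom_action_id] unfolding q_dom_id .

sublocale gp: cospan "locale_of Q" "locale_of Q" B rn dm
  using rng_map dom_map by unfold_locales

lemma mul_map: "locale_map gp.P (locale_of Q) mul"
  using hom_action.act_map[OF hom_action_id] unfolding q_dom_id .

sublocale mul: repr_map "locale_of Q" "locale_of Q" B rn dm "locale_of Q" mul "\<lambda>x y. x \<cdot> y"
proof unfold_locales
  fix x y z assume "x \<in> carrier (locale_of Q)" "y \<in> carrier (locale_of Q)" "z \<in> carrier (locale_of Q)"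
  then show "(x, y) \<in> invim mul z \<longleftrightarrow> x \<cdot> y \<sqsubseteq>\<^bsub>locale_of Q\<^esub> z"
    using hom_action.invim_act[OF hom_action_id, of z] by simp
qed (use mul_map in auto)

lemma mul_slide:
  assumes "gp.I W" "x \<in> carrier Q" "y \<in> carrier Q" "c \<in> carrier Q" "c \<sqsubseteq> \<ee>"
  shows "(x \<cdot> c, y) \<in> W \<longleftrightarrow> (x, c \<cdot> y) \<in> W"
  using hom_action.slide[OF hom_action_id, of W x y c] assms unfolding q_dom_id by simp

lemma mul_rng_frob: "\<lbrakk>x \<in> carrier Q; y \<in> carrier Q; b \<in> carrier B\<rbrakk>
    \<Longrightarrow> x \<cdot> (\<top> \<cdot> \<epsilon> b \<sqinter> y) = x \<cdot> y \<sqinter> \<top> \<cdot> \<epsilon> b"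
  using Q.subunit_mult_right[of "\<epsilon> b" y] Q.subunit_mult_right[of "\<epsilon> b" "x \<cdot> y"]
  by (simp add: Q.mult_assoc meet_comm[of Q "x \<cdot> y"])

end

context hom_action begin

lemma act_dom_frob: "\<lbrakk>g \<in> carrier Q; x \<in> carrier R; b \<in> carrier B\<rbrakk>
    \<Longrightarrow> h (\<epsilon> b \<cdot> \<top> \<sqinter> g) \<cdot>\<^bsub>R\<^esub> x = h (\<epsilon> b) \<cdot>\<^bsub>R\<^esub> \<top>\<^bsub>R\<^esub> \<sqinter>\<^bsub>R\<^esub> h g \<cdot>\<^bsub>R\<^esub> x"
  using Q.subunit_mult_left[of "\<epsilon> b" g] R.subunit_mult_left[of "h (\<epsilon> b)" "h g \<cdot>\<^bsub>R\<^esub> x"]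
  by (simp add: h_mult R.mult_assoc)

text \<open>The inclusion of the generator is immediate. The converse has to find, for each partial
  unit \<open>s \<le> g\<close>, a restriction that does not change the relevant part of
  \<open>x\<close> but pushes \<open>s\<close> into \<open>\<epsilon> b \<top>\<close>.\<close>

lemma act_dom: "p \<circ>\<^sub>L act = dm \<circ>\<^sub>L lfst r p"
proof (subst comp_eq_iff[OF act_map p_map ap.pr_maps(1) dom_map], rule ballI)
  fix b assume b: "b \<in> carrier B"
  let ?y = "h (\<epsilon> b) \<cdot>\<^bsub>R\<^esub> \<top>\<^bsub>R\<^esub>" and ?d = "\<epsilon> b \<cdot> \<top>"
  have cl: "?y \<in> carrier R" "?d \<in> carrier Q" "h ?d \<in> carrier R" using b by auto
  have T: "ap.I (ap.T ?d \<top>\<^bsub>R\<^esub>)" using cl by (intro ap.T_I) auto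
  have "{(g, x). g \<in> carrier Q \<and> x \<in> carrier R \<and> h g \<cdot>\<^bsub>R\<^esub> x \<sqsubseteq>\<^bsub>R\<^esub> ?y} = ap.T ?d \<top>\<^bsub>R\<^esub>" (is "?U = _")
  proof
    have "h ?d \<cdot>\<^bsub>R\<^esub> \<top>\<^bsub>R\<^esub> = h (\<epsilon> b) \<cdot>\<^bsub>R\<^esub> (h \<top> \<cdot>\<^bsub>R\<^esub> \<top>\<^bsub>R\<^esub>)" using b by (simp add: h_mult R.mult_assoc)
    also have "\<dots> \<sqsubseteq>\<^bsub>R\<^esub> ?y" using b by (intro R.mult_mono) auto
    finally show "ap.T ?d \<top>\<^bsub>R\<^esub> \<subseteq> ?U" using cl by (intro ap.T_le slice) auto
    show "?U \<subseteq> ap.T ?d \<top>\<^bsub>R\<^esub>"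
    proof clarify
      fix g x assume g: "g \<in> carrier Q" and x: "x \<in> carrier R" and le: "h g \<cdot>\<^bsub>R\<^esub> x \<sqsubseteq>\<^bsub>R\<^esub> ?y"
      show "(g, x) \<in> ap.T ?d \<top>\<^bsub>R\<^esub>"
      proof (rule by_partial_units[OF T g x])
        fix s assume s: "Q.partial_unit s" "s \<sqsubseteq> g"
        note c = Q.partial_unitD[OF s(1)]
        \<comment> \<open>The subunit \<open>\<epsilon> b\<close> conjugated by \<open>s\<close>. As
          \<open>h s x\<close> already lies over \<open>b\<close>, \<open>h ?c x\<close> equals
          \<open>h (s\<^sup>\<star> s) x\<close>, while \<open>s ?c\<close> is below
          \<open>\<epsilon> b \<top>\<close>.\<close>
        let ?c = "s\<^sup>\<star> \<cdot> (\<epsilon> b \<cdot> s)"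
        have "?c \<sqsubseteq> s\<^sup>\<star> \<cdot> s" using b c by (intro Q.mult_mono Q.mult_le_left) auto
        then have ce: "?c \<sqsubseteq> \<ee>" using c b Q.le_trans[of ?c "s\<^sup>\<star> \<cdot> s"] by simp
        have "h s \<cdot>\<^bsub>R\<^esub> x \<sqsubseteq>\<^bsub>R\<^esub> h g \<cdot>\<^bsub>R\<^esub> x" using s c g x by (intro R.mult_mono h_mono) auto
        then have "h s \<cdot>\<^bsub>R\<^esub> x \<sqsubseteq>\<^bsub>R\<^esub> ?y" using R.le_trans[OF _ le, of "h s \<cdot>\<^bsub>R\<^esub> x"] c g x cl by simp
        then have "?y \<sqinter>\<^bsub>R\<^esub> (h s \<cdot>\<^bsub>R\<^esub> x) = h s \<cdot>\<^bsub>R\<^esub> x" using c x cl by (simp add: R.meet_absorb)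
        then have e: "h (\<epsilon> b) \<cdot>\<^bsub>R\<^esub> (h s \<cdot>\<^bsub>R\<^esub> x) = h s \<cdot>\<^bsub>R\<^esub> x"
          using R.subunit_mult_left[of "h (\<epsilon> b)" "h s \<cdot>\<^bsub>R\<^esub> x"] b c x by simp
        have "h ?c \<cdot>\<^bsub>R\<^esub> x = h (s\<^sup>\<star>) \<cdot>\<^bsub>R\<^esub> (h (\<epsilon> b) \<cdot>\<^bsub>R\<^esub> (h s \<cdot>\<^bsub>R\<^esub> x))"
          using b c x by (simp add: h_mult R.mult_assoc)
        also have "\<dots> = h (s\<^sup>\<star> \<cdot> s) \<cdot>\<^bsub>R\<^esub> x"
          unfolding e using c x by (simp add: h_mult R.mult_assoc)
        finally have e': "h ?c \<cdot>\<^bsub>R\<^esub> x = h (s\<^sup>\<star> \<cdot> s) \<cdot>\<^bsub>R\<^esub> x" .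
        have "s \<cdot> ?c = (s \<cdot> s\<^sup>\<star>) \<cdot> (\<epsilon> b \<cdot> s)" using b c by (simp add: Q.mult_assoc)
        also have "\<dots> \<sqsubseteq> \<epsilon> b \<cdot> s" using b c by (intro Q.mult_le_left) auto
        also have "\<dots> \<sqsubseteq> ?d" using b c by (intro Q.mult_mono) auto
        finally have "s \<cdot> ?c \<sqsubseteq> ?d" using b c by simp
        then have "(s \<cdot> ?c, x) \<in> ap.T ?d \<top>\<^bsub>R\<^esub>"
          using ap.I_down[OF T ap.T_mem] b c x by simp
        then show "(s, h (s\<^sup>\<star> \<cdot> s) \<cdot>\<^bsub>R\<^esub> x) \<in> ap.T ?d \<top>\<^bsub>R\<^esub>"
          using slide[OF T, of s x ?c] ce b c x by (simp add: e')
      qed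
    qed
  qed
  then show "invim act (invim p b) = invim (lfst r p) (invim dm b)"
    using b by (simp add: invim_act ap.invim_lfst)
qed

end

locale bi_action = hom_action Q B \<epsilon> R h + tgt: base_iso R C \<eta>
  for Q :: "'a quantale" (structure) and B \<epsilon> and R :: "'a quantale" and h and C \<eta>
begin

text \<open>An inequality \<open>h g x \<le> \<top> \<eta>(b)\<close> is undone by
  \<open>h (g\<^sup>\<star>)\<close>: the part of \<open>x\<close> over
  \<open>g\<^sup>\<star> g \<sqinter> \<ee>\<close> is below
  \<open>h (g\<^sup>\<star>) h g x\<close>, and left multiples of \<open>\<top> \<eta>(b)\<close>
  stay below it. The identity \<open>g (g\<^sup>\<star> g \<sqinter> \<ee>) = g\<close> then slides
  that subunit away.\<close>

lemma act_rng: "tgt.rn \<circ>\<^sub>L act = tgt.rn \<circ>\<^sub>L lsnd r p"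
proof (subst comp_eq_iff[OF act_map tgt.rng_map ap.pr_maps(2) tgt.rng_map], rule ballI)
  fix b assume b: "b \<in> carrier C"
  let ?y = "\<top>\<^bsub>R\<^esub> \<cdot>\<^bsub>R\<^esub> \<eta> b"
  have y: "?y \<in> carrier R" using b by simp
  have T: "ap.I (ap.T \<top> ?y)" using b by (intro ap.T_I) auto
  have l: "x \<cdot>\<^bsub>R\<^esub> ?y \<sqsubseteq>\<^bsub>R\<^esub> ?y" if x: "x \<in> carrier R" for x
  proof -
    have "(x \<cdot>\<^bsub>R\<^esub> \<top>\<^bsub>R\<^esub>) \<cdot>\<^bsub>R\<^esub> \<eta> b \<sqsubseteq>\<^bsub>R\<^esub> ?y" using b x by (intro R.mult_mono) auto
    then show ?thesis using b x by (simp add: R.mult_assoc)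
  qed
  have "{(g, x). g \<in> carrier Q \<and> x \<in> carrier R \<and> h g \<cdot>\<^bsub>R\<^esub> x \<sqsubseteq>\<^bsub>R\<^esub> ?y} = ap.T \<top> ?y" (is "?U = _")
  proof
    show "ap.T \<top> ?y \<subseteq> ?U" using l[of "h \<top>"] y by (intro ap.T_le slice) auto
    show "?U \<subseteq> ap.T \<top> ?y"
    proof clarify
      fix g x assume g: "g \<in> carrier Q" and x: "x \<in> carrier R" and le: "h g \<cdot>\<^bsub>R\<^esub> x \<sqsubseteq>\<^bsub>R\<^esub> ?y"
      let ?c = "g\<^sup>\<star> \<cdot> g \<sqinter> \<ee>"
      have "h ?c \<cdot>\<^bsub>R\<^esub> x \<sqsubseteq>\<^bsub>R\<^esub> h (g\<^sup>\<star> \<cdot> g) \<cdot>\<^bsub>R\<^esub> x"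
        using g x by (intro R.mult_mono h_mono Q.meet_left) auto
      also have "\<dots> = h (g\<^sup>\<star>) \<cdot>\<^bsub>R\<^esub> (h g \<cdot>\<^bsub>R\<^esub> x)" using g x by (simp add: h_mult R.mult_assoc)
      also have "\<dots> \<sqsubseteq>\<^bsub>R\<^esub> h (g\<^sup>\<star>) \<cdot>\<^bsub>R\<^esub> ?y" using le g x y by (intro R.mult_mono[OF R.le_refl le]) auto
      also have "\<dots> \<sqsubseteq>\<^bsub>R\<^esub> ?y" using l g by simp
      finally have "h ?c \<cdot>\<^bsub>R\<^esub> x \<sqsubseteq>\<^bsub>R\<^esub> ?y" using g x y by simp
      then have "(g, h ?c \<cdot>\<^bsub>R\<^esub> x) \<in> ap.T \<top> ?y"
        using ap.I_down[OF T ap.T_mem] g x by simp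
      then show "(g, x) \<in> ap.T \<top> ?y"
        using slide[OF T, of g x ?c] g x by (simp add: Q.mult_support Q.meet_right)
    qed
  qed
  then show "invim act (invim tgt.rn b) = invim (lsnd r p) (invim tgt.rn b)"
    using b by (simp add: invim_act ap.invim_lsnd)
qed

text \<open>The mirror image of \<open>act_rng\<close>: the factor \<open>z\<close> is undone by its
  involution on the right, using \<open>(z z\<^sup>\<star> \<sqinter> \<ee>) z = z\<close>.\<close>

lemma p_mul: "p \<circ>\<^sub>L tgt.mul = p \<circ>\<^sub>L lfst tgt.rn tgt.dm"
proof (subst comp_eq_iff[OF tgt.mul_map p_map tgt.gp.pr_maps(1) p_map], rule ballI)
  fix b assume b: "b \<in> carrier B"
  let ?y = "h (\<epsilon> b) \<cdot>\<^bsub>R\<^esub> \<top>\<^bsub>R\<^esub>"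
  have y: "?y \<in> carrier R" using b by simp
  have T: "tgt.gp.I (tgt.gp.T ?y \<top>\<^bsub>R\<^esub>)" using b by (intro tgt.gp.T_I) auto
  have l: "?y \<cdot>\<^bsub>R\<^esub> x \<sqsubseteq>\<^bsub>R\<^esub> ?y" if x: "x \<in> carrier R" for x
  proof -
    have "h (\<epsilon> b) \<cdot>\<^bsub>R\<^esub> (\<top>\<^bsub>R\<^esub> \<cdot>\<^bsub>R\<^esub> x) \<sqsubseteq>\<^bsub>R\<^esub> ?y" using b x by (intro R.mult_mono) auto
    then show ?thesis using b x by (simp add: R.mult_assoc)
  qed
  have "invim tgt.mul ?y = tgt.gp.T ?y \<top>\<^bsub>R\<^esub>"
  proof
    have I: "tgt.gp.I (invim tgt.mul ?y)" using tgt.mul.t_I y by simp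
    show "tgt.gp.T ?y \<top>\<^bsub>R\<^esub> \<subseteq> invim tgt.mul ?y"
      using l[of "\<top>\<^bsub>R\<^esub>"] y I tgt.mul.rep[of ?y "\<top>\<^bsub>R\<^esub>" ?y] by (intro tgt.gp.T_le) auto
    show "invim tgt.mul ?y \<subseteq> tgt.gp.T ?y \<top>\<^bsub>R\<^esub>"
    proof clarify
      fix x z assume m: "(x, z) \<in> invim tgt.mul ?y"
      then have x: "x \<in> carrier R" and z: "z \<in> carrier R" using tgt.gp.I_sub[OF I m] by simp_all
      have le: "x \<cdot>\<^bsub>R\<^esub> z \<sqsubseteq>\<^bsub>R\<^esub> ?y" using tgt.mul.rep[of x z ?y] m x y z by simp
      let ?c = "z \<cdot>\<^bsub>R\<^esub> z\<^sup>\<star>\<^bsub>R\<^esub> \<sqinter>\<^bsub>R\<^esub> \<ee>\<^bsub>R\<^esub>"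
      have "x \<cdot>\<^bsub>R\<^esub> ?c \<sqsubseteq>\<^bsub>R\<^esub> x \<cdot>\<^bsub>R\<^esub> (z \<cdot>\<^bsub>R\<^esub> z\<^sup>\<star>\<^bsub>R\<^esub>)" using x z by (intro R.mult_mono R.meet_left) auto
      also have "\<dots> = (x \<cdot>\<^bsub>R\<^esub> z) \<cdot>\<^bsub>R\<^esub> z\<^sup>\<star>\<^bsub>R\<^esub>" using x z by (simp add: R.mult_assoc)
      also have "\<dots> \<sqsubseteq>\<^bsub>R\<^esub> ?y \<cdot>\<^bsub>R\<^esub> z\<^sup>\<star>\<^bsub>R\<^esub>" using x y z by (intro R.mult_mono[OF le R.le_refl]) auto
      also have "\<dots> \<sqsubseteq>\<^bsub>R\<^esub> ?y" using l z by simp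
      finally have "x \<cdot>\<^bsub>R\<^esub> ?c \<sqsubseteq>\<^bsub>R\<^esub> ?y" using x y z by simp
      then have "(x \<cdot>\<^bsub>R\<^esub> ?c, z) \<in> tgt.gp.T ?y \<top>\<^bsub>R\<^esub>"
        using tgt.gp.I_down[OF T tgt.gp.T_mem] x z by simp
      then show "(x, z) \<in> tgt.gp.T ?y \<top>\<^bsub>R\<^esub>"
        using tgt.mul_slide[OF T, of x z ?c] x z by (simp add: R.support_mult' R.meet_right)
    qed
  qed
  then show "invim tgt.mul (invim p b) = invim (lfst tgt.rn tgt.dm) (invim p b)"
    using b by (simp add: tgt.gp.invim_lfst)
qed

end

context base_iso begin

lemma bi_action_id: "bi_action Q B \<epsilon> Q (\<lambda>a\<in>carrier Q. a) B \<epsilon>"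
  using hom_action_id base_iso_axioms by (simp add: bi_action_def)

lemma dom_mul: "dm \<circ>\<^sub>L mul = dm \<circ>\<^sub>L lfst rn dm"
  using hom_action.act_dom[OF hom_action_id] unfolding q_dom_id .

lemma rng_mul: "rn \<circ>\<^sub>L mul = rn \<circ>\<^sub>L lsnd rn dm"
  using bi_action.act_rng[OF bi_action_id] unfolding q_dom_id .

lemma q_groupoid_simps [simp]:
  "objs (quantale_groupoid B \<epsilon> Q) = B" "arrs (quantale_groupoid B \<epsilon> Q) = locale_of Q"
  "gdom (quantale_groupoid B \<epsilon> Q) = dm" "grng (quantale_groupoid B \<epsilon> Q) = rn"
  "gunit (quantale_groupoid B \<epsilon> Q) = un" "ginv (quantale_groupoid B \<epsilon> Q) = q_inv Q"
  "gmult (quantale_groupoid B \<epsilon> Q) = mul"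
  by (simp_all add: quantale_groupoid_def)

end

context hom_action begin

lemma act_left_locale: "left_G_locale (quantale_groupoid B \<epsilon> Q) (locale_of R) p act"
proof -
  interpret u: unit_section "locale_of Q" "locale_of R" B r p "q_unit B \<epsilon> Q" "\<ee>"
    by (rule unit_section_rng[OF p_map])
  interpret t: triple "locale_of Q" "locale_of Q" "locale_of R" B B rn dm rn p
    "locale_of Q" rn mul "\<lambda>x y. x \<cdot> y" "locale_of R" p act "\<lambda>g x. h g \<cdot>\<^bsub>R\<^esub> x"
    "locale_of R" act "\<lambda>g x. h g \<cdot>\<^bsub>R\<^esub> x" act "\<lambda>g x. h g \<cdot>\<^bsub>R\<^esub> x"
    by (intro triple.intro mul.repr_map_axioms act.repr_map_axioms rng_mul act_dom)
      (simp_all add: mul_rng_frob act_dom_frob)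
  have unit: "act \<circ>\<^sub>L lpair r p (q_unit B \<epsilon> Q \<circ>\<^sub>L p) (lid (locale_of R)) = lid (locale_of R)"
    using u.unit_law_iff[OF act.repr_map_axioms] by (simp add: R.unit_mult)
  show ?thesis
    unfolding left_G_locale_def Let_def q_groupoid_simps
    using t.triple_eq_iff' unit p_map act_map act_dom by (simp add: h_mult R.mult_assoc)
qed

end

context bi_action begin

theorem act_algebraic: "algebraic_morphism (quantale_groupoid B \<epsilon> Q) (quantale_groupoid C \<eta> R) (p, act)"
proof -
  interpret t: triple "locale_of Q" "locale_of R" "locale_of R" B C r p tgt.rn tgt.dm
    "locale_of R" tgt.rn act "\<lambda>g x. h g \<cdot>\<^bsub>R\<^esub> x" "locale_of R" p tgt.mul "\<lambda>x y. x \<cdot>\<^bsub>R\<^esub> y"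
    "locale_of R" tgt.mul "\<lambda>x y. x \<cdot>\<^bsub>R\<^esub> y" act "\<lambda>g x. h g \<cdot>\<^bsub>R\<^esub> x"
  proof (intro triple.intro tgt.mul.repr_map_axioms act.repr_map_axioms act_rng p_mul)
    fix x y b assume "x \<in> carrier (locale_of Q)" "y \<in> carrier (locale_of R)" "b \<in> carrier C"
    then show "h x \<cdot>\<^bsub>R\<^esub> (invim tgt.rn b \<sqinter>\<^bsub>locale_of R\<^esub> y)
        = h x \<cdot>\<^bsub>R\<^esub> y \<sqinter>\<^bsub>locale_of R\<^esub> invim tgt.rn b"
      using tgt.mul_rng_frob by simp
  next
    fix y z a assume "y \<in> carrier (locale_of R)" "z \<in> carrier (locale_of R)" "a \<in> carrier B"
    then show "(invim p a \<sqinter>\<^bsub>locale_of R\<^esub> y) \<cdot>\<^bsub>R\<^esub> z = invim p a \<sqinter>\<^bsub>locale_of R\<^esub> y \<cdot>\<^bsub>R\<^esub> z"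
      using R.subunit_mult_left[of "h (\<epsilon> a)"] by (simp add: R.mult_assoc)
  qed
  show ?thesis
    unfolding algebraic_morphism_def Let_def q_groupoid_simps tgt.q_groupoid_simps prod.case
    using t.triple_eq_iff' act_left_locale act_rng p_mul by (simp add: R.mult_assoc)
qed

end

section \<open>Unit laws, inverse laws and the local homeomorphism condition for
  \<open>quantale_groupoid\<close>\<close>

context base_iso begin

lemma dom_unit: "dm \<circ>\<^sub>L un = lid B"
proof (rule locale_map_eqI)
  show "locale_map B B (dm \<circ>\<^sub>L un)" using dom_map unit_map by blast
  show "locale_map B B (lid B)" using B.frame_axioms by blast
qed (simp add: invim_lcomp'[OF dom_map] Q.subunit_support)

text \<open>Here the unit is in the second place, so the pairing is evaluated directly: its
  generators are \<open>x \<sqinter> \<top> (y \<sqinter> \<ee>) = x (y \<sqinter> \<ee>) \<le> x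
  y\<close>, and \<open>(a, \<ee>)\<close> attains the bound.\<close>

lemma unit_law_right: "mul \<circ>\<^sub>L lpair rn dm (lid (locale_of Q)) (un \<circ>\<^sub>L rn) = lid (locale_of Q)"
proof -
  have ur: "locale_map (locale_of Q) (locale_of Q) (un \<circ>\<^sub>L rn)" using unit_map rng_map by blast
  interpret c: cone "locale_of Q" "locale_of Q" B rn dm "locale_of Q" "lid (locale_of Q)" "un \<circ>\<^sub>L rn"
    by (rule coneI[OF rng_map dom_map lid_map[OF LQ] ur])
      (simp add: lcomp_assoc[OF dom_map, symmetric] locale_mapD[OF unit_map] dom_unit lid_lcomp[OF rng_map] lcomp_lid[OF rng_map])
  show ?thesis
  proof (rule locale_map_eqI[OF lcomp_map[OF c.lpair_map mul_map] lid_map[OF LQ]])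
    fix a assume "a \<in> carrier (locale_of Q)"
    then have a: "a \<in> carrier Q" by simp
    let ?w = "invim (lpair rn dm (lid (locale_of Q)) (un \<circ>\<^sub>L rn)) (invim mul a)"
    have I: "gp.I (invim mul a)" using mul.t_I a by simp
    have w: "?w \<in> carrier Q" using invim_closed[OF c.lpair_map, of "invim mul a"] I by simp
    have ur_inv: "invim (un \<circ>\<^sub>L rn) y = \<top> \<cdot> (y \<sqinter> \<ee>)" if "y \<in> carrier Q" for y
      using that by (simp add: invim_lcomp'[OF unit_map] Q.meet_right)
    have "?w \<sqsubseteq>\<^bsub>locale_of Q\<^esub> a"
    proof (subst c.invim_lpair_le[OF I]; (intro allI impI)?)
      fix x y assume xy: "(x, y) \<in> invim mul a"
      then have c: "x \<in> carrier Q" "y \<in> carrier Q" using gp.I_sub[OF I xy] by simp_all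
      have le: "x \<cdot> y \<sqsubseteq> a" using mul.rep[of x y a] xy c a by simp
      have "x \<sqinter> \<top> \<cdot> (y \<sqinter> \<ee>) = x \<cdot> (y \<sqinter> \<ee>)"
        using Q.subunit_mult_right[of "y \<sqinter> \<ee>" x] c by (simp add: Q.meet_right meet_comm[of Q x])
      also have "\<dots> \<sqsubseteq> x \<cdot> y" using c by (intro Q.mult_mono Q.meet_left) auto
      also note le
      finally show "invim (lid (locale_of Q)) x \<sqinter>\<^bsub>locale_of Q\<^esub> invim (un \<circ>\<^sub>L rn) y \<sqsubseteq>\<^bsub>locale_of Q\<^esub> a"
        using c a by (simp add: ur_inv)
    qed (use a in simp)
    moreover have "(a, \<ee>) \<in> invim mul a" using mul.rep[of a \<ee> a] a by (simp add: Q.mult_unit)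
    from c.le_invim_lpair[OF I this] have "a \<sqsubseteq> ?w" using a by (simp add: ur_inv Q.mult_unit)
    ultimately have "?w = a" using w a by (intro Q.le_antisym) auto
    then show "invim (mul \<circ>\<^sub>L lpair rn dm (lid (locale_of Q)) (un \<circ>\<^sub>L rn)) a = invim (lid (locale_of Q)) a"
      using a by (simp add: invim_lcomp'[OF mul_map])
  qed
qed

lemma dom_inv: "dm \<circ>\<^sub>L q_inv Q = rn"
proof (rule locale_map_eqI)
  show "locale_map (locale_of Q) B (dm \<circ>\<^sub>L q_inv Q)" using dom_map inv_map by blast
qed (auto simp: rng_map invim_lcomp'[OF dom_map] Q.star_mult Q.subunit_star)

lemma rng_inv: "rn \<circ>\<^sub>L q_inv Q = dm"
proof (rule locale_map_eqI)
  show "locale_map (locale_of Q) B (rn \<circ>\<^sub>L q_inv Q)" using rng_map inv_map by blast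
qed (auto simp: dom_map invim_lcomp'[OF rng_map] Q.star_mult Q.subunit_star)

text \<open>The join of all \<open>x \<sqinter> y\<^sup>\<star>\<close> with
  \<open>x y \<le> a\<close> must be \<open>(a \<sqinter> \<ee>) \<top>\<close>. For
  \<open>z = x \<sqinter> y\<^sup>\<star>\<close> one has \<open>z z\<^sup>\<star> \<le> a\<close>,
  so the support of \<open>z\<close> is below \<open>a \<sqinter> \<ee>\<close>. Conversely
  \<open>z = (a \<sqinter> \<ee>) s\<close> with a partial unit \<open>s\<close> satisfies
  \<open>z z\<^sup>\<star> \<le> a\<close>, and such elements cover
  \<open>(a \<sqinter> \<ee>) \<top>\<close>.\<close>

lemma inv_law_right: "mul \<circ>\<^sub>L lpair rn dm (lid (locale_of Q)) (q_inv Q) = un \<circ>\<^sub>L dm"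
proof -
  interpret c: cone "locale_of Q" "locale_of Q" B rn dm "locale_of Q" "lid (locale_of Q)" "q_inv Q"
    by (rule coneI) (use rng_map dom_map inv_map LQ in \<open>auto simp: dom_inv lcomp_lid[OF rng_map]\<close>)
  show ?thesis
  proof (subst comp_eq_iff[OF c.lpair_map mul_map dom_map unit_map], rule ballI)
    fix a assume "a \<in> carrier (locale_of Q)"
    then have a: "a \<in> carrier Q" by simp
    let ?w = "invim (lpair rn dm (lid (locale_of Q)) (q_inv Q)) (invim mul a)"
    let ?v = "(a \<sqinter> \<ee>) \<cdot> \<top>"
    have I: "gp.I (invim mul a)" using mul.t_I a by simp
    have ae: "a \<sqinter> \<ee> \<sqsubseteq> \<ee>" using a by (simp add: Q.meet_right)
    have w: "?w \<in> carrier Q" using invim_closed[OF c.lpair_map, of "invim mul a"] I by simp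
    have "?w \<sqsubseteq>\<^bsub>locale_of Q\<^esub> ?v"
    proof (subst c.invim_lpair_le[OF I]; (intro allI impI)?)
      fix x y assume xy: "(x, y) \<in> invim mul a"
      then have c: "x \<in> carrier Q" "y \<in> carrier Q" using gp.I_sub[OF I xy] by simp_all
      have le: "x \<cdot> y \<sqsubseteq> a" using mul.rep[of x y a] xy c a by simp
      let ?z = "x \<sqinter> y\<^sup>\<star>"
      have z: "?z \<in> carrier Q" using c by simp
      have "?z\<^sup>\<star> \<sqsubseteq> y" using c by (simp add: Q.star_le_iff Q.meet_right)
      then have "?z \<cdot> ?z\<^sup>\<star> \<sqsubseteq> x \<cdot> y" using c z by (intro Q.mult_mono Q.meet_left) auto
      then have "?z \<cdot> ?z\<^sup>\<star> \<sqsubseteq> a" using Q.le_trans[OF _ le, of "?z \<cdot> ?z\<^sup>\<star>"] c a by simp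
      then have "(?z \<cdot> ?z\<^sup>\<star> \<sqinter> \<ee>) \<cdot> ?z \<sqsubseteq> ?v"
        using c a z by (intro Q.mult_mono Q.meet_mono) auto
      then have "?z \<sqsubseteq> ?v" unfolding Q.support_mult'[OF z] .
      then show "invim (lid (locale_of Q)) x \<sqinter>\<^bsub>locale_of Q\<^esub> invim (q_inv Q) y \<sqsubseteq>\<^bsub>locale_of Q\<^esub> ?v"
        using c by simp
    qed (use a in simp)
    moreover have "?v \<sqsubseteq> ?w"
    proof (rule Q.mult_le_by_partial_units')
      fix s assume s: "Q.partial_unit s"
      note c = Q.partial_unitD[OF s]
      let ?z = "(a \<sqinter> \<ee>) \<cdot> s"
      have z: "?z \<in> carrier Q" using a c by simp
      have "?z \<cdot> ?z\<^sup>\<star> = (a \<sqinter> \<ee>) \<cdot> ((s \<cdot> s\<^sup>\<star>) \<cdot> (a \<sqinter> \<ee>))"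
        using a c ae by (simp add: Q.star_mult Q.subunit_star Q.mult_assoc)
      also have "\<dots> \<sqsubseteq> a \<cdot> (\<ee> \<cdot> \<ee>)"
        using a c ae by (intro Q.mult_mono Q.meet_left) auto
      finally have "?z \<cdot> ?z\<^sup>\<star> \<sqsubseteq> a" using a c by (simp add: Q.mult_unit)
      then have "(?z, ?z\<^sup>\<star>) \<in> invim mul a" using mul.rep[of ?z "?z\<^sup>\<star>" a] z a by simp
      from c.le_invim_lpair[OF I this] show "?z \<sqsubseteq> ?w" using z by (simp add: Q.star_star)
    qed (use a w in auto)
    ultimately have "?w = ?v" using w a by (intro Q.le_antisym) auto
    then show "?w = invim dm (invim un a)" using a ae by simp
  qed
qed

lemma inv_inv: "q_inv Q \<circ>\<^sub>L q_inv Q = lid (locale_of Q)"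
proof (rule locale_map_eqI)
  show "locale_map (locale_of Q) (locale_of Q) (q_inv Q \<circ>\<^sub>L q_inv Q)" using inv_map by blast
  show "locale_map (locale_of Q) (locale_of Q) (lid (locale_of Q))" using LQ by blast
qed (simp add: invim_lcomp'[OF inv_map] Q.star_star)

text \<open>Precompose the right inverse law with the inversion, which is its own inverse.\<close>

lemma inv_law_left: "mul \<circ>\<^sub>L lpair rn dm (q_inv Q) (lid (locale_of Q)) = un \<circ>\<^sub>L rn"
proof -
  have c: "cone (locale_of Q) (locale_of Q) B rn dm (locale_of Q) (lid (locale_of Q)) (q_inv Q)"
    by (rule coneI) (use rng_map dom_map inv_map LQ in \<open>auto simp: dom_inv lcomp_lid[OF rng_map]\<close>)
  have "mul \<circ>\<^sub>L lpair rn dm (lid (locale_of Q)) (q_inv Q) \<circ>\<^sub>L q_inv Q = un \<circ>\<^sub>L dm \<circ>\<^sub>L q_inv Q"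
    using inv_law_right by simp
  then show ?thesis
    using lpair_lcomp[OF c inv_map] cone.lpair_map[OF c]
    by (simp add: lcomp_assoc[OF mul_map] lcomp_assoc[OF unit_map] locale_mapD[OF dom_map]
        locale_mapD[OF cone.lpair_map[OF c]] inv_inv lid_lcomp[OF inv_map] dom_inv)
qed

text \<open>The direct image of \<open>x\<close> is its support
  \<open>x \<top> \<sqinter> \<ee>\<close>, transported to \<open>B\<close>. The partial units form
  the required cover: below a partial unit \<open>s\<close>, every \<open>x\<close> equals its
  support times \<open>s\<close>, so \<open>b \<mapsto> \<epsilon> b \<cdot> s\<close> inverts the
  direct image.\<close>

lemma dom_etale: "local_homeomorphism dm"
proof -
  let ?\<phi> = "\<lambda>x. del (x \<cdot> \<top> \<sqinter> \<ee>)"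
  have le: "x \<cdot> \<top> \<sqinter> \<ee> \<sqsubseteq> \<ee>" if "x \<in> carrier Q" for x
    using that by (simp add: Q.meet_right)
  have eps: "\<epsilon> (?\<phi> x) = x \<cdot> \<top> \<sqinter> \<ee>" and cl: "?\<phi> x \<in> carrier B" if "x \<in> carrier Q" for x
    using that le by auto
  have adj: "?\<phi> x \<sqsubseteq>\<^bsub>B\<^esub> b \<longleftrightarrow> x \<sqsubseteq> \<epsilon> b \<cdot> \<top>" if x: "x \<in> carrier Q" and b: "b \<in> carrier B" for x b
  proof -
    have "?\<phi> x \<sqsubseteq>\<^bsub>B\<^esub> b \<longleftrightarrow> x \<cdot> \<top> \<sqinter> \<ee> \<sqsubseteq> \<epsilon> b"
      using eps_iff[of "?\<phi> x" b] eps[OF x] cl[OF x] b by simp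
    also have "\<dots> \<longleftrightarrow> x \<sqsubseteq> \<epsilon> b \<cdot> \<top>"
    proof
      assume "x \<cdot> \<top> \<sqinter> \<ee> \<sqsubseteq> \<epsilon> b"
      then have "(x \<cdot> \<top> \<sqinter> \<ee>) \<cdot> x \<sqsubseteq> \<epsilon> b \<cdot> \<top>"
        using x b by (intro Q.mult_mono) auto
      then show "x \<sqsubseteq> \<epsilon> b \<cdot> \<top>" using x by (simp add: Q.support_mult)
    next
      assume "x \<sqsubseteq> \<epsilon> b \<cdot> \<top>"
      then have "x \<cdot> \<top> \<sqsubseteq> (\<epsilon> b \<cdot> \<top>) \<cdot> \<top>" using x b by (intro Q.mult_mono) auto
      also have "\<dots> \<sqsubseteq> \<epsilon> b \<cdot> \<top>" using b by (simp add: Q.mult_assoc Q.mult_mono)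
      finally have "x \<cdot> \<top> \<sqinter> \<ee> \<sqsubseteq> \<epsilon> b \<cdot> \<top> \<sqinter> \<ee>"
        using x b by (intro Q.meet_mono) auto
      then show "x \<cdot> \<top> \<sqinter> \<ee> \<sqsubseteq> \<epsilon> b" using b by (simp add: Q.subunit_support)
    qed
    finally show ?thesis .
  qed
  have frob: "?\<phi> (\<epsilon> b \<cdot> \<top> \<sqinter> x) = b \<sqinter>\<^bsub>B\<^esub> ?\<phi> x" if x: "x \<in> carrier Q" and b: "b \<in> carrier B" for x b
  proof (rule eps_eqD)
    have "\<epsilon> (?\<phi> (\<epsilon> b \<cdot> \<top> \<sqinter> x)) = (\<epsilon> b \<cdot> x) \<cdot> \<top> \<sqinter> \<ee>"
      using x b eps[of "\<epsilon> b \<cdot> x"] by (simp add: Q.subunit_mult_left)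
    also have "\<dots> = (\<epsilon> b \<cdot> \<top> \<sqinter> x \<cdot> \<top>) \<sqinter> \<ee>"
      using x b by (simp add: Q.subunit_mult_left Q.mult_assoc)
    also have "\<dots> = \<epsilon> b \<cdot> \<top> \<sqinter> \<epsilon> (?\<phi> x)"
      using x b by (simp add: eps Q.meet_assoc)
    also have "\<dots> = \<epsilon> (b \<sqinter>\<^bsub>B\<^esub> ?\<phi> x)"
      using b cl[OF x] by (simp only: eps_meet Q.subunit_mult_left eps_cl eps_le)
    finally show "\<epsilon> (?\<phi> (\<epsilon> b \<cdot> \<top> \<sqinter> x)) = \<epsilon> (b \<sqinter>\<^bsub>B\<^esub> ?\<phi> x)" .
  qed (use x b cl in auto)
  have di: "direct_image dm ?\<phi>"
    unfolding direct_image_def using adj frob cl by (auto simp: locale_mapD[OF dom_map])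
  have mono: "?\<phi> x \<sqsubseteq>\<^bsub>B\<^esub> ?\<phi> y" if "x \<sqsubseteq> y" "x \<in> carrier Q" "y \<in> carrier Q" for x y
  proof -
    have "\<epsilon> (?\<phi> x) \<sqsubseteq> \<epsilon> (?\<phi> y)" unfolding eps[OF that(2)] eps[OF that(3)]
      using that by (intro Q.meet_mono Q.mult_mono) auto
    then show ?thesis using eps_iff[OF cl cl, of x y] that by simp
  qed
  have rec: "\<epsilon> (?\<phi> x) \<cdot> s = x" if s: "Q.partial_unit s" and x: "x \<in> carrier Q" "x \<sqsubseteq> s" for s x
  proof (rule Q.le_antisym)
    note c = Q.partial_unitD[OF s]
    have e: "\<epsilon> (?\<phi> x) = x \<cdot> x\<^sup>\<star> \<sqinter> \<ee>" using eps Q.support x by simp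
    have "(x \<cdot> x\<^sup>\<star> \<sqinter> \<ee>) \<cdot> s \<sqsubseteq> (x \<cdot> x\<^sup>\<star>) \<cdot> s"
      using x c by (intro Q.mult_mono Q.meet_left) auto
    also have "\<dots> = x \<cdot> (x\<^sup>\<star> \<cdot> s)" using x c by (simp add: Q.mult_assoc)
    also have "\<dots> \<sqsubseteq> x \<cdot> (s\<^sup>\<star> \<cdot> s)" using x c by (intro Q.mult_mono Q.star_mono) auto
    also have "\<dots> \<sqsubseteq> x" using x c by (intro Q.mult_le_right) auto
    finally show "\<epsilon> (?\<phi> x) \<cdot> s \<sqsubseteq> x" unfolding e using x c by simp
    have "(x \<cdot> x\<^sup>\<star> \<sqinter> \<ee>) \<cdot> x \<sqsubseteq> \<epsilon> (?\<phi> x) \<cdot> s"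
      unfolding e using x c by (intro Q.mult_mono) auto
    then show "x \<sqsubseteq> \<epsilon> (?\<phi> x) \<cdot> s" using Q.support_mult'[OF x(1)] by simp
  qed (use x Q.partial_unitD[OF s] eps[of x] in auto)
  have sec: "?\<phi> (\<epsilon> b \<cdot> s) = b"
    if s: "s \<in> carrier Q" and b: "b \<in> carrier B" "b \<sqsubseteq>\<^bsub>B\<^esub> ?\<phi> s" for s b
    using frob[OF s b(1)] Q.subunit_mult_left[of "\<epsilon> b" s] b s cl[OF s] by (simp add: B.meet_absorb)
  show ?thesis
    unfolding local_homeomorphism_def locale_mapD[OF dom_map]
  proof (intro exI conjI ballI)
    show "direct_image dm ?\<phi>" by (rule di)
    show "{s. Q.partial_unit s} \<subseteq> carrier (locale_of Q)" by (auto simp: Q.partial_unit_def)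
    show "\<Squnion>\<^bsub>locale_of Q\<^esub>{s. Q.partial_unit s} = \<top>\<^bsub>locale_of Q\<^esub>" using Q.sup_partial_units by simp
  next
    fix s assume "s \<in> {s. Q.partial_unit s}"
    then have s: "Q.partial_unit s" by simp
    note c = Q.partial_unitD[OF s]
    show "bij_betw ?\<phi> (down_set (locale_of Q) s) (down_set B (?\<phi> s))"
    proof (rule bij_betwI[where g = "\<lambda>b. \<epsilon> b \<cdot> s"])
      show "?\<phi> \<in> down_set (locale_of Q) s \<rightarrow> down_set B (?\<phi> s)"
        using c mono cl by (auto simp: down_set_def)
      show "(\<lambda>b. \<epsilon> b \<cdot> s) \<in> down_set B (?\<phi> s) \<rightarrow> down_set (locale_of Q) s"
        using c by (auto simp: down_set_def intro: Q.mult_le_left)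
    qed (use rec[OF s] sec c in \<open>auto simp: down_set_def\<close>)
    fix x y assume "x \<in> down_set (locale_of Q) s" "y \<in> down_set (locale_of Q) s"
    then have x: "x \<in> carrier Q" "x \<sqsubseteq> s" and y: "y \<in> carrier Q" "y \<sqsubseteq> s" by (auto simp: down_set_def)
    show "x \<sqsubseteq>\<^bsub>locale_of Q\<^esub> y \<longleftrightarrow> ?\<phi> x \<sqsubseteq>\<^bsub>B\<^esub> ?\<phi> y"
    proof
      assume "?\<phi> x \<sqsubseteq>\<^bsub>B\<^esub> ?\<phi> y"
      then have "\<epsilon> (?\<phi> x) \<cdot> s \<sqsubseteq> \<epsilon> (?\<phi> y) \<cdot> s"
        using x y c cl eps_iff by (intro Q.mult_mono) auto
      then show "x \<sqsubseteq>\<^bsub>locale_of Q\<^esub> y" using rec[OF s] x y by simp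
    qed (use mono x y in simp)
  qed
qed

theorem quantale_groupoid_etale: "localic_etale_groupoid (quantale_groupoid B \<epsilon> Q)"
proof -
  have L: "left_G_locale (quantale_groupoid B \<epsilon> Q) (locale_of Q) dm mul"
    using hom_action.act_left_locale[OF hom_action_id] unfolding q_dom_id .
  show ?thesis
    using L unit_law_right unfolding left_G_locale_def localic_etale_groupoid_def localic_groupoid_def
      localic_etale_groupoid_axioms_def q_groupoid_simps
    by (simp add: dom_map rng_map unit_map inv_map mul_map dom_unit rng_unit dom_mul rng_mul dom_inv rng_inv
        inv_law_right inv_law_left dom_etale)
qed

end

section \<open>Generalized elements of a localic groupoid\<close>

lemma act_pair_map:
  assumes "cone X Y B f g Z h k" "locale_map (lpullback f g) V a"
  shows "locale_map Z V (a \<circ>\<^sub>L lpair f g h k)"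
  using cone.lpair_map[OF assms(1)] assms(2) by blast

lemma act_pair_lcomp:
  assumes c: "cone X Y B f g Z h k" and a: "locale_map (lpullback f g) V a" and t: "locale_map W Z t"
  shows "a \<circ>\<^sub>L lpair f g h k \<circ>\<^sub>L t = a \<circ>\<^sub>L lpair f g (h \<circ>\<^sub>L t) (k \<circ>\<^sub>L t)"
  using lpair_lcomp[OF c t] by (simp add: lcomp_assoc[OF a] locale_mapD[OF cone.lpair_map[OF c]])

lemma act_pair_fst:
  assumes c: "cone X Y B f g Z h k" and a: "locale_map (lpullback f g) V a"
    and q: "locale_map V C q" "locale_map X C q'" "q \<circ>\<^sub>L a = q' \<circ>\<^sub>L lfst f g"
  shows "q \<circ>\<^sub>L (a \<circ>\<^sub>L lpair f g h k) = q' \<circ>\<^sub>L h"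
proof -
  interpret cone X Y B f g Z h k by fact
  show ?thesis
    using q(3) lfst_lpair
    by (simp add: lcomp_assoc[OF q(1), symmetric] locale_mapD[OF a] lcomp_assoc[OF q(2)])
qed

lemma act_pair_snd:
  assumes c: "cone X Y B f g Z h k" and a: "locale_map (lpullback f g) V a"
    and q: "locale_map V C q" "locale_map Y C q'" "q \<circ>\<^sub>L a = q' \<circ>\<^sub>L lsnd f g"
  shows "q \<circ>\<^sub>L (a \<circ>\<^sub>L lpair f g h k) = q' \<circ>\<^sub>L k"
proof -
  interpret cone X Y B f g Z h k by fact
  show ?thesis
    using q(3) lsnd_lpair
    by (simp add: lcomp_assoc[OF q(1), symmetric] locale_mapD[OF a] lcomp_assoc[OF q(2)])
qed

locale left_action = localic_groupoid G for G :: "'a groupoid" +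
  fixes X :: "'x gorder" and p :: "('x, 'a) lmap" and act :: "(('a \<times> 'x) set, 'x) lmap"
  assumes left: "left_G_locale G X p act"
begin

lemma p_map: "locale_map X (objs G) p"
  and act_map: "locale_map (lpullback (grng G) p) X act"
  and p_act: "p \<circ>\<^sub>L act = gdom G \<circ>\<^sub>L lfst (grng G) p"
  and unit_act: "act \<circ>\<^sub>L lpair (grng G) p (gunit G \<circ>\<^sub>L p) (lid X) = lid X"
  and assoc_act: "act \<circ>\<^sub>L lpair (grng G) p
      (gmult G \<circ>\<^sub>L lpair (grng G) (gdom G)
        (lfst (grng G) (gdom G) \<circ>\<^sub>L lfst (grng G \<circ>\<^sub>L lsnd (grng G) (gdom G)) p)
        (lsnd (grng G) (gdom G) \<circ>\<^sub>L lfst (grng G \<circ>\<^sub>L lsnd (grng G) (gdom G)) p))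
      (lsnd (grng G \<circ>\<^sub>L lsnd (grng G) (gdom G)) p)
    = act \<circ>\<^sub>L lpair (grng G) p
      (lfst (grng G) (gdom G) \<circ>\<^sub>L lfst (grng G \<circ>\<^sub>L lsnd (grng G) (gdom G)) p)
      (act \<circ>\<^sub>L lpair (grng G) p
        (lsnd (grng G) (gdom G) \<circ>\<^sub>L lfst (grng G \<circ>\<^sub>L lsnd (grng G) (gdom G)) p)
        (lsnd (grng G \<circ>\<^sub>L lsnd (grng G) (gdom G)) p))"
  using left by (simp_all add: left_G_locale_def Let_def)

abbreviation "d \<equiv> gdom G"
abbreviation "r \<equiv> grng G"
abbreviation "u \<equiv> gunit G"
abbreviation "i \<equiv> ginv G"
abbreviation "mul x y \<equiv> gmult G \<circ>\<^sub>L lpair (grng G) (gdom G) x y"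
abbreviation "ap g x \<equiv> act \<circ>\<^sub>L lpair (grng G) p g x"

sublocale pb: cospan "arrs G" X "objs G" r p using rng_map p_map by unfold_locales
sublocale gg: cospan "arrs G" "arrs G" "objs G" r d using rng_map dom_map by unfold_locales

lemma mul_cone: "\<lbrakk>locale_map Z (arrs G) x; locale_map Z (arrs G) y; r \<circ>\<^sub>L x = d \<circ>\<^sub>L y\<rbrakk>
    \<Longrightarrow> cone (arrs G) (arrs G) (objs G) r d Z x y"
  by (rule coneI[OF rng_map dom_map])

lemma ap_cone: "\<lbrakk>locale_map Z (arrs G) g; locale_map Z X x; r \<circ>\<^sub>L g = p \<circ>\<^sub>L x\<rbrakk>
    \<Longrightarrow> cone (arrs G) X (objs G) r p Z g x"
  by (rule coneI[OF rng_map p_map])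

lemmas mul_map [intro] = act_pair_map[OF mul_cone mult_map]
lemmas ap_map [intro] = act_pair_map[OF ap_cone act_map]
lemmas mul_lcomp = act_pair_lcomp[OF mul_cone mult_map]
lemmas ap_lcomp = act_pair_lcomp[OF ap_cone act_map]
lemmas d_mul = act_pair_fst[OF mul_cone mult_map dom_map dom_map dom_mult]
lemmas r_mul = act_pair_snd[OF mul_cone mult_map rng_map rng_map rng_mult]
lemmas p_ap = act_pair_fst[OF ap_cone act_map p_map dom_map p_act]

text \<open>The axiom speaks of the universal composable triple. Every composable triple
  \<open>(g, h, x)\<close> is the universal one precomposed with the map \<open>t\<close> that it
  induces into the iterated pullback.\<close>

lemma ap_mul:
  assumes g: "locale_map Z (arrs G) g" and h: "locale_map Z (arrs G) h" and x: "locale_map Z X x"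
    and gh: "r \<circ>\<^sub>L g = d \<circ>\<^sub>L h" and hx: "r \<circ>\<^sub>L h = p \<circ>\<^sub>L x"
  shows "ap (mul g h) x = ap g (ap h x)"
proof -
  let ?s = "r \<circ>\<^sub>L lsnd r d"
  have s: "locale_map gg.P (objs G) ?s" using rng_map gg.pr_maps(2) by blast
  interpret W: cospan gg.P X "objs G" ?s p using s p_map by unfold_locales
  interpret c1: cone "arrs G" "arrs G" "objs G" r d Z g h by (rule mul_cone[OF g h gh])
  have l: "locale_map Z gg.P (lpair r d g h)" by (rule c1.lpair_map)
  interpret c2: cone gg.P X "objs G" ?s p Z "lpair r d g h" x
    by (rule coneI[OF s p_map l x]) (simp add: lcomp_assoc[OF rng_map] c1.lsnd_lpair hx)
  define t where "t = lpair ?s p (lpair r d g h) x"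
  have t: "locale_map Z W.P t" unfolding t_def by (rule c2.lpair_map)
  let ?x = "lfst r d \<circ>\<^sub>L lfst ?s p" and ?y = "lsnd r d \<circ>\<^sub>L lfst ?s p" and ?z = "lsnd ?s p"
  have xm: "locale_map W.P (arrs G) ?x" and ym: "locale_map W.P (arrs G) ?y" and zm: "locale_map W.P X ?z"
    by blast+
  have xt: "?x \<circ>\<^sub>L t = g" and yt: "?y \<circ>\<^sub>L t = h" and zt: "?z \<circ>\<^sub>L t = x"
    unfolding t_def
    by (simp_all add: lcomp_assoc[OF gg.pr_maps(1)] lcomp_assoc[OF gg.pr_maps(2)] c2.lfst_lpair c2.lsnd_lpair
        c1.lfst_lpair c1.lsnd_lpair)
  have xy: "r \<circ>\<^sub>L ?x = d \<circ>\<^sub>L ?y"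
    using gg.square by (simp add: lcomp_assoc[symmetric, OF rng_map] lcomp_assoc[symmetric, OF dom_map])
  have yz: "r \<circ>\<^sub>L ?y = p \<circ>\<^sub>L ?z"
    using W.square by (simp add: lcomp_assoc[symmetric, OF rng_map])
  have mm: "locale_map W.P (arrs G) (mul ?x ?y)" by (rule mul_map[OF xm ym xy])
  have am: "locale_map W.P X (ap ?y ?z)" by (rule ap_map[OF ym zm yz])
  have mz: "r \<circ>\<^sub>L mul ?x ?y = p \<circ>\<^sub>L ?z" using r_mul[OF xm ym xy] yz by simp
  have xa: "r \<circ>\<^sub>L ?x = p \<circ>\<^sub>L ap ?y ?z" using p_ap[OF ym zm yz] xy by simp
  have "ap (mul ?x ?y) ?z \<circ>\<^sub>L t = ap (mul g h) x"
    using ap_lcomp[OF mm zm mz t] mul_lcomp[OF xm ym xy t] by (simp add: xt yt zt)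
  moreover have "ap ?x (ap ?y ?z) \<circ>\<^sub>L t = ap g (ap h x)"
    using ap_lcomp[OF xm am xa t] ap_lcomp[OF ym zm yz t] by (simp add: xt yt zt)
  ultimately show ?thesis using assoc_act by simp
qed

lemma ap_unit:
  assumes x: "locale_map Z X x"
  shows "ap (u \<circ>\<^sub>L (p \<circ>\<^sub>L x)) x = x"
proof -
  have up: "locale_map X (arrs G) (u \<circ>\<^sub>L p)" using unit_map p_map by blast
  have X: "locale_map X X (lid X)" using p_map by (auto dest: locale_mapD)
  have c: "r \<circ>\<^sub>L (u \<circ>\<^sub>L p) = p \<circ>\<^sub>L lid X"
    by (simp add: lcomp_assoc[OF rng_map, symmetric] locale_mapD[OF unit_map] rng_unit lid_lcomp[OF p_map] lcomp_lid[OF p_map])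
  have "ap (u \<circ>\<^sub>L p) (lid X) \<circ>\<^sub>L x = ap (u \<circ>\<^sub>L (p \<circ>\<^sub>L x)) x"
    using ap_lcomp[OF up X c x] by (simp add: lcomp_assoc[OF unit_map] locale_mapD[OF p_map] lid_lcomp[OF x])
  then show ?thesis using unit_act by (simp add: lid_lcomp[OF x])
qed

lemma mul_inv_left:
  assumes x: "locale_map Z (arrs G) x"
  shows "mul (i \<circ>\<^sub>L x) x = u \<circ>\<^sub>L (r \<circ>\<^sub>L x)"
proof -
  have l: "locale_map (arrs G) (arrs G) (lid (arrs G))" using inv_map by (auto dest: locale_mapD)
  have c: "r \<circ>\<^sub>L i = d \<circ>\<^sub>L lid (arrs G)" by (simp add: rng_inv lcomp_lid[OF dom_map])
  have "mul i (lid (arrs G)) \<circ>\<^sub>L x = mul (i \<circ>\<^sub>L x) x"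
    using mul_lcomp[OF inv_map l c x] by (simp add: lid_lcomp[OF x])
  then show ?thesis using inv_left by (simp add: lcomp_assoc[OF unit_map] locale_mapD[OF rng_map])
qed

lemma mul_inv_right:
  assumes x: "locale_map Z (arrs G) x"
  shows "mul x (i \<circ>\<^sub>L x) = u \<circ>\<^sub>L (d \<circ>\<^sub>L x)"
proof -
  have l: "locale_map (arrs G) (arrs G) (lid (arrs G))" using inv_map by (auto dest: locale_mapD)
  have c: "r \<circ>\<^sub>L lid (arrs G) = d \<circ>\<^sub>L i" by (simp add: dom_inv lcomp_lid[OF rng_map])
  have "mul (lid (arrs G)) i \<circ>\<^sub>L x = mul x (i \<circ>\<^sub>L x)"
    using mul_lcomp[OF l inv_map c x] by (simp add: lid_lcomp[OF x])
  then show ?thesis using inv_right by (simp add: lcomp_assoc[OF unit_map] locale_mapD[OF dom_map])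
qed

lemma mul_unit:
  assumes x: "locale_map Z (arrs G) x"
  shows "mul x (u \<circ>\<^sub>L (r \<circ>\<^sub>L x)) = x"
proof -
  have l: "locale_map (arrs G) (arrs G) (lid (arrs G))" using inv_map by (auto dest: locale_mapD)
  have ur: "locale_map (arrs G) (arrs G) (u \<circ>\<^sub>L r)" using unit_map rng_map by blast
  have c: "r \<circ>\<^sub>L lid (arrs G) = d \<circ>\<^sub>L (u \<circ>\<^sub>L r)"
    by (simp add: lcomp_assoc[OF dom_map, symmetric] locale_mapD[OF unit_map] dom_unit lid_lcomp[OF rng_map] lcomp_lid[OF rng_map])
  have "mul (lid (arrs G)) (u \<circ>\<^sub>L r) \<circ>\<^sub>L x = mul x (u \<circ>\<^sub>L (r \<circ>\<^sub>L x))"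
    using mul_lcomp[OF l ur c x] by (simp add: lid_lcomp[OF x] lcomp_assoc[OF unit_map] locale_mapD[OF rng_map])
  then show ?thesis using unit_right by (simp add: lid_lcomp[OF x])
qed

lemma d_inv: "locale_map Z (arrs G) x \<Longrightarrow> d \<circ>\<^sub>L (i \<circ>\<^sub>L x) = r \<circ>\<^sub>L x"
  by (simp add: lcomp_assoc[OF dom_map, symmetric] locale_mapD[OF inv_map] dom_inv)

lemma r_inv: "locale_map Z (arrs G) x \<Longrightarrow> r \<circ>\<^sub>L (i \<circ>\<^sub>L x) = d \<circ>\<^sub>L x"
  by (simp add: lcomp_assoc[OF rng_map, symmetric] locale_mapD[OF inv_map] rng_inv)

end

context localic_groupoid begin

text \<open>Thereby facts about actions serve as groupoid laws: for this action
  \<open>ap_mul\<close> is associativity of multiplication and \<open>ap_unit\<close> the left unit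
  law.\<close>

lemma self_action: "left_action G (arrs G) (gdom G) (gmult G)"
  using dom_map mult_map dom_mult unit_left assoc
  by unfold_locales (simp add: left_G_locale_def)

end

context left_action begin

sublocale self: left_action G "arrs G" "gdom G" "gmult G"
  by (rule self_action)

lemma inv_maps: "locale_map Z (arrs G) x \<Longrightarrow> locale_map Z (arrs G) (i \<circ>\<^sub>L x)" using inv_map by blast

text \<open>This and \<open>inv_mul_el\<close> are the usual deductions from uniqueness of inverses,
  carried out with generalized elements in place of arrows.\<close>

lemma inv_inv_el:
  assumes x: "locale_map Z (arrs G) x"
  shows "i \<circ>\<^sub>L (i \<circ>\<^sub>L x) = x"
proof -
  note ix = inv_maps[OF x] and iix = inv_maps[OF inv_maps[OF x]]
  have e: "i \<circ>\<^sub>L (i \<circ>\<^sub>L x) = mul (u \<circ>\<^sub>L (d \<circ>\<^sub>L x)) (i \<circ>\<^sub>L (i \<circ>\<^sub>L x))"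
    using self.ap_unit[OF iix] by (simp add: d_inv[OF ix] r_inv[OF x])
  also have "\<dots> = mul (mul x (i \<circ>\<^sub>L x)) (i \<circ>\<^sub>L (i \<circ>\<^sub>L x))"
    by (simp add: mul_inv_right[OF x])
  also have "\<dots> = mul x (mul (i \<circ>\<^sub>L x) (i \<circ>\<^sub>L (i \<circ>\<^sub>L x)))"
    by (rule self.ap_mul[OF x ix iix]) (simp_all add: d_inv[OF x] d_inv[OF ix])
  also have "\<dots> = x"
    using mul_inv_right[OF ix] mul_unit[OF x] by (simp add: d_inv[OF x])
  finally show ?thesis .
qed

lemma inv_mul_el:
  assumes x: "locale_map Z (arrs G) x" and y: "locale_map Z (arrs G) y" and xy: "r \<circ>\<^sub>L x = d \<circ>\<^sub>L y"
  shows "i \<circ>\<^sub>L mul x y = mul (i \<circ>\<^sub>L y) (i \<circ>\<^sub>L x)"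
proof -
  note ix = inv_maps[OF x] and iy = inv_maps[OF y]
  have yx: "r \<circ>\<^sub>L (i \<circ>\<^sub>L y) = d \<circ>\<^sub>L (i \<circ>\<^sub>L x)" by (simp add: r_inv[OF y] d_inv[OF x] xy)
  note w = mul_map[OF x y xy] and v = mul_map[OF iy ix yx]
  note iw = inv_maps[OF w]
  have dw: "d \<circ>\<^sub>L mul x y = d \<circ>\<^sub>L x" and rw: "r \<circ>\<^sub>L mul x y = r \<circ>\<^sub>L y"
    using d_mul[OF x y xy] r_mul[OF x y xy] by auto
  have dv: "d \<circ>\<^sub>L mul (i \<circ>\<^sub>L y) (i \<circ>\<^sub>L x) = r \<circ>\<^sub>L y" using d_mul[OF iy ix yx] by (simp add: d_inv[OF y])
  have "mul (mul x y) (mul (i \<circ>\<^sub>L y) (i \<circ>\<^sub>L x)) = mul x (mul y (mul (i \<circ>\<^sub>L y) (i \<circ>\<^sub>L x)))"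
    by (rule self.ap_mul[OF x y v xy]) (simp add: dv)
  also have "mul y (mul (i \<circ>\<^sub>L y) (i \<circ>\<^sub>L x)) = mul (mul y (i \<circ>\<^sub>L y)) (i \<circ>\<^sub>L x)"
    by (rule self.ap_mul[OF y iy ix _ yx, symmetric]) (simp add: d_inv[OF y])
  also have "\<dots> = i \<circ>\<^sub>L x"
    using self.ap_unit[OF ix] by (simp add: mul_inv_right[OF y] d_inv[OF x] xy)
  also have "mul x (i \<circ>\<^sub>L x) = u \<circ>\<^sub>L (d \<circ>\<^sub>L x)" by (rule mul_inv_right[OF x])
  finally have wv: "mul (mul x y) (mul (i \<circ>\<^sub>L y) (i \<circ>\<^sub>L x)) = u \<circ>\<^sub>L (d \<circ>\<^sub>L x)" .
  have "i \<circ>\<^sub>L mul x y = mul (i \<circ>\<^sub>L mul x y) (u \<circ>\<^sub>L (d \<circ>\<^sub>L x))"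
    using mul_unit[OF iw] by (simp add: r_inv[OF w] dw)
  also have "\<dots> = mul (mul (i \<circ>\<^sub>L mul x y) (mul x y)) (mul (i \<circ>\<^sub>L y) (i \<circ>\<^sub>L x))"
    unfolding wv[symmetric]
    by (rule self.ap_mul[OF iw w v, symmetric]) (simp_all add: r_inv[OF w] rw dv)
  also have "\<dots> = mul (i \<circ>\<^sub>L y) (i \<circ>\<^sub>L x)"
    using self.ap_unit[OF v] by (simp add: mul_inv_left[OF w] rw dv)
  finally show ?thesis .
qed

text \<open>\<open>\<phi>(g, x) = (g\<^sup>-\<^sup>1, g x)\<close> is an involution carrying the second projection to the action, so the
  action is open as soon as \<open>r\<close> is.\<close>

definition \<phi> where "\<phi> = lpair r p (i \<circ>\<^sub>L lfst r p) act"

lemma \<phi>_cone: "cone (arrs G) X (objs G) r p pb.P (i \<circ>\<^sub>L lfst r p) act"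
  by (rule coneI[OF rng_map p_map inv_maps[OF pb.pr_maps(1)] act_map]) (simp add: r_inv[OF pb.pr_maps(1)] p_act)

lemma \<phi>_map: "locale_map pb.P pb.P \<phi>"
  unfolding \<phi>_def by (rule cone.lpair_map[OF \<phi>_cone])

lemma ap_proj: "ap (lfst r p) (lsnd r p) = act"
proof -
  have l: "locale_map pb.P pb.P (lid pb.P)" using pb.P_frame by blast
  have "lpair r p (lfst r p) (lsnd r p) = lid pb.P"
    using lpair_lfst_lsnd[OF rng_map p_map l] by (simp add: lcomp_lid[OF pb.pr_maps(1)] lcomp_lid[OF pb.pr_maps(2)])
  then show ?thesis by (simp add: lcomp_lid[OF act_map])
qed

lemma act_\<phi>: "act \<circ>\<^sub>L \<phi> = lsnd r p"
proof -
  note l = pb.pr_maps(1) and s = pb.pr_maps(2)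
  have "act \<circ>\<^sub>L \<phi> = ap (i \<circ>\<^sub>L lfst r p) (ap (lfst r p) (lsnd r p))" by (simp add: \<phi>_def ap_proj)
  also have "\<dots> = ap (mul (i \<circ>\<^sub>L lfst r p) (lfst r p)) (lsnd r p)"
    by (rule ap_mul[OF inv_maps[OF l] l s, symmetric]) (simp_all add: r_inv[OF l] pb.square)
  also have "\<dots> = lsnd r p" using ap_unit[OF s] by (simp add: mul_inv_left[OF l] pb.square)
  finally show ?thesis .
qed

lemma lsnd_\<phi>: "lsnd r p \<circ>\<^sub>L \<phi> = act"
  unfolding \<phi>_def using cone.lsnd_lpair[OF \<phi>_cone] .

lemma \<phi>_\<phi>: "\<phi> \<circ>\<^sub>L \<phi> = lid pb.P"
proof -
  note l = pb.pr_maps(1) and s = pb.pr_maps(2)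
  have i: "locale_map pb.P pb.P (lid pb.P)" using pb.P_frame by blast
  have lf: "lfst r p \<circ>\<^sub>L \<phi> = i \<circ>\<^sub>L lfst r p" unfolding \<phi>_def using cone.lfst_lpair[OF \<phi>_cone] .
  have "\<phi> \<circ>\<^sub>L \<phi> = lpair r p (i \<circ>\<^sub>L lfst r p \<circ>\<^sub>L \<phi>) (act \<circ>\<^sub>L \<phi>)"
    using lpair_lcomp[OF \<phi>_cone \<phi>_map] by (simp add: \<phi>_def)
  also have "i \<circ>\<^sub>L lfst r p \<circ>\<^sub>L \<phi> = lfst r p"
    using inv_inv_el[OF l] by (simp add: lcomp_assoc[OF inv_map] lf)
  also have "lpair r p (lfst r p) (act \<circ>\<^sub>L \<phi>) = lid pb.P"
    using lpair_lfst_lsnd[OF rng_map p_map i] by (simp add: act_\<phi> lcomp_lid[OF l] lcomp_lid[OF s])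
  finally show ?thesis .
qed

lemma invim_\<phi>: 
  assumes "pb.I U" shows "pb.I (invim \<phi> U)" "invim \<phi> (invim \<phi> U) = U"
  using pb.I_invim[OF \<phi>_map, of U] assms invim_lcomp'[OF \<phi>_map, of U \<phi>] by (simp_all add: \<phi>_\<phi>)

lemma \<phi>_le_iff:
  assumes "pb.I U" "pb.I V" shows "invim \<phi> U \<subseteq> V \<longleftrightarrow> U \<subseteq> invim \<phi> V"
  using invim_mono[OF \<phi>_map, of "invim \<phi> U" V] invim_mono[OF \<phi>_map, of U "invim \<phi> V"] assms invim_\<phi>
  by auto

end

section \<open>Openness of actions and Frobenius reciprocity\<close>

locale open_left_action = left_action +
  fixes \<rho> assumes r_open: "direct_image r \<rho>"
begin

lemma rho_cl [simp]: "g \<in> carrier (arrs G) \<Longrightarrow> \<rho> g \<in> carrier (objs G)"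
  and rho_le_iff: "\<lbrakk>g \<in> carrier (arrs G); b \<in> carrier (objs G)\<rbrakk>
    \<Longrightarrow> \<rho> g \<sqsubseteq>\<^bsub>objs G\<^esub> b \<longleftrightarrow> g \<sqsubseteq>\<^bsub>arrs G\<^esub> invim r b"
  and rho_frob: "\<lbrakk>g \<in> carrier (arrs G); b \<in> carrier (objs G)\<rbrakk>
    \<Longrightarrow> \<rho> (invim r b \<sqinter>\<^bsub>arrs G\<^esub> g) = b \<sqinter>\<^bsub>objs G\<^esub> \<rho> g"
  using r_open by (auto simp: direct_image_def locale_mapD[OF rng_map])

lemma rho_mono: "\<lbrakk>g \<sqsubseteq>\<^bsub>arrs G\<^esub> g'; g \<in> carrier (arrs G); g' \<in> carrier (arrs G)\<rbrakk>
    \<Longrightarrow> \<rho> g \<sqsubseteq>\<^bsub>objs G\<^esub> \<rho> g'"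
  using rho_le_iff[of g' "\<rho> g'"] pb.X.le_trans[of g g' "invim r (\<rho> g')"] by (simp add: rho_le_iff)

lemma rho_sup:
  assumes S: "S \<subseteq> carrier (arrs G)"
  shows "\<rho> (\<Squnion>\<^bsub>arrs G\<^esub>S) = \<Squnion>\<^bsub>objs G\<^esub>(\<rho> ` S)"
proof (rule pb.B.eq_by_upper)
  fix b assume b: "b \<in> carrier (objs G)"
  have "\<rho> ` S \<subseteq> carrier (objs G)" using S by auto
  then show "\<rho> (\<Squnion>\<^bsub>arrs G\<^esub>S) \<sqsubseteq>\<^bsub>objs G\<^esub> b \<longleftrightarrow> \<Squnion>\<^bsub>objs G\<^esub>(\<rho> ` S) \<sqsubseteq>\<^bsub>objs G\<^esub> b"
    using S b by (auto simp: rho_le_iff pb.X.sup_le_iff pb.B.sup_le_iff subset_iff)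
qed (use S in \<open>auto intro!: pb.B.sup_closed\<close>)

text \<open>The Beck-Chevalley condition: an open \<open>r\<close> makes the second projection open,
  with direct image \<open>g \<otimes> x \<mapsto> invim p (\<rho> g) \<sqinter> x\<close>, and
  \<open>\<sigma>\<close> below extends this to ideals. The harder inclusion slides
  \<open>\<rho> g\<close> across the tensor and uses
  \<open>g \<le> invim r (\<rho> g)\<close>.\<close>

lemma invim_lsnd:
  assumes c: "c \<in> carrier X"
  shows "invim (lsnd r p) c = {(g, x). g \<in> carrier (arrs G) \<and> x \<in> carrier X \<and> invim p (\<rho> g) \<sqinter>\<^bsub>X\<^esub> x \<sqsubseteq>\<^bsub>X\<^esub> c}"
    (is "_ = ?U")
proof
  have I: "pb.I ?U"
  proof (rule pb.II, goal_cases)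
    case 1 show ?case by auto
  next
    case (2 g g' x x')
    then have "invim p (\<rho> g') \<sqinter>\<^bsub>X\<^esub> x' \<sqsubseteq>\<^bsub>X\<^esub> invim p (\<rho> g) \<sqinter>\<^bsub>X\<^esub> x"
      by (intro pb.Y.meet_mono invim_mono[OF p_map] rho_mono) auto
    then show ?case using 2 c pb.Y.le_trans[of "invim p (\<rho> g') \<sqinter>\<^bsub>X\<^esub> x'" "invim p (\<rho> g) \<sqinter>\<^bsub>X\<^esub> x" c] by auto
  next
    case (3 S x)
    then have S: "\<rho> ` S \<subseteq> carrier (objs G)" and S': "(\<lambda>g. invim p (\<rho> g)) ` S \<subseteq> carrier X" by auto
    have "invim p (\<rho> (\<Squnion>\<^bsub>arrs G\<^esub>S)) = \<Squnion>\<^bsub>X\<^esub>((\<lambda>g. invim p (\<rho> g)) ` S)"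
      using 3 by (simp add: rho_sup invim_sup[OF p_map S] image_image)
    moreover have "\<Squnion>\<^bsub>X\<^esub>((\<lambda>g. invim p (\<rho> g)) ` S) \<sqinter>\<^bsub>X\<^esub> x \<sqsubseteq>\<^bsub>X\<^esub> c"
      using 3 c S' by (intro pb.Y.meet_sup_le) auto
    ultimately show ?case using 3 by simp
  next
    case (4 S g)
    then have "\<Squnion>\<^bsub>X\<^esub>S \<sqinter>\<^bsub>X\<^esub> invim p (\<rho> g) \<sqsubseteq>\<^bsub>X\<^esub> c"
      using c by (intro pb.Y.meet_sup_le) (auto simp: meet_comm[of X _ "invim p (\<rho> g)"])
    then show ?case using 4 by (simp add: meet_comm[of X _ "invim p (\<rho> g)"])
  next
    case (5 g x b)
    then have "\<rho> (g \<sqinter>\<^bsub>arrs G\<^esub> invim r b) = \<rho> g \<sqinter>\<^bsub>objs G\<^esub> b"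
      using rho_frob[of g b] by (simp add: meet_comm[of "arrs G"] meet_comm[of "objs G"])
    then show ?case using 5 by (simp add: invim_meet[OF p_map] pb.Y.meet_assoc)
  qed
  have T: "pb.I (pb.T \<top>\<^bsub>arrs G\<^esub> c)" using c by (intro pb.T_I) auto
  show "invim (lsnd r p) c \<subseteq> ?U"
    unfolding pb.invim_lsnd[OF c] using c
    by (intro pb.T_le[OF I]) (auto intro: pb.Y.meet_right)
  show "?U \<subseteq> invim (lsnd r p) c"
    unfolding pb.invim_lsnd[OF c]
  proof clarify
    fix g x assume g: "g \<in> carrier (arrs G)" and x: "x \<in> carrier X" and le: "invim p (\<rho> g) \<sqinter>\<^bsub>X\<^esub> x \<sqsubseteq>\<^bsub>X\<^esub> c"
    have "(g, invim p (\<rho> g) \<sqinter>\<^bsub>X\<^esub> x) \<in> pb.T \<top>\<^bsub>arrs G\<^esub> c"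
      using pb.I_down[OF T pb.T_mem] g x le by simp
    then have "(g \<sqinter>\<^bsub>arrs G\<^esub> invim r (\<rho> g), x) \<in> pb.T \<top>\<^bsub>arrs G\<^esub> c"
      using pb.I_bal[OF T g x, of "\<rho> g"] g by simp
    then show "(g, x) \<in> pb.T \<top>\<^bsub>arrs G\<^esub> c"
      using rho_le_iff[of g "\<rho> g"] g by (simp add: pb.X.meet_absorb)
  qed
qed

definition \<sigma> where "\<sigma> U = \<Squnion>\<^bsub>X\<^esub>((\<lambda>(g, x). invim p (\<rho> g) \<sqinter>\<^bsub>X\<^esub> x) ` U)"

lemma \<sigma>_image: "pb.I U \<Longrightarrow> (\<lambda>(g, x). invim p (\<rho> g) \<sqinter>\<^bsub>X\<^esub> x) ` U \<subseteq> carrier X"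
  using pb.I_subset[of U] by auto

lemma \<sigma>_cl: "pb.I U \<Longrightarrow> \<sigma> U \<in> carrier X"
  unfolding \<sigma>_def using \<sigma>_image by simp

lemma \<sigma>_le_iff: "\<lbrakk>pb.I U; c \<in> carrier X\<rbrakk> \<Longrightarrow> \<sigma> U \<sqsubseteq>\<^bsub>X\<^esub> c \<longleftrightarrow> U \<subseteq> invim (lsnd r p) c"
  unfolding \<sigma>_def invim_lsnd using pb.I_subset[of U] by (auto simp: pb.Y.sup_le_iff[OF \<sigma>_image])

text \<open>Since the action is the second projection after \<open>\<phi>\<close>, and the
  involution \<open>\<phi>\<close> has \<open>invim \<phi>\<close> as its own direct image, this is
  the direct image of the action at \<open>g \<otimes> x\<close>.\<close>

definition \<mu> where "\<mu> g x = \<sigma> (invim \<phi> (pb.T g x))"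

lemma \<mu>_le_iff':
  assumes "pb.I U" "c \<in> carrier X"
  shows "\<sigma> (invim \<phi> U) \<sqsubseteq>\<^bsub>X\<^esub> c \<longleftrightarrow> U \<subseteq> invim act c"
proof -
  have "invim act c = invim \<phi> (invim (lsnd r p) c)"
    using assms invim_lcomp'[OF pb.pr_maps(2), of c \<phi>] by (simp add: lsnd_\<phi>)
  then show ?thesis
    using assms \<phi>_le_iff[of U "invim (lsnd r p) c"] pb.I_invim[OF pb.pr_maps(2)] by (simp add: \<sigma>_le_iff invim_\<phi>)
qed

sublocale act: repr_map "arrs G" X "objs G" r p X act \<mu>
proof unfold_locales
  fix g x z assume a: "g \<in> carrier (arrs G)" "x \<in> carrier X" "z \<in> carrier X"
  then show "(g, x) \<in> invim act z \<longleftrightarrow> \<mu> g x \<sqsubseteq>\<^bsub>X\<^esub> z"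
    unfolding \<mu>_def using \<mu>_le_iff'[of "pb.T g x" z] pb.T_le_iff[OF pb.I_invim[OF act_map]] pb.T_I by simp
qed (auto simp: act_map \<mu>_def \<sigma>_cl invim_\<phi> pb.T_I)

text \<open>Frobenius reciprocity for the action, stated through upper bounds. Transported along
  \<open>\<phi>\<close> it concerns the second projection, where it is associativity of
  meets.\<close>

lemma frob:
  assumes g: "g \<in> carrier (arrs G)" and x: "x \<in> carrier X" and c: "c \<in> carrier X" and z: "z \<in> carrier X"
  shows "\<mu> g x \<sqinter>\<^bsub>X\<^esub> c \<sqsubseteq>\<^bsub>X\<^esub> z \<longleftrightarrow> pb.T g x \<inter> invim act c \<subseteq> invim act z"
proof
  have T: "pb.I (pb.T g x)" using g x by (rule pb.T_I)
  have Ic: "pb.I (invim act c)" "pb.I (invim act z)" using act.t_I c z by auto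
  {
    assume l: "\<mu> g x \<sqinter>\<^bsub>X\<^esub> c \<sqsubseteq>\<^bsub>X\<^esub> z"
    have "pb.T g x \<inter> invim act c \<subseteq> invim act (\<mu> g x) \<inter> invim act c"
      using act.rep[of g x "\<mu> g x"] g x pb.T_le_iff[OF act.t_I, of "\<mu> g x" g x] by auto
    also have "\<dots> = invim act (\<mu> g x \<sqinter>\<^bsub>X\<^esub> c)"
      using invim_meet[OF act_map, of "\<mu> g x" c] g x c act.t_I by (simp add: pb.P_meet)
    also have "\<dots> \<subseteq> invim act z"
      using invim_mono[OF act_map, of "\<mu> g x \<sqinter>\<^bsub>X\<^esub> c" z] l g x c z by simp
    finally show "pb.T g x \<inter> invim act c \<subseteq> invim act z" .
  next
    assume l: "pb.T g x \<inter> invim act c \<subseteq> invim act z"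
    let ?V = "invim \<phi> (pb.T g x)"
    have V: "pb.I ?V" using T by (rule invim_\<phi>(1))
    have ls: "invim \<phi> (invim act c) = invim (lsnd r p) c"
      using c invim_lcomp'[OF act_map, of c \<phi>] by (simp add: act_\<phi>)
    have IT: "pb.I (pb.T g x \<inter> invim act c)" using T Ic by (intro pb.I_Int)
    have "\<sigma> (invim \<phi> (pb.T g x \<inter> invim act c)) \<sqsubseteq>\<^bsub>X\<^esub> z"
      using l \<mu>_le_iff'[OF IT z] by simp
    then have "invim \<phi> (pb.T g x \<inter> invim act c) \<subseteq> invim (lsnd r p) z"
      using \<sigma>_le_iff[OF invim_\<phi>(1)[OF IT] z] by simp
    moreover have "invim \<phi> (pb.T g x \<inter> invim act c) = ?V \<inter> invim (lsnd r p) c"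
      using invim_meet[OF \<phi>_map, of "pb.T g x" "invim act c"] T Ic V
      by (simp add: pb.P_meet invim_\<phi> ls[symmetric])
    ultimately have V': "?V \<inter> invim (lsnd r p) c \<subseteq> invim (lsnd r p) z" by simp
    have "\<sigma> ?V \<sqinter>\<^bsub>X\<^esub> c \<sqsubseteq>\<^bsub>X\<^esub> z"
      unfolding \<sigma>_def
    proof (rule pb.Y.meet_sup_le[OF c \<sigma>_image[OF V] z], clarify)
      fix k y assume ky: "(k, y) \<in> ?V"
      then have cl: "k \<in> carrier (arrs G)" "y \<in> carrier X" using pb.I_sub[OF V ky] by auto
      have "(k, y \<sqinter>\<^bsub>X\<^esub> c) \<in> ?V" using pb.I_down[OF V ky] cl c by (simp add: pb.Y.meet_left)
      moreover have "(k, y \<sqinter>\<^bsub>X\<^esub> c) \<in> invim (lsnd r p) c"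
        using cl c by (simp add: invim_lsnd) (simp add: pb.Y.meet_assoc[symmetric] pb.Y.meet_right)
      ultimately have "invim p (\<rho> k) \<sqinter>\<^bsub>X\<^esub> (y \<sqinter>\<^bsub>X\<^esub> c) \<sqsubseteq>\<^bsub>X\<^esub> z"
        using V' invim_lsnd[OF z] by auto
      then show "invim p (\<rho> k) \<sqinter>\<^bsub>X\<^esub> y \<sqinter>\<^bsub>X\<^esub> c \<sqsubseteq>\<^bsub>X\<^esub> z"
        using cl c by (simp add: pb.Y.meet_assoc)
    qed
    then show "\<mu> g x \<sqinter>\<^bsub>X\<^esub> c \<sqsubseteq>\<^bsub>X\<^esub> z" by (simp add: \<mu>_def)
  }
qed

text \<open>An invariant \<open>q\<close> makes the action pull \<open>invim q c\<close> back to a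
  cylinder over the second factor, and Frobenius moves it inside \<open>\<mu>\<close>. This supplies
  the condition \<open>F\<alpha>\<close> of \<open>triple\<close>.\<close>

lemma frob_snd:
  assumes q: "locale_map X C q" and eq: "q \<circ>\<^sub>L act = q \<circ>\<^sub>L lsnd r p"
    and g: "g \<in> carrier (arrs G)" and x: "x \<in> carrier X" and c: "c \<in> carrier C"
  shows "\<mu> g (invim q c \<sqinter>\<^bsub>X\<^esub> x) = \<mu> g x \<sqinter>\<^bsub>X\<^esub> invim q c"
proof (rule pb.Y.eq_by_upper)
  have qc: "invim q c \<in> carrier X" using invim_closed[OF q c] .
  fix z assume z: "z \<in> carrier X"
  have "invim act (invim q c) = pb.T \<top>\<^bsub>arrs G\<^esub> (invim q c)"
    using arg_cong[OF eq, of "\<lambda>t. invim t c"] c qc by (simp add: invim_lcomp'[OF q] pb.invim_lsnd)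
  then have "pb.T g x \<inter> invim act (invim q c) = pb.T g (invim q c \<sqinter>\<^bsub>X\<^esub> x)"
    using g x qc by (simp add: pb.T_meet pb.X_meet_top meet_comm[of X x])
  then show "\<mu> g (invim q c \<sqinter>\<^bsub>X\<^esub> x) \<sqsubseteq>\<^bsub>X\<^esub> z \<longleftrightarrow> \<mu> g x \<sqinter>\<^bsub>X\<^esub> invim q c \<sqsubseteq>\<^bsub>X\<^esub> z"
    using frob[OF g x qc z] g x qc z pb.T_le_iff[OF act.t_I[OF z]] act.rep by simp
qed (use invim_closed[OF q c] g x in auto)

text \<open>By \<open>p_act\<close> the open \<open>invim p b\<close> pulls back to a cylinder over
  the first factor. This supplies the condition \<open>F\<beta>\<close> of
  \<open>triple\<close>.\<close>

lemma frob_fst: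
  assumes g: "g \<in> carrier (arrs G)" and x: "x \<in> carrier X" and b: "b \<in> carrier (objs G)"
  shows "\<mu> (invim d b \<sqinter>\<^bsub>arrs G\<^esub> g) x = invim p b \<sqinter>\<^bsub>X\<^esub> \<mu> g x"
proof (rule pb.Y.eq_by_upper)
  have db: "invim d b \<in> carrier (arrs G)" and pb: "invim p b \<in> carrier X"
    using invim_closed[OF dom_map b] invim_closed[OF p_map b] by auto
  fix z assume z: "z \<in> carrier X"
  have "invim act (invim p b) = pb.T (invim d b) \<top>\<^bsub>X\<^esub>"
    using arg_cong[OF p_act, of "\<lambda>t. invim t b"] b db by (simp add: invim_lcomp'[OF p_map] invim_lcomp'[OF dom_map] pb.invim_lfst)
  then have "pb.T g x \<inter> invim act (invim p b) = pb.T (invim d b \<sqinter>\<^bsub>arrs G\<^esub> g) x"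
    using g x db by (simp add: pb.T_meet pb.Y_meet_top meet_comm[of "arrs G" g])
  then show "\<mu> (invim d b \<sqinter>\<^bsub>arrs G\<^esub> g) x \<sqsubseteq>\<^bsub>X\<^esub> z \<longleftrightarrow> invim p b \<sqinter>\<^bsub>X\<^esub> \<mu> g x \<sqsubseteq>\<^bsub>X\<^esub> z"
    using frob[OF g x pb z] g x db pb z pb.T_le_iff[OF act.t_I[OF z]] act.rep by (simp add: meet_comm[of X "invim p b"])
qed (use invim_closed[OF dom_map b] invim_closed[OF p_map b] g x in auto)

end

section \<open>The quantale of an etale groupoid\<close>

text \<open>Witnesses for the local homeomorphism \<open>d\<close>, fixed as parameters because the
  product is defined from \<open>\<delta>\<close> and the unit from \<open>\<Gamma>\<close>.\<close>

locale etale_data = localic_groupoid G for G :: "'a groupoid" +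
  fixes \<delta> :: "'a \<Rightarrow> 'a" and \<Gamma> :: "'a set"
  assumes d_open: "direct_image (gdom G) \<delta>"
    and Gam: "\<Gamma> \<subseteq> carrier (arrs G)" and Gam_top: "\<Squnion>\<^bsub>arrs G\<^esub>\<Gamma> = \<top>\<^bsub>arrs G\<^esub>"
    and Gam_inj: "s \<in> \<Gamma> \<Longrightarrow> inj_on \<delta> (down_set (arrs G) s)"
begin

abbreviation "A \<equiv> arrs G"
abbreviation "B \<equiv> objs G"
abbreviation "st a \<equiv> invim (ginv G) a"
abbreviation "ds b \<equiv> invim (gdom G) b"
abbreviation "rs b \<equiv> invim (grng G) b"
abbreviation "us a \<equiv> invim (gunit G) a"

sublocale A: frame "arrs G" using inv_map unfolding locale_map_def by blast
sublocale B: frame "objs G" using unit_map unfolding locale_map_def by blast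

lemma cl [simp]:
  "a \<in> carrier A \<Longrightarrow> st a \<in> carrier A" "a \<in> carrier A \<Longrightarrow> us a \<in> carrier B"
  "b \<in> carrier B \<Longrightarrow> ds b \<in> carrier A" "b \<in> carrier B \<Longrightarrow> rs b \<in> carrier A"
  using invim_closed[OF inv_map] invim_closed[OF unit_map] invim_closed[OF dom_map] invim_closed[OF rng_map] by auto

lemma delta_cl [simp]: "g \<in> carrier A \<Longrightarrow> \<delta> g \<in> carrier B"
  and delta_le_iff: "\<lbrakk>g \<in> carrier A; b \<in> carrier B\<rbrakk> \<Longrightarrow> \<delta> g \<sqsubseteq>\<^bsub>B\<^esub> b \<longleftrightarrow> g \<sqsubseteq>\<^bsub>A\<^esub> ds b"
  and delta_frob: "\<lbrakk>g \<in> carrier A; b \<in> carrier B\<rbrakk> \<Longrightarrow> \<delta> (ds b \<sqinter>\<^bsub>A\<^esub> g) = b \<sqinter>\<^bsub>B\<^esub> \<delta> g"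
  using d_open by (auto simp: direct_image_def locale_mapD[OF dom_map])

text \<open>The law for generalized elements, taken at the generic element
  \<open>lid A\<close>.\<close>

lemma st_st [simp]: "a \<in> carrier A \<Longrightarrow> st (st a) = a"
proof -
  interpret L: left_action G "arrs G" "gdom G" "gmult G" by (rule self_action)
  assume "a \<in> carrier A"
  moreover have l: "locale_map A A (lid A)" using A.frame_axioms by blast
  ultimately show ?thesis
    using arg_cong[OF L.inv_inv_el[OF l], of "\<lambda>t. invim t a"]
    by (simp add: lcomp_lid[OF inv_map] invim_lcomp'[OF inv_map])
qed

lemma st_mono: "\<lbrakk>a \<sqsubseteq>\<^bsub>A\<^esub> b; a \<in> carrier A; b \<in> carrier A\<rbrakk> \<Longrightarrow> st a \<sqsubseteq>\<^bsub>A\<^esub> st b"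
  using invim_mono[OF inv_map] by blast

lemma st_le_iff: "\<lbrakk>a \<in> carrier A; b \<in> carrier A\<rbrakk> \<Longrightarrow> st a \<sqsubseteq>\<^bsub>A\<^esub> b \<longleftrightarrow> a \<sqsubseteq>\<^bsub>A\<^esub> st b"
  using st_mono[of a "st b"] st_mono[of "st a" b] by auto

lemma st_ds: "b \<in> carrier B \<Longrightarrow> st (ds b) = rs b"
  using arg_cong[OF dom_inv, of "\<lambda>t. invim t b"] by (simp add: invim_lcomp'[OF dom_map])

lemma us_ds: "b \<in> carrier B \<Longrightarrow> us (ds b) = b"
  using arg_cong[OF dom_unit, of "\<lambda>t. invim t b"] by (simp add: invim_lcomp'[OF dom_map])

lemma us_rs: "b \<in> carrier B \<Longrightarrow> us (rs b) = b"
  using arg_cong[OF rng_unit, of "\<lambda>t. invim t b"] by (simp add: invim_lcomp'[OF rng_map])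

definition \<rho> where "\<rho> g = \<delta> (st g)"

lemma r_open: "direct_image (grng G) \<rho>"
proof -
  have "st (rs b \<sqinter>\<^bsub>A\<^esub> g) = ds b \<sqinter>\<^bsub>A\<^esub> st g" if "b \<in> carrier B" "g \<in> carrier A" for b g
    using that invim_meet[OF inv_map, of "rs b" g] by (simp add: st_ds[symmetric])
  then show ?thesis
    by (auto simp: direct_image_def locale_mapD[OF rng_map] \<rho>_def delta_le_iff st_le_iff st_ds delta_frob)
qed

sublocale S: open_left_action G "arrs G" "gdom G" "gmult G" \<rho>
  by (intro open_left_action.intro self_action open_left_action_axioms.intro r_open)

abbreviation mlt (infixl \<open>\<odot>\<close> 75) where "x \<odot> y \<equiv> S.\<mu> x y"

text \<open>An open part of a section is determined by its domain: both sides lie below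
  \<open>s\<close> and have the same image under \<open>\<delta>\<close>, which is injective
  there.\<close>

lemma section_eq:
  assumes s: "s \<in> \<Gamma>" and x: "x \<in> carrier A" "x \<sqsubseteq>\<^bsub>A\<^esub> s"
  shows "s \<sqinter>\<^bsub>A\<^esub> ds (\<delta> x) = x"
proof (rule inj_onD[OF Gam_inj[OF s]])
  have sc: "s \<in> carrier A" using s Gam by auto
  have "\<delta> x \<sqsubseteq>\<^bsub>B\<^esub> \<delta> s"
    using x sc delta_le_iff[of s "\<delta> s"] A.le_trans[of x s "ds (\<delta> s)"] by (simp add: delta_le_iff)
  then show "\<delta> (s \<sqinter>\<^bsub>A\<^esub> ds (\<delta> x)) = \<delta> x"
    using x sc delta_frob[of s "\<delta> x"] by (simp add: meet_comm[of A s] B.meet_absorb)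
qed (use s x Gam in \<open>auto simp: down_set_def A.meet_left\<close>)

text \<open>Over a local section \<open>s\<close> the arrow \<open>g\<close> is a unit iff \<open>u(d(g))\<close> lies in \<open>s\<close>, so \<open>\<iota>\<close> is the image of
  the unit map.\<close>

definition \<iota> where "\<iota> = \<Squnion>\<^bsub>A\<^esub>((\<lambda>s. s \<sqinter>\<^bsub>A\<^esub> ds (us s)) ` \<Gamma>)"

lemma iota_image: "(\<lambda>s. s \<sqinter>\<^bsub>A\<^esub> ds (us s)) ` \<Gamma> \<subseteq> carrier A"
  using Gam by auto

lemma iota_cl [simp]: "\<iota> \<in> carrier A"
  unfolding \<iota>_def using iota_image by simp

lemma us_iota: "us \<iota> = \<top>\<^bsub>B\<^esub>"
proof -
  have "us \<iota> = \<Squnion>\<^bsub>B\<^esub>(us ` \<Gamma>)"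
    unfolding \<iota>_def invim_sup[OF unit_map iota_image] image_image
    using Gam by (intro arg_cong[of _ _ "Lattice.sup B"] image_cong) (auto simp: invim_meet[OF unit_map] us_ds subset_iff)
  also have "\<dots> = \<top>\<^bsub>B\<^esub>" using invim_sup[OF unit_map Gam] Gam_top invim_top[OF unit_map] by simp
  finally show ?thesis .
qed

text \<open>On units the arrow \<open>g\<close> equals \<open>u(d(g))\<close>, so \<open>a\<close>
  and its pullback along \<open>u \<circ> d\<close> agree there. This is checked over each section
  \<open>s\<close>, where \<open>loc\<close> holds because \<open>s \<sqinter> a\<close> is
  \<open>s\<close> restricted to the domain of \<open>s \<sqinter> a\<close>.\<close>

lemma iota_meet:
  assumes a: "a \<in> carrier A"
  shows "\<iota> \<sqinter>\<^bsub>A\<^esub> ds (us a) = \<iota> \<sqinter>\<^bsub>A\<^esub> a"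
proof (rule A.le_antisym)
  have loc: "us (s \<sqinter>\<^bsub>A\<^esub> a) = us s \<sqinter>\<^bsub>B\<^esub> \<delta> (s \<sqinter>\<^bsub>A\<^esub> a)" if s: "s \<in> \<Gamma>" for s
  proof -
    have sc: "s \<in> carrier A" using s Gam by auto
    have "s \<sqinter>\<^bsub>A\<^esub> ds (\<delta> (s \<sqinter>\<^bsub>A\<^esub> a)) = s \<sqinter>\<^bsub>A\<^esub> a"
      using section_eq[OF s] sc a by (simp add: A.meet_left)
    then have "us (s \<sqinter>\<^bsub>A\<^esub> a) = us (s \<sqinter>\<^bsub>A\<^esub> ds (\<delta> (s \<sqinter>\<^bsub>A\<^esub> a)))" by simp
    also have "\<dots> = us s \<sqinter>\<^bsub>B\<^esub> \<delta> (s \<sqinter>\<^bsub>A\<^esub> a)" using sc a by (simp add: invim_meet[OF unit_map] us_ds)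
    finally show ?thesis .
  qed
  have "\<iota> \<sqinter>\<^bsub>A\<^esub> ds (us a) \<sqsubseteq>\<^bsub>A\<^esub> a"
    unfolding \<iota>_def
  proof (rule A.meet_sup_le[OF _ iota_image a], use a in simp)
    fix w assume "w \<in> (\<lambda>s. s \<sqinter>\<^bsub>A\<^esub> ds (us s)) ` \<Gamma>"
    then obtain s where s: "s \<in> \<Gamma>" "w = s \<sqinter>\<^bsub>A\<^esub> ds (us s)" by auto
    have sc: "s \<in> carrier A" using s Gam by auto
    have "w \<sqinter>\<^bsub>A\<^esub> ds (us a) = s \<sqinter>\<^bsub>A\<^esub> ds (us (s \<sqinter>\<^bsub>A\<^esub> a))"
      using sc a by (simp add: s invim_meet[OF unit_map] invim_meet[OF dom_map] A.meet_assoc)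
    also have "\<dots> \<sqsubseteq>\<^bsub>A\<^esub> s \<sqinter>\<^bsub>A\<^esub> ds (\<delta> (s \<sqinter>\<^bsub>A\<^esub> a))"
      using sc a by (intro A.meet_mono invim_mono[OF dom_map]) (auto simp: loc[OF s(1)] B.meet_right)
    also have "\<dots> = s \<sqinter>\<^bsub>A\<^esub> a" using section_eq[OF s(1)] sc a by (simp add: A.meet_left)
    also have "\<dots> \<sqsubseteq>\<^bsub>A\<^esub> a" using sc a by (simp add: A.meet_right)
    finally show "w \<sqinter>\<^bsub>A\<^esub> ds (us a) \<sqsubseteq>\<^bsub>A\<^esub> a" using sc a s by simp
  qed
  then show "\<iota> \<sqinter>\<^bsub>A\<^esub> ds (us a) \<sqsubseteq>\<^bsub>A\<^esub> \<iota> \<sqinter>\<^bsub>A\<^esub> a" using a by (simp add: A.le_meet_iff A.meet_left)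
  have "\<iota> \<sqinter>\<^bsub>A\<^esub> a \<sqsubseteq>\<^bsub>A\<^esub> ds (us a)"
    unfolding \<iota>_def
  proof (rule A.meet_sup_le[OF a iota_image], use a in simp)
    fix w assume "w \<in> (\<lambda>s. s \<sqinter>\<^bsub>A\<^esub> ds (us s)) ` \<Gamma>"
    then obtain s where s: "s \<in> \<Gamma>" "w = s \<sqinter>\<^bsub>A\<^esub> ds (us s)" by auto
    have sc: "s \<in> carrier A" using s Gam by auto
    have "w \<sqinter>\<^bsub>A\<^esub> a = ds (us s) \<sqinter>\<^bsub>A\<^esub> (s \<sqinter>\<^bsub>A\<^esub> a)"
      using sc a by (simp add: s A.meet_assoc A.meet_left_commute)
    also have "\<dots> \<sqsubseteq>\<^bsub>A\<^esub> ds (us s) \<sqinter>\<^bsub>A\<^esub> ds (\<delta> (s \<sqinter>\<^bsub>A\<^esub> a))"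
      using sc a delta_le_iff[of "s \<sqinter>\<^bsub>A\<^esub> a" "\<delta> (s \<sqinter>\<^bsub>A\<^esub> a)"] by (intro A.meet_mono) auto
    also have "\<dots> = ds (us (s \<sqinter>\<^bsub>A\<^esub> a))" using sc a by (simp add: loc[OF s(1)] invim_meet[OF dom_map])
    also have "\<dots> \<sqsubseteq>\<^bsub>A\<^esub> ds (us a)" using sc a by (intro invim_mono[OF dom_map] invim_mono[OF unit_map]) (auto intro: A.meet_right)
    finally show "w \<sqinter>\<^bsub>A\<^esub> a \<sqsubseteq>\<^bsub>A\<^esub> ds (us a)" using sc a s by simp
  qed
  then show "\<iota> \<sqinter>\<^bsub>A\<^esub> a \<sqsubseteq>\<^bsub>A\<^esub> \<iota> \<sqinter>\<^bsub>A\<^esub> ds (us a)" using a by (simp add: A.le_meet_iff A.meet_left)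
qed (use a in auto)

lemma iota_ds_rs: "b \<in> carrier B \<Longrightarrow> \<iota> \<sqinter>\<^bsub>A\<^esub> rs b = \<iota> \<sqinter>\<^bsub>A\<^esub> ds b"
  using iota_meet[of "rs b"] by (simp add: us_rs)

lemma iota_meet': "a \<in> carrier A \<Longrightarrow> \<iota> \<sqinter>\<^bsub>A\<^esub> rs (us a) = \<iota> \<sqinter>\<^bsub>A\<^esub> a"
  by (simp add: iota_ds_rs iota_meet)

lemma unit_section_left: "locale_map Y B g \<Longrightarrow> unit_section A Y B (grng G) g (gunit G) \<iota>"
  by (intro unit_section.intro cospan.intro unit_section_axioms.intro)
    (auto simp: rng_map unit_map rng_unit us_iota iota_meet')

lemma iota_mlt: "x \<in> carrier A \<Longrightarrow> \<iota> \<odot> x = x"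
  using unit_section.unit_law_iff[OF unit_section_left[OF dom_map] S.act.repr_map_axioms] unit_left by blast

lemma frob_ds: "\<lbrakk>x \<in> carrier A; y \<in> carrier A; b \<in> carrier B\<rbrakk> \<Longrightarrow> (ds b \<sqinter>\<^bsub>A\<^esub> x) \<odot> y = ds b \<sqinter>\<^bsub>A\<^esub> x \<odot> y"
  by (rule S.frob_fst)

lemma frob_rs: "\<lbrakk>x \<in> carrier A; y \<in> carrier A; b \<in> carrier B\<rbrakk> \<Longrightarrow> x \<odot> (rs b \<sqinter>\<^bsub>A\<^esub> y) = x \<odot> y \<sqinter>\<^bsub>A\<^esub> rs b"
  by (rule S.frob_snd[OF rng_map rng_mult])

lemma mlt_assoc: "\<lbrakk>x \<in> carrier A; y \<in> carrier A; z \<in> carrier A\<rbrakk> \<Longrightarrow> x \<odot> y \<odot> z = x \<odot> (y \<odot> z)"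
proof -
  interpret t: triple A A A B B "grng G" "gdom G" "grng G" "gdom G" A "grng G" "gmult G" S.\<mu> A "gdom G" "gmult G" S.\<mu>
    A "gmult G" S.\<mu> "gmult G" S.\<mu>
    by (intro triple.intro S.act.repr_map_axioms rng_mult dom_mult frob_rs frob_ds)
  show "\<lbrakk>x \<in> carrier A; y \<in> carrier A; z \<in> carrier A\<rbrakk> \<Longrightarrow> x \<odot> y \<odot> z = x \<odot> (y \<odot> z)"
    using t.triple_eq_iff' assoc by (simp add: Let_def)
qed

text \<open>The map equation for the inverse of a product yields one inequality directly; applying
  it to \<open>st y\<close> and \<open>st x\<close> and using that \<open>st\<close> is an
  involution gives the other.\<close>

lemma st_mlt:
  assumes x: "x \<in> carrier A" and y: "y \<in> carrier A"
  shows "st (x \<odot> y) = st y \<odot> st x"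
proof -
  note l = S.pb.pr_maps(1) and s = S.pb.pr_maps(2)
  note il = S.inv_maps[OF l] and ism = S.inv_maps[OF s]
  have eq: "ginv G \<circ>\<^sub>L gmult G = gmult G \<circ>\<^sub>L lpair (grng G) (gdom G) (ginv G \<circ>\<^sub>L lsnd (grng G) (gdom G)) (ginv G \<circ>\<^sub>L lfst (grng G) (gdom G))"
    using S.inv_mul_el[OF l s S.pb.square] S.ap_proj by simp
  interpret c: cone A A B "grng G" "gdom G" S.pb.P "ginv G \<circ>\<^sub>L lsnd (grng G) (gdom G)" "ginv G \<circ>\<^sub>L lfst (grng G) (gdom G)"
    by (rule coneI[OF rng_map dom_map ism il]) (simp add: S.r_inv[OF s] S.d_inv[OF l] S.pb.square)
  have le: "st (x \<odot> y) \<sqsubseteq>\<^bsub>A\<^esub> st y \<odot> st x" if x: "x \<in> carrier A" and y: "y \<in> carrier A" for x y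
  proof -
    let ?a = "st y \<odot> st x"
    have a: "?a \<in> carrier A" using x y by simp
    have "(st y, st x) \<in> invim (gmult G) ?a" using S.act.rep[of "st y" "st x" ?a] x y by simp
    from c.le_invim_lpair[OF S.act.t_I[OF a] this]
    have "S.pb.T \<top>\<^bsub>A\<^esub> y \<sqinter>\<^bsub>S.pb.P\<^esub> S.pb.T x \<top>\<^bsub>A\<^esub> \<subseteq> invim (gmult G) (st ?a)"
      using x y a arg_cong[OF eq, of "\<lambda>t. invim t ?a"]
      by (simp add: invim_lcomp'[OF inv_map] invim_lcomp'[OF mult_map] S.pb.invim_lsnd S.pb.invim_lfst)
    then have "S.pb.T x y \<subseteq> invim (gmult G) (st ?a)"
      using x y by (simp add: S.pb.T_meet_tops meet_comm[of S.pb.P])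
    then have "x \<odot> y \<sqsubseteq>\<^bsub>A\<^esub> st ?a"
      using S.pb.T_le_iff[OF S.act.t_I, of "st ?a" x y] S.act.rep[of x y "st ?a"] x y by simp
    then show ?thesis using x y by (simp add: st_le_iff)
  qed
  have "st (st y \<odot> st x) \<sqsubseteq>\<^bsub>A\<^esub> x \<odot> y" using le[of "st y" "st x"] x y by simp
  then have "st y \<odot> st x \<sqsubseteq>\<^bsub>A\<^esub> st (x \<odot> y)" using x y by (simp add: st_le_iff)
  then show ?thesis using le[OF x y] x y by (intro A.le_antisym) auto
qed

text \<open>The involution turns the left unit law into \<open>y \<odot> st \<iota> = y\<close>. At
  \<open>y = \<iota>\<close> this gives \<open>\<iota> \<odot> st \<iota> = \<iota>\<close>, whose
  left side is \<open>st \<iota>\<close> by the left unit law, so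
  \<open>st \<iota> = \<iota>\<close>.\<close>

lemma mlt_iota:
  assumes x: "x \<in> carrier A" shows "x \<odot> \<iota> = x"
proof -
  have r: "y \<odot> st \<iota> = y" if "y \<in> carrier A" for y
    using st_mlt[of \<iota> "st y"] iota_mlt[of "st y"] that by simp
  have "st \<iota> = \<iota>" using r[of \<iota>] iota_mlt[of "st \<iota>"] by simp
  then show ?thesis using r[OF x] by simp
qed

lemma mlt_le_ds:
  assumes a: "a \<in> carrier A" and x: "x \<in> carrier A"
  shows "a \<odot> x \<sqsubseteq>\<^bsub>A\<^esub> ds (\<delta> a)"
proof -
  have "a \<sqsubseteq>\<^bsub>A\<^esub> ds (\<delta> a)" using a delta_le_iff[of a "\<delta> a"] by simp
  then have "a \<odot> x = ds (\<delta> a) \<sqinter>\<^bsub>A\<^esub> a \<odot> x" using frob_ds[OF a x, of "\<delta> a"] a by (simp add: A.meet_absorb)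
  then show ?thesis using a x by (metis A.meet_left S.act.\<mu>_cl cl(3) delta_cl)
qed

text \<open>The law \<open>g g\<^sup>-\<^sup>1 = u(d(g))\<close> for arrows in \<open>a\<close> says
  \<open>a \<le> ds (us (a \<odot> st a))\<close>. By adjunction \<open>\<delta> a\<close> is below
  \<open>us (a \<odot> st a)\<close>, and on units \<open>ds (us w)\<close> and \<open>w\<close>
  agree.\<close>

lemma iota_ds_le:
  assumes a: "a \<in> carrier A"
  shows "\<iota> \<sqinter>\<^bsub>A\<^esub> ds (\<delta> a) \<sqsubseteq>\<^bsub>A\<^esub> a \<odot> st a"
proof -
  have c: "cone A A B (grng G) (gdom G) A (lid A) (ginv G)"
    by (rule coneI) (use rng_map dom_map inv_map A.frame_axioms in \<open>auto simp: dom_inv lcomp_lid[OF rng_map]\<close>)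
  interpret c: cone A A B "grng G" "gdom G" A "lid A" "ginv G" by (rule c)
  let ?w = "a \<odot> st a"
  have w: "?w \<in> carrier A" using a by simp
  have "(a, st a) \<in> invim (gmult G) ?w" using S.act.rep[of a "st a" ?w] a by simp
  from c.le_invim_lpair[OF S.act.t_I[OF w] this]
  have "a \<sqsubseteq>\<^bsub>A\<^esub> ds (us ?w)"
    using a w arg_cong[OF inv_right, of "\<lambda>t. invim t ?w"]
    by (simp add: invim_lcomp'[OF unit_map] invim_lcomp'[OF mult_map])
  then have "\<delta> a \<sqsubseteq>\<^bsub>B\<^esub> us ?w" using a w by (simp add: delta_le_iff)
  then have "ds (\<delta> a) \<sqsubseteq>\<^bsub>A\<^esub> ds (us ?w)" using a w by (intro invim_mono[OF dom_map]) auto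
  then have "\<iota> \<sqinter>\<^bsub>A\<^esub> ds (\<delta> a) \<sqsubseteq>\<^bsub>A\<^esub> \<iota> \<sqinter>\<^bsub>A\<^esub> ds (us ?w)" using a w by (intro A.meet_mono) auto
  also have "\<dots> \<sqsubseteq>\<^bsub>A\<^esub> ?w" unfolding iota_meet[OF w] using w by (simp add: A.meet_right)
  finally show ?thesis using a w by simp
qed

text \<open>Both expressions are squeezed into a cycle: \<open>a \<odot> st a\<close> is below
  \<open>a \<odot> \<top>\<close>, which is below \<open>ds (\<delta> a)\<close>, and on units the
  latter is below \<open>a \<odot> st a\<close> again.\<close>

lemma supp:
  assumes a: "a \<in> carrier A"
  shows "a \<odot> \<top>\<^bsub>A\<^esub> \<sqinter>\<^bsub>A\<^esub> \<iota> = \<iota> \<sqinter>\<^bsub>A\<^esub> ds (\<delta> a)" "a \<odot> st a \<sqinter>\<^bsub>A\<^esub> \<iota> = \<iota> \<sqinter>\<^bsub>A\<^esub> ds (\<delta> a)"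
proof -
  have 1: "a \<odot> st a \<sqinter>\<^bsub>A\<^esub> \<iota> \<sqsubseteq>\<^bsub>A\<^esub> a \<odot> \<top>\<^bsub>A\<^esub> \<sqinter>\<^bsub>A\<^esub> \<iota>"
    using a by (intro A.meet_mono S.act.\<mu>_mono) auto
  have 2: "a \<odot> \<top>\<^bsub>A\<^esub> \<sqinter>\<^bsub>A\<^esub> \<iota> \<sqsubseteq>\<^bsub>A\<^esub> \<iota> \<sqinter>\<^bsub>A\<^esub> ds (\<delta> a)"
    unfolding meet_comm[of A \<iota>] using a by (intro A.meet_mono mlt_le_ds) auto
  have 3: "\<iota> \<sqinter>\<^bsub>A\<^esub> ds (\<delta> a) \<sqsubseteq>\<^bsub>A\<^esub> a \<odot> st a \<sqinter>\<^bsub>A\<^esub> \<iota>"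
    using iota_ds_le[OF a] a by (intro A.meet_le) (auto intro: A.meet_left)
  have cl': "a \<odot> st a \<sqinter>\<^bsub>A\<^esub> \<iota> \<in> carrier A" "a \<odot> \<top>\<^bsub>A\<^esub> \<sqinter>\<^bsub>A\<^esub> \<iota> \<in> carrier A" "\<iota> \<sqinter>\<^bsub>A\<^esub> ds (\<delta> a) \<in> carrier A"
    using a by auto
  show "a \<odot> \<top>\<^bsub>A\<^esub> \<sqinter>\<^bsub>A\<^esub> \<iota> = \<iota> \<sqinter>\<^bsub>A\<^esub> ds (\<delta> a)"
    using 2 A.le_trans[OF 3 1] cl' by (intro A.le_antisym) auto
  show "a \<odot> st a \<sqinter>\<^bsub>A\<^esub> \<iota> = \<iota> \<sqinter>\<^bsub>A\<^esub> ds (\<delta> a)"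
    using A.le_trans[OF 1 2] 3 cl' by (intro A.le_antisym) auto
qed

lemma supp_mlt:
  assumes a: "a \<in> carrier A"
  shows "(\<iota> \<sqinter>\<^bsub>A\<^esub> ds (\<delta> a)) \<odot> a = a"
proof -
  have "a \<sqsubseteq>\<^bsub>A\<^esub> ds (\<delta> a)" using a delta_le_iff[of a "\<delta> a"] by simp
  then show ?thesis
    using frob_ds[of \<iota> a "\<delta> a"] a by (simp add: iota_mlt A.meet_absorb meet_comm[of A \<iota>])
qed

text \<open>By the left inverse law the opens \<open>st x \<sqinter> y\<close> with
  \<open>x \<odot> y \<le> \<iota>\<close> cover all arrows. If \<open>w\<close> is the part of
  \<open>s\<close> in such a piece, then \<open>st w \<odot> w \<le> \<iota>\<close>, and
  \<open>st s \<odot> w = st w \<odot> w\<close> because the balance condition restricts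
  \<open>s\<close> to the domain of \<open>w\<close>, which is \<open>w\<close> itself.\<close>

lemma section_mlt:
  assumes s: "s \<in> \<Gamma>"
  shows "st s \<odot> s \<sqsubseteq>\<^bsub>A\<^esub> \<iota>"
proof -
  have sc: "s \<in> carrier A" using s Gam by auto
  have c: "cone A A B (grng G) (gdom G) A (ginv G) (lid A)"
    by (rule coneI) (use rng_map dom_map inv_map A.frame_axioms in \<open>auto simp: rng_inv lcomp_lid[OF dom_map]\<close>)
  interpret c: cone A A B "grng G" "gdom G" A "ginv G" "lid A" by (rule c)
  have I: "S.pb.I (invim (gmult G) \<iota>)" using S.act.t_I by simp
  let ?Z = "(\<lambda>(x, y). c.m x y) ` invim (gmult G) \<iota>"
  have Z: "?Z \<subseteq> carrier A" by (rule c.m_image[OF I])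
  have top: "\<Squnion>\<^bsub>A\<^esub>?Z = \<top>\<^bsub>A\<^esub>"
    using arg_cong[OF inv_left, of "\<lambda>t. invim t \<iota>"] c.invim_lpair[OF I] invim_top[OF rng_map]
    by (simp add: invim_lcomp'[OF unit_map] invim_lcomp'[OF mult_map] c.p_def us_iota)
  let ?W = "(\<lambda>z. s \<sqinter>\<^bsub>A\<^esub> z) ` ?Z"
  have W: "?W \<subseteq> carrier A" using Z sc by auto
  have "st s \<odot> \<Squnion>\<^bsub>A\<^esub>?W \<sqsubseteq>\<^bsub>A\<^esub> \<iota>"
  proof (subst S.act.\<mu>_sup2_le[OF W]; (intro ballI)?)
    fix w assume "w \<in> ?W"
    then obtain x y where xy: "(x, y) \<in> invim (gmult G) \<iota>" "w = s \<sqinter>\<^bsub>A\<^esub> c.m x y" by auto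
    have cl': "x \<in> carrier A" "y \<in> carrier A" using S.pb.I_sub[OF I xy(1)] by auto
    have wc: "w \<in> carrier A" using xy cl' sc by simp
    have wm: "w \<sqsubseteq>\<^bsub>A\<^esub> st x \<sqinter>\<^bsub>A\<^esub> y" using xy cl' sc by (simp add: c.m_def A.meet_right)
    have ws: "w \<sqsubseteq>\<^bsub>A\<^esub> s" using xy cl' sc by (simp add: A.meet_left)
    have "st w \<sqsubseteq>\<^bsub>A\<^esub> x" "w \<sqsubseteq>\<^bsub>A\<^esub> y" using wm wc cl' by (auto simp: A.le_meet_iff st_le_iff)
    then have "st w \<odot> w \<sqsubseteq>\<^bsub>A\<^esub> x \<odot> y" using wc cl' by (intro S.act.\<mu>_mono) auto
    moreover have "x \<odot> y \<sqsubseteq>\<^bsub>A\<^esub> \<iota>" using S.act.rep[of x y \<iota>] xy cl' by simp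
    ultimately have wi: "st w \<odot> w \<sqsubseteq>\<^bsub>A\<^esub> \<iota>" using A.le_trans[of "st w \<odot> w" "x \<odot> y" \<iota>] wc cl' by simp
    have "w = ds (\<delta> w) \<sqinter>\<^bsub>A\<^esub> w" using wc delta_le_iff[of w "\<delta> w"] by (simp add: A.meet_absorb)
    then have "st s \<odot> w = (st s \<sqinter>\<^bsub>A\<^esub> rs (\<delta> w)) \<odot> w"
      using S.act.\<mu>_bal[of "st s" w "\<delta> w"] sc wc by simp
    also have "st s \<sqinter>\<^bsub>A\<^esub> rs (\<delta> w) = st (s \<sqinter>\<^bsub>A\<^esub> ds (\<delta> w))"
      using sc wc by (simp add: invim_meet[OF inv_map] st_ds)
    also have "\<dots> = st w" by (simp add: section_eq[OF s wc ws])
    finally show "st s \<odot> w \<sqsubseteq>\<^bsub>A\<^esub> \<iota>" using wi by simp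
  qed (use sc in auto)
  then show ?thesis using A.le_sup_meet[OF sc Z top] by simp
qed

text \<open>A section \<open>s\<close> of the domain map satisfies only
  \<open>st s \<odot> s \<le> \<iota>\<close>. Meeting it with the inverse of another section gives
  \<open>s \<sqinter> st t\<close>, which satisfies both inequalities, and these meets still
  cover.\<close>

lemma sections_cover: "\<Squnion>\<^bsub>A\<^esub>{s \<in> carrier A. s \<odot> st s \<squnion>\<^bsub>A\<^esub> st s \<odot> s \<sqsubseteq>\<^bsub>A\<^esub> \<iota>} = \<top>\<^bsub>A\<^esub>" (is "\<Squnion>\<^bsub>A\<^esub>?C = _")
proof (rule A.top_le)
  have C: "?C \<subseteq> carrier A" by auto
  then show cc: "\<Squnion>\<^bsub>A\<^esub>?C \<in> carrier A" by simp
  have st_top: "\<Squnion>\<^bsub>A\<^esub>(st ` \<Gamma>) = \<top>\<^bsub>A\<^esub>"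
    using invim_sup[OF inv_map Gam] Gam_top invim_top[OF inv_map] by simp
  have stG: "st ` \<Gamma> \<subseteq> carrier A" using Gam by auto
  have "s \<sqsubseteq>\<^bsub>A\<^esub> \<Squnion>\<^bsub>A\<^esub>?C" if s: "s \<in> \<Gamma>" for s
  proof -
    have sc: "s \<in> carrier A" using s Gam by auto
    have "\<Squnion>\<^bsub>A\<^esub>((\<lambda>b. s \<sqinter>\<^bsub>A\<^esub> b) ` st ` \<Gamma>) \<sqsubseteq>\<^bsub>A\<^esub> \<Squnion>\<^bsub>A\<^esub>?C"
    proof (rule A.sup_least[OF _ cc])
      fix w assume "w \<in> (\<lambda>b. s \<sqinter>\<^bsub>A\<^esub> b) ` st ` \<Gamma>"
      then obtain t where t: "t \<in> \<Gamma>" "w = s \<sqinter>\<^bsub>A\<^esub> st t" by auto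
      have tc: "t \<in> carrier A" using t Gam by auto
      have wc: "w \<in> carrier A" using sc tc t by simp
      have ws: "w \<sqsubseteq>\<^bsub>A\<^esub> s" "st w \<sqsubseteq>\<^bsub>A\<^esub> t" "w \<sqsubseteq>\<^bsub>A\<^esub> st t" "st w \<sqsubseteq>\<^bsub>A\<^esub> st s"
        using sc tc wc st_mono[of w s] by (auto simp: t st_le_iff A.meet_left A.meet_right)
      have "w \<odot> st w \<sqsubseteq>\<^bsub>A\<^esub> st t \<odot> t" "st w \<odot> w \<sqsubseteq>\<^bsub>A\<^esub> st s \<odot> s"
        using ws wc sc tc by (auto intro!: S.act.\<mu>_mono)
      then have "w \<odot> st w \<sqsubseteq>\<^bsub>A\<^esub> \<iota>" "st w \<odot> w \<sqsubseteq>\<^bsub>A\<^esub> \<iota>"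
        using A.le_trans[OF _ section_mlt[OF t(1)], of "w \<odot> st w"] A.le_trans[OF _ section_mlt[OF s], of "st w \<odot> w"]
          wc sc tc by auto
      then have "w \<in> ?C" using wc by (simp add: A.join_le)
      then show "w \<sqsubseteq>\<^bsub>A\<^esub> \<Squnion>\<^bsub>A\<^esub>?C" using C by (intro A.sup_upper) auto
    qed (use stG sc in auto)
    then show ?thesis using A.le_sup_meet[OF sc stG st_top] by simp
  qed
  then have "\<Squnion>\<^bsub>A\<^esub>\<Gamma> \<sqsubseteq>\<^bsub>A\<^esub> \<Squnion>\<^bsub>A\<^esub>?C" by (intro A.sup_least[OF Gam cc])
  then show "\<top>\<^bsub>A\<^esub> \<sqsubseteq>\<^bsub>A\<^esub> \<Squnion>\<^bsub>A\<^esub>?C" using Gam_top by simp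
qed

definition Q :: "'a quantale"
  where "Q = \<lparr>carrier = carrier A, eq = eq A, le = le A, qmult = S.\<mu>, qstar = invim (ginv G), qunit = \<iota>\<rparr>"

lemma Q_simps [simp]:
  "carrier Q = carrier A" "eq Q = eq A" "le Q = le A" "qmult Q = S.\<mu>" "qstar Q = invim (ginv G)" "qunit Q = \<iota>"
  by (simp_all add: Q_def)

lemma Q_ops [simp]: "Lattice.sup Q = Lattice.sup A" "meet Q = meet A" "join Q = join A" "top Q = top A"
  by (rule lattice_ops_cong; simp)+

lemma Q_inverse_quantal_frame: "inverse_quantal_frame Q"
proof -
  have "frame Q" using A.frame_axioms by (rule frame_cong) simp_all
  then interpret F: frame Q .
  show ?thesis
    by unfold_locales
      (simp_all add: mlt_assoc iota_mlt mlt_iota st_mlt sup_preserving_def S.act.\<mu>_sup1 S.act.\<mu>_sup2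
        invim_sup[OF inv_map] supp supp_mlt sections_cover)
qed

text \<open>The direct image of \<open>b\<close> under the unit map, whose image is
  \<open>\<iota>\<close>.\<close>

definition \<epsilon> where "\<epsilon> b = \<iota> \<sqinter>\<^bsub>A\<^esub> ds b"

lemma base: "base_iso Q B \<epsilon>"
proof (intro base_iso.intro Q_inverse_quantal_frame B.frame_axioms base_iso_axioms.intro)
  fix b assume b: "b \<in> carrier B"
  then show "\<epsilon> b \<in> carrier Q" "\<epsilon> b \<sqsubseteq>\<^bsub>Q\<^esub> \<ee>\<^bsub>Q\<^esub>" by (auto simp: \<epsilon>_def A.meet_left)
next
  have ue: "us (\<epsilon> b) = b" if "b \<in> carrier B" for b
    using that by (simp add: \<epsilon>_def invim_meet[OF unit_map] us_iota us_ds)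
  fix b c assume bc: "b \<in> carrier B" "c \<in> carrier B"
  show "\<epsilon> b \<sqsubseteq>\<^bsub>Q\<^esub> \<epsilon> c \<longleftrightarrow> b \<sqsubseteq>\<^bsub>B\<^esub> c"
  proof
    assume "\<epsilon> b \<sqsubseteq>\<^bsub>Q\<^esub> \<epsilon> c"
    then have "us (\<epsilon> b) \<sqsubseteq>\<^bsub>B\<^esub> us (\<epsilon> c)" using bc by (intro invim_mono[OF unit_map]) (auto simp: \<epsilon>_def)
    then show "b \<sqsubseteq>\<^bsub>B\<^esub> c" using ue bc by simp
  next
    assume "b \<sqsubseteq>\<^bsub>B\<^esub> c"
    then show "\<epsilon> b \<sqsubseteq>\<^bsub>Q\<^esub> \<epsilon> c" using bc by (auto simp: \<epsilon>_def intro!: A.meet_mono invim_mono[OF dom_map])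
  qed
next
  fix a assume "a \<in> carrier Q" "a \<sqsubseteq>\<^bsub>Q\<^esub> \<ee>\<^bsub>Q\<^esub>"
  then show "\<exists>b\<in>carrier B. \<epsilon> b = a"
    by (intro bexI[of _ "us a"]) (auto simp: \<epsilon>_def iota_meet A.meet_absorb)
qed

text \<open>Once sources and targets agree, each structure map is compared on inverse images. For
  multiplication both are the slices of the same product \<open>\<odot>\<close>.\<close>

theorem eq_quantale_groupoid: "G = quantale_groupoid B \<epsilon> Q"
proof -
  interpret b: base_iso Q B \<epsilon> by (rule base)
  have L: "locale_of Q = A" by (simp add: locale_of_def)
  have d: "q_dom B \<epsilon> Q = gdom G"
  proof (rule locale_map_eqI[OF b.dom_map[unfolded L] dom_map])
    fix y assume y: "y \<in> carrier B"
    then show "invim (q_dom B \<epsilon> Q) y = ds y"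
      using frob_ds[of \<iota> "\<top>\<^bsub>A\<^esub>" y] by (simp add: \<epsilon>_def iota_mlt meet_comm[of A \<iota>])
  qed
  have r: "q_rng B \<epsilon> Q = grng G"
  proof (rule locale_map_eqI[OF b.rng_map[unfolded L] rng_map])
    fix y assume y: "y \<in> carrier B"
    then have "\<epsilon> y = rs y \<sqinter>\<^bsub>A\<^esub> \<iota>" using iota_ds_rs[of y] by (simp add: \<epsilon>_def meet_comm[of A "rs y"])
    then show "invim (q_rng B \<epsilon> Q) y = rs y"
      using frob_rs[of "\<top>\<^bsub>A\<^esub>" \<iota> y] y by (simp add: mlt_iota)
  qed
  have u: "q_unit B \<epsilon> Q = gunit G"
  proof (rule locale_map_eqI[OF b.unit_map[unfolded L] unit_map])
    fix a assume a: "a \<in> carrier A"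
    have "\<epsilon> (us a) = a \<sqinter>\<^bsub>A\<^esub> \<iota>" using a by (simp add: \<epsilon>_def iota_meet meet_comm[of A])
    then show "invim (q_unit B \<epsilon> Q) a = us a" using b.del_eps[of "us a"] a by simp
  qed
  have i: "q_inv Q = ginv G"
    by (rule locale_map_eqI[OF b.inv_map[unfolded L] inv_map]) simp
  have m: "q_act B \<epsilon> Q Q (\<lambda>a\<in>carrier Q. a) = gmult G"
  proof (rule locale_map_eqI[OF b.mul_map[unfolded L d r] mult_map])
    fix a assume a: "a \<in> carrier A"
    then show "invim (q_act B \<epsilon> Q Q (\<lambda>a\<in>carrier Q. a)) a = invim (gmult G) a"
      using b.mul.invim_rep[of a] S.act.invim_rep[of a] by simp
  qed
  show ?thesis unfolding quantale_groupoid_def using d r u i m L by simp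
qed

end

lemma etale_data_exists:
  assumes "localic_etale_groupoid G"
  shows "\<exists>\<delta> \<Gamma>. etale_data G \<delta> \<Gamma>"
proof -
  interpret localic_etale_groupoid G by fact
  obtain \<delta> \<Gamma> where "direct_image (gdom G) \<delta>" "\<Gamma> \<subseteq> carrier (arrs G)" "\<Squnion>\<^bsub>arrs G\<^esub>\<Gamma> = \<top>\<^bsub>arrs G\<^esub>"
    "\<forall>s\<in>\<Gamma>. bij_betw \<delta> (down_set (arrs G) s) (down_set (objs G) (\<delta> s))"
    using etale unfolding local_homeomorphism_def locale_mapD[OF dom_map] by blast
  then have "etale_data G \<delta> \<Gamma>" by unfold_locales (auto simp: bij_betw_def)
  then show ?thesis by blast
qed

theorem etale_groupoid_eq_quantale_groupoid:
  assumes "localic_etale_groupoid G"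
  shows "\<exists>Q \<epsilon>. base_iso Q (objs G) \<epsilon> \<and> G = quantale_groupoid (objs G) \<epsilon> Q"
  using etale_data_exists[OF assms] etale_data.base etale_data.eq_quantale_groupoid by blast

lemma etale_rng_open: "localic_etale_groupoid G \<Longrightarrow> \<exists>\<rho>. direct_image (grng G) \<rho>"
  using etale_data_exists etale_data.r_open by blast

section \<open>Algebraic morphisms and homomorphisms\<close>

definition hom_algmor :: "'a gorder \<Rightarrow> ('a \<Rightarrow> 'a) \<Rightarrow> 'a quantale \<Rightarrow> 'a quantale \<Rightarrow> ('a \<Rightarrow> 'a) \<Rightarrow> 'a algmor"
  where "hom_algmor B \<epsilon> Q R h = (q_dom B (\<lambda>b. h (\<epsilon> b)) R, q_act B \<epsilon> Q R h)"

context inverse_quantal_frame begin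

text \<open>A right ideal is the inverse image of its support along the domain. This will be applied
  to \<open>invim p b\<close> for the anchor \<open>p\<close> of an algebraic morphism.\<close>

lemma right_ideal_eq:
  assumes c: "c \<in> carrier Q" "c \<cdot> \<top> \<sqsubseteq> c"
  shows "(c \<cdot> \<top> \<sqinter> \<ee>) \<cdot> \<top> = c"
proof (rule le_antisym)
  have "(c \<cdot> \<top> \<sqinter> \<ee>) \<cdot> \<top> \<sqsubseteq> (c \<cdot> \<top>) \<cdot> \<top>" using c by (intro mult_mono meet_left) auto
  also have "\<dots> \<sqsubseteq> c \<cdot> \<top>" using c by (simp add: mult_assoc mult_mono)
  also have "\<dots> \<sqsubseteq> c" by (rule c)
  finally show "(c \<cdot> \<top> \<sqinter> \<ee>) \<cdot> \<top> \<sqsubseteq> c" using c by simp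
  have "(c \<cdot> \<top> \<sqinter> \<ee>) \<cdot> c \<sqsubseteq> (c \<cdot> \<top> \<sqinter> \<ee>) \<cdot> \<top>" using c by (intro mult_mono) auto
  then show "c \<sqsubseteq> (c \<cdot> \<top> \<sqinter> \<ee>) \<cdot> \<top>" using c by (simp add: support_mult)
qed (use c in auto)

lemma sup_star_below:
  assumes a: "a \<in> carrier Q"
  shows "\<Squnion>((\<lambda>s. s\<^sup>\<star>) ` {s. partial_unit s \<and> s \<sqsubseteq> a}) = a\<^sup>\<star>"
proof -
  have "{s. partial_unit s \<and> s \<sqsubseteq> a} \<subseteq> carrier Q" by (auto simp: partial_unit_def)
  then show ?thesis using sup_preserving_sup[OF star_sup] sup_partial_units_below[OF a] by metis
qed

end

section \<open>The homomorphism of an algebraic morphism\<close>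

locale algebraic_data = src: base_iso Q B \<epsilon> + tgt: base_iso R C \<eta>
  for Q :: "'a quantale" (structure) and B \<epsilon> and R :: "'a quantale" and C \<eta> +
  fixes p :: "('a, 'a) lmap" and a :: "(('a \<times> 'a) set, 'a) lmap" and \<rho>
  assumes alg: "algebraic_morphism (quantale_groupoid B \<epsilon> Q) (quantale_groupoid C \<eta> R) (p, a)"
    and rho: "direct_image src.rn \<rho>"
begin

sublocale L: open_left_action "quantale_groupoid B \<epsilon> Q" "locale_of R" p a \<rho>
proof (intro open_left_action.intro left_action.intro left_action_axioms.intro open_left_action_axioms.intro)
  show "localic_groupoid (quantale_groupoid B \<epsilon> Q)"
    using src.quantale_groupoid_etale by (simp add: localic_etale_groupoid_def)
  show "left_G_locale (quantale_groupoid B \<epsilon> Q) (locale_of R) p a"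
    using alg by (simp add: algebraic_morphism_def)
  show "direct_image (grng (quantale_groupoid B \<epsilon> Q)) \<rho>" using rho by simp
qed

abbreviation "\<mu> \<equiv> L.\<mu>"

lemma rep: "repr_map (locale_of Q) (locale_of R) B src.rn p (locale_of R) a \<mu>"
  using L.act.repr_map_axioms by simp

sublocale A: repr_map "locale_of Q" "locale_of R" B src.rn p "locale_of R" a \<mu> by (rule rep)

lemma r_act: "tgt.rn \<circ>\<^sub>L a = tgt.rn \<circ>\<^sub>L lsnd src.rn p"
  and p_mul: "p \<circ>\<^sub>L tgt.mul = p \<circ>\<^sub>L lfst tgt.rn tgt.dm"
  and equivariant: "tgt.mul \<circ>\<^sub>L lpair tgt.rn tgt.dm
      (a \<circ>\<^sub>L lpair src.rn p (lfst src.rn p \<circ>\<^sub>L lfst (tgt.rn \<circ>\<^sub>L lsnd src.rn p) tgt.dm)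
        (lsnd src.rn p \<circ>\<^sub>L lfst (tgt.rn \<circ>\<^sub>L lsnd src.rn p) tgt.dm))
      (lsnd (tgt.rn \<circ>\<^sub>L lsnd src.rn p) tgt.dm)
    = a \<circ>\<^sub>L lpair src.rn p (lfst src.rn p \<circ>\<^sub>L lfst (tgt.rn \<circ>\<^sub>L lsnd src.rn p) tgt.dm)
      (tgt.mul \<circ>\<^sub>L lpair tgt.rn tgt.dm (lsnd src.rn p \<circ>\<^sub>L lfst (tgt.rn \<circ>\<^sub>L lsnd src.rn p) tgt.dm)
        (lsnd (tgt.rn \<circ>\<^sub>L lsnd src.rn p) tgt.dm))"
  using alg by (simp_all add: algebraic_morphism_def Let_def)

lemma p_map: "locale_map (locale_of R) B p" using L.p_map by simp

lemma p_cl [simp]: "b \<in> carrier B \<Longrightarrow> invim p b \<in> carrier R"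
  using invim_closed[OF p_map, of b] by simp

lemma unit_mu: "x \<in> carrier R \<Longrightarrow> \<mu> \<ee> x = x"
  using unit_section.unit_law_iff[OF src.unit_section_rng[OF p_map] rep] L.unit_act by simp

lemma mu_mult: "\<lbrakk>g \<in> carrier Q; k \<in> carrier Q; x \<in> carrier R\<rbrakk> \<Longrightarrow> \<mu> (g \<cdot> k) x = \<mu> g (\<mu> k x)"
proof -
  interpret t: triple "locale_of Q" "locale_of Q" "locale_of R" B B src.rn src.dm src.rn p
    "locale_of Q" src.rn src.mul "\<lambda>x y. x \<cdot> y" "locale_of R" p a \<mu>
    "locale_of R" a \<mu> a \<mu>
    using L.frob_fst L.p_act
    by (intro triple.intro src.mul.repr_map_axioms rep src.rng_mul) (simp_all add: src.mul_rng_frob)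
  show "\<lbrakk>g \<in> carrier Q; k \<in> carrier Q; x \<in> carrier R\<rbrakk> \<Longrightarrow> \<mu> (g \<cdot> k) x = \<mu> g (\<mu> k x)"
    using t.triple_eq_iff' L.assoc_act by simp
qed

text \<open>The law \<open>p_mul\<close> makes \<open>invim p b\<close> a right ideal, hence of the
  form \<open>c \<top>\<close> with a subunit \<open>c\<close>; restriction to it is left
  multiplication by \<open>c\<close>, which associates. This is the condition
  \<open>F\<beta>\<close> needed for the equivariance law.\<close>

lemma p_frob:
  assumes "b \<in> carrier B" "y \<in> carrier R" "z \<in> carrier R"
  shows "(invim p b \<sqinter>\<^bsub>R\<^esub> y) \<cdot>\<^bsub>R\<^esub> z = invim p b \<sqinter>\<^bsub>R\<^esub> y \<cdot>\<^bsub>R\<^esub> z"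
proof -
  let ?c = "invim p b"
  have c: "?c \<in> carrier R" using assms by simp
  have "invim tgt.mul ?c = tgt.gp.T ?c \<top>\<^bsub>R\<^esub>"
    using arg_cong[OF p_mul, of "\<lambda>t. invim t b"] assms c by (simp add: invim_lcomp'[OF p_map] tgt.gp.invim_lfst)
  then have "?c \<cdot>\<^bsub>R\<^esub> \<top>\<^bsub>R\<^esub> \<sqsubseteq>\<^bsub>R\<^esub> ?c"
    using tgt.mul.rep[of ?c "\<top>\<^bsub>R\<^esub>" ?c] tgt.gp.T_mem[of ?c "\<top>\<^bsub>R\<^esub>"] c by simp
  then have e: "(?c \<cdot>\<^bsub>R\<^esub> \<top>\<^bsub>R\<^esub> \<sqinter>\<^bsub>R\<^esub> \<ee>\<^bsub>R\<^esub>) \<cdot>\<^bsub>R\<^esub> \<top>\<^bsub>R\<^esub> = ?c" using tgt.Q.right_ideal_eq c by blast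
  let ?b = "?c \<cdot>\<^bsub>R\<^esub> \<top>\<^bsub>R\<^esub> \<sqinter>\<^bsub>R\<^esub> \<ee>\<^bsub>R\<^esub>"
  have b: "?b \<in> carrier R" "?b \<sqsubseteq>\<^bsub>R\<^esub> \<ee>\<^bsub>R\<^esub>" using c by (auto intro: tgt.Q.meet_right)
  show ?thesis
    using tgt.Q.subunit_mult_left[OF b, of y] tgt.Q.subunit_mult_left[OF b, of "y \<cdot>\<^bsub>R\<^esub> z"] assms b
    by (simp add: e tgt.Q.mult_assoc)
qed

lemma mu_equivariant: "\<lbrakk>g \<in> carrier Q; x \<in> carrier R; y \<in> carrier R\<rbrakk> \<Longrightarrow> \<mu> g x \<cdot>\<^bsub>R\<^esub> y = \<mu> g (x \<cdot>\<^bsub>R\<^esub> y)"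
proof -
  interpret t: triple "locale_of Q" "locale_of R" "locale_of R" B C src.rn p tgt.rn tgt.dm
    "locale_of R" tgt.rn a \<mu> "locale_of R" p tgt.mul "\<lambda>x y. x \<cdot>\<^bsub>R\<^esub> y"
    "locale_of R" tgt.mul "\<lambda>x y. x \<cdot>\<^bsub>R\<^esub> y" a \<mu>
  proof (intro triple.intro tgt.mul.repr_map_axioms rep r_act p_mul)
    fix x y b assume "x \<in> carrier (locale_of Q)" "y \<in> carrier (locale_of R)" "b \<in> carrier C"
    then show "\<mu> x (invim tgt.rn b \<sqinter>\<^bsub>locale_of R\<^esub> y) = \<mu> x y \<sqinter>\<^bsub>locale_of R\<^esub> invim tgt.rn b"
      using L.frob_snd[OF tgt.rng_map, of x y b] r_act by simp
  qed (simp add: p_frob)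
  show "\<lbrakk>g \<in> carrier Q; x \<in> carrier R; y \<in> carrier R\<rbrakk> \<Longrightarrow> \<mu> g x \<cdot>\<^bsub>R\<^esub> y = \<mu> g (x \<cdot>\<^bsub>R\<^esub> y)"
    using t.triple_eq_iff' equivariant by simp
qed

definition h where "h = (\<lambda>g\<in>carrier Q. \<mu> g \<ee>\<^bsub>R\<^esub>)"

lemma mu_cl [simp]: "\<lbrakk>g \<in> carrier Q; x \<in> carrier R\<rbrakk> \<Longrightarrow> \<mu> g x \<in> carrier R"
  using A.\<mu>_cl[of g x] by simp

lemma h_cl [simp]: "g \<in> carrier Q \<Longrightarrow> h g \<in> carrier R"
  by (simp add: h_def)

lemma h_mu: "\<lbrakk>g \<in> carrier Q; x \<in> carrier R\<rbrakk> \<Longrightarrow> h g \<cdot>\<^bsub>R\<^esub> x = \<mu> g x"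
  by (simp add: h_def mu_equivariant tgt.Q.unit_mult)

lemma h_mult: "\<lbrakk>g \<in> carrier Q; k \<in> carrier Q\<rbrakk> \<Longrightarrow> h (g \<cdot> k) = h g \<cdot>\<^bsub>R\<^esub> h k"
  by (simp add: h_mu) (simp add: h_def mu_mult)

lemma h_unit: "h \<ee> = \<ee>\<^bsub>R\<^esub>"
  by (simp add: h_def unit_mu)

lemma h_sup: 
  assumes S: "S \<subseteq> carrier Q" shows "h (\<Squnion>S) = \<Squnion>\<^bsub>R\<^esub>(h ` S)"
proof -
  have "h ` S = (\<lambda>g. \<mu> g \<ee>\<^bsub>R\<^esub>) ` S" using S by (intro image_cong) (auto simp: h_def)
  then show ?thesis using A.\<mu>_sup1[of S "\<ee>\<^bsub>R\<^esub>"] S by (simp add: h_def)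
qed

lemma h_sp: "sup_preserving Q R h" by (auto simp: sup_preserving_def h_sup)

lemma h_mono: "\<lbrakk>x \<sqsubseteq> y; x \<in> carrier Q; y \<in> carrier Q\<rbrakk> \<Longrightarrow> h x \<sqsubseteq>\<^bsub>R\<^esub> h y"
  using sup_preserving_mono[OF src.Q.frame_axioms tgt.Q.frame_axioms h_sp] by blast

lemma h_star_section:
  assumes s: "src.Q.partial_unit s"
  shows "h (s\<^sup>\<star>) = (h s)\<^sup>\<star>\<^bsub>R\<^esub>"
proof (rule tgt.Q.star_eq_of_sections)
  note c = src.Q.partial_unitD[OF s]
  show "h s \<in> carrier R" "h (s\<^sup>\<star>) \<in> carrier R" using c by auto
  show "h s \<cdot>\<^bsub>R\<^esub> h (s\<^sup>\<star>) \<sqsubseteq>\<^bsub>R\<^esub> \<ee>\<^bsub>R\<^esub>" "h (s\<^sup>\<star>) \<cdot>\<^bsub>R\<^esub> h s \<sqsubseteq>\<^bsub>R\<^esub> \<ee>\<^bsub>R\<^esub>"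
    using c h_mono[of _ "\<ee>"] by (simp_all add: h_mult[symmetric] h_unit)
  show "h s \<cdot>\<^bsub>R\<^esub> (h (s\<^sup>\<star>) \<cdot>\<^bsub>R\<^esub> h s) = h s"
    using src.Q.partial_unit_cancel[OF s] c by (simp add: h_mult[symmetric])
  show "h (s\<^sup>\<star>) \<cdot>\<^bsub>R\<^esub> (h s \<cdot>\<^bsub>R\<^esub> h (s\<^sup>\<star>)) = h (s\<^sup>\<star>)"
    using src.Q.partial_unit_cancel[OF src.Q.partial_unit_star[OF s]] c
    by (simp add: h_mult[symmetric] src.Q.star_star)
qed

lemma h_star:
  assumes g: "g \<in> carrier Q"
  shows "h (g\<^sup>\<star>) = (h g)\<^sup>\<star>\<^bsub>R\<^esub>"
proof -
  let ?S = "{s. src.Q.partial_unit s \<and> s \<sqsubseteq> g}"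
  have S: "?S \<subseteq> carrier Q" "(\<lambda>s. s\<^sup>\<star>) ` ?S \<subseteq> carrier Q" "h ` ?S \<subseteq> carrier R" by (auto simp: src.Q.partial_unitD)
  have "h (g\<^sup>\<star>) = \<Squnion>\<^bsub>R\<^esub>(h ` (\<lambda>s. s\<^sup>\<star>) ` ?S)"
    using h_sup[OF S(2)] src.Q.sup_star_below[OF g] by simp
  also have "h ` (\<lambda>s. s\<^sup>\<star>) ` ?S = (\<lambda>x. x\<^sup>\<star>\<^bsub>R\<^esub>) ` h ` ?S"
    unfolding image_image by (intro image_cong) (auto simp: h_star_section)
  also have "\<Squnion>\<^bsub>R\<^esub>\<dots> = (h g)\<^sup>\<star>\<^bsub>R\<^esub>"
    using sup_preserving_sup[OF tgt.Q.star_sup S(3)] h_sup[OF S(1)] src.Q.sup_partial_units_below[OF g] by simp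
  finally show ?thesis .
qed

lemma h_hom: "quantale_hom Q R h"
  by (auto simp: quantale_hom_def h_sp h_mult h_star h_unit) (simp add: h_def)

text \<open>Sliding \<open>b\<close> across \<open>\<ee> \<otimes> \<top>\<close> equates
  \<open>h (\<epsilon> b) \<top>\<close> with \<open>invim p b\<close>, so the action determines the
  anchor.\<close>

lemma p_eq: "p = q_dom B (\<lambda>b. h (\<epsilon> b)) R"
proof -
  interpret f: hom_action Q B \<epsilon> R h
    using src.base_iso_axioms src.Q.inverse_quantal_frame_axioms tgt.Q.inverse_quantal_frame_axioms h_hom
    by (simp add: hom_action_def quantale_morphism_def quantale_morphism_axioms_def)
  show ?thesis
  proof (rule locale_map_eqI[OF p_map f.p_map])
    fix b assume b: "b \<in> carrier B"
    have "\<mu> (\<ee> \<sqinter> \<top> \<cdot> \<epsilon> b) \<top>\<^bsub>R\<^esub> = \<mu> \<ee> (invim p b \<sqinter>\<^bsub>R\<^esub> \<top>\<^bsub>R\<^esub>)"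
      using A.\<mu>_bal[of "\<ee>" "\<top>\<^bsub>R\<^esub>" b] b by simp
    then show "invim p b = invim (q_dom B (\<lambda>b. h (\<epsilon> b)) R) b"
      using src.Q.subunit_mult_right[of "\<epsilon> b" "\<ee>"] b
      by (simp add: unit_mu h_mu src.Q.unit_mult meet_comm[of Q "\<ee>"])
  qed
qed

lemma a_eq: "a = q_act B \<epsilon> Q R h"
proof -
  interpret f: hom_action Q B \<epsilon> R h
    using src.base_iso_axioms src.Q.inverse_quantal_frame_axioms tgt.Q.inverse_quantal_frame_axioms h_hom
    by (simp add: hom_action_def quantale_morphism_def quantale_morphism_axioms_def)
  show ?thesis
  proof (rule locale_map_eqI[OF A.t f.act_map[folded p_eq]])
    fix y assume "y \<in> carrier (locale_of R)"
    then show "invim a y = invim (q_act B \<epsilon> Q R h) y"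
      using A.invim_rep[of y] by (auto simp: f.invim_act h_mu)
  qed
qed

end

lemma hom_actionI: "\<lbrakk>base_iso Q B \<epsilon>; inverse_quantal_frame R; quantale_hom Q R h\<rbrakk> \<Longrightarrow> hom_action Q B \<epsilon> R h"
  by (simp add: hom_action_def quantale_morphism_def quantale_morphism_axioms_def base_iso_def)

text \<open>For injectivity, \<open>h g\<close> is recovered from the action by its upper bounds:
  \<open>(g, \<ee>)\<close> lies in the inverse image of \<open>y\<close> exactly when
  \<open>h g \<le> y\<close>. Surjectivity comes from \<open>algebraic_data\<close>, with openness
  of \<open>r\<close> supplied by the etale groupoid of \<open>Q\<close>.\<close>

theorem hom_algmor_bij:
  assumes "base_iso Q B \<epsilon>" "base_iso R C \<eta>"
  shows "bij_betw (hom_algmor B \<epsilon> Q R) {h. quantale_hom Q R h}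
    {m. algebraic_morphism (quantale_groupoid B \<epsilon> Q) (quantale_groupoid C \<eta> R) m}"
proof -
  interpret src: base_iso Q B \<epsilon> by fact
  interpret tgt: base_iso R C \<eta> by fact
  note act = hom_actionI[OF assms(1) tgt.Q.inverse_quantal_frame_axioms]
  show ?thesis
  proof (rule bij_betw_imageI)
    show "inj_on (hom_algmor B \<epsilon> Q R) {h. quantale_hom Q R h}"
    proof (rule inj_onI, clarify)
      fix h k assume h: "quantale_hom Q R h" and k: "quantale_hom Q R k"
        and eq: "hom_algmor B \<epsilon> Q R h = hom_algmor B \<epsilon> Q R k"
      interpret h: hom_action Q B \<epsilon> R h by (rule act[OF h])
      interpret k: hom_action Q B \<epsilon> R k by (rule act[OF k])
      show "h = k"
      proof (rule extensionalityI[OF h.h_ext k.h_ext], rule tgt.Q.eq_by_upper)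
        fix g y assume g: "g \<in> carrier Q" and y: "y \<in> carrier R"
        have "invim h.act y = invim k.act y" using eq by (simp add: hom_algmor_def)
        then have "(g, \<ee>\<^bsub>R\<^esub>) \<in> invim h.act y \<longleftrightarrow> (g, \<ee>\<^bsub>R\<^esub>) \<in> invim k.act y" by simp
        then show "h g \<sqsubseteq>\<^bsub>R\<^esub> y \<longleftrightarrow> k g \<sqsubseteq>\<^bsub>R\<^esub> y"
          using g y by (simp add: h.invim_act k.invim_act tgt.Q.mult_unit)
      qed auto
    qed
    show "hom_algmor B \<epsilon> Q R ` {h. quantale_hom Q R h}
      = {m. algebraic_morphism (quantale_groupoid B \<epsilon> Q) (quantale_groupoid C \<eta> R) m}"
    proof (intro subset_antisym image_subsetI subsetI CollectI)
      fix h assume "h \<in> {h. quantale_hom Q R h}"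
      then interpret h: bi_action Q B \<epsilon> R h C \<eta> using act assms(2) by (simp add: bi_action_def)
      show "algebraic_morphism (quantale_groupoid B \<epsilon> Q) (quantale_groupoid C \<eta> R) (hom_algmor B \<epsilon> Q R h)"
        unfolding hom_algmor_def by (rule h.act_algebraic)
    next
      fix m assume "m \<in> {m. algebraic_morphism (quantale_groupoid B \<epsilon> Q) (quantale_groupoid C \<eta> R) m}"
      then obtain p a where m: "m = (p, a)"
        and alg: "algebraic_morphism (quantale_groupoid B \<epsilon> Q) (quantale_groupoid C \<eta> R) (p, a)"
        by (cases m) auto
      obtain \<rho> where "direct_image src.rn \<rho>"
        using etale_rng_open[OF src.quantale_groupoid_etale] by auto
      with alg interpret A: algebraic_data Q B \<epsilon> R C \<eta> p a \<rho> by unfold_locales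
      show "m \<in> hom_algmor B \<epsilon> Q R ` {h. quantale_hom Q R h}"
        using A.p_eq A.a_eq A.h_hom unfolding hom_algmor_def m by (intro image_eqI[of _ _ A.h]) auto
    qed
  qed
qed

lemma hom_algmor_id:
  assumes "base_iso Q B \<epsilon>"
  shows "hom_algmor B \<epsilon> Q Q (\<lambda>a\<in>carrier Q. a) = algmor_id (quantale_groupoid B \<epsilon> Q)"
proof -
  interpret base_iso Q B \<epsilon> by fact
  show ?thesis unfolding hom_algmor_def q_dom_id by (simp add: algmor_id_def)
qed

text \<open>The composite action is evaluated on generators. Inserting the unit
  \<open>u(q(k))\<close> replaces \<open>w\<close> in \<open>R\<close> by its unit part
  \<open>w \<sqinter> \<ee>\<close>, which acts on \<open>S\<close> through \<open>k\<close> as a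
  restriction. The inverse image of \<open>y\<close> is thus generated by the elements
  \<open>\<gamma> \<otimes> k (w \<sqinter> \<ee>) x\<close> with
  \<open>h \<gamma> w \<le> z\<close> and \<open>k z x \<le> y\<close>.\<close>

theorem hom_algmor_comp:
  assumes Q: "base_iso Q B \<epsilon>" and R: "base_iso R C \<eta>" and S: "base_iso S D \<theta>"
    and h: "quantale_hom Q R h" and k: "quantale_hom R S k"
  shows "hom_algmor B \<epsilon> Q S (compose (carrier Q) k h)
    = algmor_comp (quantale_groupoid B \<epsilon> Q) (quantale_groupoid C \<eta> R) (quantale_groupoid D \<theta> S)
        (hom_algmor C \<eta> R S k) (hom_algmor B \<epsilon> Q R h)"
proof -
  interpret S: base_iso S D \<theta> by fact
  interpret R': base_iso R C \<eta> by fact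
  interpret f: bi_action Q B \<epsilon> R h C \<eta>
    using hom_actionI[OF Q R'.Q.inverse_quantal_frame_axioms h] R by (simp add: bi_action_def)
  interpret g: hom_action R C \<eta> S k by (rule hom_actionI[OF R S.Q.inverse_quantal_frame_axioms k])
  let ?kh = "compose (carrier Q) k h"
  have kh: "quantale_hom Q S ?kh"
    using quantale_hom_comp f.Q.inverse_quantal_frame_axioms R'.Q.inverse_quantal_frame_axioms
      S.Q.inverse_quantal_frame_axioms h k by blast
  interpret fg: hom_action Q B \<epsilon> S ?kh by (rule hom_actionI[OF Q S.Q.inverse_quantal_frame_axioms kh])
  have kh_eq: "x \<in> carrier Q \<Longrightarrow> ?kh x = k (h x)" for x by (simp add: compose_eq)
  let ?u = "q_unit C \<eta> R"
  have pu: "locale_map C B (f.p \<circ>\<^sub>L ?u)" and uq: "locale_map (locale_of S) (locale_of R) (?u \<circ>\<^sub>L g.p)"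
    using f.p_map R'.unit_map g.p_map by blast+
  have uq_inv: "invim (?u \<circ>\<^sub>L g.p) w = k (w \<sqinter>\<^bsub>R\<^esub> \<ee>\<^bsub>R\<^esub>) \<cdot>\<^bsub>S\<^esub> \<top>\<^bsub>S\<^esub>" if "w \<in> carrier R" for w
    using that by (simp add: invim_lcomp'[OF R'.unit_map] R'.Q.meet_right)
  have t: "f.p \<circ>\<^sub>L ?u \<circ>\<^sub>L g.p = fg.p"
  proof (rule locale_map_eqI[OF _ fg.p_map])
    show "locale_map (locale_of S) B (f.p \<circ>\<^sub>L ?u \<circ>\<^sub>L g.p)" using pu g.p_map by blast
    fix b assume b: "b \<in> carrier B"
    then show "invim (f.p \<circ>\<^sub>L ?u \<circ>\<^sub>L g.p) b = invim fg.p b"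
      by (simp add: lcomp_assoc[OF f.p_map] locale_mapD[OF R'.unit_map] invim_lcomp'[OF f.p_map] uq_inv
          R'.Q.subunit_support kh_eq)
  qed
  let ?g = "lfst f.r fg.p" and ?k = "lsnd f.r fg.p"
  let ?uk = "?u \<circ>\<^sub>L g.p \<circ>\<^sub>L ?k"
  have uk: "locale_map fg.ap.P (locale_of R) ?uk" using uq fg.ap.pr_maps(2) by blast
  have uk_inv: "invim ?uk w = fg.ap.T \<top>\<^bsub>Q\<^esub> (k (w \<sqinter>\<^bsub>R\<^esub> \<ee>\<^bsub>R\<^esub>) \<cdot>\<^bsub>S\<^esub> \<top>\<^bsub>S\<^esub>)" if "w \<in> carrier R" for w
    using that by (simp add: invim_lcomp'[OF uq] uq_inv fg.ap.invim_lsnd)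
  interpret c1: cone "locale_of Q" "locale_of R" B f.r f.p fg.ap.P ?g ?uk
  proof (rule coneI[OF f.rng_map f.p_map fg.ap.pr_maps(1) uk])
    have "f.p \<circ>\<^sub>L ?uk = f.p \<circ>\<^sub>L ?u \<circ>\<^sub>L g.p \<circ>\<^sub>L ?k"
      by (simp add: lcomp_assoc[OF f.p_map] lcomp_assoc[OF R'.unit_map] locale_mapD[OF R'.unit_map] locale_mapD[OF g.p_map])
    then show "f.r \<circ>\<^sub>L ?g = f.p \<circ>\<^sub>L ?uk" by (simp only: t fg.ap.square)
  qed
  let ?a = "f.act \<circ>\<^sub>L lpair f.r f.p ?g ?uk"
  have a: "locale_map fg.ap.P (locale_of R) ?a" using f.act_map c1.lpair_map by blast
  interpret c2: cone "locale_of R" "locale_of S" C g.r g.p fg.ap.P ?a ?k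
  proof (rule coneI[OF R'.rng_map g.p_map a fg.ap.pr_maps(2)])
    have "g.r \<circ>\<^sub>L ?a = g.r \<circ>\<^sub>L ?uk"
      by (rule act_pair_snd[OF c1.cone_axioms f.act_map R'.rng_map R'.rng_map f.act_rng])
    also have "\<dots> = g.p \<circ>\<^sub>L ?k"
      using R'.rng_unit by (simp add: lcomp_assoc[OF R'.unit_map] locale_mapD[OF g.p_map] lcomp_assoc[OF R'.rng_map, symmetric]
        locale_mapD[OF R'.unit_map] lid_lcomp[OF lcomp_map[OF fg.ap.pr_maps(2) g.p_map]])
    finally show "g.r \<circ>\<^sub>L ?a = g.p \<circ>\<^sub>L ?k" .
  qed
  let ?c = "g.act \<circ>\<^sub>L lpair g.r g.p ?a ?k"
  have c: "locale_map fg.ap.P (locale_of S) ?c" using g.act_map c2.lpair_map by blast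
  \<comment> \<open>The inverse image of \<open>w\<close> under \<open>u(q(k))\<close> is a cylinder
    over \<open>k (w \<sqinter> \<ee>) \<top>\<close>; meeting it with \<open>x\<close> is
    multiplication by a subunit.\<close>
  have key: "c1.m \<gamma> w \<sqinter>\<^bsub>fg.ap.P\<^esub> invim ?k x = fg.ap.T \<gamma> (k (w \<sqinter>\<^bsub>R\<^esub> \<ee>\<^bsub>R\<^esub>) \<cdot>\<^bsub>S\<^esub> x)"
    if cl: "\<gamma> \<in> carrier Q" "w \<in> carrier R" "x \<in> carrier S" for \<gamma> w x
  proof -
    have "k (w \<sqinter>\<^bsub>R\<^esub> \<ee>\<^bsub>R\<^esub>) \<sqsubseteq>\<^bsub>S\<^esub> \<ee>\<^bsub>S\<^esub>" using cl by (intro g.h_subunit) (auto intro: R'.Q.meet_right)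
    then have "k (w \<sqinter>\<^bsub>R\<^esub> \<ee>\<^bsub>R\<^esub>) \<cdot>\<^bsub>S\<^esub> x = k (w \<sqinter>\<^bsub>R\<^esub> \<ee>\<^bsub>R\<^esub>) \<cdot>\<^bsub>S\<^esub> \<top>\<^bsub>S\<^esub> \<sqinter>\<^bsub>S\<^esub> x"
      using cl by (simp add: S.Q.subunit_mult_left)
    then show ?thesis
      using cl by (simp add: c1.m_def uk_inv fg.ap.invim_lfst fg.ap.invim_lsnd fg.ap.P_meet fg.ap.T_I fg.ap.T_meet fg.ap.I_Int)
  qed
  have "?c = fg.act"
  proof (rule locale_map_eqI[OF c fg.act_map])
    fix y assume "y \<in> carrier (locale_of S)"
    then have y: "y \<in> carrier S" by simp
    have gI: "g.ap.I (invim g.act y)" using g.act.t_I y by simp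
    have E: "fg.ap.I (invim fg.act y)" using fg.act.t_I y by simp
    have ce: "invim ?c y = invim (lpair g.r g.p ?a ?k) (invim g.act y)" using y by (simp add: invim_lcomp'[OF g.act_map])
    have cI: "fg.ap.I (invim ?c y)" using fg.ap.I_invim[OF c] y by simp
    have ae: "invim ?a z = c1.p (invim f.act z)" if "z \<in> carrier R" for z
      using that f.act.t_I by (simp add: invim_lcomp'[OF f.act_map] c1.invim_lpair)
    have "invim ?c y \<sqsubseteq>\<^bsub>fg.ap.P\<^esub> invim fg.act y"
      unfolding ce
    proof (subst c2.invim_lpair_le[OF gI]; (intro allI impI)?)
      fix z x assume zx: "(z, x) \<in> invim g.act y"
      then have cl: "z \<in> carrier R" "x \<in> carrier S" and le: "k z \<cdot>\<^bsub>S\<^esub> x \<sqsubseteq>\<^bsub>S\<^esub> y" using y by (auto simp: g.invim_act)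
      have fI: "f.ap.I (invim f.act z)" using f.act.t_I cl by simp
      have "c1.p (invim f.act z) \<sqinter>\<^bsub>fg.ap.P\<^esub> invim ?k x \<sqsubseteq>\<^bsub>fg.ap.P\<^esub> invim fg.act y"
        unfolding c1.p_def
      proof (rule c1.Z.meet_sup_le[OF _ c1.m_image[OF fI]])
        show "invim ?k x \<in> carrier fg.ap.P" using invim_closed[OF fg.ap.pr_maps(2), of x] cl by simp
        show "invim fg.act y \<in> carrier fg.ap.P" using E by simp
        fix W assume "W \<in> (\<lambda>(x, y). c1.m x y) ` invim f.act z"
        then obtain \<gamma> w where gw: "(\<gamma>, w) \<in> invim f.act z" "W = c1.m \<gamma> w" by auto
        then have cl': "\<gamma> \<in> carrier Q" "w \<in> carrier R" and le': "h \<gamma> \<cdot>\<^bsub>R\<^esub> w \<sqsubseteq>\<^bsub>R\<^esub> z" using cl by (auto simp: f.invim_act)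
        have "h \<gamma> \<cdot>\<^bsub>R\<^esub> (w \<sqinter>\<^bsub>R\<^esub> \<ee>\<^bsub>R\<^esub>) \<sqsubseteq>\<^bsub>R\<^esub> h \<gamma> \<cdot>\<^bsub>R\<^esub> w" using cl' by (intro R'.Q.mult_mono R'.Q.meet_left) auto
        then have "h \<gamma> \<cdot>\<^bsub>R\<^esub> (w \<sqinter>\<^bsub>R\<^esub> \<ee>\<^bsub>R\<^esub>) \<sqsubseteq>\<^bsub>R\<^esub> z" using R'.Q.le_trans[OF _ le', of "h \<gamma> \<cdot>\<^bsub>R\<^esub> (w \<sqinter>\<^bsub>R\<^esub> \<ee>\<^bsub>R\<^esub>)"] cl cl' by simp
        then have "k (h \<gamma> \<cdot>\<^bsub>R\<^esub> (w \<sqinter>\<^bsub>R\<^esub> \<ee>\<^bsub>R\<^esub>)) \<cdot>\<^bsub>S\<^esub> x \<sqsubseteq>\<^bsub>S\<^esub> k z \<cdot>\<^bsub>S\<^esub> x" using cl cl' by (intro S.Q.mult_mono g.h_mono) auto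
        then have "k (h \<gamma> \<cdot>\<^bsub>R\<^esub> (w \<sqinter>\<^bsub>R\<^esub> \<ee>\<^bsub>R\<^esub>)) \<cdot>\<^bsub>S\<^esub> x \<sqsubseteq>\<^bsub>S\<^esub> y"
          using S.Q.le_trans[OF _ le, of "k (h \<gamma> \<cdot>\<^bsub>R\<^esub> (w \<sqinter>\<^bsub>R\<^esub> \<ee>\<^bsub>R\<^esub>)) \<cdot>\<^bsub>S\<^esub> x"] cl cl' y by simp
        then have "(\<gamma>, k (w \<sqinter>\<^bsub>R\<^esub> \<ee>\<^bsub>R\<^esub>) \<cdot>\<^bsub>S\<^esub> x) \<in> invim fg.act y"
          using cl cl' y by (simp add: fg.invim_act kh_eq g.h_mult S.Q.mult_assoc)
        then show "W \<sqinter>\<^bsub>fg.ap.P\<^esub> invim ?k x \<sqsubseteq>\<^bsub>fg.ap.P\<^esub> invim fg.act y"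
          using fg.ap.T_le[OF E] by (simp add: gw(2) key cl cl')
      qed
      then show "invim ?a z \<sqinter>\<^bsub>fg.ap.P\<^esub> invim ?k x \<sqsubseteq>\<^bsub>fg.ap.P\<^esub> invim fg.act y" using ae cl by simp
    qed (use E in simp)
    moreover have "invim fg.act y \<subseteq> invim ?c y"
    proof clarify
      fix \<gamma> x assume "(\<gamma>, x) \<in> invim fg.act y"
      then have cl: "\<gamma> \<in> carrier Q" "x \<in> carrier S" and le: "k (h \<gamma>) \<cdot>\<^bsub>S\<^esub> x \<sqsubseteq>\<^bsub>S\<^esub> y"
        using y by (auto simp: fg.invim_act kh_eq)
      have fI: "f.ap.I (invim f.act (h \<gamma>))" using f.act.t_I cl by simp
      \<comment> \<open>The extreme choice \<open>z = h \<gamma>\<close>, together with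
        \<open>w = \<ee>\<close> below, already produces the generator
        \<open>\<gamma> \<otimes> x\<close>.\<close>
      have "(h \<gamma>, x) \<in> invim g.act y" using cl le y by (simp add: g.invim_act)
      from c2.le_invim_lpair[OF gI this]
      have 1: "c1.p (invim f.act (h \<gamma>)) \<sqinter>\<^bsub>fg.ap.P\<^esub> invim ?k x \<subseteq> invim ?c y" using ae cl ce by simp
      have "(\<gamma>, \<ee>\<^bsub>R\<^esub>) \<in> invim f.act (h \<gamma>)" using cl by (simp add: f.invim_act R'.Q.mult_unit)
      then have 2: "c1.m \<gamma> \<ee>\<^bsub>R\<^esub> \<subseteq> c1.p (invim f.act (h \<gamma>))" using c1.m_le_p[OF fI] by simp
      have kx: "invim ?k x \<in> carrier fg.ap.P" using invim_closed[OF fg.ap.pr_maps(2), of x] cl by simp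
      have m: "c1.m \<gamma> \<ee>\<^bsub>R\<^esub> \<in> carrier fg.ap.P" using c1.m_cl[of \<gamma> "\<ee>\<^bsub>R\<^esub>"] cl by simp
      have pp: "c1.p (invim f.act (h \<gamma>)) \<in> carrier fg.ap.P" using c1.p_cl[OF fI] .
      have "fg.ap.T \<gamma> x \<subseteq> invim ?c y"
        using key[of \<gamma> "\<ee>\<^bsub>R\<^esub>" x] 1 2 kx m pp cl by (auto simp: fg.ap.P_meet S.Q.unit_mult)
      then show "(\<gamma>, x) \<in> invim ?c y" using fg.ap.T_mem by blast
    qed
    ultimately show "invim ?c y = invim fg.act y" by auto
  qed
  then show ?thesis
    unfolding algmor_comp_def hom_algmor_def prod.case Let_def f.q_groupoid_simps R'.q_groupoid_simps t by simp
qed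

section \<open>The equivalence of categories\<close>

lemma (in frame) frame_down_set:
  assumes e: "e \<in> carrier L"
  shows "frame \<lparr>carrier = {a \<in> carrier L. a \<sqsubseteq> e}, eq = (=), le = le L\<rparr>" (is "frame ?D")
proof -
  interpret D: partial_order ?D
    by standard (auto intro: le_trans)
  have S: "\<Squnion>A \<in> carrier ?D" if "A \<subseteq> carrier ?D" for A
  proof -
    have "A \<subseteq> carrier L" using that by auto
    then show ?thesis using that e by (auto simp: sup_le_iff)
  qed
  interpret D: complete_lattice ?D
  proof
    fix A assume A: "A \<subseteq> carrier ?D"
    then have A': "A \<subseteq> carrier L" by auto
    have "\<Squnion>A \<sqsubseteq> y" if "y \<in> Upper ?D A" for y
      using that A by (intro sup_least[OF A']) (auto simp: Upper_def)
    then have "is_lub ?D (\<Squnion>A) A"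
      using S[OF A] A A' by (intro least_UpperI) (auto intro: sup_upper)
    then show "\<exists>s. is_lub ?D s A" by blast
    \<comment> \<open>The meet with \<open>e\<close> gives the right value for empty
      \<open>A\<close>, whose infimum in the down-set is \<open>e\<close>.\<close>
    have i: "e \<sqinter> \<Sqinter>A \<in> carrier ?D" using A' e by (simp add: meet_left)
    have "e \<sqinter> \<Sqinter>A \<sqsubseteq> x" if "x \<in> A" for x
      using inf_lower[OF A' that] A' e that le_trans[of "e \<sqinter> \<Sqinter>A" "\<Sqinter>A" x] by (auto simp: meet_right)
    moreover have "y \<sqsubseteq> e \<sqinter> \<Sqinter>A" if "y \<in> carrier L" "y \<sqsubseteq> e" "\<And>x. x \<in> A \<Longrightarrow> y \<sqsubseteq> x" for y
      using that A' e inf_greatest[OF A', of y] by (simp add: le_meet_iff)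
    ultimately have "is_glb ?D (e \<sqinter> \<Sqinter>A) A"
      using i A by (intro greatest_LowerI) (auto simp: Lower_def subset_iff)
    then show "\<exists>s. is_glb ?D s A" by blast
  qed
  have sup_eq: "\<Squnion>\<^bsub>?D\<^esub>A = \<Squnion>A" if A: "A \<subseteq> carrier ?D" for A
  proof -
    have A': "A \<subseteq> carrier L" using A by auto
    have c: "\<Squnion>\<^bsub>?D\<^esub>A \<in> carrier ?D" using A by (rule D.sup_closed)
    have "\<Squnion>\<^bsub>?D\<^esub>A \<sqsubseteq>\<^bsub>?D\<^esub> \<Squnion>A" using A A' by (intro D.sup_least S) (auto intro: sup_upper)
    moreover have "\<Squnion>A \<sqsubseteq> \<Squnion>\<^bsub>?D\<^esub>A"
      using D.sup_upper[OF A] c A' by (intro sup_least) auto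
    ultimately show ?thesis using c S[OF A] by (intro le_antisym) auto
  qed
  have meet_eq: "a \<sqinter>\<^bsub>?D\<^esub> b = a \<sqinter> b" if ab: "a \<in> carrier ?D" "b \<in> carrier ?D" for a b
  proof -
    have m: "a \<sqinter> b \<in> carrier ?D" using ab e le_trans[of "a \<sqinter> b" a e] by (simp add: meet_left)
    have c: "a \<sqinter>\<^bsub>?D\<^esub> b \<in> carrier ?D" using ab by (rule D.meet_closed)
    have "a \<sqinter>\<^bsub>?D\<^esub> b \<sqsubseteq> a \<sqinter> b"
      using D.meet_left[OF ab] D.meet_right[OF ab] ab c by (intro meet_le) auto
    moreover have "a \<sqinter> b \<sqsubseteq>\<^bsub>?D\<^esub> a \<sqinter>\<^bsub>?D\<^esub> b"
      using ab m by (intro D.meet_le) (auto intro: meet_left meet_right)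
    ultimately show ?thesis using c m by (intro le_antisym) auto
  qed
  show ?thesis
  proof
    fix a A assume a: "a \<in> carrier ?D" and A: "A \<subseteq> carrier ?D"
    then have A': "A \<subseteq> carrier L" by auto
    have m: "a \<sqinter> b \<in> carrier ?D" if "b \<in> A" for b
    proof -
      have "b \<in> carrier L" using that A' by auto
      then show ?thesis using a e le_trans[of "a \<sqinter> b" a e] by (simp add: meet_left)
    qed
    have im: "(\<sqinter>\<^bsub>?D\<^esub>) a ` A = (\<sqinter>) a ` A"
      using A by (intro image_cong meet_eq[OF a]) auto
    have "(\<sqinter>) a ` A \<subseteq> carrier ?D" using m by blast
    then show "a \<sqinter>\<^bsub>?D\<^esub> \<Squnion>\<^bsub>?D\<^esub>A = \<Squnion>\<^bsub>?D\<^esub>((\<sqinter>\<^bsub>?D\<^esub>) a ` A)"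
      using S[OF A] meet_eq[OF a S[OF A]] meet_sup_distrib[OF _ A', of a] a unfolding im by (simp add: sup_eq A sup_eq[OF A])
  qed
qed

lemma base_iso_subunits:
  assumes "inverse_quantal_frame Q"
  shows "base_iso Q \<lparr>carrier = {a \<in> carrier Q. a \<sqsubseteq>\<^bsub>Q\<^esub> \<ee>\<^bsub>Q\<^esub>}, eq = (=), le = le Q\<rparr> (\<lambda>a. a)"
proof -
  interpret inverse_quantal_frame Q by fact
  show ?thesis
    by (intro base_iso.intro assms frame_down_set base_iso_axioms.intro) auto
qed

lemma category_InvQuF: "category InvQuF"
proof
  fix X :: "'u quantale" assume "X \<in> Ob InvQuF"
  then show "Id InvQuF X \<in> Hom InvQuF X X" by (simp add: InvQuF_def quantale_hom_id)
next
  fix X Y Z :: "'u quantale" and f g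
  assume "X \<in> Ob InvQuF" "Y \<in> Ob InvQuF" "Z \<in> Ob InvQuF" "f \<in> Hom InvQuF X Y" "g \<in> Hom InvQuF Y Z"
  then show "Comp InvQuF X Y Z g f \<in> Hom InvQuF X Z" by (auto simp: InvQuF_def intro: quantale_hom_comp)
next
  fix X Y :: "'u quantale" and f
  assume a: "X \<in> Ob InvQuF" "Y \<in> Ob InvQuF" "f \<in> Hom InvQuF X Y"
  then have f: "f \<in> extensional (carrier X)" "f \<in> carrier X \<rightarrow> carrier Y"
    by (auto simp: InvQuF_def quantale_hom_def sup_preserving_def)
  then show "Comp InvQuF X X Y f (Id InvQuF X) = f"
    by (auto simp: InvQuF_def compose_def intro!: extensionalityI[of _ "carrier X"])
  show "Comp InvQuF X Y Y (Id InvQuF Y) f = f"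
    using f by (auto simp: InvQuF_def compose_def Pi_iff intro!: extensionalityI[of _ "carrier X"])
next
  fix W X Y Z :: "'u quantale" and f g h
  assume "f \<in> Hom InvQuF W X"
  then have "f \<in> carrier W \<rightarrow> carrier X" by (auto simp: InvQuF_def quantale_hom_def sup_preserving_def)
  then show "Comp InvQuF W X Z (Comp InvQuF X Y Z h g) f = Comp InvQuF W Y Z h (Comp InvQuF W X Y g f)"
    by (auto simp: InvQuF_def compose_def Pi_iff fun_eq_iff)
qed

text \<open>\<open>C\<close> is not assumed to be a category: its laws are transported from \<open>D\<close> along \<open>\<Psi>\<close>.\<close>

locale full_embedding = D: category D for D :: "('p, 'n) cat" +
  fixes C :: "('o, 'm) cat" and F :: "'o \<Rightarrow> 'p" and \<Psi> :: "'o \<Rightarrow> 'o \<Rightarrow> 'n \<Rightarrow> 'm"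
  assumes F_Ob [simp]: "X \<in> Ob C \<Longrightarrow> F X \<in> Ob D"
    and bij: "\<lbrakk>X \<in> Ob C; Y \<in> Ob C\<rbrakk> \<Longrightarrow> bij_betw (\<Psi> X Y) (Hom D (F X) (F Y)) (Hom C X Y)"
    and \<Psi>_Id: "X \<in> Ob C \<Longrightarrow> \<Psi> X X (Id D (F X)) = Id C X"
    and \<Psi>_Comp: "\<lbrakk>X \<in> Ob C; Y \<in> Ob C; Z \<in> Ob C; f \<in> Hom D (F X) (F Y); g \<in> Hom D (F Y) (F Z)\<rbrakk>
      \<Longrightarrow> \<Psi> X Z (Comp D (F X) (F Y) (F Z) g f) = Comp C X Y Z (\<Psi> Y Z g) (\<Psi> X Y f)"
begin

definition \<Phi> where "\<Phi> X Y = inv_into (Hom D (F X) (F Y)) (\<Psi> X Y)"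

lemma \<Psi>_Hom [simp]: "\<lbrakk>X \<in> Ob C; Y \<in> Ob C; f \<in> Hom D (F X) (F Y)\<rbrakk> \<Longrightarrow> \<Psi> X Y f \<in> Hom C X Y"
  using bij by (auto simp: bij_betw_def)

lemma \<Phi>_Hom [simp]: "\<lbrakk>X \<in> Ob C; Y \<in> Ob C; f \<in> Hom C X Y\<rbrakk> \<Longrightarrow> \<Phi> X Y f \<in> Hom D (F X) (F Y)"
  unfolding \<Phi>_def using bij[of X Y] by (metis bij_betw_def inv_into_into)

lemma \<Psi>_\<Phi> [simp]: "\<lbrakk>X \<in> Ob C; Y \<in> Ob C; f \<in> Hom C X Y\<rbrakk> \<Longrightarrow> \<Psi> X Y (\<Phi> X Y f) = f"
  unfolding \<Phi>_def using bij[of X Y] by (metis bij_betw_def f_inv_into_f)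

lemma \<Phi>_\<Psi> [simp]: "\<lbrakk>X \<in> Ob C; Y \<in> Ob C; f \<in> Hom D (F X) (F Y)\<rbrakk> \<Longrightarrow> \<Phi> X Y (\<Psi> X Y f) = f"
  unfolding \<Phi>_def using bij[of X Y] by (metis bij_betw_def inv_into_f_f)

lemma D_Comp [simp]: "\<lbrakk>X \<in> Ob D; Y \<in> Ob D; Z \<in> Ob D; f \<in> Hom D X Y; g \<in> Hom D Y Z\<rbrakk>
    \<Longrightarrow> Comp D X Y Z g f \<in> Hom D X Z"
  by (rule D.Comp_in_Hom)

lemma Comp_eq: "\<lbrakk>X \<in> Ob C; Y \<in> Ob C; Z \<in> Ob C; f \<in> Hom C X Y; g \<in> Hom C Y Z\<rbrakk>
    \<Longrightarrow> Comp C X Y Z g f = \<Psi> X Z (Comp D (F X) (F Y) (F Z) (\<Phi> Y Z g) (\<Phi> X Y f))"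
  by (simp add: \<Psi>_Comp)

lemma Id_eq: "X \<in> Ob C \<Longrightarrow> Id C X = \<Psi> X X (Id D (F X))"
  by (simp add: \<Psi>_Id)

lemma category_C: "category C"
proof
  fix X assume "X \<in> Ob C"
  then show "Id C X \<in> Hom C X X" by (simp add: Id_eq D.Id_in_Hom)
next
  fix X Y Z f g assume "X \<in> Ob C" "Y \<in> Ob C" "Z \<in> Ob C" "f \<in> Hom C X Y" "g \<in> Hom C Y Z"
  then show "Comp C X Y Z g f \<in> Hom C X Z" by (simp add: Comp_eq)
next
  fix X Y f assume a: "X \<in> Ob C" "Y \<in> Ob C" "f \<in> Hom C X Y"
  note i = D.Id_in_Hom[OF F_Ob[OF a(1)]] D.Id_in_Hom[OF F_Ob[OF a(2)]]
  show "Comp C X X Y f (Id C X) = f" "Comp C X Y Y (Id C Y) f = f"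
    using a i by (simp_all add: Id_eq Comp_eq D.Comp_Id D.Id_Comp)
next
  fix W X Y Z f g h
  assume "W \<in> Ob C" "X \<in> Ob C" "Y \<in> Ob C" "Z \<in> Ob C" "f \<in> Hom C W X" "g \<in> Hom C X Y" "h \<in> Hom C Y Z"
  then show "Comp C W X Z (Comp C X Y Z h g) f = Comp C W Y Z h (Comp C W X Y g f)"
    by (simp add: Comp_eq D.Comp_assoc)
qed

text \<open>The weak inverse sends \<open>d\<close> to a chosen object \<open>K d\<close> with an
  isomorphism from \<open>F (K d)\<close> to \<open>d\<close>, and an arrow to its conjugate by
  these isomorphisms, transported along \<open>\<Psi>\<close>.\<close>

theorem equivalence:
  assumes ess: "\<And>d. d \<in> Ob D \<Longrightarrow> \<exists>c\<in>Ob C. \<exists>i. is_iso D (F c) d i"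
  shows "equivalent_categories C D"
proof -
  \<comment> \<open>Object, isomorphism and inverse are packed into one tuple, so that a single
    choice keeps them compatible.\<close>
  define P where "P d x \<longleftrightarrow> fst x \<in> Ob C \<and>
      fst (snd x) \<in> Hom D (F (fst x)) d \<and> snd (snd x) \<in> Hom D d (F (fst x)) \<and>
      Comp D (F (fst x)) d (F (fst x)) (snd (snd x)) (fst (snd x)) = Id D (F (fst x)) \<and>
      Comp D d (F (fst x)) d (fst (snd x)) (snd (snd x)) = Id D d" for d x
  have "\<exists>x. P d x" if "d \<in> Ob D" for d
    using ess[OF that] unfolding P_def is_iso_def by auto
  then obtain w where w: "\<And>d. d \<in> Ob D \<Longrightarrow> P d (w d)" by metis
  define K where "K d = fst (w d)" for d
  define \<theta> where "\<theta> d = fst (snd (w d))" for d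
  define \<kappa> where "\<kappa> d = snd (snd (w d))" for d
  have K [simp]: "K d \<in> Ob C" and th [simp]: "\<theta> d \<in> Hom D (F (K d)) d" and ka [simp]: "\<kappa> d \<in> Hom D d (F (K d))"
    and kt: "Comp D (F (K d)) d (F (K d)) (\<kappa> d) (\<theta> d) = Id D (F (K d))"
    and tk: "Comp D d (F (K d)) d (\<theta> d) (\<kappa> d) = Id D d" if "d \<in> Ob D" for d
    using w[OF that] by (simp_all add: P_def K_def \<theta>_def \<kappa>_def)
  \<comment> \<open>The rules \<open>kt'\<close> and \<open>tk'\<close> cancel adjacent inverses
    inside composites bracketed to the right, the normal form used below.\<close>
  have kta: "Comp D X (F (K d)) (F (K d)) (Comp D (F (K d)) d (F (K d)) (\<kappa> d) (\<theta> d)) f = f"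
    if "d \<in> Ob D" "X \<in> Ob D" "f \<in> Hom D X (F (K d))" for d X f
    using that by (simp add: kt D.Id_Comp)
  have kt': "Comp D X d (F (K d)) (\<kappa> d) (Comp D X (F (K d)) d (\<theta> d) f) = f"
    if "d \<in> Ob D" "X \<in> Ob D" "f \<in> Hom D X (F (K d))" for d X f
    using that kta[OF that] by (simp add: D.Comp_assoc)
  have tk': "Comp D X (F (K d)) d (\<theta> d) (Comp D X d (F (K d)) (\<kappa> d) f) = f"
    if "d \<in> Ob D" "X \<in> Ob D" "f \<in> Hom D X d" for d X f
  proof -
    have "Comp D X d d (Comp D d (F (K d)) d (\<theta> d) (\<kappa> d)) f = f" using that by (simp add: tk D.Id_Comp)
    then show ?thesis using that by (simp add: D.Comp_assoc)
  qed
  define F1 where "F1 = \<lparr>onObj = F, onMor = \<Phi>\<rparr>"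
  define c where "c X Y k = Comp D (F (K X)) Y (F (K Y)) (\<kappa> Y) (Comp D (F (K X)) X Y k (\<theta> X))" for X Y k
  have c [simp]: "c X Y k \<in> Hom D (F (K X)) (F (K Y))" if "X \<in> Ob D" "Y \<in> Ob D" "k \<in> Hom D X Y" for X Y k
    using that by (simp add: c_def)
  define F2 where "F2 = \<lparr>onObj = K, onMor = (\<lambda>X Y k. \<Psi> (K X) (K Y) (c X Y k))\<rparr>"
  have "is_functor C D F1"
    unfolding is_functor_def F1_def by (auto simp: Id_eq Comp_eq D.Id_in_Hom)
  moreover have "is_functor D C F2"
    unfolding is_functor_def F2_def
  proof (simp, intro conjI ballI)
    fix X assume X: "X \<in> Ob D"
    then have "c X X (Id D X) = Id D (F (K X))" by (simp add: c_def D.Id_Comp kt)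
    then show "\<Psi> (K X) (K X) (c X X (Id D X)) = Id C (K X)" using X by (simp add: Id_eq)
  next
    fix X Y Z f g assume a: "X \<in> Ob D" "Y \<in> Ob D" "Z \<in> Ob D" "f \<in> Hom D X Y" "g \<in> Hom D Y Z"
    have "c X Z (Comp D X Y Z g f) = Comp D (F (K X)) (F (K Y)) (F (K Z)) (c Y Z g) (c X Y f)"
      using a by (simp add: c_def D.Comp_assoc tk')
    then show "\<Psi> (K X) (K Z) (c X Z (Comp D X Y Z g f))
        = Comp C (K X) (K Y) (K Z) (\<Psi> (K Y) (K Z) (c Y Z g)) (\<Psi> (K X) (K Y) (c X Y f))"
      using a by (simp add: \<Psi>_Comp)
  qed
  moreover have "naturally_isomorphic C C id_functor (comp_functor F2 F1)"
    unfolding naturally_isomorphic_def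
  proof (intro exI conjI ballI)
    let ?\<eta> = "\<lambda>X. \<Psi> X (K (F X)) (\<kappa> (F X))"
    fix X assume X: "X \<in> Ob C"
    have "Comp C X (K (F X)) X (\<Psi> (K (F X)) X (\<theta> (F X))) (?\<eta> X) = Id C X"
      "Comp C (K (F X)) X (K (F X)) (?\<eta> X) (\<Psi> (K (F X)) X (\<theta> (F X))) = Id C (K (F X))"
      using X by (simp_all add: \<Psi>_Comp[symmetric] tk kt \<Psi>_Id)
    then show "is_iso C (onObj id_functor X) (onObj (comp_functor F2 F1) X) (?\<eta> X)"
      using X by (auto simp: is_iso_def id_functor_def comp_functor_def F1_def F2_def
          intro!: bexI[of _ "\<Psi> (K (F X)) X (\<theta> (F X))"])
    fix Y f assume Y: "Y \<in> Ob C" and f: "f \<in> Hom C X Y"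
    have "Comp D (F X) (F (K (F X))) (F (K (F Y))) (c (F X) (F Y) (\<Phi> X Y f)) (\<kappa> (F X))
      = Comp D (F X) (F Y) (F (K (F Y))) (\<kappa> (F Y)) (\<Phi> X Y f)"
      using X Y f by (simp add: c_def D.Comp_assoc tk D.Comp_Id)
    then show "Comp C (onObj id_functor X) (onObj id_functor Y) (onObj (comp_functor F2 F1) Y) (?\<eta> Y) (onMor id_functor X Y f)
      = Comp C (onObj id_functor X) (onObj (comp_functor F2 F1) X) (onObj (comp_functor F2 F1) Y)
          (onMor (comp_functor F2 F1) X Y f) (?\<eta> X)"
      using X Y f by (simp add: id_functor_def comp_functor_def F1_def F2_def Comp_eq)
  qed
  moreover have "naturally_isomorphic D D (comp_functor F1 F2) id_functor"
    unfolding naturally_isomorphic_def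
  proof (intro exI conjI ballI)
    fix X assume X: "X \<in> Ob D"
    show "is_iso D (onObj (comp_functor F1 F2) X) (onObj id_functor X) (\<theta> X)"
      using X by (auto simp: is_iso_def id_functor_def comp_functor_def F1_def F2_def kt tk intro!: bexI[of _ "\<kappa> X"])
    fix Y f assume Y: "Y \<in> Ob D" and f: "f \<in> Hom D X Y"
    then show "Comp D (onObj (comp_functor F1 F2) X) (onObj (comp_functor F1 F2) Y) (onObj id_functor Y) (\<theta> Y)
        (onMor (comp_functor F1 F2) X Y f)
      = Comp D (onObj (comp_functor F1 F2) X) (onObj id_functor X) (onObj id_functor Y) (onMor id_functor X Y f) (\<theta> X)"
      using X by (simp add: id_functor_def comp_functor_def F1_def F2_def) (simp add: c_def tk')
  qed
  ultimately show ?thesis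
    unfolding equivalent_categories_def using category_C D.category_axioms by blast
qed

end

text \<open>The identity of the common groupoid is represented by a homomorphism from
  \<open>Q\<close> to \<open>R\<close> and by one from \<open>R\<close> to \<open>Q\<close>. Their
  composites represent the identity again, so by injectivity of \<open>hom_algmor\<close> they are
  identities.\<close>

lemma quantale_groupoid_determines:
  assumes Q: "base_iso Q B \<epsilon>" and R: "base_iso R B \<eta>"
    and eq: "quantale_groupoid B \<epsilon> Q = quantale_groupoid B \<eta> R"
  shows "\<exists>h. is_iso InvQuF Q R h"
proof -
  interpret Q: base_iso Q B \<epsilon> by fact
  interpret R: base_iso R B \<eta> by fact
  let ?G = "quantale_groupoid B \<epsilon> Q"
  let ?id = "\<lambda>Q. \<lambda>a\<in>carrier Q. a"
  have id: "algebraic_morphism ?G ?G (algmor_id ?G)"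
    using hom_algmor_bij[OF Q Q] hom_algmor_id[OF Q] quantale_hom_id[OF Q.Q.inverse_quantal_frame_axioms]
    unfolding bij_betw_def by (metis (lifting) imageI mem_Collect_eq)
  obtain h where h: "quantale_hom Q R h" "hom_algmor B \<epsilon> Q R h = algmor_id ?G"
    using hom_algmor_bij[OF Q R] id unfolding eq[symmetric] bij_betw_def by (metis (lifting) imageE mem_Collect_eq)
  obtain k where k: "quantale_hom R Q k" "hom_algmor B \<eta> R Q k = algmor_id ?G"
    using hom_algmor_bij[OF R Q] id unfolding eq[symmetric] bij_betw_def by (metis (lifting) imageE mem_Collect_eq)
  have idid: "algmor_comp ?G ?G ?G (algmor_id ?G) (algmor_id ?G) = algmor_id ?G"
  proof -
    note i = quantale_hom_id[OF Q.Q.inverse_quantal_frame_axioms]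
    have "compose (carrier Q) (?id Q) (?id Q) = ?id Q" by (auto simp: compose_def)
    then show ?thesis using hom_algmor_comp[OF Q Q Q i i] hom_algmor_id[OF Q] by simp
  qed
  have "hom_algmor B \<epsilon> Q Q (compose (carrier Q) k h) = hom_algmor B \<epsilon> Q Q (?id Q)"
    using hom_algmor_comp[OF Q R Q h(1) k(1)] hom_algmor_id[OF Q] idid unfolding eq[symmetric] h(2) k(2) by simp
  moreover have "quantale_hom Q Q (compose (carrier Q) k h)"
    using quantale_hom_comp Q.Q.inverse_quantal_frame_axioms R.Q.inverse_quantal_frame_axioms h(1) k(1) by blast
  ultimately have kh: "compose (carrier Q) k h = ?id Q"
    using hom_algmor_bij[OF Q Q] quantale_hom_id[OF Q.Q.inverse_quantal_frame_axioms]
    by (auto simp: bij_betw_def dest: inj_onD)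
  have "hom_algmor B \<eta> R R (compose (carrier R) h k) = hom_algmor B \<eta> R R (?id R)"
    using hom_algmor_comp[OF R Q R k(1) h(1)] hom_algmor_id[OF R] idid unfolding eq[symmetric] h(2) k(2) by simp
  moreover have "quantale_hom R R (compose (carrier R) h k)"
    using quantale_hom_comp Q.Q.inverse_quantal_frame_axioms R.Q.inverse_quantal_frame_axioms h(1) k(1) by blast
  ultimately have hk: "compose (carrier R) h k = ?id R"
    using hom_algmor_bij[OF R R] quantale_hom_id[OF R.Q.inverse_quantal_frame_axioms]
    by (auto simp: bij_betw_def dest: inj_onD)
  show ?thesis
    using h(1) k(1) kh hk by (auto simp: is_iso_def InvQuF_def)
qed

theorem theorem5p15:
  shows "equivalent_categories (Gpd_A :: ('u groupoid, 'u algmor) cat) (InvQuF :: ('u quantale, 'u \<Rightarrow> 'u) cat)"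
proof -
  \<comment> \<open>A quantale and a parametrisation of its subunits by \<open>objs G\<close> are
    chosen together, so that \<open>G\<close> is literally the groupoid they define and hom-sets
    need no further transport.\<close>
  define P where "P G x \<longleftrightarrow> base_iso (fst x) (objs G) (snd x) \<and> G = quantale_groupoid (objs G) (snd x) (fst x)"
    for G :: "'u groupoid" and x
  define F where "F G = fst (SOME x. P G x)" for G
  define \<epsilon> where "\<epsilon> G = snd (SOME x. P G x)" for G
  have base: "base_iso (F G) (objs G) (\<epsilon> G)" and G: "quantale_groupoid (objs G) (\<epsilon> G) (F G) = G"
    if "G \<in> Ob Gpd_A" for G
  proof -
    have "\<exists>x. P G x"
      using etale_groupoid_eq_quantale_groupoid[of G] that by (auto simp: P_def Gpd_A_def)
    then have "P G (SOME x. P G x)" by (rule someI_ex)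
    then show "base_iso (F G) (objs G) (\<epsilon> G)" "quantale_groupoid (objs G) (\<epsilon> G) (F G) = G"
      by (simp_all add: P_def F_def \<epsilon>_def)
  qed
  have F: "inverse_quantal_frame (F G)" if "G \<in> Ob Gpd_A" for G
    using base[OF that] by (simp add: base_iso_def)
  interpret full_embedding InvQuF Gpd_A F "\<lambda>G H. hom_algmor (objs G) (\<epsilon> G) (F G) (F H)"
  proof (intro full_embedding.intro category_InvQuF full_embedding_axioms.intro)
    fix X Y :: "'u groupoid" assume X: "X \<in> Ob Gpd_A" and Y: "Y \<in> Ob Gpd_A"
    show "bij_betw (hom_algmor (objs X) (\<epsilon> X) (F X) (F Y)) (Hom InvQuF (F X) (F Y)) (Hom Gpd_A X Y)"
      using hom_algmor_bij[OF base[OF X] base[OF Y]] G[OF X] G[OF Y] by (simp add: InvQuF_def Gpd_A_def)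
  next
    fix X :: "'u groupoid" assume X: "X \<in> Ob Gpd_A"
    show "F X \<in> Ob InvQuF" using F[OF X] by (simp add: InvQuF_def)
    show "hom_algmor (objs X) (\<epsilon> X) (F X) (F X) (Id InvQuF (F X)) = Id Gpd_A X"
      using hom_algmor_id[OF base[OF X]] G[OF X] by (simp add: InvQuF_def Gpd_A_def)
  next
    fix X Y Z :: "'u groupoid" and f g
    assume X: "X \<in> Ob Gpd_A" and Y: "Y \<in> Ob Gpd_A" and Z: "Z \<in> Ob Gpd_A"
      and f: "f \<in> Hom InvQuF (F X) (F Y)" and g: "g \<in> Hom InvQuF (F Y) (F Z)"
    then show "hom_algmor (objs X) (\<epsilon> X) (F X) (F Z) (Comp InvQuF (F X) (F Y) (F Z) g f)
      = Comp Gpd_A X Y Z (hom_algmor (objs Y) (\<epsilon> Y) (F Y) (F Z) g) (hom_algmor (objs X) (\<epsilon> X) (F X) (F Y) f)"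
      using hom_algmor_comp[OF base[OF X] base[OF Y] base[OF Z], of f g] G[OF X] G[OF Y] G[OF Z]
      by (simp add: InvQuF_def Gpd_A_def)
  qed
  show ?thesis
  proof (rule equivalence)
    fix Q :: "'u quantale" assume "Q \<in> Ob InvQuF"
    then have Q: "inverse_quantal_frame Q" by (simp add: InvQuF_def)
    \<comment> \<open>The subunits of \<open>Q\<close> themselves serve as locale of objects. The
      quantale \<open>F\<close> chosen for the resulting groupoid may differ from \<open>Q\<close>,
      which is why the two are compared by \<open>quantale_groupoid_determines\<close>.\<close>
    obtain B where b: "base_iso Q B (\<lambda>a. a)" using base_iso_subunits[OF Q] by blast
    let ?G = "quantale_groupoid B (\<lambda>a. a) Q"
    have Gob: "?G \<in> Ob Gpd_A" using base_iso.quantale_groupoid_etale[OF b] by (simp add: Gpd_A_def)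
    have o: "objs ?G = B" by (simp add: quantale_groupoid_def)
    have "\<exists>h. is_iso InvQuF (F ?G) Q h"
      by (rule quantale_groupoid_determines[OF base[OF Gob, unfolded o] b G[OF Gob, unfolded o]])
    then show "\<exists>c\<in>Ob Gpd_A. \<exists>i. is_iso InvQuF (F c) Q i" using Gob by blast
  qed
qed

end
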